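(* Let $d=5$ and $s=14$, and let $Y$ be the blow-up of $\mathbf P^2$ at $s=14$ points in sufficiently general position, with $L$, $E$, $K_Y$ as in the context. Then the linear system $|-2K_Y+2dL-2E|$ on $Y$ is base-point-free.
   Context: Work over an algebraically closed field of characteristic $0$. $L$ is the pullback to $Y$ of a line in $\mathbf P^2$, $E=E_1+\cdots+E_{s}$ is the sum of the exceptional divisors, and $K_Y$ is the canonical divisor of $Y$. *)

theory Defs
  imports
    "HOL-Analysis.Analysis"
    "HOL-Computational_Algebra.Fraction_Field"
    "HOL-Computational_Algebra.Polynomial"
    "HOL-Library.Poly_Mapping"
begin

section \<open>The projective plane and products of projective planes\<close>

definition proj_rel :: "('a::field)^3 \<Rightarrow> 'a^3 \<Rightarrow> bool" where
  "proj_rel u v \<longleftrightarrow> u \<noteq> 0 \<and> v \<noteq> 0 \<and> (\<exists>c. c \<noteq> 0 \<and> v = c *s u)"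

lemma part_equivp_proj_rel: "part_equivp (proj_rel :: ('a::field)^3 \<Rightarrow> _)"
proof (rule part_equivpI)
  show "\<exists>x. proj_rel x (x :: 'a^3)"
    by (rule exI[of _ "\<chi> i. 1"]) (auto simp: proj_rel_def vec_eq_iff intro!: exI[of _ 1])
  show "symp (proj_rel :: 'a^3 \<Rightarrow> _)"
  proof (rule sympI)
    fix u v :: "'a^3" assume "proj_rel u v"
    then obtain c where "u \<noteq> 0" "v \<noteq> 0" "c \<noteq> 0" "v = c *s u" by (auto simp: proj_rel_def)
    then show "proj_rel v u"
      by (auto simp: proj_rel_def vec_eq_iff intro!: exI[of _ "inverse c"])
  qed
  show "transp (proj_rel :: 'a^3 \<Rightarrow> _)"
  proof (rule transpI)
    fix u v w :: "'a^3" assume "proj_rel u v" "proj_rel v w"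
    then obtain c d where "u \<noteq> 0" "w \<noteq> 0" "c \<noteq> 0" "v = c *s u" "d \<noteq> 0" "w = d *s v"
      by (auto simp: proj_rel_def)
    then show "proj_rel u w"
      by (auto simp: proj_rel_def vec_eq_iff intro!: exI[of _ "d * c"])
  qed
qed

text \<open>The type \<open>'a proj2\<close> is the set of closed points of the projective plane; via coefficients it
  also serves as the dual plane of lines. \<open>rep_proj2\<close> picks homogeneous coordinates; they are used
  below only in ways that do not depend on their scaling.\<close>

quotient_type (overloaded) 'a proj2 = "('a::field)^3" / partial: proj_rel
  by (rule part_equivp_proj_rel)

definition incident :: "'a::field proj2 \<Rightarrow> 'a proj2 \<Rightarrow> bool" where
  "incident x l \<longleftrightarrow> (\<Sum>j\<in>UNIV. rep_proj2 l $ j * rep_proj2 x $ j) = 0"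

text \<open>A point of the product of \<open>n\<close> planes is a list of length \<open>n\<close>. Its homogeneous coordinates
  are polynomial variables indexed by the factor \<open>i\<close> and the coordinate \<open>j\<close>.\<close>

type_synonym 'a mpoly = "((nat \<times> 3) \<Rightarrow>\<^sub>0 nat) \<Rightarrow>\<^sub>0 'a"

definition multihomogeneous :: "nat \<Rightarrow> (nat \<Rightarrow> nat) \<Rightarrow> 'a::comm_ring_1 mpoly \<Rightarrow> bool" where
  "multihomogeneous n e F \<longleftrightarrow>
     (\<forall>m\<in>Poly_Mapping.keys F.
        (\<forall>i<n. (\<Sum>j\<in>UNIV. Poly_Mapping.lookup m (i, j)) = e i) \<and>
        (\<forall>i\<ge>n. \<forall>j. Poly_Mapping.lookup m (i, j) = 0))"

text \<open>Value at a list of coordinate vectors, with the coefficients mapped along \<open>\<phi>\<close>.\<close>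

definition eval_mpoly :: "('a \<Rightarrow> 'b) \<Rightarrow> 'a::comm_ring_1 mpoly \<Rightarrow> (('b::comm_ring_1)^3) list \<Rightarrow> 'b" where
  "eval_mpoly \<phi> F vs =
     (\<Sum>m\<in>Poly_Mapping.keys F. \<phi> (Poly_Mapping.lookup F m) *
        (\<Prod>v\<in>Poly_Mapping.keys m. (vs ! fst v $ snd v) ^ Poly_Mapping.lookup m v))"

definition nonvanishing_locus :: "nat \<Rightarrow> 'a::field mpoly \<Rightarrow> 'a proj2 list set" where
  "nonvanishing_locus n F = {P. length P = n \<and> eval_mpoly id F (map rep_proj2 P) \<noteq> 0}"

definition zariski :: "nat \<Rightarrow> 'a::field proj2 list topology" where
  "zariski n = topology_generated_by {nonvanishing_locus n F | F. \<exists>e. multihomogeneous n e F}"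

definition irreducible_closedin :: "'b topology \<Rightarrow> 'b set \<Rightarrow> bool" where
  "irreducible_closedin T C \<longleftrightarrow> closedin T C \<and> C \<noteq> {} \<and>
     (\<forall>A B. closedin T A \<and> closedin T B \<and> C \<subseteq> A \<union> B \<longrightarrow> C \<subseteq> A \<or> C \<subseteq> B)"


section \<open>The blow-up of the plane at a list of distinct points\<close>

text \<open>The blow-up at \<open>p\<^sub>1, \<dots>, p\<^sub>s\<close> consists of the \<open>(x, l\<^sub>1, \<dots>, l\<^sub>s)\<close> such that
  \<open>l\<^sub>i\<close> is a line through \<open>p\<^sub>i\<close> and \<open>x\<close>. The lines through \<open>p\<^sub>i\<close> form a projective line, and
  for distinct points this is the closure of the graph of the simultaneous projection from
  \<open>p\<^sub>1, \<dots>, p\<^sub>s\<close>. The blow-down map is \<open>hd\<close>.\<close>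

definition blowup :: "'a::field proj2 list \<Rightarrow> 'a proj2 list set" where
  "blowup ps = {x # ls | x ls. length ls = length ps \<and>
     (\<forall>i<length ps. incident (ps ! i) (ls ! i) \<and> incident x (ls ! i))}"

text \<open>Codimension one: no irreducible closed set lies strictly between \<open>C\<close> and the surface.\<close>

definition prime_divisor :: "'a::field proj2 list \<Rightarrow> 'a proj2 list set \<Rightarrow> bool" where
  "prime_divisor ps C \<longleftrightarrow>
     irreducible_closedin (zariski (Suc (length ps))) C \<and> C \<subset> blowup ps \<and>
     \<not> (\<exists>Z. irreducible_closedin (zariski (Suc (length ps))) Z \<and> C \<subset> Z \<and> Z \<subset> blowup ps)"


section \<open>Rational functions, local rings and orders of vanishing\<close>

text \<open>The function field of the plane, hence of its blow-up, is \<open>k(x, y)\<close> in the affine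
  coordinates of the chart \<open>(x : y : 1)\<close>; here \<open>x\<close> is the inner and \<open>y\<close> the outer variable.\<close>

type_synonym 'a ratfun = "'a poly poly fract"

definition rf_const :: "'a::field \<Rightarrow> 'a ratfun" where
  "rf_const c = Fract [:[:c:]:] 1"

definition rf_x :: "'a::field ratfun" where
  "rf_x = Fract [:[:0, 1:]:] 1"

definition rf_y :: "'a::field ratfun" where
  "rf_y = Fract [:0, 1:] 1"

definition generic_point :: "('a::field ratfun)^3" where
  "generic_point = vector [rf_x, rf_y, 1]"

definition cross :: "('b::comm_ring_1)^3 \<Rightarrow> 'b^3 \<Rightarrow> 'b^3" where
  "cross u v = vector [u$2 * v$3 - u$3 * v$2, u$3 * v$1 - u$1 * v$3, u$1 * v$2 - u$2 * v$1]"

text \<open>The generic point of the blow-up: the generic point \<open>\<xi>\<close> of the plane, together with the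
  coefficients of the lines joining it to the \<open>p\<^sub>i\<close>. Evaluation at it identifies the function
  field of the blow-up with that of the plane, and thus turns the local ring of the multiprojective
  variety \<open>blowup ps\<close> at a point \<open>P\<close>, i.e. the ring of fractions \<open>F / G\<close> of forms of equal
  multidegree with \<open>G(P) \<noteq> 0\<close>, into a subring of \<open>k(x, y)\<close>.\<close>

definition blowup_generic_point :: "'a::field proj2 list \<Rightarrow> (('a ratfun)^3) list" where
  "blowup_generic_point ps =
     generic_point # map (\<lambda>p. cross (\<chi> j. rf_const (rep_proj2 p $ j)) generic_point) ps"

definition local_ring :: "'a::field proj2 list \<Rightarrow> 'a proj2 list \<Rightarrow> 'a ratfun set" where
  "local_ring ps P =
     {eval_mpoly rf_const F (blowup_generic_point ps) / eval_mpoly rf_const G (blowup_generic_point ps)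
       | F G e. multihomogeneous (Suc (length ps)) e F \<and> multihomogeneous (Suc (length ps)) e G \<and>
                eval_mpoly id G (map rep_proj2 P) \<noteq> 0}"

definition local_ring_along :: "'a::field proj2 list \<Rightarrow> 'a proj2 list set \<Rightarrow> 'a ratfun set" where
  "local_ring_along ps C = (\<Union>P\<in>C. local_ring ps P)"

definition units_in :: "'b::field set \<Rightarrow> 'b set" where
  "units_in R = {f\<in>R. f \<noteq> 0 \<and> inverse f \<in> R}"

definition maximal_ideal_of :: "'b::field set \<Rightarrow> 'b set" where
  "maximal_ideal_of R = R - units_in R"

definition uniformizer :: "'b::field set \<Rightarrow> 'b \<Rightarrow> bool" where
  "uniformizer R t \<longleftrightarrow> t \<in> R \<and> maximal_ideal_of R = (\<lambda>g. t * g) ` R"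

text \<open>Order of \<open>f \<noteq> 0\<close> along a prime divisor \<open>C\<close>, whose local ring is a discrete valuation ring.\<close>

definition ord_along :: "'a::field proj2 list \<Rightarrow> 'a proj2 list set \<Rightarrow> 'a ratfun \<Rightarrow> int" where
  "ord_along ps C f = (THE n. \<exists>t u. uniformizer (local_ring_along ps C) t \<and>
     u \<in> units_in (local_ring_along ps C) \<and> f = u * t powi n)"


section \<open>Divisors and linear systems\<close>

type_synonym 'a divisor = "'a proj2 list set \<Rightarrow> int"

definition support :: "'a divisor \<Rightarrow> 'a::field proj2 list set set" where
  "support D = {C. D C \<noteq> 0}"

definition is_divisor :: "'a::field proj2 list \<Rightarrow> 'a divisor \<Rightarrow> bool" where
  "is_divisor ps D \<longleftrightarrow> finite (support D) \<and> (\<forall>C\<in>support D. prime_divisor ps C)"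

definition effective :: "'a::field divisor \<Rightarrow> bool" where
  "effective D \<longleftrightarrow> (\<forall>C. D C \<ge> 0)"

definition principal_divisor :: "'a::field proj2 list \<Rightarrow> 'a ratfun \<Rightarrow> 'a divisor" where
  "principal_divisor ps f = (\<lambda>C. if prime_divisor ps C then ord_along ps C f else 0)"

definition linearly_equivalent ::
  "'a::field proj2 list \<Rightarrow> 'a divisor \<Rightarrow> 'a divisor \<Rightarrow> bool" where
  "linearly_equivalent ps D D' \<longleftrightarrow> (\<exists>f. f \<noteq> 0 \<and> (\<lambda>C. D' C - D C) = principal_divisor ps f)"

definition linear_system :: "'a::field proj2 list \<Rightarrow> 'a divisor \<Rightarrow> 'a divisor set" where
  "linear_system ps D = {D'. is_divisor ps D' \<and> effective D' \<and> linearly_equivalent ps D D'}"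

definition base_point_free :: "'a::field proj2 list \<Rightarrow> 'a divisor set \<Rightarrow> bool" where
  "base_point_free ps S \<longleftrightarrow> (\<forall>P\<in>blowup ps. \<exists>D\<in>S. P \<notin> \<Union>(support D))"


section \<open>The divisors \<open>L\<close>, \<open>E\<close> and \<open>K\<close>\<close>

text \<open>The pullback of a line \<open>a\<close> as a Cartier divisor: near the image of a point \<open>P\<close> of the blow-up,
  \<open>a\<close> has the local equation \<open>a(\<xi>) / b(\<xi>)\<close>, for any linear form \<open>b\<close> not vanishing there.\<close>

definition linear_form :: "'a::field proj2 \<Rightarrow> 'a ratfun" where
  "linear_form a = (\<Sum>j\<in>UNIV. rf_const (rep_proj2 a $ j) * generic_point $ j)"

definition line_pullback :: "'a::field proj2 list \<Rightarrow> 'a proj2 \<Rightarrow> 'a divisor" where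
  "line_pullback ps a = (\<lambda>C. if prime_divisor ps C then
     (THE n. \<exists>P\<in>C. \<exists>b. \<not> incident (hd P) b \<and> n = ord_along ps C (linear_form a / linear_form b))
     else 0)"

definition exceptional_curve :: "'a::field proj2 list \<Rightarrow> nat \<Rightarrow> 'a proj2 list set" where
  "exceptional_curve ps i = {P\<in>blowup ps. hd P = ps ! i}"

definition exceptional_divisor :: "'a::field proj2 list \<Rightarrow> 'a divisor" where
  "exceptional_divisor ps = (\<lambda>C. \<Sum>i<length ps. if C = exceptional_curve ps i then 1 else 0)"

text \<open>Extension of a derivation of \<open>k[x, y]\<close> to \<open>k(x, y)\<close> by the quotient rule.\<close>

definition fract_deriv :: "('b \<Rightarrow> 'b) \<Rightarrow> 'b::idom fract \<Rightarrow> 'b fract" where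
  "fract_deriv \<delta> f = (THE g. \<forall>a b. b \<noteq> 0 \<and> f = Fract a b \<longrightarrow> g = Fract (\<delta> a * b - a * \<delta> b) (b\<^sup>2))"

definition deriv_x :: "'a::field ratfun \<Rightarrow> 'a ratfun" where
  "deriv_x = fract_deriv (map_poly pderiv)"

definition deriv_y :: "'a::field ratfun \<Rightarrow> 'a ratfun" where
  "deriv_y = fract_deriv pderiv"

text \<open>\<open>du \<and> dv = jacobian u v \<cdot> dx \<and> dy\<close>\<close>

definition jacobian :: "'a::field ratfun \<Rightarrow> 'a ratfun \<Rightarrow> 'a ratfun" where
  "jacobian u v = deriv_x u * deriv_y v - deriv_y u * deriv_x v"

definition local_parameters ::
  "'a::field proj2 list \<Rightarrow> 'a proj2 list \<Rightarrow> 'a ratfun \<Rightarrow> 'a ratfun \<Rightarrow> bool" where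
  "local_parameters ps P u v \<longleftrightarrow> u \<in> local_ring ps P \<and> v \<in> local_ring ps P \<and>
     maximal_ideal_of (local_ring ps P) =
       {g * u + h * v | g h. g \<in> local_ring ps P \<and> h \<in> local_ring ps P}"

text \<open>Every rational 2-form is \<open>\<omega> = f dx \<and> dy\<close> for a unique rational function \<open>f\<close>. At a point with
  local parameters \<open>u, v\<close> the 2-form \<open>du \<and> dv\<close> generates the canonical sheaf, so \<open>\<omega>\<close> is there
  given by the function \<open>f / jacobian u v\<close>. For every \<open>f \<noteq> 0\<close> the divisor of \<open>\<omega>\<close> is a canonical
  divisor.\<close>

definition canonical_divisor :: "'a::field proj2 list \<Rightarrow> 'a ratfun \<Rightarrow> 'a divisor" where
  "canonical_divisor ps f = (\<lambda>C. if prime_divisor ps C then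
     (THE n. \<exists>P\<in>C. \<exists>u v. local_parameters ps P u v \<and> n = ord_along ps C (f / jacobian u v))
     else 0)"

end

theory Submission
  imports Defs "Berlekamp_Zassenhaus.Unique_Factorization_Poly"
begin

no_notation Matrix.vec_index (infixl "$" 100)

text \<open>Sections of \<open>-2K + 10L - 2E\<close> are the curves of degree 16 with multiplicity 4 at the points.
  Specialize the points to the grid \<open>{0, 1, 2, 3}\<^sup>2\<close> without \<open>(0, 0)\<close> and \<open>(1, 2)\<close>. The ideal of the full
  grid is generated by two quartics \<open>gA, gB\<close>, and curves with multiplicity 4 on it are combinations
  of the \<open>gA\<^sup>i gB\<^sup>4\<^sup>-\<^sup>i\<close>. Curves that are less singular at the two omitted points serve to remove the few
  monomials of degree 17 and 18 that remain after reduction modulo \<open>gA, gB\<close>. Hence the 140 multiplicity conditions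
  are independent in degree 16, and the curves of degree 16 generate all curves of degree 56 with multiplicity 4 at the
  fourteen points. Both properties are open. The system in degree 56 is visibly base point free, as it
  contains the fourfold unions of lines, one through each of the points, so the one in degree 16 is base point
  free for a general choice of points.\<close>


section \<open>Evaluation of bivariate polynomials\<close>

text \<open>Base point freeness concerns every point of a surface that moves with the fourteen
  points, and proving it open would call for a properness argument. Generation in one fixed degree
  avoids this: it is surjectivity of a matrix with entries polynomial in the points, so it is
  guaranteed where one polynomial does not vanish. Independence is needed beside it so that the
  chosen curves deform with the points. The sixteen points of the full grid form a complete
  intersection, which makes all powers of their ideal explicit, but they impose 160 conditions on
  the 153 coefficients in degree 16. Exactly twelve products
  \<open>gA ^ i * gB ^ j * (vX ^ a * vY ^ b)\<close> with \<open>i + j\<close> and \<open>a\<close>,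
  \<open>b\<close> at most 3 exceed that degree. The two omitted points supply fourteen relations
  between these twelve, and for the chosen pair the relations have full rank. The definitions know
  the surface only through its closed points and through subrings of k(x, y). Orders, canonical
  divisors and finiteness of supports are therefore computed in explicit charts, where they reduce
  to factorization of polynomials in two variables.\<close>

definition cc :: "'a::comm_ring_1 \<Rightarrow> 'a poly poly" where "cc c = [:[:c:]:]"
definition vX :: "'a::comm_ring_1 poly poly" where "vX = [:[:0, 1:]:]"
definition vY :: "'a::comm_ring_1 poly poly" where "vY = [:0, 1:]"

text \<open>Constants and the two variables generate the polynomial ring, so identities between
  homomorphisms and closure properties only have to be checked there.\<close>

lemma poly2_induct [case_names const X Y add mult]:
  fixes P :: "'a::comm_ring_1 poly poly \<Rightarrow> bool"
  assumes "\<And>c. P (cc c)" "P vX" "P vY"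
    and add: "\<And>f g. P f \<Longrightarrow> P g \<Longrightarrow> P (f + g)" and mult: "\<And>f g. P f \<Longrightarrow> P g \<Longrightarrow> P (f * g)"
  shows "P f"
proof -
  have inner: "P [:p:]" for p
  proof (induction p)
    case 0
    show ?case using assms(1)[of 0] by (simp add: cc_def)
  next
    case (pCons a p)
    have "[:pCons a p:] = cc a + vX * [:p:]" by (simp add: cc_def vX_def)
    then show ?case using assms(1,2) pCons add mult by metis
  qed
  show ?thesis
  proof (induction f)
    case 0
    show ?case using inner[of 0] by simp
  next
    case (pCons p f)
    have "pCons p f = [:p:] + vY * f" by (simp add: vY_def)
    then show ?case using inner assms(3) pCons add mult by metis
  qed
qed

text \<open>One evaluation in three roles: values at closed points (\<open>pt\<close>), substitution
  of polynomials (\<open>\<phi> = cc\<close>) and pullback of chart polynomials to the function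
  field (\<open>\<phi> = rf_const\<close>). \<open>hom_ev2\<close> composes them. The inner variable
  receives \<open>A\<close>, the outer one \<open>B\<close>.\<close>

definition ev2 :: "('a \<Rightarrow> 'b) \<Rightarrow> 'b \<Rightarrow> 'b \<Rightarrow> 'a::comm_ring_1 poly poly \<Rightarrow> 'b::comm_ring_1" where
  "ev2 \<phi> A B f = poly (map_poly (\<lambda>p. poly (map_poly \<phi> p) A) f) B"

lemma comm_ring_hom_ev2:
  assumes "comm_ring_hom \<phi>"
  shows "comm_ring_hom (ev2 \<phi> A B)"
proof -
  interpret comm_ring_hom \<phi> by fact
  interpret m: map_poly_comm_ring_hom \<phi> ..
  have 1: "comm_ring_hom (\<lambda>p. poly (map_poly \<phi> p) A)"
    by unfold_locales (auto simp: m.hom_add m.hom_mult)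
  interpret n: comm_ring_hom "\<lambda>p. poly (map_poly \<phi> p) A" by fact
  interpret k: map_poly_comm_ring_hom "\<lambda>p. poly (map_poly \<phi> p) A" ..
  show ?thesis
    unfolding ev2_def by unfold_locales (auto simp: k.hom_add k.hom_mult)
qed

lemma ev2_simps:
  assumes "comm_ring_hom \<phi>"
  shows "ev2 \<phi> A B (cc c) = \<phi> c" "ev2 \<phi> A B vX = A" "ev2 \<phi> A B vY = B"
    "ev2 \<phi> A B (f + g) = ev2 \<phi> A B f + ev2 \<phi> A B g"
    "ev2 \<phi> A B (f * g) = ev2 \<phi> A B f * ev2 \<phi> A B g"
    "ev2 \<phi> A B (f - g) = ev2 \<phi> A B f - ev2 \<phi> A B g"
    "ev2 \<phi> A B (- f) = - ev2 \<phi> A B f"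
    "ev2 \<phi> A B 0 = 0" "ev2 \<phi> A B 1 = 1" 
    "ev2 \<phi> A B (f ^ n) = ev2 \<phi> A B f ^ n"
    "ev2 \<phi> A B (sum h S) = (\<Sum>i\<in>S. ev2 \<phi> A B (h i))"
    "ev2 \<phi> A B (prod h S) = (\<Prod>i\<in>S. ev2 \<phi> A B (h i))"
proof -
  interpret comm_ring_hom \<phi> by fact
  interpret e: comm_ring_hom "ev2 \<phi> A B" by (rule comm_ring_hom_ev2) fact
  show "ev2 \<phi> A B (cc c) = \<phi> c" "ev2 \<phi> A B vX = A" "ev2 \<phi> A B vY = B"
    by (cases "c = 0"; auto simp: ev2_def cc_def vX_def vY_def map_poly_pCons simp del: pCons_one)+
  show "ev2 \<phi> A B (f + g) = ev2 \<phi> A B f + ev2 \<phi> A B g"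
    "ev2 \<phi> A B (f * g) = ev2 \<phi> A B f * ev2 \<phi> A B g"
    "ev2 \<phi> A B (f - g) = ev2 \<phi> A B f - ev2 \<phi> A B g"
    "ev2 \<phi> A B (- f) = - ev2 \<phi> A B f"
    "ev2 \<phi> A B 0 = 0" "ev2 \<phi> A B 1 = 1" 
    "ev2 \<phi> A B (f ^ n) = ev2 \<phi> A B f ^ n"
    "ev2 \<phi> A B (sum h S) = (\<Sum>i\<in>S. ev2 \<phi> A B (h i))"
    "ev2 \<phi> A B (prod h S) = (\<Prod>i\<in>S. ev2 \<phi> A B (h i))"
    by (auto simp: e.hom_add e.hom_mult e.hom_minus e.hom_uminus e.hom_power e.hom_sum e.hom_prod)
qed

lemma hom_ev2:
  assumes "comm_ring_hom \<phi>" "comm_ring_hom \<psi>"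
  shows "\<psi> (ev2 \<phi> A B f) = ev2 (\<lambda>c. \<psi> (\<phi> c)) (\<psi> A) (\<psi> B) f"
proof -
  interpret p: comm_ring_hom \<psi> by fact
  interpret q: comm_ring_hom \<phi> by fact
  have c: "comm_ring_hom (\<lambda>c. \<psi> (\<phi> c))"
    by unfold_locales (auto simp: p.hom_add q.hom_add p.hom_mult q.hom_mult)
  show ?thesis
    by (induction f rule: poly2_induct)
      (simp_all add: ev2_simps[OF assms(1)] ev2_simps[OF c] p.hom_add p.hom_mult)
qed

lemma comm_ring_hom_id [simp]: "comm_ring_hom (\<lambda>c. c)" "comm_ring_hom id"
  by unfold_locales auto

lemma comm_ring_hom_cc [simp]: "comm_ring_hom cc"
  by unfold_locales (auto simp: cc_def)

lemma ev2_cc_self [simp]: "ev2 cc vX vY f = f"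
  by (induction f rule: poly2_induct) (simp_all add: ev2_simps)

abbreviation pt :: "'a \<Rightarrow> 'a \<Rightarrow> 'a::comm_ring_1 poly poly \<Rightarrow> 'a" where
  "pt a b \<equiv> ev2 (\<lambda>c. c) a b"

lemma rf_const_eq: "rf_const c = Fract (cc c) 1"
  and rf_x_eq: "rf_x = Fract vX 1" and rf_y_eq: "rf_y = Fract vY 1"
  by (simp_all add: rf_const_def cc_def rf_x_def vX_def rf_y_def vY_def)

lemma comm_ring_hom_rf_const [simp]: "comm_ring_hom (rf_const :: 'a::field \<Rightarrow> _)"
  by unfold_locales
    (auto simp: rf_const_def One_fract_def Zero_fract_def mult_fract)

lemmas ev2_rf = ev2_simps[OF comm_ring_hom_rf_const]
lemmas ev2_id = ev2_simps[OF comm_ring_hom_id(1)]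
lemmas ev2_cc = ev2_simps[OF comm_ring_hom_cc]

lemma ev2_rf_generic: "ev2 rf_const rf_x rf_y f = Fract f 1"
  by (induction f rule: poly2_induct)
    (simp_all add: ev2_rf, simp_all add: rf_const_eq rf_x_eq rf_y_eq)

lemma pt_eq: "pt a b f = poly (poly f [:b:]) a"
  by (induction f rule: poly2_induct) (simp_all add: ev2_id, simp_all add: cc_def vX_def vY_def)

lemma rf_const_eq_0_iff [simp]: "rf_const c = 0 \<longleftrightarrow> c = 0"
  by (simp add: rf_const_def Zero_fract_def eq_fract)

lemma rf_const_1 [simp]: "rf_const 1 = 1" 
  by (simp add: rf_const_def One_fract_def pCons_one)

lemma poly2_nonzero_point:
  fixes f :: "'a::{idom,ring_char_0} poly poly"
  assumes "f \<noteq> 0"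
  shows "\<exists>a b. pt a b f \<noteq> 0"
proof -
  have "infinite (range (\<lambda>c::'a. [:c:]))"
    by (subst finite_image_iff) (auto simp: inj_on_def infinite_UNIV_char_0)
  moreover have "finite {q. poly f q = 0}" using assms poly_roots_finite by blast
  ultimately obtain b where "poly f [:b:] \<noteq> 0"
    by (metis (mono_tags, lifting) finite_subset image_subsetI mem_Collect_eq)
  then obtain a where "poly (poly f [:b:]) a \<noteq> 0"
    using poly_all_0_iff_0 by blast
  then show ?thesis by (auto simp: pt_eq)
qed

section \<open>A Nullstellensatz for plane curves\<close>

lemma irreducible_imp_prime2:
  fixes \<pi> :: "'a::field poly poly"
  assumes "irreducible \<pi>"
  shows "prime_elem \<pi>"
  using assms by simp

lemma dvd_smult_prime_cancel:
  fixes \<pi> :: "'a::field poly poly"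
  assumes "irreducible \<pi>" "degree \<pi> > 0" "c \<noteq> 0" "\<pi> dvd smult c f"
  shows "\<pi> dvd f"
proof -
  have "\<pi> dvd [:c:] * f" using assms by simp
  then have "\<pi> dvd [:c:] \<or> \<pi> dvd f"
    by (rule prime_elem_dvd_multD[OF irreducible_imp_prime2[OF assms(1)]])
  then show ?thesis
  proof
    assume "\<pi> dvd [:c:]"
    then have "degree \<pi> \<le> degree [:c:]" using assms by (intro dvd_imp_degree_le) auto
    then show ?thesis using assms by simp
  qed
qed

text \<open>Euclid's algorithm over k(x) with denominators cleared. By pseudo-division, a nonzero
  element \<open>m\<close> of least y-degree in the ideal of \<open>\<pi>\<close> and
  \<open>B\<close> divides both, up to factors from k[x]. From \<open>smult c \<pi> = m * q\<close>
  and primality, either \<open>\<pi>\<close> divides \<open>m\<close>, hence \<open>B\<close>, or it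
  cancels against \<open>q\<close> and leaves \<open>m\<close> free of y.\<close>

lemma irreducible_elimination:
  fixes \<pi> B :: "'a::field poly poly"
  assumes irr: "irreducible \<pi>" and deg: "degree \<pi> > 0" and nd: "\<not> \<pi> dvd B"
  shows "\<exists>S T r. r \<noteq> 0 \<and> S * \<pi> + T * B = [:r:]"
proof -
  define I where "I = {m. m \<noteq> 0 \<and> (\<exists>S T. m = S * \<pi> + T * B)}"
  have "\<pi> \<noteq> 0" using deg by auto
  moreover have "\<pi> = 1 * \<pi> + 0 * B" by simp
  ultimately have "\<pi> \<in> I" unfolding I_def by blast
  then obtain m where m: "m \<in> I" and min: "\<And>m'. m' \<in> I \<Longrightarrow> degree m \<le> degree m'"
    using arg_min_nat_lemma[of "\<lambda>m. m \<in> I" \<pi> degree] by metis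
  obtain S T where ST: "m = S * \<pi> + T * B" and m0: "m \<noteq> 0" using m by (auto simp: I_def)
  have div: "\<exists>c q. c \<noteq> 0 \<and> smult c f = m * q" if f: "f = S' * \<pi> + T' * B" for f S' T'
  proof -
    obtain q r where qr: "pseudo_divmod f m = (q, r)" by force
    define c where "c = lead_coeff m ^ (Suc (degree f) - degree m)"
    have c0: "c \<noteq> 0" using m0 by (simp add: c_def)
    have eq: "smult c f = m * q + r" using pseudo_divmod(1)[OF m0 qr] by (simp add: c_def)
    have rd: "r = 0 \<or> degree r < degree m" using pseudo_divmod(2)[OF m0 qr] .
    have "r = smult c f - m * q" using eq by simp
    also have "\<dots> = (smult c S' - q * S) * \<pi> + (smult c T' - q * T) * B"
      unfolding f ST by (simp add: algebra_simps smult_add_right)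
    finally have "r \<noteq> 0 \<Longrightarrow> r \<in> I" by (auto simp: I_def)
    with rd min[of r] have "r = 0" by fastforce
    with eq c0 show ?thesis by auto
  qed
  obtain c q where c: "c \<noteq> 0" "smult c \<pi> = m * q" using div[of \<pi> 1 0] by auto
  have "\<pi> dvd m * q" using c(2) by (metis dvd_refl dvd_smult)
  then have "\<pi> dvd m \<or> \<pi> dvd q"
    by (rule prime_elem_dvd_multD[OF irreducible_imp_prime2[OF irr]])
  then show ?thesis
  proof
    assume 1: "\<pi> dvd m"
    obtain c' q' where c': "c' \<noteq> 0" "smult c' B = m * q'" using div[of B 0 1] by auto
    then have "\<pi> dvd smult c' B" using 1 by simp
    with dvd_smult_prime_cancel[OF irr deg c'(1)] nd show ?thesis by blast
  next
    assume "\<pi> dvd q"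
    then obtain q' where "q = \<pi> * q'" by (elim dvdE)
    then have "[:c:] * \<pi> = (m * q') * \<pi>" using c by (simp add: ac_simps)
    then have *: "[:c:] = m * q'" using \<open>\<pi> \<noteq> 0\<close> mult_right_cancel by blast
    then have "q' \<noteq> 0" using c by auto
    then have "degree m = 0" using * m0 degree_mult_eq[of m q'] by (metis add_is_0 degree_pCons_0)
    then obtain r where "m = [:r:]" using degree_eq_zeroE by blast
    then show ?thesis using ST m0 by (metis pCons_0_0)
  qed
qed

text \<open>If \<open>\<pi>\<close> involves y, choose \<open>a\<close> where neither the eliminant
  \<open>r\<close> nor the leading coefficient of \<open>\<pi>\<close> vanishes. A root
  \<open>b\<close> of \<open>\<pi>\<close> over \<open>a\<close> exists, and there
  \<open>T * B\<close> takes the value \<open>r(a)\<close>, which is not 0. Otherwise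
  \<open>\<pi>\<close> is a vertical line up to a unit, and \<open>B\<close> does not vanish
  identically on it.\<close>

theorem plane_curve_nullstellensatz:
  fixes \<pi> B :: "'a::{alg_closed_field,field_char_0} poly poly"
  assumes irr: "irreducible \<pi>" and nd: "\<not> \<pi> dvd B"
  shows "\<exists>a b. pt a b \<pi> = 0 \<and> pt a b B \<noteq> 0"
proof (cases "degree \<pi> = 0")
  case True
  then obtain p where p: "\<pi> = [:p:]" using degree_eq_zeroE by blast
  have "degree p > 0"
  proof (rule ccontr)
    assume "\<not> degree p > 0"
    then obtain c where pc: "p = [:c:]" by (auto elim: degree_eq_zeroE)
    have "\<pi> \<noteq> 0" using irr unfolding irreducible_def by blast
    then have "c \<noteq> 0" unfolding p pc by simp
    then have "1 = \<pi> * [:[:1 / c:]:]" unfolding p pc by simp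
    then have "\<pi> dvd 1" by (rule dvdI)
    then show False using irr unfolding irreducible_def by blast
  qed
  then obtain a where a: "poly p a = 0" using alg_closed_imp_poly_has_root by blast
  then obtain p' where p': "p = [:-a, 1:] * p'" by (auto simp: poly_eq_0_iff_dvd elim: dvdE)
  have "\<not> [:[:-a,1:]:] dvd 1"
    by (simp add: is_unit_poly_iff pCons_one)
  moreover have pi: "\<pi> = [:[:-a, 1:]:] * [:p':]" using p p' by simp
  ultimately have u: "[:p':] dvd 1" using irr unfolding irreducible_def by metis
  have nd': "\<not> [:[:-a, 1:]:] dvd B"
  proof
    assume "[:[:-a, 1:]:] dvd B"
    moreover have "\<pi> dvd [:[:-a, 1:]:]"
    proof -
      obtain w where "1 = [:p':] * w" using u by (elim dvdE)
      then have "[:[:-a, 1:]:] = \<pi> * w" unfolding pi by (metis mult.assoc mult.right_neutral)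
      then show ?thesis by (rule dvdI)
    qed
    ultimately show False using nd dvd_trans by blast
  qed
  have ca: "comm_ring_hom (\<lambda>p. poly p a)" by unfold_locales auto
  have "map_poly (\<lambda>p. poly p a) B \<noteq> 0"
  proof
    assume 0: "map_poly (\<lambda>p. poly p a) B = 0"
    have "[:-a, 1:] dvd coeff B i" for i
    proof -
      have "coeff (map_poly (\<lambda>p. poly p a) B) i = 0" using 0 by simp
      then show ?thesis by (simp add: coeff_map_poly poly_eq_0_iff_dvd)
    qed
    then show False using nd' const_poly_dvd_iff by blast
  qed
  then obtain b where b: "poly (map_poly (\<lambda>p. poly p a) B) b \<noteq> 0"
    using poly_all_0_iff_0 by blast
  have "pt a b B \<noteq> 0" using b by (simp add: ev2_def)
  moreover have "pt a b \<pi> = 0" using a p by (simp add: pt_eq)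
  ultimately show ?thesis by blast
next
  case False
  then obtain S T r where r: "r \<noteq> 0" "S * \<pi> + T * B = [:r:]"
    using irreducible_elimination[OF irr _ nd] by auto
  have "r * lead_coeff \<pi> \<noteq> 0" using r False by auto
  then obtain a where a: "poly (r * lead_coeff \<pi>) a \<noteq> 0"
    using poly_all_0_iff_0 by blast
  define p where "p = map_poly (\<lambda>q. poly q a) \<pi>"
  have "coeff p (degree \<pi>) \<noteq> 0" using a by (simp add: p_def coeff_map_poly)
  then have "degree p > 0" using False le_degree[of p "degree \<pi>"] by simp
  then obtain b where b: "poly p b = 0" using alg_closed_imp_poly_has_root by blast
  have pi: "pt a b \<pi> = 0" using b by (simp add: ev2_def p_def)
  have "pt a b (S * \<pi> + T * B) = poly r a" using r by (simp add: pt_eq)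
  then have "pt a b T * pt a b B = poly r a" using pi by (simp add: ev2_id)
  then have "pt a b B \<noteq> 0" using a by auto
  then show ?thesis using pi by blast
qed

section \<open>Multihomogeneous forms\<close>

lemma eval_mpoly_superset:
  assumes "finite S" "Poly_Mapping.keys F \<subseteq> S" "\<phi> 0 = 0"
  shows "eval_mpoly \<phi> F vs = (\<Sum>m\<in>S. \<phi> (Poly_Mapping.lookup F m) *
    (\<Prod>v\<in>Poly_Mapping.keys m. (vs ! fst v $ snd v) ^ Poly_Mapping.lookup m v))"
  unfolding eval_mpoly_def
  by (rule sum.mono_neutral_left) (use assms in \<open>auto simp: in_keys_iff\<close>)

definition mono_eval :: "('b::comm_ring_1^3) list \<Rightarrow> ((nat \<times> 3) \<Rightarrow>\<^sub>0 nat) \<Rightarrow> 'b" where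
  "mono_eval vs m = (\<Prod>v\<in>Poly_Mapping.keys m. (vs ! fst v $ snd v) ^ Poly_Mapping.lookup m v)"

lemma mono_eval_superset:
  assumes "finite S" "Poly_Mapping.keys m \<subseteq> S"
  shows "mono_eval vs m = (\<Prod>v\<in>S. (vs ! fst v $ snd v) ^ Poly_Mapping.lookup m v)"
  unfolding mono_eval_def
  by (rule prod.mono_neutral_left) (use assms in \<open>auto simp: in_keys_iff\<close>)

lemma mono_eval_add: "mono_eval vs (m + m') = mono_eval vs m * mono_eval vs m'"
proof -
  let ?S = "Poly_Mapping.keys m \<union> Poly_Mapping.keys m'"
  have "Poly_Mapping.keys (m + m') \<subseteq> ?S" by (rule keys_add)
  then show ?thesis
    by (subst (1 2 3) mono_eval_superset[of ?S])
      (auto simp: lookup_add power_add prod.distrib)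
qed

context
  fixes \<phi> :: "'a::comm_ring_1 \<Rightarrow> 'b::comm_ring_1"
  assumes hom: "comm_ring_hom \<phi>"
begin

interpretation comm_ring_hom \<phi> by (rule hom)

lemma eval_mpoly_add: "eval_mpoly \<phi> (F + G) vs = eval_mpoly \<phi> F vs + eval_mpoly \<phi> G vs"
proof -
  let ?S = "Poly_Mapping.keys F \<union> Poly_Mapping.keys G"
  have "Poly_Mapping.keys (F + G) \<subseteq> ?S" by (rule keys_add)
  then show ?thesis
    by (subst (1 2 3) eval_mpoly_superset[of ?S])
      (auto simp: lookup_add hom_add algebra_simps sum.distrib)
qed

lemma eval_mpoly_0 [simp]: "eval_mpoly \<phi> 0 vs = 0"
  by (simp add: eval_mpoly_def)

lemma eval_mpoly_sum: "eval_mpoly \<phi> (sum f A) vs = (\<Sum>x\<in>A. eval_mpoly \<phi> (f x) vs)"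
  by (induction A rule: infinite_finite_induct) (auto simp: eval_mpoly_add)

lemma eval_mpoly_single:
  "eval_mpoly \<phi> (Poly_Mapping.single m c) vs = \<phi> c * mono_eval vs m"
  by (cases "c = 0") (auto simp: eval_mpoly_def mono_eval_def)

lemma mpoly_sum_singles:
  fixes F :: "'a mpoly"
  shows "F = (\<Sum>m\<in>Poly_Mapping.keys F. Poly_Mapping.single m (Poly_Mapping.lookup F m))"
  by (rule poly_mapping_eqI)
    (auto simp: lookup_sum lookup_single when_def in_keys_iff)

lemma eval_mpoly_mult: "eval_mpoly \<phi> (F * G) vs = eval_mpoly \<phi> F vs * eval_mpoly \<phi> G vs"
proof -
  have "eval_mpoly \<phi> (F * G) vs =
    eval_mpoly \<phi> ((\<Sum>m\<in>Poly_Mapping.keys F. Poly_Mapping.single m (Poly_Mapping.lookup F m)) *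
      (\<Sum>m\<in>Poly_Mapping.keys G. Poly_Mapping.single m (Poly_Mapping.lookup G m))) vs"
    using mpoly_sum_singles by metis
  also have "\<dots> = (\<Sum>m\<in>Poly_Mapping.keys F. \<Sum>m'\<in>Poly_Mapping.keys G.
     \<phi> (Poly_Mapping.lookup F m * Poly_Mapping.lookup G m') * mono_eval vs (m + m'))"
    by (simp add: sum_product mult_single eval_mpoly_sum eval_mpoly_single)
  also have "\<dots> = eval_mpoly \<phi> F vs * eval_mpoly \<phi> G vs"
    unfolding eval_mpoly_def sum_product mono_eval_def[symmetric]
    by (simp add: hom_mult mono_eval_add ac_simps)
  finally show ?thesis .
qed

end

definition mconst :: "'a::comm_ring_1 \<Rightarrow> 'a mpoly" where
  "mconst c = Poly_Mapping.single 0 c"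

definition mlinear :: "nat \<Rightarrow> 'a::comm_ring_1 ^ 3 \<Rightarrow> 'a mpoly" where
  "mlinear i a = (\<Sum>j\<in>UNIV. Poly_Mapping.single (Poly_Mapping.single (i, j) 1) (a $ j))"

definition unit_degree :: "nat \<Rightarrow> nat \<Rightarrow> nat" where
  "unit_degree i = (\<lambda>k. if k = i then 1 else 0)"

lemma eval_mconst: 
  assumes "comm_ring_hom \<phi>"
  shows "eval_mpoly \<phi> (mconst c) vs = \<phi> c"
  by (simp add: mconst_def eval_mpoly_single[OF assms] mono_eval_def)

lemma eval_mlinear: 
  assumes "comm_ring_hom \<phi>"
  shows "eval_mpoly \<phi> (mlinear i a) vs = (\<Sum>j\<in>UNIV. \<phi> (a $ j) * vs ! i $ j)"
  by (simp add: mlinear_def eval_mpoly_single[OF assms] mono_eval_def eval_mpoly_sum[OF assms])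

lemma multihomogeneous_0: "multihomogeneous n e 0"
  by (simp add: multihomogeneous_def)

lemma multihomogeneous_add:
  "multihomogeneous n e F \<Longrightarrow> multihomogeneous n e G \<Longrightarrow> multihomogeneous n e (F + G)"
  unfolding multihomogeneous_def using keys_add[of F G] by blast

lemma multihomogeneous_sum:
  "(\<And>x. x \<in> A \<Longrightarrow> multihomogeneous n e (f x)) \<Longrightarrow> multihomogeneous n e (sum f A)"
  by (induction A rule: infinite_finite_induct)
    (auto simp: multihomogeneous_0 intro: multihomogeneous_add)

lemma multihomogeneous_mult:
  assumes "multihomogeneous n e F" "multihomogeneous n e' G"
  shows "multihomogeneous n (\<lambda>i. e i + e' i) (F * G)"
  unfolding multihomogeneous_def
proof
  fix m assume "m \<in> Poly_Mapping.keys (F * G)"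
  then obtain a b where "m = a + b" "a \<in> Poly_Mapping.keys F" "b \<in> Poly_Mapping.keys G"
    using keys_mult[of F G] by blast
  then show "(\<forall>i<n. (\<Sum>j\<in>UNIV. Poly_Mapping.lookup m (i, j)) = e i + e' i) \<and>
        (\<forall>i\<ge>n. \<forall>j. Poly_Mapping.lookup m (i, j) = 0)"
    using assms by (auto simp: multihomogeneous_def lookup_add sum.distrib)
qed

lemma multihomogeneous_mconst: "multihomogeneous n (\<lambda>_. 0) (mconst c)"
  by (cases "c = 0") (auto simp: multihomogeneous_def mconst_def)

lemma multihomogeneous_mlinear:
  assumes "i < n"
  shows "multihomogeneous n (unit_degree i) (mlinear i a)"
  unfolding mlinear_def
proof (rule multihomogeneous_sum)
  fix j :: 3
  show "multihomogeneous n (unit_degree i)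
    (Poly_Mapping.single (Poly_Mapping.single (i, j) 1) (a $ j))"
    using assms 
    by (cases "a $ j = 0") 
      (auto simp: multihomogeneous_def unit_degree_def lookup_single when_def)
qed

definition vmap :: "('a \<Rightarrow> 'b) \<Rightarrow> 'a ^ 3 \<Rightarrow> 'b ^ 3" where
  "vmap \<psi> v = (\<chi> j. \<psi> (v $ j))"

lemma vmap_nth [simp]: "vmap \<psi> v $ j = \<psi> (v $ j)"
  by (simp add: vmap_def)

lemma multihomogeneous_keys_less:
  assumes "multihomogeneous n e F" "m \<in> Poly_Mapping.keys F" "v \<in> Poly_Mapping.keys m"
  shows "fst v < n"
  using assms unfolding multihomogeneous_def in_keys_iff[of v]
  by (metis not_less prod.collapse)

lemma eval_mpoly_hom:
  assumes "comm_ring_hom \<psi>" "multihomogeneous (length vs) e F"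
  shows "\<psi> (eval_mpoly \<phi> F vs) = eval_mpoly (\<lambda>c. \<psi> (\<phi> c)) F (map (vmap \<psi>) vs)"
proof -
  interpret comm_ring_hom \<psi> by fact
  show ?thesis
    unfolding eval_mpoly_def hom_sum hom_mult hom_prod hom_power
    by (intro sum.cong prod.cong arg_cong2[where f = "(*)"])
      (use multihomogeneous_keys_less[OF assms(2)] in auto)
qed

text \<open>All monomials of a form of multidegree \<open>e\<close> scale alike. This makes the
  vanishing of forms independent of the coordinates picked by \<open>rep_proj2\<close>, and
  quotients of forms of equal multidegree independent of scaling.\<close>

lemma eval_mpoly_scale:
  fixes vs ws :: "('b::comm_ring_1^3) list"
  assumes F: "multihomogeneous n e F" and ws: "\<And>i. i < n \<Longrightarrow> ws ! i = c i *s vs ! i"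
  shows "eval_mpoly \<phi> F ws = (\<Prod>i<n. c i ^ e i) * eval_mpoly \<phi> F vs"
proof -
  have "mono_eval ws m = (\<Prod>i<n. c i ^ e i) * mono_eval vs m" if m: "m \<in> Poly_Mapping.keys F" for m
  proof -
    let ?S = "{..<n} \<times> (UNIV :: 3 set)"
    have k: "Poly_Mapping.keys m \<subseteq> ?S"
      using multihomogeneous_keys_less[OF F m] by (auto simp: mem_Times_iff)
    have "mono_eval ws m = (\<Prod>v\<in>?S. (ws ! fst v $ snd v) ^ Poly_Mapping.lookup m v)"
      by (rule mono_eval_superset) (use k in auto)
    also have "\<dots> = (\<Prod>v\<in>?S. c (fst v) ^ Poly_Mapping.lookup m v * (vs ! fst v $ snd v) ^ Poly_Mapping.lookup m v)"
      by (rule prod.cong) (auto simp: ws power_mult_distrib)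
    also have "\<dots> = (\<Prod>v\<in>?S. c (fst v) ^ Poly_Mapping.lookup m v) * mono_eval vs m"
      by (subst mono_eval_superset[of ?S m]) (use k in \<open>auto simp: prod.distrib\<close>)
    also have "(\<Prod>v\<in>?S. c (fst v) ^ Poly_Mapping.lookup m v) = 
        (\<Prod>i<n. \<Prod>j\<in>UNIV. c i ^ Poly_Mapping.lookup m (i, j))"
      by (subst prod.cartesian_product) (auto intro!: prod.cong)
    also have "\<dots> = (\<Prod>i<n. c i ^ e i)"
      using F m by (intro prod.cong) (auto simp: multihomogeneous_def power_sum[symmetric])
    finally show ?thesis .
  qed
  then show ?thesis
    unfolding eval_mpoly_def mono_eval_def[symmetric] sum_distrib_left
    by (intro sum.cong) (auto simp: mult_ac)
qed

section \<open>Points of the projective plane\<close>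

lemma proj_rel_refl: "proj_rel v v \<longleftrightarrow> v \<noteq> 0"
  by (auto simp: proj_rel_def intro!: exI[of _ 1])

lemma rep_proj2_nonzero [simp]: "rep_proj2 P \<noteq> 0"
  using Quotient3_rep_reflp[OF Quotient3_proj2, of P] by (simp add: proj_rel_refl)

lemma abs_rep_proj2 [simp]: "abs_proj2 (rep_proj2 P) = P"
  using Quotient3_abs_rep[OF Quotient3_proj2] .

lemma rep_abs_proj2:
  assumes "v \<noteq> 0"
  obtains c where "c \<noteq> 0" "rep_proj2 (abs_proj2 v) = c *s v"
proof -
  have "proj_rel v (rep_proj2 (abs_proj2 v))"
    using rep_abs_rsp[OF Quotient3_proj2, of v v] assms by (simp add: proj_rel_refl)
  then show ?thesis using that by (auto simp: proj_rel_def)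
qed

lemma proj2_eq_iff:
  "P = Q \<longleftrightarrow> (\<exists>c. c \<noteq> 0 \<and> rep_proj2 Q = c *s rep_proj2 P)"
proof
  assume "\<exists>c. c \<noteq> 0 \<and> rep_proj2 Q = c *s rep_proj2 P"
  then have "proj_rel (rep_proj2 P) (rep_proj2 Q)" by (auto simp: proj_rel_def)
  then have "abs_proj2 (rep_proj2 P) = abs_proj2 (rep_proj2 Q)"
    using Quotient3_rel[OF Quotient3_proj2] by metis
  then show "P = Q" by simp
qed (auto intro!: exI[of _ 1])

lemma abs_proj2_eqI:
  assumes "c \<noteq> 0" "v \<noteq> 0" "rep_proj2 P = c *s v"
  shows "abs_proj2 v = P"
proof -
  have "proj_rel v (rep_proj2 P)" using assms by (auto simp: proj_rel_def)
  then have "abs_proj2 v = abs_proj2 (rep_proj2 P)"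
    using Quotient3_rel[OF Quotient3_proj2] by metis
  then show ?thesis by simp
qed

section \<open>The Zariski topology\<close>

abbreviation val :: "'a::field mpoly \<Rightarrow> 'a proj2 list \<Rightarrow> 'a" where
  "val F P \<equiv> eval_mpoly id F (map rep_proj2 P)"

lemmas val_mult = eval_mpoly_mult[OF comm_ring_hom_id(2)]

lemma nonvanishing_locus_mult:
  "nonvanishing_locus n (F * G) = nonvanishing_locus n F \<inter> nonvanishing_locus n G"
  by (auto simp: nonvanishing_locus_def val_mult)

text \<open>A product of forms is a form, so the generating sets are stable under intersection and
  are a basis of the topology, not merely a subbasis.\<close>

lemma openin_zariski_iff:
  "openin (zariski n) U \<longleftrightarrow>
    (\<forall>P\<in>U. \<exists>F e. multihomogeneous n e F \<and> P \<in> nonvanishing_locus n F \<and> nonvanishing_locus n F \<subseteq> U)"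
    (is "_ \<longleftrightarrow> ?R U")
proof
  let ?B = "{nonvanishing_locus n F |F. \<exists>e. multihomogeneous n e F}"
  assume "openin (zariski n) U"
  then have "generate_topology_on ?B U"
    by (simp add: zariski_def openin_topology_generated_by_iff)
  then show "?R U"
  proof induction
    case (Int a b)
    show ?case
    proof
      fix P assume "P \<in> a \<inter> b"
      then obtain F e G e' where "multihomogeneous n e F" "P \<in> nonvanishing_locus n F"
        "nonvanishing_locus n F \<subseteq> a" "multihomogeneous n e' G" "P \<in> nonvanishing_locus n G"
        "nonvanishing_locus n G \<subseteq> b" using Int.IH by blast
      then show "\<exists>F e. multihomogeneous n e F \<and> P \<in> nonvanishing_locus n F \<and> nonvanishing_locus n F \<subseteq> a \<inter> b"
        by (intro exI[of _ "F * G"] exI[of _ "\<lambda>i. e i + e' i"])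
          (auto simp: nonvanishing_locus_mult multihomogeneous_mult)
    qed
  next
    case (UN K)
    then show ?case by (meson UnionE UnionI subset_iff)
  qed auto
next
  assume R: "?R U"
  define B where "B = {nonvanishing_locus n F |F. (\<exists>e. multihomogeneous n e F) \<and> nonvanishing_locus n F \<subseteq> U}"
  have "\<Union>B = U"
  proof
    show "U \<subseteq> \<Union>B"
    proof
      fix P assume "P \<in> U"
      then obtain F e where "multihomogeneous n e F" "P \<in> nonvanishing_locus n F"
        "nonvanishing_locus n F \<subseteq> U" using R by meson
      then show "P \<in> \<Union>B" unfolding B_def by (intro UnionI[of "nonvanishing_locus n F"]) auto
    qed
  qed (auto simp: B_def)
  moreover have "openin (zariski n) (\<Union>B)"
    unfolding zariski_def by (intro openin_Union topology_generated_by_Basis) (auto simp: B_def)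
  ultimately show "openin (zariski n) U" by simp
qed

lemma topspace_zariski: "topspace (zariski n :: 'a::field proj2 list topology) = {P. length P = n}"
proof -
  let ?T = "{P :: 'a proj2 list. length P = n}"
  have "openin (zariski n) ?T"
    unfolding openin_zariski_iff
  proof
    fix P :: "'a proj2 list" assume "P \<in> ?T"
    then show "\<exists>F e. multihomogeneous n e F \<and> P \<in> nonvanishing_locus n F \<and> nonvanishing_locus n F \<subseteq> ?T"
      using multihomogeneous_mconst[of n 1] by (intro exI[of _ "mconst 1"] exI)
        (auto simp: nonvanishing_locus_def eval_mconst)
  qed
  then have "?T \<subseteq> topspace (zariski n)" by (rule openin_subset)
  moreover have "topspace (zariski n) \<subseteq> ?T"
  proof
    fix P assume "P \<in> topspace (zariski n :: 'a proj2 list topology)"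
    moreover have "openin (zariski n) (topspace (zariski n :: 'a proj2 list topology))" by simp
    ultimately show "P \<in> ?T"
      unfolding openin_zariski_iff[of n "topspace _"] by (auto simp: nonvanishing_locus_def)
  qed
  ultimately show ?thesis by blast
qed

lemma closedin_zariski_iff:
  "closedin (zariski n) C \<longleftrightarrow> (\<forall>P\<in>C. length P = n) \<and>
    (\<forall>P. length P = n \<and> P \<notin> C \<longrightarrow>
      (\<exists>F e. multihomogeneous n e F \<and> (\<forall>Q\<in>C. val F Q = 0) \<and> val F P \<noteq> 0))"
  (is "_ \<longleftrightarrow> ?L \<and> ?R")
proof -
  have "openin (zariski n) ({P. length P = n} - C) \<longleftrightarrow> ?R" if "?L"
    unfolding openin_zariski_iff nonvanishing_locus_def using that by (auto, blast+)
  then show ?thesis unfolding closedin_def topspace_zariski by auto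
qed

lemma irreducible_closedin_mult:
  assumes "irreducible_closedin (zariski n) C" "multihomogeneous n e F" "multihomogeneous n e' G"
    and "P \<in> C" "val F P \<noteq> 0" and "Q \<in> C" "val G Q \<noteq> 0"
  shows "\<exists>R\<in>C. val F R \<noteq> 0 \<and> val G R \<noteq> 0"
proof (rule ccontr)
  assume neg: "\<not> ?thesis"
  have len: "length R = n" if "R \<in> C" for R
    using assms(1) that unfolding irreducible_closedin_def closedin_zariski_iff by blast
  define Z where "Z = (\<lambda>H::'a mpoly. {R :: 'a proj2 list. length R = n \<and> val H R = 0})"
  have cl: "closedin (zariski n) (Z H)" if "multihomogeneous n e H" for H e
    using that unfolding closedin_zariski_iff Z_def by auto
  have "C \<subseteq> Z F \<union> Z G" using neg len by (auto simp: Z_def)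
  then have "C \<subseteq> Z F \<or> C \<subseteq> Z G"
    using assms(1) cl[OF assms(2)] cl[OF assms(3)] unfolding irreducible_closedin_def by blast
  then show False using assms by (auto simp: Z_def)
qed

section \<open>Orders in discrete valuation rings\<close>

text \<open>The order for an arbitrary subring of a field, so that the arithmetic of valuations is
  separated from the geometry.\<close>

definition ord_in :: "'b::field set \<Rightarrow> 'b \<Rightarrow> int" where
  "ord_in R f = (THE n. \<exists>t u. uniformizer R t \<and> u \<in> units_in R \<and> f = u * t powi n)"

lemma ord_along_eq: "ord_along ps C f = ord_in (local_ring_along ps C) f"
  by (simp add: ord_along_def ord_in_def)

text \<open>A discrete valuation ring described by what unique factorization in a chart supplies:
  every nonzero element of the field is a unit times a power of \<open>t\<close>. That
  \<open>t\<close> is not invertible in \<open>R\<close> makes the exponent unique.\<close>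

locale dvr =
  fixes R :: "'b::field set" and t :: 'b
  assumes zero: "0 \<in> R" and one: "1 \<in> R"
    and mult: "\<And>f g. f \<in> R \<Longrightarrow> g \<in> R \<Longrightarrow> f * g \<in> R"
    and t: "t \<in> R" "t \<noteq> 0" "inverse t \<notin> R"
    and factor: "\<And>f. f \<noteq> 0 \<Longrightarrow> \<exists>u n. u \<in> units_in R \<and> f = u * t powi n"
begin

lemma units_mult: "u \<in> units_in R \<Longrightarrow> v \<in> units_in R \<Longrightarrow> u * v \<in> units_in R"
  by (auto simp: units_in_def mult)

lemma units_inverse: "u \<in> units_in R \<Longrightarrow> inverse u \<in> units_in R"
  by (auto simp: units_in_def)

lemma units_one: "1 \<in> units_in R" by (auto simp: units_in_def one)

lemma power_in: "f \<in> R \<Longrightarrow> f ^ n \<in> R"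
  by (induction n) (auto simp: one mult)

lemma units_power: "u \<in> units_in R \<Longrightarrow> u powi n \<in> units_in R"
  by (cases "n \<ge> 0") (auto simp: units_in_def power_int_def power_in simp flip: power_inverse)

lemma t_power_not_unit: assumes "t powi n \<in> units_in R" shows "n = 0"
proof (rule ccontr)
  assume "n \<noteq> 0"
  define m where "m = \<bar>n\<bar>"
  have "t powi m \<in> units_in R"
    using assms units_inverse[OF assms] by (cases "n \<ge> 0") (auto simp: m_def power_int_minus)
  moreover have "t powi m = t * t powi (m - 1)"
    using \<open>n \<noteq> 0\<close> t(2) by (simp add: m_def power_int_diff)
  ultimately have *: "inverse (t * t powi (m - 1)) \<in> R" by (simp add: units_in_def)
  have "t powi (m - 1) \<in> R"
    using \<open>n \<noteq> 0\<close> t(1) by (auto simp: m_def power_int_def power_in)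
  from mult[OF this *] have "inverse t \<in> R" using t(2) by (simp add: field_simps)
  then show False using t(3) by simp
qed

lemma mem_cases:
  assumes "f \<in> R" "f \<noteq> 0"
  obtains u n where "u \<in> units_in R" "f = u * t ^ n"
proof -
  obtain u n where un: "u \<in> units_in R" "f = u * t powi n" using factor assms by blast
  have "n \<ge> 0"
  proof (rule ccontr)
    assume "\<not> n \<ge> 0"
    have "inverse u * f \<in> R" using un(1) assms by (auto simp: units_in_def intro!: mult)
    moreover have "inverse u * f = t powi n" using un by (simp add: units_in_def)
    ultimately have "t powi n \<in> R" by simp
    moreover have "t powi (- n) \<in> R" using \<open>\<not> n \<ge> 0\<close> t(1) by (simp add: power_int_def power_in)
    ultimately have "t powi n \<in> units_in R" using t(2) by (simp add: units_in_def power_int_minus)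
    then show False using t_power_not_unit \<open>\<not> n \<ge> 0\<close> by fastforce
  qed
  then show ?thesis using that[of u "nat n"] un by (simp add: power_int_def)
qed

lemma uniformizer_t: "uniformizer R t"
  unfolding uniformizer_def
proof
  show "t \<in> R" by (rule t(1))
  show "maximal_ideal_of R = (\<lambda>g. t * g) ` R"
  proof (intro equalityI subsetI)
    fix f assume f: "f \<in> maximal_ideal_of R"
    show "f \<in> (\<lambda>g. t * g) ` R"
    proof (cases "f = 0")
      case True
      then show ?thesis using zero by (auto intro!: image_eqI[of _ _ 0])
    next
      case False
      obtain u n where un: "u \<in> units_in R" "f = u * t ^ n"
        using f False by (auto simp: maximal_ideal_of_def elim: mem_cases)
      then obtain n' where "n = Suc n'" using f by (cases n) (auto simp: maximal_ideal_of_def)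
      then have "f = t * (u * t ^ n')" "u * t ^ n' \<in> R"
        using un power_in[OF t(1)] by (auto simp: units_in_def mult)
      then show ?thesis by blast
    qed
  next
    fix f assume "f \<in> (\<lambda>g. t * g) ` R"
    then obtain g where g: "g \<in> R" "f = t * g" by auto
    have "f \<notin> units_in R"
    proof
      assume "f \<in> units_in R"
      then have "g * inverse f \<in> R" "g \<noteq> 0" using g by (auto simp: units_in_def mult)
      then show False using g t by (simp add: field_simps)
    qed
    then show "f \<in> maximal_ideal_of R" using g t mult by (auto simp: maximal_ideal_of_def)
  qed
qed

text \<open>The definite description in the order ranges over all uniformizers. Two of them generate
  the same ideal and hence differ by a unit, so the exponent does not depend on the choice.\<close>

lemma uniformizer_unit_multiple:
  assumes "uniformizer R t'"
  shows "\<exists>a\<in>units_in R. t' = a * t"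
proof -
  have eq: "(\<lambda>g. t' * g) ` R = (\<lambda>g. t * g) ` R"
    using assms uniformizer_t by (simp add: uniformizer_def)
  have "t' * 1 \<in> (\<lambda>g. t' * g) ` R" "t * 1 \<in> (\<lambda>g. t * g) ` R" using one by (rule imageI)+
  then have "t' \<in> (\<lambda>g. t * g) ` R" and "t \<in> (\<lambda>g. t' * g) ` R" using eq by simp_all
  obtain a where "a \<in> R" "t' = t * a" using \<open>t' \<in> _\<close> by (rule imageE)
  obtain b where "b \<in> R" "t = t' * b" using \<open>t \<in> _\<close> by (rule imageE)
  note ab = \<open>a \<in> R\<close> \<open>t' = t * a\<close> \<open>b \<in> R\<close> \<open>t = t' * b\<close>
  then have "t * (a * b) = t * 1" by (metis mult.assoc mult.right_neutral)
  then have "a * b = 1" using t(2) by (simp only: mult_cancel_left) simp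
  then have "a \<in> units_in R" using ab by (auto simp: units_in_def inverse_unique)
  then show ?thesis using ab by (auto simp: mult.commute)
qed

lemma ord_in_eq:
  assumes "u \<in> units_in R"
  shows "ord_in R (u * t powi n) = n"
  unfolding ord_in_def
proof (rule the_equality)
  show "\<exists>t' u'. uniformizer R t' \<and> u' \<in> units_in R \<and> u * t powi n = u' * t' powi n"
    using uniformizer_t assms by blast
next
  fix m assume "\<exists>t' u'. uniformizer R t' \<and> u' \<in> units_in R \<and> u * t powi n = u' * t' powi m"
  then obtain t' u' where *: "uniformizer R t'" "u' \<in> units_in R" "u * t powi n = u' * t' powi m" by blast
  obtain a where a: "a \<in> units_in R" "t' = a * t" using uniformizer_unit_multiple[OF *(1)] by blast
  have nz: "u \<noteq> 0" "u' \<noteq> 0" "a \<noteq> 0" using assms * a by (auto simp: units_in_def)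
  have "u * t powi n = (u' * a powi m) * t powi m"
    using *(3) a by (simp add: power_int_mult_distrib)
  then have "t powi (n - m) = inverse u * (u' * a powi m)"
    using nz t(2) by (simp add: power_int_diff field_simps)
  also have "\<dots> \<in> units_in R"
    using assms * a by (intro units_mult units_inverse units_power) auto
  finally show "m = n" using t_power_not_unit by fastforce
qed

lemma ord_in_mult:
  assumes "f \<noteq> 0" "g \<noteq> 0"
  shows "ord_in R (f * g) = ord_in R f + ord_in R g"
proof -
  obtain u n where f: "u \<in> units_in R" "f = u * t powi n" using factor assms by blast
  obtain v m where g: "v \<in> units_in R" "g = v * t powi m" using factor assms by blast
  have "f * g = (u * v) * t powi (n + m)" using f g t(2) by (simp add: power_int_add mult_ac)
  then show ?thesis using f g ord_in_eq units_mult by metis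
qed

lemma ord_in_inverse:
  assumes "f \<noteq> 0"
  shows "ord_in R (inverse f) = - ord_in R f"
proof -
  have "ord_in R (f * inverse f) = 0" using ord_in_eq[OF units_one, of 0] assms by simp
  then show ?thesis using ord_in_mult[of f "inverse f"] assms by simp
qed

lemma ord_in_divide:
  "f \<noteq> 0 \<Longrightarrow> g \<noteq> 0 \<Longrightarrow> ord_in R (f / g) = ord_in R f - ord_in R g"
  using ord_in_mult[of f "inverse g"] ord_in_inverse[of g] by (simp add: field_simps)

lemma ord_in_power:
  "f \<noteq> 0 \<Longrightarrow> ord_in R (f ^ n) = int n * ord_in R f"
  using ord_in_eq[OF units_one, of 0]
  by (induction n) (auto simp: ord_in_mult algebra_simps)

lemma ord_in_unit: "u \<in> units_in R \<Longrightarrow> ord_in R u = 0"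
  using ord_in_eq[of u 0] by simp

lemma ord_in_nonneg:
  assumes "f \<in> R" "f \<noteq> 0"
  shows "ord_in R f \<ge> 0"
proof -
  obtain u n where "u \<in> units_in R" "f = u * t ^ n" using mem_cases assms by blast
  then have "ord_in R f = int n" using ord_in_eq[of u "int n"] by simp
  then show ?thesis by simp
qed

lemma ord_in_t: "u \<in> units_in R \<Longrightarrow> ord_in R (u * t) = 1"
  using ord_in_eq[of u 1] by simp

end

section \<open>Derivations\<close>

locale derivation =
  fixes \<delta> :: "'b::comm_ring_1 \<Rightarrow> 'b"
  assumes add: "\<delta> (f + g) = \<delta> f + \<delta> g" and mult: "\<delta> (f * g) = \<delta> f * g + f * \<delta> g"
begin

lemma zero: "\<delta> 0 = 0" using add[of 0 0] by simp

lemma one: "\<delta> 1 = 0" using mult[of 1 1] by simp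

end

lemma derivation_pderiv: "derivation (pderiv :: 'a::field poly poly \<Rightarrow> _)"
  by unfold_locales (auto simp: pderiv_add pderiv_mult algebra_simps)

lemma derivation_map_pderiv: "derivation (map_poly pderiv :: 'a::field poly poly \<Rightarrow> _)"
proof
  fix f g :: "'a poly poly"
  show "map_poly pderiv (f + g) = map_poly pderiv f + map_poly pderiv g"
    by (rule poly_eqI) (simp add: coeff_map_poly pderiv_add)
  show "map_poly pderiv (f * g) = map_poly pderiv f * g + f * map_poly pderiv g"
    by (rule poly_eqI)
      (simp add: coeff_map_poly coeff_mult pderiv_sum pderiv_mult sum.distrib, simp add: algebra_simps)
qed

text \<open>The quotient rule is independent of the representation: the cross-multiplied difference
  of two results is a combination of \<open>a * d - c * b\<close> and of its derivative, and both
  vanish.\<close>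

lemma fract_deriv_Fract:
  fixes \<delta> :: "'b::idom \<Rightarrow> 'b"
  assumes "derivation \<delta>" "b \<noteq> 0"
  shows "fract_deriv \<delta> (Fract a b) = Fract (\<delta> a * b - a * \<delta> b) (b\<^sup>2)"
proof -
  interpret derivation \<delta> by fact
  have "Fract (\<delta> a * b - a * \<delta> b) (b\<^sup>2) = Fract (\<delta> c * d - c * \<delta> d) (d\<^sup>2)"
    if "d \<noteq> 0" "Fract a b = Fract c d" for c d
  proof -
    have eq: "a * d = c * b" using that assms by (simp add: eq_fract)
    then have "\<delta> a * d + a * \<delta> d = \<delta> c * b + c * \<delta> b" using mult by metis
    have "(\<delta> a * b - a * \<delta> b) * d\<^sup>2 - (\<delta> c * d - c * \<delta> d) * b\<^sup>2 =
      b * d * ((\<delta> a * d + a * \<delta> d) - (\<delta> c * b + c * \<delta> b)) 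
      - (b * \<delta> d + d * \<delta> b) * (a * d - c * b)"
      by (simp add: algebra_simps power2_eq_square)
    also have "\<dots> = 0" using eq \<open>_ = \<delta> c * b + c * \<delta> b\<close> by simp
    finally show ?thesis using assms that by (simp add: eq_fract)
  qed
  then have 1: "\<forall>c d. d \<noteq> 0 \<and> Fract a b = Fract c d \<longrightarrow>
      Fract (\<delta> a * b - a * \<delta> b) (b\<^sup>2) = Fract (\<delta> c * d - c * \<delta> d) (d\<^sup>2)" by blast
  show ?thesis
    unfolding fract_deriv_def by (rule the_equality, rule 1) (use assms(2) in blast)
qed

lemma derivation_fract_deriv:
  fixes \<delta> :: "'b::idom \<Rightarrow> 'b"
  assumes "derivation \<delta>"
  shows "derivation (fract_deriv \<delta>)"
proof
  interpret derivation \<delta> by fact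
  fix f g :: "'b fract"
  obtain a b where f: "f = Fract a b" "b \<noteq> 0" by (cases f)
  obtain c d where g: "g = Fract c d" "d \<noteq> 0" by (cases g)
  note D = fract_deriv_Fract[OF assms]
  show "fract_deriv \<delta> (f + g) = fract_deriv \<delta> f + fract_deriv \<delta> g"
    using f g by (simp add: D eq_fract add mult) (simp add: algebra_simps power2_eq_square)
  show "fract_deriv \<delta> (f * g) = fract_deriv \<delta> f * g + f * fract_deriv \<delta> g"
    using f g by (simp add: D eq_fract add mult) (simp add: algebra_simps power2_eq_square)
qed

lemma derivation_deriv_x: "derivation (deriv_x :: 'a::field ratfun \<Rightarrow> _)"
  unfolding deriv_x_def by (intro derivation_fract_deriv derivation_map_pderiv)

lemma derivation_deriv_y: "derivation (deriv_y :: 'a::field ratfun \<Rightarrow> _)"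
  unfolding deriv_y_def by (intro derivation_fract_deriv derivation_pderiv)

lemmas deriv_arith =
  derivation.add[OF derivation_deriv_x] derivation.add[OF derivation_deriv_y]
  derivation.mult[OF derivation_deriv_x] derivation.mult[OF derivation_deriv_y]
  derivation.zero[OF derivation_deriv_x] derivation.zero[OF derivation_deriv_y]

lemma map_pderiv_simps:
  "map_poly pderiv (cc c) = 0" "map_poly pderiv vX = 1" "map_poly pderiv vY = (0 :: 'a::field poly poly)"
  "pderiv (cc c) = 0" "pderiv vX = 0" "pderiv vY = (1 :: 'a::field poly poly)"
  by (auto simp: cc_def vX_def vY_def poly_eq_iff coeff_map_poly coeff_pCons pderiv_pCons
      split: nat.splits)

lemma deriv_simps:
  fixes c :: "'a::field"
  shows "deriv_x (rf_const c) = 0" "deriv_y (rf_const c) = 0"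
   "deriv_x (rf_x :: 'a ratfun) = 1" "deriv_y (rf_x :: 'a ratfun) = 0"
   "deriv_x (rf_y :: 'a ratfun) = 0" "deriv_y (rf_y :: 'a ratfun) = 1"
  using derivation.one[OF derivation_pderiv[where 'a='a]] derivation.one[OF derivation_map_pderiv[where 'a='a]]
  by (auto simp: deriv_x_def deriv_y_def rf_const_eq rf_x_eq rf_y_eq One_fract_def Zero_fract_def
      fract_deriv_Fract derivation_pderiv derivation_map_pderiv map_pderiv_simps)

lemma derivation_ev2:
  fixes \<phi> :: "'a::field \<Rightarrow> 'b::comm_ring_1"
  assumes "derivation D" "\<And>c. D (\<phi> c) = 0" "comm_ring_hom \<phi>"
  shows "D (ev2 \<phi> u v A) = ev2 \<phi> u v (map_poly pderiv A) * D u + ev2 \<phi> u v (pderiv A) * D v"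
proof -
  interpret derivation D by fact
  interpret x: derivation "map_poly pderiv :: 'a poly poly \<Rightarrow> _" by (rule derivation_map_pderiv)
  interpret y: derivation "pderiv :: 'a poly poly \<Rightarrow> _" by (rule derivation_pderiv)
  note e = ev2_simps[OF assms(3)]
  show ?thesis
    by (induction A rule: poly2_induct)
      (simp_all add: e assms(2) map_pderiv_simps add mult x.add x.mult y.add y.mult algebra_simps)
qed

lemma derivation_divide:
  fixes D :: "'b::field \<Rightarrow> 'b"
  assumes "derivation D" "g \<noteq> 0"
  shows "D (f / g) = (D f * g - f * D g) / g\<^sup>2"
proof -
  interpret derivation D by fact
  have "D f = D (f / g) * g + f / g * D g" using mult[of "f / g" g] assms by simp
  then show ?thesis using assms by (simp add: field_simps power2_eq_square)
qed

lemma jacobian_add_left: "jacobian (f + g) h = jacobian f h + jacobian g h"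
  by (simp add: jacobian_def deriv_arith algebra_simps)

lemma jacobian_mult_left: "jacobian (f * g) h = f * jacobian g h + g * jacobian f h"
  by (simp add: jacobian_def deriv_arith algebra_simps)

lemma jacobian_swap: "jacobian f g = - jacobian g f"
  by (simp add: jacobian_def algebra_simps)

lemma jacobian_self [simp]: "jacobian f f = 0"
  by (simp add: jacobian_def)

lemma jacobian_add_right: "jacobian h (f + g) = jacobian h f + jacobian h g"
  by (metis jacobian_swap jacobian_add_left minus_add_distrib)

lemma jacobian_mult_right: "jacobian h (f * g) = f * jacobian h g + g * jacobian h f"
  using jacobian_mult_left[of f g h] jacobian_swap[of h] by (metis (no_types, lifting) minus_add_distrib mult_minus_right)

lemma jacobian_const [simp]: "jacobian (rf_const c) h = 0" "jacobian h (rf_const c) = 0"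
  by (simp_all add: jacobian_def deriv_simps)

text \<open>The Jacobian criterion for algebraic independence in characteristic 0. Applying both
  derivations to \<open>ev2 rf_const u v A = 0\<close> gives a linear system with determinant
  \<open>jacobian u v\<close>, so the partial derivatives of \<open>A\<close> satisfy the same
  relation. Induction on the degree, first in the outer and then in the inner variable, ends at a
  constant.\<close>

lemma ev2_rf_inj_of_jacobian:
  fixes u v :: "'a::field_char_0 ratfun"
  assumes jac: "jacobian u v \<noteq> 0" and "ev2 rf_const u v A = 0"
  shows "A = 0"
proof -
  define e where "e = ev2 rf_const u v"
  have der: "e (map_poly pderiv A) = 0 \<and> e (pderiv A) = 0" if "e A = 0" for A
  proof -
    have "D (e A) = e (map_poly pderiv A) * D u + e (pderiv A) * D v"
      if "derivation D" "\<And>c. D (rf_const c) = 0" for D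
      unfolding e_def using derivation_ev2[OF that comm_ring_hom_rf_const] .
    from this[OF derivation_deriv_x] this[OF derivation_deriv_y]
    have eqs: "e (map_poly pderiv A) * deriv_x u + e (pderiv A) * deriv_x v = 0"
      "e (map_poly pderiv A) * deriv_y u + e (pderiv A) * deriv_y v = 0"
      using that by (simp_all add: deriv_simps deriv_arith)
    let ?p = "e (map_poly pderiv A)" and ?q = "e (pderiv A)"
    have "?p * jacobian u v = (?p * deriv_x u + ?q * deriv_x v) * deriv_y v - (?p * deriv_y u + ?q * deriv_y v) * deriv_x v"
      "?q * jacobian u v = (?p * deriv_y u + ?q * deriv_y v) * deriv_x u - (?p * deriv_x u + ?q * deriv_x v) * deriv_y u"
      by (simp_all add: jacobian_def algebra_simps)
    then have "?p * jacobian u v = 0" "?q * jacobian u v = 0" unfolding eqs by simp_all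
    then show ?thesis using jac by simp
  qed
  have const: "p = 0" if "e [:p:] = 0" for p
    using that
  proof (induction "degree p" arbitrary: p rule: less_induct)
    case less
    show ?case
    proof (cases "degree p = 0")
      case True
      then obtain c where c: "p = [:c:]" by (elim degree_eq_zeroE)
      then have "e [:p:] = rf_const c" using ev2_rf(1)[of u v c] by (simp add: e_def cc_def)
      then show ?thesis using less.prems c by simp
    next
      case False
      have "map_poly pderiv [:p:] = [:pderiv p:]"
        by (simp add: poly_eq_iff coeff_map_poly coeff_pCons split: nat.splits)
      then have "e [:pderiv p:] = 0" using der[OF less.prems] by simp
      then have "pderiv p = 0" using less.hyps[of "pderiv p"] False by (simp add: degree_pderiv)
      then show ?thesis using False by (simp add: pderiv_eq_0_iff)
    qed
  qed
  have "e A = 0" using assms by (simp add: e_def)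
  then show ?thesis
  proof (induction "degree A" arbitrary: A rule: less_induct)
    case less
    show ?case
    proof (cases "degree A = 0")
      case True
      then obtain p where "A = [:p:]" by (elim degree_eq_zeroE)
      then show ?thesis using const less.prems by simp
    next
      case False
      have "pderiv A = 0" using less.hyps[of "pderiv A"] der[OF less.prems] False by (simp add: degree_pderiv)
      then show ?thesis using False by (simp add: pderiv_eq_0_iff)
    qed
  qed
qed

section \<open>Affine charts of the blow-up\<close>

definition chart_at :: "('a::field poly poly ^ 3) list \<Rightarrow> 'a \<Rightarrow> 'a \<Rightarrow> ('a ^ 3) list" where
  "chart_at ws a b = map (vmap (pt a b)) ws"

definition chart_dom :: "('a::field poly poly ^ 3) list \<Rightarrow> 'a \<Rightarrow> 'a \<Rightarrow> bool" where
  "chart_dom ws a b \<longleftrightarrow> 0 \<notin> set (chart_at ws a b)"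

definition chart_pt :: "('a::field poly poly ^ 3) list \<Rightarrow> 'a \<Rightarrow> 'a \<Rightarrow> 'a proj2 list" where
  "chart_pt ws a b = map abs_proj2 (chart_at ws a b)"

lemma cc_one [simp]: "cc 1 = 1" and cc_zero [simp]: "cc 0 = 0"
  by (simp_all add: cc_def)

lemma length_chart [simp]: "length (chart_at ws a b) = length ws" "length (chart_pt ws a b) = length ws"
  by (simp_all add: chart_at_def chart_pt_def)

lemma pt_sub:
  assumes "multihomogeneous (length ws) e F"
  shows "pt a b (eval_mpoly cc F ws) = eval_mpoly id F (chart_at ws a b)"
  using eval_mpoly_hom[OF comm_ring_hom_ev2[OF comm_ring_hom_id(1)] assms]
  by (simp add: ev2_id chart_at_def id_def)

lemma val_chart_pt:
  assumes "chart_dom ws a b" "multihomogeneous (length ws) e F"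
  shows "val F (chart_pt ws a b) = 0 \<longleftrightarrow> pt a b (eval_mpoly cc F ws) = 0"
proof -
  have "\<exists>c. c \<noteq> 0 \<and> map rep_proj2 (chart_pt ws a b) ! i = c *s chart_at ws a b ! i"
    if "i < length ws" for i
  proof -
    have "chart_at ws a b ! i \<noteq> 0" using assms(1) that unfolding chart_dom_def
      by (metis length_chart(1) nth_mem)
    from rep_abs_proj2[OF this] obtain c where "c \<noteq> 0" "rep_proj2 (abs_proj2 (chart_at ws a b ! i)) = c *s chart_at ws a b ! i" .
    then show ?thesis using that by (auto simp: chart_pt_def)
  qed
  then obtain c where c: "\<And>i. i < length ws \<Longrightarrow> c i \<noteq> 0 \<and> map rep_proj2 (chart_pt ws a b) ! i = c i *s chart_at ws a b ! i"
    by metis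
  have "val F (chart_pt ws a b) = (\<Prod>i<length ws. c i ^ e i) * eval_mpoly id F (chart_at ws a b)"
    by (rule eval_mpoly_scale[OF assms(2)]) (use c in blast)
  then show ?thesis using c by (auto simp: pt_sub[OF assms(2)])
qed

text \<open>An affine chart of the blow-up: \<open>ws\<close> holds polynomial homogeneous
  coordinates of the point and of all the lines. Each factor may have its own scalar in
  \<open>generic\<close>, because only homogeneous coordinates matter. The forms in
  \<open>coordinate\<close> say that \<open>u\<close> and \<open>v\<close> are regular on the chart.
  \<open>cover\<close> says that the chart is open: every point has a principal neighbourhood in the
  blow-up inside the image.\<close>

locale pre_chart =
  fixes ps :: "'a::{alg_closed_field, field_char_0} proj2 list"
    and ws :: "('a poly poly ^ 3) list" and u v :: "'a ratfun"
  assumes len: "length ws = Suc (length ps)"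
    and generic: "i \<le> length ps \<Longrightarrow>
      \<exists>c. c \<noteq> 0 \<and> blowup_generic_point ps ! i = c *s vmap (ev2 rf_const u v) (ws ! i)"
    and coordinate: "z = u \<and> (z' :: 'a poly poly) = vX \<or> z = v \<and> z' = vY \<Longrightarrow>
      \<exists>F G e. multihomogeneous (length ws) e F \<and> multihomogeneous (length ws) e G \<and>
        eval_mpoly rf_const F (blowup_generic_point ps) = z * eval_mpoly rf_const G (blowup_generic_point ps) \<and>
        (\<forall>a b. chart_dom ws a b \<longrightarrow> eval_mpoly id G (chart_at ws a b) \<noteq> 0)"
    and jac: "jacobian u v \<noteq> 0"
    and in_blowup: "chart_dom ws a b \<Longrightarrow> chart_pt ws a b \<in> blowup ps"
    and cover: "chart_dom ws a b \<Longrightarrow> \<exists>H e. multihomogeneous (length ws) e H \<and>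
      eval_mpoly id H (chart_at ws a b) \<noteq> 0 \<and>
      (\<forall>a' b'. eval_mpoly id H (chart_at ws a' b') \<noteq> 0 \<longrightarrow> chart_dom ws a' b') \<and>
      (\<forall>P\<in>blowup ps. val H P \<noteq> 0 \<longrightarrow> (\<exists>a' b'. chart_dom ws a' b' \<and> P = chart_pt ws a' b'))"
begin

abbreviation ev where "ev \<equiv> ev2 rf_const u v"
abbreviation dom where "dom \<equiv> chart_dom ws"
abbreviation \<sigma> where "\<sigma> \<equiv> chart_pt ws"
abbreviation form :: "(nat \<Rightarrow> nat) \<Rightarrow> 'a mpoly \<Rightarrow> bool" where "form \<equiv> multihomogeneous (length ws)"
abbreviation sub where "sub F \<equiv> eval_mpoly cc F ws"
abbreviation gval where "gval F \<equiv> eval_mpoly rf_const F (blowup_generic_point ps)"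

lemmas ev_simps = ev2_rf[of u v]

lemma ev_eq_0_iff [simp]: "ev A = 0 \<longleftrightarrow> A = 0"
  using ev2_rf_inj_of_jacobian[OF jac] ev_simps by blast

lemma ev_eq_iff [simp]: "ev A = ev B \<longleftrightarrow> A = B"
  using ev_eq_0_iff[of "A - B"] by (simp add: ev_simps)

lemma sub_mult: "sub (F * G) = sub F * sub G" and sub_add: "sub (F + G) = sub F + sub G"
  by (rule eval_mpoly_mult eval_mpoly_add, rule comm_ring_hom_cc)+

text \<open>The scalars of \<open>generic\<close> enter the value of a form only through its
  multidegree. The factor therefore cancels in every quotient that represents a rational
  function.\<close>

lemma gval_scale:
  "\<exists>\<kappa>. (\<forall>e. \<kappa> e \<noteq> 0) \<and> (\<forall>F e. form e F \<longrightarrow> gval F = \<kappa> e * ev (sub F))"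
proof -
  from generic obtain c where c: "\<And>i. i \<le> length ps \<Longrightarrow> c i \<noteq> 0 \<and> blowup_generic_point ps ! i = c i *s vmap ev (ws ! i)"
    by metis
  show ?thesis
  proof (intro exI[of _ "\<lambda>e. \<Prod>i<length ws. c i ^ e i"] conjI allI impI)
    show "(\<Prod>i<length ws. c i ^ e i) \<noteq> 0" for e using c len by auto
    fix F e assume F: "form e F"
    have "gval F = (\<Prod>i<length ws. c i ^ e i) * eval_mpoly rf_const F (map (vmap ev) ws)"
      by (rule eval_mpoly_scale[OF F]) (use c len in auto)
    also have "eval_mpoly rf_const F (map (vmap ev) ws) = ev (sub F)"
      using eval_mpoly_hom[OF comm_ring_hom_ev2[OF comm_ring_hom_rf_const] F, of u v cc]
      by (simp add: ev_simps)
    finally show "gval F = (\<Prod>i<length ws. c i ^ e i) * ev (sub F)" .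
  qed
qed

lemma gval_eq_0_iff: "form e F \<Longrightarrow> gval F = 0 \<longleftrightarrow> sub F = 0"
  using gval_scale by (metis ev_eq_0_iff mult_eq_0_iff)

lemma val_\<sigma>: "dom a b \<Longrightarrow> form e F \<Longrightarrow> val F (\<sigma> a b) = 0 \<longleftrightarrow> pt a b (sub F) = 0"
  by (rule val_chart_pt)

text \<open>Denominators are cleared on the generators, and sums and products are put over a common
  denominator. The denominator has no zero on the domain, so polynomials of the chart and forms on
  the product of planes cut out the same sets there.\<close>

lemma homogenize:
  "\<exists>F G e. form e F \<and> form e G \<and> sub F = A * sub G \<and> (\<forall>a b. dom a b \<longrightarrow> pt a b (sub G) \<noteq> 0)"
proof -
  have coord: "\<exists>F G e. form e F \<and> form e G \<and> sub F = z' * sub G \<and> (\<forall>a b. dom a b \<longrightarrow> pt a b (sub G) \<noteq> 0)"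
    if "z = u \<and> z' = vX \<or> z = v \<and> z' = vY" for z and z' :: "'a poly poly"
  proof -
    from coordinate[OF that] obtain F G e where FG: "form e F" "form e G" "gval F = z * gval G"
      "\<And>a b. dom a b \<Longrightarrow> eval_mpoly id G (chart_at ws a b) \<noteq> 0" by blast
    obtain \<kappa> where \<kappa>: "\<And>e. \<kappa> e \<noteq> 0" "\<And>F e. form e F \<Longrightarrow> gval F = \<kappa> e * ev (sub F)"
      using gval_scale by blast
    have "\<kappa> e * ev (sub F) = \<kappa> e * ev (z' * sub G)"
      using FG \<kappa>(2)[of e] that by (auto simp: ev_simps)
    then have "sub F = z' * sub G" using \<kappa>(1) by (simp only: mult_cancel_left ev_eq_iff) simp
    moreover have "\<forall>a b. dom a b \<longrightarrow> pt a b (sub G) \<noteq> 0" using FG(4) pt_sub[OF FG(2)] by simp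
    ultimately show ?thesis using FG(1,2) by blast
  qed
  show ?thesis
  proof (induction A rule: poly2_induct)
    case (const c)
    show ?case
      by (rule_tac exI[of _ "mconst c"], rule_tac exI[of _ "mconst 1"], rule_tac exI[of _ "\<lambda>_. 0"])
        (simp add: eval_mconst ev2_id multihomogeneous_mconst)
  next
    case X
    show ?case using coord[of u vX] by simp
  next
    case Y
    show ?case using coord[of v vY] by simp
  next
    case (add f g)
    then obtain F G e F' G' e' where FG: "form e F" "form e G" "sub F = f * sub G"
      "\<And>a b. dom a b \<Longrightarrow> pt a b (sub G) \<noteq> 0"
      "form e' F'" "form e' G'" "sub F' = g * sub G'"
      "\<And>a b. dom a b \<Longrightarrow> pt a b (sub G') \<noteq> 0" by blast
    have "form (\<lambda>i. e i + e' i) (G * F')" "form (\<lambda>i. e i + e' i) (F * G')" "form (\<lambda>i. e i + e' i) (G * G')"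
      using FG by (auto intro: multihomogeneous_mult)
    moreover have "sub (F * G' + G * F') = (f + g) * sub (G * G')"
      using FG by (simp add: sub_mult sub_add algebra_simps)
    moreover have "\<forall>a b. dom a b \<longrightarrow> pt a b (sub (G * G')) \<noteq> 0" using FG by (simp add: sub_mult ev2_id)
    ultimately show ?case using multihomogeneous_add by blast
  next
    case (mult f g)
    then obtain F G e F' G' e' where FG: "form e F" "form e G" "sub F = f * sub G"
      "\<And>a b. dom a b \<Longrightarrow> pt a b (sub G) \<noteq> 0"
      "form e' F'" "form e' G'" "sub F' = g * sub G'"
      "\<And>a b. dom a b \<Longrightarrow> pt a b (sub G') \<noteq> 0" by blast
    have "form (\<lambda>i. e i + e' i) (F * F')" "form (\<lambda>i. e i + e' i) (G * G')"
      using FG by (auto intro: multihomogeneous_mult)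
    moreover have "sub (F * F') = (f * g) * sub (G * G')"
      using FG by (simp add: sub_mult algebra_simps)
    moreover have "\<forall>a b. dom a b \<longrightarrow> pt a b (sub (G * G')) \<noteq> 0" using FG by (simp add: sub_mult ev2_id)
    ultimately show ?case by blast
  qed
qed

text \<open>The coordinates \<open>u\<close>, \<open>v\<close> generate the whole function field:
  the first vector of \<open>ws\<close> is proportional to the generic point, which exhibits
  \<open>rf_x\<close> and \<open>rf_y\<close> as quotients of polynomials in \<open>u\<close> and
  \<open>v\<close>.\<close>

lemma fraction_of_ev: "\<exists>A B. B \<noteq> 0 \<and> f = ev A / ev B"
proof -
  define Q where "Q = {f. \<exists>A B. B \<noteq> 0 \<and> f = ev A / ev B}"
  obtain c where c: "c \<noteq> 0" "blowup_generic_point ps ! 0 = c *s vmap ev (ws ! 0)"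
    using generic[of 0] by auto
  have gp: "generic_point = c *s vmap ev (ws ! 0)"
    using c by (simp add: blowup_generic_point_def)
  have g: "generic_point $ i = c * ev (ws ! 0 $ i)" for i
    by (subst gp) simp
  have "generic_point $ 1 = rf_x" "generic_point $ 2 = rf_y" "generic_point $ 3 = 1"
    by (simp_all add: generic_point_def)
  with g have g: "c * ev (ws ! 0 $ 1) = rf_x" "c * ev (ws ! 0 $ 2) = rf_y" "c * ev (ws ! 0 $ 3) = 1"
    by metis+
  have w: "ws ! 0 $ 3 \<noteq> 0" using g(3) ev_eq_0_iff by (metis mult_zero_right zero_neq_one)
  then have "ev (ws ! 0 $ 3) \<noteq> 0" by simp
  then have "c = 1 / ev (ws ! 0 $ 3)" using g(3) by (simp add: field_simps)
  then have "rf_x = ev (ws ! 0 $ 1) / ev (ws ! 0 $ 3)" "rf_y = ev (ws ! 0 $ 2) / ev (ws ! 0 $ 3)"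
    using g by auto
  then have x: "rf_x \<in> Q" "rf_y \<in> Q" unfolding Q_def using w by blast+
  have add: "f + g \<in> Q" if "f \<in> Q" "g \<in> Q" for f g
  proof -
    obtain A B A' B' where "B \<noteq> 0" "f = ev A / ev B" "B' \<noteq> 0" "g = ev A' / ev B'" using \<open>f \<in> Q\<close> \<open>g \<in> Q\<close> by (auto simp: Q_def)
    then have "f + g = ev (A * B' + A' * B) / ev (B * B')" "B * B' \<noteq> 0"
      by (simp_all add: ev_simps add_frac_eq)
    then show ?thesis unfolding Q_def by blast
  qed
  have mult: "f * g \<in> Q" if "f \<in> Q" "g \<in> Q" for f g
  proof -
    obtain A B A' B' where "B \<noteq> 0" "f = ev A / ev B" "B' \<noteq> 0" "g = ev A' / ev B'" using \<open>f \<in> Q\<close> \<open>g \<in> Q\<close> by (auto simp: Q_def)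
    then have "f * g = ev (A * A') / ev (B * B')" "B * B' \<noteq> 0"
      by (simp_all add: ev_simps)
    then show ?thesis unfolding Q_def by blast
  qed
  have const: "rf_const c \<in> Q" for c
  proof -
    have "rf_const c = ev (cc c) / ev 1" by (simp add: ev_simps)
    then show ?thesis unfolding Q_def using one_neq_zero by blast
  qed
  have inv: "inverse f \<in> Q" if fQ: "f \<in> Q" for f
  proof (cases "f = 0")
    case True
    then show ?thesis using that by simp
  next
    case False
    obtain A B where AB: "B \<noteq> 0" "f = ev A / ev B" using fQ by (auto simp: Q_def)
    then have "A \<noteq> 0" "inverse f = ev B / ev A" using False by auto
    then show ?thesis unfolding Q_def by blast
  qed
  have poly: "Fract a 1 \<in> Q" for a
    unfolding ev2_rf_generic[symmetric]
    by (induction a rule: poly2_induct) (simp_all add: ev2_rf const x add mult)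
  obtain a b where "f = Fract a b" "b \<noteq> 0" by (cases f)
  then have "f = Fract a 1 * inverse (Fract b 1)" by simp
  then have "f \<in> Q" using poly mult inv by metis
  then show ?thesis by (auto simp: Q_def)
qed

lemma local_ring_\<sigma>:
  assumes "dom a b"
  shows "local_ring ps (\<sigma> a b) = {ev A / ev B | A B. pt a b B \<noteq> 0}"
proof (intro equalityI subsetI)
  fix f assume "f \<in> local_ring ps (\<sigma> a b)"
  then obtain F G e where FG: "form e F" "form e G" "val G (\<sigma> a b) \<noteq> 0" "f = gval F / gval G"
    unfolding local_ring_def len[symmetric] by blast
  obtain \<kappa> where \<kappa>: "\<And>e. \<kappa> e \<noteq> 0" "\<And>F e. form e F \<Longrightarrow> gval F = \<kappa> e * ev (sub F)"
      using gval_scale by blast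
  have "f = ev (sub F) / ev (sub G)" using FG \<kappa> by simp
  moreover have "pt a b (sub G) \<noteq> 0" using FG val_\<sigma>[OF assms] by blast
  ultimately show "f \<in> {ev A / ev B | A B. pt a b B \<noteq> 0}" by blast
next
  fix f assume "f \<in> {ev A / ev B | A B. pt a b B \<noteq> 0}"
  then obtain A B where AB: "pt a b B \<noteq> 0" "f = ev A / ev B" by blast
  then have "B \<noteq> 0" by (auto simp: ev2_id)
  obtain F G e where FG: "form e F" "form e G" "sub F = A * sub G" "pt a b (sub G) \<noteq> 0"
    using homogenize[of A] assms by blast
  obtain F' G' e' where FG': "form e' F'" "form e' G'" "sub F' = B * sub G'" "pt a b (sub G') \<noteq> 0"
    using homogenize[of B] assms by blast
  have nz: "sub G \<noteq> 0" "sub G' \<noteq> 0" using FG(4) FG'(4) by (auto simp: ev2_id)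
  obtain \<kappa> where \<kappa>: "\<And>e. \<kappa> e \<noteq> 0" "\<And>F e. form e F \<Longrightarrow> gval F = \<kappa> e * ev (sub F)"
      using gval_scale by blast
  have fm: "form (\<lambda>i. e i + e' i) (F * G')" "form (\<lambda>i. e i + e' i) (G * F')"
    using FG FG' by (auto intro: multihomogeneous_mult)
  have "gval (F * G') / gval (G * F') = ev (sub (F * G')) / ev (sub (G * F'))"
    using \<kappa> fm by simp
  also have "\<dots> = f" using AB nz \<open>B \<noteq> 0\<close> FG FG' by (simp add: sub_mult ev_simps)
  finally have "f = gval (F * G') / gval (G * F')" ..
  moreover have "val (G * F') (\<sigma> a b) \<noteq> 0"
    using val_\<sigma>[OF assms fm(2)] FG FG' AB by (simp add: sub_mult ev2_id)
  ultimately show "f \<in> local_ring ps (\<sigma> a b)"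
    unfolding local_ring_def len[symmetric] using fm by blast
qed

end

lemma dvd_decompose:
  fixes \<pi> A :: "'a::field poly poly"
  assumes "irreducible \<pi>" "A \<noteq> 0"
  shows "\<exists>n B. A = \<pi> ^ n * B \<and> \<not> \<pi> dvd B"
proof -
  \<comment> \<open>The y-degree plus the x-degree of the leading coefficient is additive on
    products and positive on \<open>\<pi>\<close>, so splitting off factors \<open>\<pi>\<close>
    terminates.\<close>
  define \<mu> where "\<mu> = (\<lambda>A::'a poly poly. degree A + degree (lead_coeff A))"
  have \<mu>_mult: "\<mu> (A * B) = \<mu> A + \<mu> B" if "A \<noteq> 0" "B \<noteq> 0" for A B
    unfolding \<mu>_def lead_coeff_mult using that by (simp add: degree_mult_eq)
  have \<pi>0: "\<pi> \<noteq> 0" using assms(1) unfolding irreducible_def by blast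
  have "\<mu> \<pi> > 0"
  proof (rule ccontr)
    assume "\<not> \<mu> \<pi> > 0"
    then have "degree \<pi> = 0" "degree (lead_coeff \<pi>) = 0" by (auto simp: \<mu>_def)
    then obtain p where p: "\<pi> = [:p:]" by (elim degree_eq_zeroE)
    then have "degree p = 0" using \<open>degree (lead_coeff \<pi>) = 0\<close> by simp
    then obtain c where c: "p = [:c:]" by (elim degree_eq_zeroE)
    then have "c \<noteq> 0" using \<pi>0 p by auto
    then have "1 = \<pi> * [:[:1 / c:]:]" unfolding p c by simp
    then have "\<pi> dvd 1" by (rule dvdI)
    then show False using assms(1) unfolding irreducible_def by blast
  qed
  show ?thesis
    using assms(2)
  proof (induction "\<mu> A" arbitrary: A rule: less_induct)
    case less
    show ?case
    proof (cases "\<pi> dvd A")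
      case False
      then show ?thesis by (intro exI[of _ 0] exI[of _ A]) simp
    next
      case True
      then obtain A' where A': "A = \<pi> * A'" by (elim dvdE)
      then have "A' \<noteq> 0" using less.prems by auto
      then have "\<mu> A' < \<mu> A" using \<mu>_mult[OF \<pi>0] \<open>\<mu> \<pi> > 0\<close> A' by simp
      then obtain n B where "A' = \<pi> ^ n * B" "\<not> \<pi> dvd B" using less.hyps \<open>A' \<noteq> 0\<close> by blast
      then show ?thesis using A' by (intro exI[of _ "Suc n"] exI[of _ B]) simp
    qed
  qed
qed

lemma irreducible_dvd_irreducible:
  assumes "irreducible p" "irreducible q" "p dvd q"
  shows "q dvd p"
proof -
  obtain c where c: "q = p * c" using assms(3) by (elim dvdE)
  then have "c dvd 1" using assms(1,2) unfolding irreducible_def by blast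
  then obtain d where "1 = c * d" by (elim dvdE)
  then have "p = q * d" unfolding c by (metis mult.assoc mult.right_neutral)
  then show ?thesis by (rule dvdI)
qed

section \<open>Prime divisors in a chart\<close>

lemma prod_mset_prime_set:
  assumes "1 \<notin> I" "\<And>A B. A * B \<in> I \<Longrightarrow> A \<in> I \<or> B \<in> I" "prod_mset M \<in> I"
  shows "\<exists>x. x \<in># M \<and> x \<in> I"
  using assms(3) by (induction M) (use assms(1,2) in auto)

lemma pt_dvd: "\<pi> dvd A \<Longrightarrow> pt a b \<pi> = 0 \<Longrightarrow> pt a b A = 0"
  by (auto simp: ev2_id elim!: dvdE)

text \<open>Density of the generic point is kept apart from \<open>pre_chart\<close> because its
  proof needs the whole atlas: a single pre-chart yields it only at its own points.\<close>

locale chart = pre_chart +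
  assumes dense: "P \<in> blowup ps \<Longrightarrow> multihomogeneous (length ws) e F \<Longrightarrow>
    eval_mpoly rf_const F (blowup_generic_point ps) = 0 \<Longrightarrow> val F P = 0"
begin

text \<open>The closure in the blow-up of the curve \<open>\<pi> = 0\<close> of the chart. Using all
  forms divisible by \<open>\<pi>\<close> makes it closed by construction; the forms that are zero
  on the chart are among them and confine it to the blow-up.\<close>

definition Z where
  "Z \<pi> = {P. length P = length ws \<and> (\<forall>F e. form e F \<and> \<pi> dvd sub F \<longrightarrow> val F P = 0)}"

lemma cover':
  assumes "dom a b"
  shows "\<exists>H e. form e H \<and> pt a b (sub H) \<noteq> 0 \<and>
    (\<forall>a' b'. pt a' b' (sub H) \<noteq> 0 \<longrightarrow> dom a' b') \<and>
    (\<forall>P. P \<in> blowup ps \<longrightarrow> val H P \<noteq> 0 \<longrightarrow> (\<exists>a' b'. dom a' b' \<and> P = \<sigma> a' b'))"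
proof -
  from cover[OF assms] obtain H e where H: "form e H" "eval_mpoly id H (chart_at ws a b) \<noteq> 0"
      "\<forall>a' b'. eval_mpoly id H (chart_at ws a' b') \<noteq> 0 \<longrightarrow> dom a' b'"
      "\<forall>P\<in>blowup ps. val H P \<noteq> 0 \<longrightarrow> (\<exists>a' b'. dom a' b' \<and> P = \<sigma> a' b')" by blast
  then show ?thesis
    by (intro exI[of _ H] exI[of _ e]) (simp add: pt_sub)
qed

text \<open>The polynomials vanishing on the part of \<open>C\<close> inside the chart form a prime
  ideal. It is not zero, because some form vanishes on \<open>C\<close> but not at a further point
  of the surface, and density keeps that form nonzero on the chart. One of the irreducible factors
  of this element lies in the ideal.\<close>

lemma irreducible_subset_Z:
  assumes irr: "irreducible_closedin (zariski (length ws)) C" and sub: "C \<subset> blowup ps"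
    and ab: "dom a b" "\<sigma> a b \<in> C"
  shows "\<exists>\<pi>. irreducible \<pi> \<and> pt a b \<pi> = 0 \<and> C \<subseteq> Z \<pi>"
proof -
  obtain H eH where H: "form eH H" "pt a b (sub H) \<noteq> 0"
    "\<And>a' b'. pt a' b' (sub H) \<noteq> 0 \<Longrightarrow> dom a' b'"
    "\<And>P. P \<in> blowup ps \<Longrightarrow> val H P \<noteq> 0 \<Longrightarrow> \<exists>a' b'. dom a' b' \<and> P = \<sigma> a' b'"
    using cover'[OF ab(1)] by blast
  have Hab: "val H (\<sigma> a b) \<noteq> 0" using val_\<sigma>[OF ab(1) H(1)] H(2) by simp
  define I where "I = {A. \<forall>a b. dom a b \<and> \<sigma> a b \<in> C \<longrightarrow> pt a b A = 0}"
  have closed: "closedin (zariski (length ws)) C" using irr by (simp add: irreducible_closedin_def)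
  have lenC: "length P = length ws" if "P \<in> C" for P
    using that closed unfolding closedin_zariski_iff by blast
  \<comment> \<open>By irreducibility a form that is nonzero somewhere on \<open>C\<close> is
    nonzero at a point where \<open>H\<close> does not vanish either, and such a point lies in the
    chart.\<close>
  have witness: "\<exists>a' b'. dom a' b' \<and> \<sigma> a' b' \<in> C \<and> pt a' b' (sub F) \<noteq> 0"
    if F: "form e F" and P: "P \<in> C" "val F P \<noteq> 0" for F e P
  proof -
    obtain R where R: "R \<in> C" "val F R \<noteq> 0" "val H R \<noteq> 0"
      using irreducible_closedin_mult[OF irr F H(1) P ab(2) Hab] by blast
    then obtain a' b' where "dom a' b'" "R = \<sigma> a' b'" using H(4) sub by blast
    then show ?thesis using R val_\<sigma>[OF _ F] by blast
  qed
  have one: "1 \<notin> I" using ab by (auto simp: I_def ev2_id)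
  have prime: "A \<in> I \<or> B \<in> I" if "A * B \<in> I" for A B
  proof (rule ccontr)
    assume "\<not> ?thesis"
    then obtain a1 b1 a2 b2 where p: "dom a1 b1" "\<sigma> a1 b1 \<in> C" "pt a1 b1 A \<noteq> 0"
      "dom a2 b2" "\<sigma> a2 b2 \<in> C" "pt a2 b2 B \<noteq> 0" by (auto simp: I_def)
    obtain F G e where F: "form e F" "form e G" "sub F = A * sub G" 
      "\<And>a b. dom a b \<Longrightarrow> pt a b (sub G) \<noteq> 0" using homogenize[of A] by blast
    obtain F' G' e' where F': "form e' F'" "form e' G'" "sub F' = B * sub G'" 
      "\<And>a b. dom a b \<Longrightarrow> pt a b (sub G') \<noteq> 0" using homogenize[of B] by blast
    have "val F (\<sigma> a1 b1) \<noteq> 0" "val F' (\<sigma> a2 b2) \<noteq> 0"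
      using val_\<sigma>[OF p(1) F(1)] val_\<sigma>[OF p(4) F'(1)] p F F' by (auto simp: ev2_id)
    then obtain R where R: "R \<in> C" "val F R \<noteq> 0" "val F' R \<noteq> 0"
      using irreducible_closedin_mult[OF irr F(1) F'(1) p(2) _ p(5)] by blast
    then have "val (F * F') R \<noteq> 0" by (simp add: val_mult)
    then obtain a' b' where "dom a' b'" "\<sigma> a' b' \<in> C" "pt a' b' (sub (F * F')) \<noteq> 0"
      using witness[OF multihomogeneous_mult[OF F(1) F'(1)] R(1)] by blast
    then have "pt a' b' (A * B) \<noteq> 0" using F F' by (auto simp: ev2_id sub_mult)
    then show False using that \<open>dom a' b'\<close> \<open>\<sigma> a' b' \<in> C\<close> by (auto simp: I_def)
  qed
  obtain Q where Q: "Q \<in> blowup ps" "Q \<notin> C" using sub by blast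
  then have "length Q = length ws" using len by (auto simp: blowup_def)
  then obtain F e where F: "form e F" "\<And>P. P \<in> C \<Longrightarrow> val F P = 0" "val F Q \<noteq> 0"
    using closed Q(2) unfolding closedin_zariski_iff by blast
  have "sub F \<noteq> 0" using dense[OF Q(1) F(1)] F(3) gval_eq_0_iff[OF F(1)] by blast
  have "sub F \<in> I" using val_\<sigma>[OF _ F(1)] F(2) by (auto simp: I_def)
  have "\<not> sub F dvd 1"
  proof
    assume "sub F dvd 1"
    then have "pt a b 1 = 0" using pt_dvd[of "sub F" 1 a b] val_\<sigma>[OF ab(1) F(1)] F(2)[OF ab(2)] by blast
    then show False by (simp add: ev2_id)
  qed
  with \<open>sub F \<noteq> 0\<close> obtain M where M: "mset_factors M (sub F)" using mset_factors_exist by blast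
  then have "prod_mset M \<in> I" using \<open>sub F \<in> I\<close> mset_factorsD(3) by metis
  then obtain \<pi> where \<pi>: "\<pi> \<in># M" "\<pi> \<in> I"
    using prod_mset_prime_set[of I M] one prime by blast
  have "irreducible \<pi>" using M \<pi>(1) mset_factorsD(1) by blast
  moreover have "pt a b \<pi> = 0" using \<pi>(2) ab by (auto simp: I_def)
  moreover have "C \<subseteq> Z \<pi>"
  proof
    fix P assume P: "P \<in> C"
    have "val F P = 0" if F: "form e F" "\<pi> dvd sub F" for F e
    proof (rule ccontr)
      assume "val F P \<noteq> 0"
      then obtain a' b' where "dom a' b'" "\<sigma> a' b' \<in> C" "pt a' b' (sub F) \<noteq> 0"
        using witness[OF F(1) P] by blast
      then show False using \<pi>(2) pt_dvd[OF F(2)] by (auto simp: I_def)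
    qed
    then show "P \<in> Z \<pi>" using lenC[OF P] by (auto simp: Z_def)
  qed
  ultimately show ?thesis by blast
qed

lemma Z_\<sigma>:
  assumes "dom a b" "pt a b \<pi> = 0"
  shows "\<sigma> a b \<in> Z \<pi>"
proof -
  have "val F (\<sigma> a b) = 0" if "form e F" "\<pi> dvd sub F" for F e
    using val_\<sigma>[OF assms(1) that(1)] pt_dvd[OF that(2) assms(2)] by simp
  then show ?thesis by (auto simp: Z_def)
qed

lemma closed_Z: "closedin (zariski (length ws)) (Z \<pi>)"
  unfolding closedin_zariski_iff
proof (intro conjI ballI allI impI)
  fix P assume "length P = length ws \<and> P \<notin> Z \<pi>"
  then obtain F e where "form e F" "\<pi> dvd sub F" "val F P \<noteq> 0" by (auto simp: Z_def)
  then show "\<exists>F e. form e F \<and> (\<forall>Q\<in>Z \<pi>. val F Q = 0) \<and> val F P \<noteq> 0"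
    by (intro exI[of _ F] exI[of _ e]) (auto simp: Z_def)
qed (auto simp: Z_def)

text \<open>The incidence relations that define the blow-up are forms vanishing at the generic
  point. Their restriction to the chart is 0, which every \<open>\<pi>\<close> divides.\<close>

lemma Z_subset_blowup: "Z \<pi> \<subseteq> blowup ps"
proof
  fix P assume P: "P \<in> Z \<pi>"
  then have lenP: "length P = Suc (length ps)" by (simp add: Z_def len)
  then obtain x ls where xls: "P = x # ls" "length ls = length ps" by (cases P) auto
  have zero: "val F P = 0" if "form e F" "gval F = 0" for F e
    using P that gval_eq_0_iff[OF that(1)] by (auto simp: Z_def)
  have nth: "blowup_generic_point ps ! Suc i = cross (vmap rf_const (rep_proj2 (ps ! i))) generic_point"
    "blowup_generic_point ps ! 0 = generic_point" if "i < length ps" for i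
    using that by (auto simp: blowup_generic_point_def vmap_def)
  have "incident (ps ! i) (ls ! i) \<and> incident x (ls ! i)" if i: "i < length ps" for i
  proof
    let ?F = "mlinear (Suc i) (rep_proj2 (ps ! i))"
    have "form (unit_degree (Suc i)) ?F" using i len by (intro multihomogeneous_mlinear) simp
    moreover have "gval ?F = 0"
      using nth[OF i] by (simp add: eval_mlinear cross_def sum_3 algebra_simps)
    ultimately have "val ?F P = 0" by (rule zero)
    then show "incident (ps ! i) (ls ! i)"
      using xls i by (simp add: eval_mlinear incident_def mult.commute)
  next
    let ?G = "\<Sum>j\<in>UNIV. mlinear 0 (axis j 1) * mlinear (Suc i) (axis j 1)"
    have ax: "(\<Sum>k\<in>UNIV. \<phi> (axis j 1 $ k) * (w :: 'c ^ 3) $ k) = w $ j" 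
      if "comm_ring_hom \<phi>" for \<phi> :: "'a \<Rightarrow> 'c::comm_ring_1" and j w
    proof -
      interpret comm_ring_hom \<phi> by fact
      show ?thesis by (simp add: axis_def if_distrib[of \<phi>] mult_if_delta cong: if_cong)
    qed
    have ev: "eval_mpoly \<phi> ?G vs = (\<Sum>j\<in>UNIV. vs ! 0 $ j * vs ! Suc i $ j)"
      if "comm_ring_hom \<phi>" for \<phi> :: "'a \<Rightarrow> 'c::comm_ring_1" and vs
      using that by (simp add: eval_mpoly_sum eval_mpoly_mult eval_mlinear ax)
    have "form (\<lambda>k. unit_degree 0 k + unit_degree (Suc i) k) ?G"
      using i len by (intro multihomogeneous_sum multihomogeneous_mult multihomogeneous_mlinear) auto
    moreover have "gval ?G = 0"
      unfolding ev[OF comm_ring_hom_rf_const] nth[OF i]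
      by (simp add: cross_def sum_3 algebra_simps)
    ultimately have "val ?G P = 0" by (rule zero)
    then show "incident x (ls ! i)"
      using xls i by (simp add: ev incident_def mult.commute)
  qed
  then show "P \<in> blowup ps" using xls by (auto simp: blowup_def)
qed

text \<open>Multiplying \<open>B\<close> by the form \<open>H\<close> of \<open>cover\<close> keeps
  the point inside the domain. The product is still prime to \<open>\<pi>\<close>, since
  \<open>H\<close> does not vanish at the given point of the curve.\<close>

lemma nullstellensatz:
  assumes "irreducible \<pi>" "dom a b" "pt a b \<pi> = 0" "\<not> \<pi> dvd B"
  shows "\<exists>a' b'. dom a' b' \<and> pt a' b' \<pi> = 0 \<and> pt a' b' B \<noteq> 0"
proof -
  obtain H e where H: "form e H" "pt a b (sub H) \<noteq> 0"
    "\<And>a' b'. pt a' b' (sub H) \<noteq> 0 \<Longrightarrow> dom a' b'" using cover'[OF assms(2)] by blast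
  have "\<not> \<pi> dvd sub H" using pt_dvd[OF _ assms(3)] H(2) by blast
  then have "\<not> \<pi> dvd B * sub H"
    using assms(4) prime_elem_dvd_multD[OF irreducible_imp_prime2[OF assms(1)]] by blast
  then obtain a' b' where "pt a' b' \<pi> = 0" "pt a' b' (B * sub H) \<noteq> 0"
    using plane_curve_nullstellensatz[OF assms(1)] by blast
  then show ?thesis using H(3)[of a' b'] by (auto simp: ev2_id)
qed

lemma vanishes_on_Z_iff:
  assumes "irreducible \<pi>" "dom a b" "pt a b \<pi> = 0" "form e F"
  shows "(\<forall>P\<in>Z \<pi>. val F P = 0) \<longleftrightarrow> \<pi> dvd sub F"
proof
  assume *: "\<forall>P\<in>Z \<pi>. val F P = 0"
  show "\<pi> dvd sub F"
  proof (rule ccontr)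
    assume "\<not> \<pi> dvd sub F"
    then obtain a' b' where "dom a' b'" "pt a' b' \<pi> = 0" "pt a' b' (sub F) \<noteq> 0"
      using nullstellensatz[OF assms(1-3)] by blast
    then show False using * Z_\<sigma> val_\<sigma>[OF _ assms(4)] by blast
  qed
qed (use assms(4) in \<open>auto simp: Z_def\<close>)

lemma irreducible_Z:
  assumes "irreducible \<pi>" "dom a b" "pt a b \<pi> = 0"
  shows "irreducible_closedin (zariski (length ws)) (Z \<pi>)"
  unfolding irreducible_closedin_def
proof (intro conjI allI impI)
  show "closedin (zariski (length ws)) (Z \<pi>)" by (rule closed_Z)
  show "Z \<pi> \<noteq> {}" using Z_\<sigma>[OF assms(2,3)] by blast
  fix A B assume AB: "closedin (zariski (length ws)) A \<and> closedin (zariski (length ws)) B \<and> Z \<pi> \<subseteq> A \<union> B"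
  show "Z \<pi> \<subseteq> A \<or> Z \<pi> \<subseteq> B"
  proof (rule ccontr)
    assume "\<not> ?thesis"
    then obtain P Q where PQ: "P \<in> Z \<pi>" "P \<notin> A" "Q \<in> Z \<pi>" "Q \<notin> B" by blast
    then have l: "length P = length ws" "length Q = length ws" by (auto simp: Z_def)
    obtain F e where F: "form e F" "\<forall>R\<in>A. val F R = 0" "val F P \<noteq> 0"
      using AB PQ(2) l(1) unfolding closedin_zariski_iff by blast
    obtain G e' where G: "form e' G" "\<forall>R\<in>B. val G R = 0" "val G Q \<noteq> 0"
      using AB PQ(4) l(2) unfolding closedin_zariski_iff by blast
    have "\<forall>R\<in>Z \<pi>. val (F * G) R = 0" using AB F(2) G(2) by (auto simp: val_mult)
    then have "\<pi> dvd sub F * sub G"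
      using vanishes_on_Z_iff[OF assms multihomogeneous_mult[OF F(1) G(1)]] by (simp add: sub_mult)
    then have "\<pi> dvd sub F \<or> \<pi> dvd sub G" 
      by (rule prime_elem_dvd_multD[OF irreducible_imp_prime2[OF assms(1)]])
    then show False using F(1,3) G(1,3) PQ by (auto simp: Z_def)
  qed
qed

lemma Z_ne_blowup:
  assumes "irreducible \<pi>" "dom a b" "pt a b \<pi> = 0"
  shows "Z \<pi> \<noteq> blowup ps"
proof -
  obtain H e where H: "pt a b (sub H) \<noteq> 0"
    "\<And>a' b'. pt a' b' (sub H) \<noteq> 0 \<Longrightarrow> dom a' b'" using cover'[OF assms(2)] by metis
  obtain F G e where F: "form e F" "form e G" "sub F = \<pi> * sub G" 
      "\<And>a b. dom a b \<Longrightarrow> pt a b (sub G) \<noteq> 0" using homogenize[of \<pi>] by blast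
  have "\<pi> \<noteq> 0" using assms(1) unfolding irreducible_def by blast
  moreover have "sub H \<noteq> 0" using H(1) by (auto simp: ev2_id)
  ultimately obtain a' b' where p: "pt a' b' (\<pi> * sub H) \<noteq> 0"
    using poly2_nonzero_point[of "\<pi> * sub H"] by auto
  then have d: "dom a' b'" "pt a' b' \<pi> \<noteq> 0" using H(2) by (auto simp: ev2_id)
  then have "val F (\<sigma> a' b') \<noteq> 0" using val_\<sigma>[OF d(1) F(1)] F by (simp add: ev2_id)
  moreover have "\<pi> dvd sub F" using F(3) by simp
  ultimately have "\<sigma> a' b' \<notin> Z \<pi>" using F(1) by (auto simp: Z_def)
  then show ?thesis using in_blowup[OF d(1)] by blast
qed

lemma Z_mono_dvd:
  assumes "irreducible \<pi>" "dom a b" "pt a b \<pi> = 0" "Z \<pi> \<subseteq> Z \<pi>'"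
  shows "\<pi> dvd \<pi>'"
proof (rule ccontr)
  assume "\<not> \<pi> dvd \<pi>'"
  then obtain a' b' where p: "dom a' b'" "pt a' b' \<pi> = 0" "pt a' b' \<pi>' \<noteq> 0"
    using nullstellensatz[OF assms(1-3)] by blast
  obtain F G e where F: "form e F" "form e G" "sub F = \<pi>' * sub G" 
      "\<And>a b. dom a b \<Longrightarrow> pt a b (sub G) \<noteq> 0" using homogenize[of \<pi>'] by blast
  have "\<sigma> a' b' \<in> Z \<pi>'" using Z_\<sigma>[OF p(1,2)] assms(4) by blast
  moreover have "\<pi>' dvd sub F" using F(3) by simp
  ultimately have "val F (\<sigma> a' b') = 0" using F(1) by (auto simp: Z_def)
  then show False using val_\<sigma>[OF p(1) F(1)] F p by (simp add: ev2_id)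
qed

lemma Z_dvd_mono: "\<pi> dvd \<pi>' \<Longrightarrow> Z \<pi> \<subseteq> Z \<pi>'"
  unfolding Z_def using dvd_trans by blast

lemma Z_assoc:
  assumes "irreducible \<pi>" "irreducible \<pi>'" "\<pi> dvd \<pi>'"
  shows "Z \<pi> = Z \<pi>'"
  using Z_dvd_mono assms irreducible_dvd_irreducible by blast

text \<open>For maximality, an irreducible set between \<open>Z \<pi>\<close> and the surface lies
  in some \<open>Z \<pi>'\<close>. The inclusion of closures forces \<open>\<pi>\<close> to divide
  \<open>\<pi>'\<close>, and irreducible polynomials dividing each other have the same
  closure.\<close>

lemma prime_divisor_Z:
  assumes "irreducible \<pi>" "dom a b" "pt a b \<pi> = 0"
  shows "prime_divisor ps (Z \<pi>)"
  unfolding prime_divisor_def len[symmetric]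
proof (intro conjI)
  show "irreducible_closedin (zariski (length ws)) (Z \<pi>)" by (rule irreducible_Z[OF assms])
  show "Z \<pi> \<subset> blowup ps" using Z_subset_blowup Z_ne_blowup[OF assms] by blast
  show "\<nexists>Y. irreducible_closedin (zariski (length ws)) Y \<and> Z \<pi> \<subset> Y \<and> Y \<subset> blowup ps"
  proof
    assume "\<exists>Y. irreducible_closedin (zariski (length ws)) Y \<and> Z \<pi> \<subset> Y \<and> Y \<subset> blowup ps"
    then obtain Y where Y: "irreducible_closedin (zariski (length ws)) Y" "Z \<pi> \<subset> Y" "Y \<subset> blowup ps" by blast
    then have "\<sigma> a b \<in> Y" using Z_\<sigma>[OF assms(2,3)] by blast
    from irreducible_subset_Z[OF Y(1,3) assms(2) this]
    obtain \<pi>' where "irreducible \<pi>'" "Y \<subseteq> Z \<pi>'" by blast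
    moreover have "Z \<pi> \<subseteq> Z \<pi>'" using Y(2) calculation by blast
    ultimately have "Z \<pi> = Z \<pi>'" using Z_mono_dvd[OF assms] Z_assoc assms(1) by blast
    then show False using \<open>Y \<subseteq> Z \<pi>'\<close> Y(2) by blast
  qed
qed

lemma prime_divisor_eq_Z:
  assumes "prime_divisor ps C" "dom a b" "\<sigma> a b \<in> C"
  shows "\<exists>\<pi>. irreducible \<pi> \<and> pt a b \<pi> = 0 \<and> C = Z \<pi>"
proof -
  have C: "irreducible_closedin (zariski (length ws)) C" "C \<subset> blowup ps"
    "\<not> (\<exists>Y. irreducible_closedin (zariski (length ws)) Y \<and> C \<subset> Y \<and> Y \<subset> blowup ps)"
    using assms(1) unfolding prime_divisor_def len[symmetric] by blast+
  obtain \<pi> where \<pi>: "irreducible \<pi>" "pt a b \<pi> = 0" "C \<subseteq> Z \<pi>"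
    using irreducible_subset_Z[OF C(1,2) assms(2,3)] by blast
  have "irreducible_closedin (zariski (length ws)) (Z \<pi>)" "Z \<pi> \<subset> blowup ps"
    using irreducible_Z[OF \<pi>(1) assms(2) \<pi>(2)] Z_subset_blowup Z_ne_blowup[OF \<pi>(1) assms(2) \<pi>(2)] by blast+
  then have "C = Z \<pi>" using C(3) \<pi>(3) by blast
  then show ?thesis using \<pi> by blast
qed

lemma local_ring_along_Z:
  assumes "irreducible \<pi>" "dom a b" "pt a b \<pi> = 0"
  shows "local_ring_along ps (Z \<pi>) = {ev A / ev B | A B. \<not> \<pi> dvd B}"
proof (intro equalityI subsetI)
  fix f assume "f \<in> local_ring_along ps (Z \<pi>)"
  then obtain P F G e where FG: "P \<in> Z \<pi>" "form e F" "form e G" "val G P \<noteq> 0" "f = gval F / gval G"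
    unfolding local_ring_along_def local_ring_def len[symmetric] by blast
  obtain \<kappa> where \<kappa>: "\<And>e. \<kappa> e \<noteq> 0" "\<And>F e. form e F \<Longrightarrow> gval F = \<kappa> e * ev (sub F)"
    using gval_scale by blast
  have "f = ev (sub F) / ev (sub G)" using FG \<kappa> by simp
  moreover have "\<not> \<pi> dvd sub G" using FG by (auto simp: Z_def)
  ultimately show "f \<in> {ev A / ev B | A B. \<not> \<pi> dvd B}" by blast
next
  fix f assume "f \<in> {ev A / ev B | A B. \<not> \<pi> dvd B}"
  then obtain A B where AB: "\<not> \<pi> dvd B" "f = ev A / ev B" by blast
  then obtain a' b' where "dom a' b'" "pt a' b' \<pi> = 0" "pt a' b' B \<noteq> 0"
    using nullstellensatz[OF assms] by blast
  then have "f \<in> local_ring ps (\<sigma> a' b')" "\<sigma> a' b' \<in> Z \<pi>"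
    using AB(2) Z_\<sigma> by (auto simp: local_ring_\<sigma>)
  then show "f \<in> local_ring_along ps (Z \<pi>)" by (auto simp: local_ring_along_def)
qed

lemma unit_along_Z:
  assumes "irreducible \<pi>" "dom a b" "pt a b \<pi> = 0" "\<not> \<pi> dvd A" "\<not> \<pi> dvd B"
  shows "ev A / ev B \<in> units_in (local_ring_along ps (Z \<pi>))"
proof -
  have "A \<noteq> 0" "B \<noteq> 0" using assms by auto
  then show ?thesis
    unfolding units_in_def local_ring_along_Z[OF assms(1-3)] using assms(4,5) by auto
qed

text \<open>The local ring along the curve is the polynomial ring of the chart localized at the
  prime \<open>\<pi>\<close>; splitting powers of \<open>\<pi>\<close> off numerator and denominator
  gives the valuation.\<close>

lemma dvr_along_Z:
  assumes "irreducible \<pi>" "dom a b" "pt a b \<pi> = 0"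
  shows "dvr (local_ring_along ps (Z \<pi>)) (ev \<pi>)"
proof
  let ?R = "local_ring_along ps (Z \<pi>)"
  note R = local_ring_along_Z[OF assms]
  have u: "\<not> \<pi> dvd 1" using assms(1) unfolding irreducible_def by blast
  have in_R: "ev A \<in> ?R" for A
  proof -
    have "ev A = ev A / ev 1" by (simp add: ev_simps)
    then show ?thesis unfolding R using u by blast
  qed
  show "0 \<in> ?R" "1 \<in> ?R" "ev \<pi> \<in> ?R" using in_R[of 0] in_R[of 1] in_R by (simp_all add: ev_simps)
  show "ev \<pi> \<noteq> 0" using assms(1) unfolding irreducible_def by simp
  fix f g assume "f \<in> ?R" "g \<in> ?R"
  then obtain A B A' B' where "f = ev A / ev B" "\<not> \<pi> dvd B" "g = ev A' / ev B'" "\<not> \<pi> dvd B'"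
    unfolding R by blast
  then have "f * g = ev (A * A') / ev (B * B')" "\<not> \<pi> dvd B * B'"
    using prime_elem_dvd_multD[OF irreducible_imp_prime2[OF assms(1)]] by (auto simp: ev_simps)
  then show "f * g \<in> ?R" unfolding R by blast
next
  show "inverse (ev \<pi>) \<notin> local_ring_along ps (Z \<pi>)"
  proof
    assume "inverse (ev \<pi>) \<in> local_ring_along ps (Z \<pi>)"
    then obtain A B where AB: "inverse (ev \<pi>) = ev A / ev B" "\<not> \<pi> dvd B"
      unfolding local_ring_along_Z[OF assms] by blast
    moreover have "ev \<pi> \<noteq> 0" using assms(1) unfolding irreducible_def by simp
    moreover have "ev B \<noteq> 0" using AB by auto
    ultimately have "ev B = ev (A * \<pi>)" by (simp add: ev_simps field_simps)
    then show False using AB(2) by simp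
  qed
next
  fix f :: "'a ratfun" assume "f \<noteq> 0"
  obtain A B where AB: "B \<noteq> 0" "f = ev A / ev B" using fraction_of_ev by blast
  then have "A \<noteq> 0" using \<open>f \<noteq> 0\<close> by (auto simp: ev_simps)
  obtain n A' where A': "A = \<pi> ^ n * A'" "\<not> \<pi> dvd A'" using dvd_decompose[OF assms(1) \<open>A \<noteq> 0\<close>] by blast
  obtain m B' where B': "B = \<pi> ^ m * B'" "\<not> \<pi> dvd B'" using dvd_decompose[OF assms(1) AB(1)] by blast
  have p0: "ev \<pi> \<noteq> 0" using assms(1) unfolding irreducible_def by simp
  have "f = (ev A' / ev B') * ev \<pi> powi (int n - int m)"
    unfolding AB(2) A'(1) B'(1) using p0 by (simp add: ev_simps power_int_diff mult.commute)
  then show "\<exists>u n. u \<in> units_in (local_ring_along ps (Z \<pi>)) \<and> f = u * ev \<pi> powi n"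
    using unit_along_Z[OF assms A'(2) B'(2)] by blast
qed

text \<open>The four facts that turn a local equation into a divisor: it is effective, it misses
  points where the equation is nonzero, an irreducible equation has order one along its own curve,
  and only components of the equation occur.\<close>

lemma ord_along_ev:
  assumes "prime_divisor ps C" "dom a b" "\<sigma> a b \<in> C" "A \<noteq> 0"
  shows "ord_along ps C (ev A) \<ge> 0" "pt a b A \<noteq> 0 \<Longrightarrow> ord_along ps C (ev A) = 0"
    "irreducible A \<Longrightarrow> pt a b A = 0 \<Longrightarrow> ord_along ps C (ev A) = (if C = Z A then 1 else 0)"
    "ord_along ps C (ev A) \<noteq> 0 \<Longrightarrow> \<exists>\<pi>. irreducible \<pi> \<and> \<pi> dvd A \<and> C = Z \<pi>"
proof -
  obtain \<pi> where \<pi>: "irreducible \<pi>" "pt a b \<pi> = 0" "C = Z \<pi>" using prime_divisor_eq_Z[OF assms(1-3)] by blast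
  interpret dvr "local_ring_along ps C" "ev \<pi>" unfolding \<pi>(3) by (rule dvr_along_Z[OF \<pi>(1) assms(2) \<pi>(2)])
  have u: "\<not> \<pi> dvd 1" using \<pi>(1) unfolding irreducible_def by blast
  have "ev A / ev 1 \<in> local_ring_along ps C"
    unfolding \<pi>(3) local_ring_along_Z[OF \<pi>(1) assms(2) \<pi>(2)] using u by blast
  then show "ord_along ps C (ev A) \<ge> 0"
    unfolding ord_along_eq using ord_in_nonneg[of "ev A"] assms(4) by (simp add: ev_simps)
  have *: "ord_along ps C (ev A) = 0" if "\<not> \<pi> dvd A"
    using ord_in_unit[of "ev A / ev 1"] unit_along_Z[OF \<pi>(1) assms(2) \<pi>(2) that u]
    unfolding ord_along_eq \<pi>(3) by (simp add: ev_simps)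
  show "ord_along ps C (ev A) = 0" if "pt a b A \<noteq> 0" using * pt_dvd[OF _ \<pi>(2)] that by blast
  show "\<exists>\<pi>. irreducible \<pi> \<and> \<pi> dvd A \<and> C = Z \<pi>" if "ord_along ps C (ev A) \<noteq> 0"
    using * that \<pi> by blast
  show "ord_along ps C (ev A) = (if C = Z A then 1 else 0)" if A: "irreducible A" "pt a b A = 0"
  proof (cases "\<pi> dvd A")
    case True
    then have C: "C = Z A" using Z_assoc \<pi> A by blast
    interpret A: dvr "local_ring_along ps C" "ev A" unfolding C by (rule dvr_along_Z[OF A(1) assms(2) A(2)])
    show ?thesis using C A.ord_in_t[OF A.units_one] by (simp add: ord_along_eq)
  next
    case False
    then have "C \<noteq> Z A" using Z_mono_dvd[OF \<pi>(1) assms(2) \<pi>(2)] \<pi>(3) by blast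
    then show ?thesis using * False by simp
  qed
qed

lemma dvr_along:
  assumes "prime_divisor ps C" "dom a b" "\<sigma> a b \<in> C"
  shows "\<exists>t. dvr (local_ring_along ps C) t"
  using prime_divisor_eq_Z[OF assms] dvr_along_Z[OF _ assms(2)] by blast

end

section \<open>The standard charts\<close>

definition dot3 :: "('b::comm_ring_1)^3 \<Rightarrow> 'b^3 \<Rightarrow> 'b" where
  "dot3 a b = (\<Sum>j\<in>UNIV. a $ j * b $ j)"

lemma dot3_expand: "dot3 a b = a$1 * b$1 + a$2 * b$2 + a$3 * b$3"
  by (simp add: dot3_def sum_3)

lemma cross_nth:
  "cross u v $ 1 = u$2 * v$3 - u$3 * v$2" "cross u v $ 2 = u$3 * v$1 - u$1 * v$3"
  "cross u v $ 3 = u$1 * v$2 - u$2 * v$1"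
  by (simp_all add: cross_def)

lemmas vec3_simps = Finite_Cartesian_Product.vec_eq_iff forall_3 cross_nth dot3_expand

lemma eval_mlinear_dot3:
  "comm_ring_hom \<phi> \<Longrightarrow> eval_mpoly \<phi> (mlinear i a) vs = dot3 (vmap \<phi> a) (vs ! i)"
  by (simp add: eval_mlinear dot3_def)

lemma vmap_simps:
  assumes "comm_ring_hom \<phi>"
  shows "vmap \<phi> (a + b) = vmap \<phi> a + vmap \<phi> b" "vmap \<phi> (c *s a) = \<phi> c *s vmap \<phi> a"
    "vmap \<phi> (cross a b) = cross (vmap \<phi> a) (vmap \<phi> b)" "\<phi> (dot3 a b) = dot3 (vmap \<phi> a) (vmap \<phi> b)"
proof -
  interpret comm_ring_hom \<phi> by fact
  show "vmap \<phi> (a + b) = vmap \<phi> a + vmap \<phi> b" "vmap \<phi> (c *s a) = \<phi> c *s vmap \<phi> a"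
    "vmap \<phi> (cross a b) = cross (vmap \<phi> a) (vmap \<phi> b)" "\<phi> (dot3 a b) = dot3 (vmap \<phi> a) (vmap \<phi> b)"
    by (simp_all add: vec3_simps hom_add hom_mult hom_minus)
qed

lemma vmap_vmap: "vmap \<phi> (vmap \<psi> a) = vmap (\<lambda>c. \<phi> (\<psi> c)) a"
  by (simp add: Finite_Cartesian_Product.vec_eq_iff)

lemma vmap_ident [simp]: "vmap (\<lambda>c. c) a = a" "vmap id a = a"
  by (simp_all add: Finite_Cartesian_Product.vec_eq_iff)

lemma cross_scale: "cross a (c *s b) = c *s cross a b"
  by (simp add: vec3_simps algebra_simps)

lemma dot3_scale: "dot3 a (c *s b) = c * dot3 a b" "dot3 (c *s a) b = c * dot3 a b"
  by (simp_all add: vec3_simps algebra_simps)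

lemma dot3_commute: "dot3 a b = dot3 b a"
  by (simp add: dot3_def mult.commute)

lemma dot3_cross [simp]: "dot3 (cross a b) a = 0" "dot3 (cross a b) b = 0"
  by (simp_all add: vec3_simps algebra_simps)

lemma incident_iff: "incident x l \<longleftrightarrow> dot3 (rep_proj2 l) (rep_proj2 x) = 0"
  by (simp add: incident_def dot3_def)

lemma incident_abs:
  assumes "v \<noteq> 0"
  shows "incident (abs_proj2 v) l \<longleftrightarrow> dot3 (rep_proj2 l) v = 0"
    "incident x (abs_proj2 v) \<longleftrightarrow> dot3 v (rep_proj2 x) = 0"
proof -
  obtain c where "c \<noteq> 0" "rep_proj2 (abs_proj2 v) = c *s v" using rep_abs_proj2[OF assms] .
  then show "incident (abs_proj2 v) l \<longleftrightarrow> dot3 (rep_proj2 l) v = 0"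
    "incident x (abs_proj2 v) \<longleftrightarrow> dot3 v (rep_proj2 x) = 0"
    by (simp_all add: incident_iff dot3_scale)
qed

lemma proportional_of_cross_zero:
  fixes k l :: "'a::field ^ 3"
  assumes "cross l k = 0" "k \<noteq> 0"
  shows "\<exists>c. l = c *s k"
proof -
  from assms(2) obtain m where m: "k $ m \<noteq> 0" by (auto simp: Finite_Cartesian_Product.vec_eq_iff)
  have eq: "l $ i * k $ j = l $ j * k $ i" for i j
    using assms(1) exhaust_3[of i] exhaust_3[of j] by (auto simp: vec3_simps mult.commute)
  have "l = (l $ m / k $ m) *s k"
    using m eq[of _ m] by (simp add: Finite_Cartesian_Product.vec_eq_iff field_simps)
  then show ?thesis by blast
qed

text \<open>The triple product expansion of \<open>cross l (cross p x)\<close> has the two vanishing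
  scalar products as coefficients, so \<open>l\<close> is parallel to
  \<open>cross p x\<close>.\<close>

lemma cross_unique:
  fixes l p x :: "'a::field ^ 3"
  assumes "dot3 l p = 0" "dot3 l x = 0" "cross p x \<noteq> 0" "l \<noteq> 0"
  shows "\<exists>c. c \<noteq> 0 \<and> l = c *s cross p x"
proof -
  have "cross l (cross p x) = dot3 l x *s p - dot3 l p *s x"
    by (simp add: vec3_simps algebra_simps)
  then have "cross l (cross p x) = 0" using assms by simp
  then obtain c where "l = c *s cross p x" using proportional_of_cross_zero assms(3) by blast
  then show ?thesis using assms(4) by auto
qed

lemma cross_rep_eq_0_iff: "cross (rep_proj2 p) (rep_proj2 q) = 0 \<longleftrightarrow> p = q"
proof
  assume "cross (rep_proj2 p) (rep_proj2 q) = 0"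
  then obtain c where c: "rep_proj2 p = c *s rep_proj2 q"
    using proportional_of_cross_zero rep_proj2_nonzero by blast
  then have "c \<noteq> 0" using rep_proj2_nonzero[of p] by auto
  then show "p = q" using c proj2_eq_iff[of q p] by metis
qed (simp add: vec3_simps mult.commute)

lemma multihomogeneous_prod:
  "(\<And>i. i \<in> A \<Longrightarrow> multihomogeneous n (e i) (F i)) \<Longrightarrow>
    multihomogeneous n (\<lambda>k. \<Sum>i\<in>A. e i k) (prod F A)"
proof (induction A rule: infinite_finite_induct)
  case (insert x A)
  then have "multihomogeneous n (\<lambda>k. e x k + (\<Sum>i\<in>A. e i k)) (F x * prod F A)"
    by (intro multihomogeneous_mult) auto
  then show ?case using insert by simp
qed (use multihomogeneous_mconst[of n 1] in \<open>simp_all add: mconst_def\<close>)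

lemma eval_mpoly_1:
  assumes "comm_ring_hom \<phi>" shows "eval_mpoly \<phi> 1 vs = 1"
proof -
  interpret comm_ring_hom \<phi> by fact
  show ?thesis using eval_mconst[OF assms, of 1 vs] by (simp add: mconst_def)
qed

lemma eval_mpoly_prod:
  assumes "comm_ring_hom \<phi>" shows "eval_mpoly \<phi> (prod F A) vs = (\<Prod>i\<in>A. eval_mpoly \<phi> (F i) vs)"
  by (induction A rule: infinite_finite_induct)
    (auto simp: eval_mpoly_1 eval_mpoly_mult assms)

text \<open>The coefficient vector of the linear form sending \<open>x\<close> to coordinate
  \<open>m\<close> of \<open>cross p x\<close>. Such forms express in coordinates that a point
  differs from \<open>p\<close>.\<close>

definition cross_row :: "'a::comm_ring_1 ^ 3 \<Rightarrow> 3 \<Rightarrow> 'a ^ 3" where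
  "cross_row p m = (\<chi> j. cross p (axis j 1) $ m)"

lemma dot3_cross_row: "dot3 (cross_row p m) x = cross p x $ m"
  using exhaust_3[of m] by (auto simp: cross_row_def vec3_simps axis_def algebra_simps)

section \<open>Jacobians of quotients of linear forms\<close>

lemma jacobian_quotients:
  assumes "g \<noteq> 0"
  shows "jacobian (f / g) (h / g) = (g * jacobian f h - f * jacobian g h + h * jacobian g f) / g ^ 3"
proof -
  have "jacobian (f / g) (h / g) = 
    ((deriv_x f * g - f * deriv_x g) * (deriv_y h * g - h * deriv_y g) -
    (deriv_y f * g - f * deriv_y g) * (deriv_x h * g - h * deriv_x g)) / (g * g * (g * g))"
    unfolding jacobian_def derivation_divide[OF derivation_deriv_x assms]
      derivation_divide[OF derivation_deriv_y assms] 
    by (simp only: power2_eq_square times_divide_times_eq diff_divide_distrib[symmetric])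
  also have "\<dots> = g * (g * jacobian f h - f * jacobian g h + h * jacobian g f) / (g * g * (g * g))"
    by (rule arg_cong2[where f = "(/)"]) (simp_all add: jacobian_def algebra_simps)
  also have "\<dots> = (g * jacobian f h - f * jacobian g h + h * jacobian g f) / g ^ 3"
    using assms by (simp add: power3_eq_cube)
  finally show ?thesis .
qed

lemma jacobian_quotient_right:
  assumes "u \<noteq> 0" shows "jacobian u (v / u) = jacobian u v / u"
  using jacobian_mult_right[of u u "v / u"] assms by (simp add: field_simps)

definition lin :: "'a::field ^ 3 \<Rightarrow> 'a ratfun" where
  "lin n = dot3 (vmap rf_const n) generic_point"

lemma generic_point_nth: "generic_point $ 1 = rf_x" "generic_point $ 2 = rf_y" "generic_point $ 3 = 1"
  by (simp_all add: generic_point_def)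

lemma lin_eq: "lin n = rf_const (n $ 1) * rf_x + rf_const (n $ 2) * rf_y + rf_const (n $ 3)"
  by (simp add: lin_def dot3_expand generic_point_nth)

lemma linear_form_eq: "linear_form a = lin (rep_proj2 a)"
  by (simp add: linear_form_def lin_def dot3_def)

lemma lin_nonzero:
  assumes "n \<noteq> 0" shows "lin n \<noteq> 0"
proof
  assume "lin n = 0"
  moreover have "lin n = ev2 rf_const rf_x rf_y (cc (n $ 1) * vX + cc (n $ 2) * vY + cc (n $ 3))"
    by (simp add: lin_eq ev2_rf)
  ultimately have "Fract (cc (n $ 1) * vX + cc (n $ 2) * vY + cc (n $ 3)) 1 = 0"
    by (simp only: ev2_rf_generic)
  then have "cc (n $ 1) * vX + cc (n $ 2) * vY + cc (n $ 3) = 0"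
    by (simp add: Zero_fract_def eq_fract)
  then have "n $ 1 = 0 \<and> n $ 2 = 0 \<and> n $ 3 = 0"
    by (simp add: cc_def vX_def vY_def)
  then show False using assms by (simp add: vec3_simps)
qed

lemma deriv_lin: "deriv_x (lin n) = rf_const (n $ 1)" "deriv_y (lin n) = rf_const (n $ 2)"
  by (simp_all add: lin_eq deriv_arith deriv_simps)

lemmas rf_hom = comm_ring_hom_rf_const

lemma rf_const_arith: "rf_const (a + b) = rf_const a + rf_const b" "rf_const (a * b) = rf_const a * rf_const b"
  "rf_const (a - b) = rf_const a - rf_const b" "rf_const (- a) = - rf_const a"
proof -
  interpret comm_ring_hom rf_const by (rule rf_hom)
  show "rf_const (a + b) = rf_const a + rf_const b" "rf_const (a * b) = rf_const a * rf_const b"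
    "rf_const (a - b) = rf_const a - rf_const b" "rf_const (- a) = - rf_const a"
    using hom_minus[of 0 a] by (simp_all add: hom_add hom_mult hom_minus)
qed

lemma jacobian_lin:
  assumes "n0 \<noteq> 0"
  shows "jacobian (lin n1 / lin n0) (lin n2 / lin n0) = rf_const (dot3 (cross n0 n1) n2) / lin n0 ^ 3"
proof -
  have "lin n0 * jacobian (lin n1) (lin n2) - lin n1 * jacobian (lin n0) (lin n2) + lin n2 * jacobian (lin n0) (lin n1)
    = rf_const (dot3 (cross n0 n1) n2)"
    unfolding jacobian_def deriv_lin
    unfolding lin_eq dot3_expand cross_nth rf_const_arith by (simp add: algebra_simps)
  then show ?thesis using jacobian_quotients[OF lin_nonzero[OF assms], of "lin n1" "lin n2"] by simp
qed

text \<open>A basis \<open>q0, q1, q2\<close> with dual basis \<open>n0, n1, n2\<close>;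
  \<open>expand\<close> is the completeness relation. The chart is centred at \<open>q0\<close>. An
  index \<open>i0\<close> below \<open>length ps\<close> names the centre that is blown up there,
  and a larger value encodes a chart of the plane without a centre.\<close>

locale frame =
  fixes ps :: "'a::{alg_closed_field, field_char_0} proj2 list" and i0 :: nat
    and q0 q1 q2 n0 n1 n2 :: "'a ^ 3"
  assumes expand: "q0 $ i * n0 $ j + q1 $ i * n1 $ j + q2 $ i * n2 $ j = (if i = j then 1 else 0)"
    and n0: "dot3 n0 q0 = 1" "dot3 n0 q1 = 0" "dot3 n0 q2 = 0"
    and det: "dot3 (cross q0 q1) q2 \<noteq> 0" "dot3 (cross n0 n1) n2 \<noteq> 0"
    and centre: "i0 < length ps \<Longrightarrow> rep_proj2 (ps ! i0) = q0"
begin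

abbreviation blown where "blown \<equiv> i0 < length ps"

text \<open>The usual chart of a blow-up: \<open>vX\<close> is the equation of the exceptional curve
  and \<open>vY\<close> the slope, so the second affine coordinate is their product.\<close>

definition w0 where
  "w0 = vmap cc q0 + vX *s vmap cc q1 + (if blown then vX * vY else vY) *s vmap cc q2"

text \<open>At the centre itself this is \<open>cross q0 w0\<close> divided by \<open>vX\<close>.
  The quotient stays nonzero on the exceptional curve, where the cross product degenerates.\<close>

definition w where
  "w i = (if i = i0 then cross (vmap cc q0) (vmap cc q1 + vY *s vmap cc q2)
    else cross (vmap cc (rep_proj2 (ps ! i))) w0)"

definition ws where "ws = w0 # map w [0..<length ps]"

definition cu :: "'a ratfun" where "cu = lin n1 / lin n0"
definition cv :: "'a ratfun" where "cv = (if blown then lin n2 / lin n1 else lin n2 / lin n0)"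
text \<open>The local equation of the whole exceptional divisor: the domain of a chart excludes all
  other centres, so no further exceptional curve meets it.\<close>

definition ce :: "'a ratfun" where "ce = (if blown then cu else 1)"

lemma n_nonzero: "n0 \<noteq> 0" "n1 \<noteq> 0" "n2 \<noteq> 0"
  using det(2) by (auto simp: vec3_simps)

lemma lin_n_nonzero [simp]: "lin n0 \<noteq> 0" "lin n1 \<noteq> 0" "lin n2 \<noteq> 0"
  using n_nonzero lin_nonzero by blast+

lemma cu_nonzero [simp]: "cu \<noteq> 0" by (simp add: cu_def)

text \<open>The formula behind K = -3L + E: the cube of \<open>lin n0\<close> is the pole of dx dy
  along a line, and \<open>ce\<close> comes from dividing the second coordinate by the
  first.\<close>

lemma jacobian_frame: "jacobian cu cv = rf_const (dot3 (cross n0 n1) n2) / (lin n0 ^ 3 * ce)"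
proof -
  have "lin n2 / lin n1 = (lin n2 / lin n0) / cu" by (simp add: cu_def)
  then show ?thesis
    using jacobian_lin[OF n_nonzero(1), of n1 n2] jacobian_quotient_right[OF cu_nonzero, of "lin n2 / lin n0"]
    by (auto simp: cv_def ce_def cu_def)
qed

lemma length_ws: "length ws = Suc (length ps)" by (simp add: ws_def)

lemma nth_ws: "ws ! 0 = w0" "i < length ps \<Longrightarrow> ws ! Suc i = w i"
  by (simp_all add: ws_def)

lemma frame_expand:
  assumes "comm_ring_hom \<phi>"
  shows "x = dot3 (vmap \<phi> n0) x *s vmap \<phi> q0 + dot3 (vmap \<phi> n1) x *s vmap \<phi> q1 + dot3 (vmap \<phi> n2) x *s vmap \<phi> q2"
proof -
  interpret comm_ring_hom \<phi> by fact
  have e: "\<phi> (q0 $ i) * \<phi> (n0 $ j) + \<phi> (q1 $ i) * \<phi> (n1 $ j) + \<phi> (q2 $ i) * \<phi> (n2 $ j) = (if i = j then 1 else 0)"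
    for i j
    using arg_cong[OF expand[of i j], of \<phi>] by (simp add: hom_add hom_mult split: if_splits)
  have *: "x $ i = (\<Sum>j\<in>UNIV. (\<phi> (q0 $ i) * \<phi> (n0 $ j) + \<phi> (q1 $ i) * \<phi> (n1 $ j) + \<phi> (q2 $ i) * \<phi> (n2 $ j)) * x $ j)" for i
    unfolding e by (simp add: mult_if_delta)
  show ?thesis
    unfolding Finite_Cartesian_Product.vec_eq_iff
  proof
    fix i
    show "x $ i = (dot3 (vmap \<phi> n0) x *s vmap \<phi> q0 + dot3 (vmap \<phi> n1) x *s vmap \<phi> q1 + dot3 (vmap \<phi> n2) x *s vmap \<phi> q2) $ i"
      by (rule trans[OF *]) (simp add: dot3_expand sum_3 algebra_simps)
  qed
qed

lemma vmap_w0: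
  assumes "comm_ring_hom \<phi>"
  shows "vmap (ev2 \<phi> A B) w0 = vmap \<phi> q0 + A *s vmap \<phi> q1 + (if blown then A * B else B) *s vmap \<phi> q2"
  unfolding w0_def
  using vmap_simps[OF comm_ring_hom_ev2[OF assms]]
  by (simp add: vmap_vmap ev2_simps[OF assms])

lemma vmap_w:
  assumes "comm_ring_hom \<phi>"
  shows "vmap (ev2 \<phi> A B) (w i) = (if i = i0 then cross (vmap \<phi> q0) (vmap \<phi> q1 + B *s vmap \<phi> q2)
    else cross (vmap \<phi> (rep_proj2 (ps ! i))) (vmap (ev2 \<phi> A B) w0))"
  unfolding w_def
  using vmap_simps[OF comm_ring_hom_ev2[OF assms]]
  by (simp add: vmap_vmap ev2_simps[OF assms])

lemma generic_w0: "generic_point = lin n0 *s vmap (ev2 rf_const cu cv) w0"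
proof -
  have "generic_point = lin n0 *s vmap rf_const q0 + lin n1 *s vmap rf_const q1 + lin n2 *s vmap rf_const q2"
    using frame_expand[OF rf_hom, of generic_point] by (simp add: lin_def)
  also have "\<dots> = lin n0 *s vmap (ev2 rf_const cu cv) w0"
    by (simp add: vmap_w0[OF rf_hom] Finite_Cartesian_Product.vec_eq_iff cu_def cv_def algebra_simps)
  finally show ?thesis .
qed

lemma generic_nth: "blowup_generic_point ps ! 0 = generic_point"
  "i < length ps \<Longrightarrow> blowup_generic_point ps ! Suc i = cross (vmap rf_const (rep_proj2 (ps ! i))) generic_point"
  by (simp_all add: blowup_generic_point_def vmap_def)

lemma generic_i0:
  assumes blown
  shows "blowup_generic_point ps ! Suc i0 = lin n1 *s vmap (ev2 rf_const cu cv) (w i0)"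
proof -
  have "generic_point = lin n0 *s vmap rf_const q0 + lin n1 *s vmap rf_const q1 + lin n2 *s vmap rf_const q2"
    using frame_expand[OF rf_hom, of generic_point] by (simp add: lin_def)
  moreover have "lin n2 = lin n1 * cv" using assms by (simp add: cv_def)
  ultimately show ?thesis
    unfolding generic_nth(2)[OF assms] centre[OF assms] vmap_w[OF rf_hom]
    by (simp add: vec3_simps algebra_simps)
qed

lemma chart_nth:
  "chart_at ws a b ! 0 = q0 + a *s q1 + (if blown then a * b else b) *s q2"
  "i < length ps \<Longrightarrow> chart_at ws a b ! Suc i = (if i = i0 then cross q0 (q1 + b *s q2)
    else cross (rep_proj2 (ps ! i)) (chart_at ws a b ! 0))"
  using vmap_w0[OF comm_ring_hom_id(1), of a b] vmap_w[OF comm_ring_hom_id(1), of a b i]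
  by (simp_all add: chart_at_def length_ws nth_ws)

lemma chart_i0_nonzero: "cross q0 (q1 + b *s q2) \<noteq> 0"
proof
  assume "cross q0 (q1 + b *s q2) = 0"
  then have "dot3 (cross q0 (q1 + b *s q2)) q2 = 0" by (simp add: dot3_expand)
  moreover have "dot3 (cross q0 (q1 + b *s q2)) q2 = dot3 (cross q0 q1) q2"
    by (simp add: vec3_simps algebra_simps)
  ultimately show False using det by simp
qed

lemma chart_0_nonzero: "chart_at ws a b ! 0 \<noteq> 0"
proof
  assume "chart_at ws a b ! 0 = 0"
  then have "dot3 n0 (q0 + a *s q1 + (if blown then a * b else b) *s q2) = 0"
    by (simp add: chart_nth dot3_expand)
  moreover have "dot3 n0 (q0 + a *s q1 + c *s q2) = dot3 n0 q0 + a * dot3 n0 q1 + c * dot3 n0 q2" for c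
    by (simp add: vec3_simps algebra_simps)
  ultimately show False using n0 by simp
qed

lemma dom_iff:
  "chart_dom ws a b \<longleftrightarrow> (\<forall>i<length ps. i \<noteq> i0 \<longrightarrow> cross (rep_proj2 (ps ! i)) (chart_at ws a b ! 0) \<noteq> 0)"
proof -
  have "chart_dom ws a b \<longleftrightarrow> (\<forall>i<Suc (length ps). chart_at ws a b ! i \<noteq> 0)"
    unfolding chart_dom_def in_set_conv_nth by (auto simp: length_ws)
  also have "\<dots> \<longleftrightarrow> chart_at ws a b ! 0 \<noteq> 0 \<and> (\<forall>i<length ps. chart_at ws a b ! Suc i \<noteq> 0)"
    by (simp add: All_less_Suc2)
  also have "\<dots> \<longleftrightarrow> (\<forall>i<length ps. i \<noteq> i0 \<longrightarrow> cross (rep_proj2 (ps ! i)) (chart_at ws a b ! 0) \<noteq> 0)"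
    using chart_0_nonzero chart_i0_nonzero chart_nth(2) by auto
  finally show ?thesis .
qed

text \<open>The inverse of the chart. The slope \<open>b\<close> is read off from the line through
  the centre and not from \<open>x\<close>, which determines no slope when it is the centre.\<close>

lemma chart_surj:
  assumes P: "P \<in> blowup ps" and x: "dot3 n0 (rep_proj2 (hd P)) \<noteq> 0"
    and c: "\<And>i. i < length ps \<Longrightarrow> i \<noteq> i0 \<Longrightarrow> cross (rep_proj2 (ps ! i)) (rep_proj2 (hd P)) \<noteq> 0"
    and l: "blown \<Longrightarrow> dot3 (rep_proj2 (P ! Suc i0)) q2 \<noteq> 0"
  shows "\<exists>a b. chart_dom ws a b \<and> P = chart_pt ws a b"
proof -
  obtain y ls where Pyls: "P = y # ls" "length ls = length ps"
    "\<And>i. i < length ps \<Longrightarrow> incident (ps ! i) (ls ! i) \<and> incident y (ls ! i)"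
    using P by (auto simp: blowup_def)
  define x where "x = rep_proj2 y"
  define d where "d = dot3 n0 x"
  have d: "d \<noteq> 0" using assms(2) Pyls by (simp add: d_def x_def)
  define a where "a = dot3 n1 x / d"
  define \<mu> where "\<mu> = rep_proj2 (ls ! i0)"
  define b where "b = (if blown then - dot3 \<mu> q1 / dot3 \<mu> q2 else dot3 n2 x / d)"
  have \<mu>: "dot3 \<mu> q2 \<noteq> 0" "dot3 \<mu> q0 = 0" "dot3 \<mu> x = 0" if blown
    using l[OF that] Pyls(1,2) Pyls(3)[OF that] centre[OF that] that by (auto simp: incident_iff \<mu>_def x_def)
  have ex: "x = d *s q0 + dot3 n1 x *s q1 + dot3 n2 x *s q2"
    using frame_expand[OF comm_ring_hom_id(1), of x] by (simp add: d_def)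
  have c2: "dot3 n2 x = d * (if blown then a * b else b)"
  proof (cases blown)
    case True
    have "dot3 \<mu> x = d * dot3 \<mu> q0 + dot3 n1 x * dot3 \<mu> q1 + dot3 n2 x * dot3 \<mu> q2"
      using arg_cong[OF ex, of "dot3 \<mu>"] by (simp add: dot3_expand algebra_simps)
    then have "dot3 n1 x * dot3 \<mu> q1 + dot3 n2 x * dot3 \<mu> q2 = 0" using \<mu>[OF True] by simp
    then have "dot3 n2 x * dot3 \<mu> q2 = - dot3 n1 x * dot3 \<mu> q1" by (simp add: eq_neg_iff_add_eq_0 add.commute)
    then have "dot3 n2 x = - dot3 n1 x * dot3 \<mu> q1 / dot3 \<mu> q2" using \<mu>(1)[OF True] by (metis nonzero_eq_divide_eq)
    then show ?thesis using True d by (simp add: a_def b_def)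
  qed (use d in \<open>simp add: b_def\<close>)
  have w0: "x = d *s (chart_at ws a b ! 0)"
    unfolding chart_nth
    by (subst ex, subst c2) (use d in \<open>simp add: Finite_Cartesian_Product.vec_eq_iff a_def algebra_simps\<close>)
  have w0x: "chart_at ws a b ! 0 = inverse d *s x" by (subst w0) (use d in \<open>simp\<close>)
  have dom: "chart_dom ws a b"
    unfolding dom_iff w0x cross_scale using c d Pyls by (simp add: x_def)
  have "P ! i = chart_pt ws a b ! i" if "i < Suc (length ps)" for i
  proof (cases i)
    case 0
    have "abs_proj2 (chart_at ws a b ! 0) = y"
      by (rule abs_proj2_eqI[OF d chart_0_nonzero]) (use w0 in \<open>simp add: x_def\<close>)
    then show ?thesis using 0 Pyls by (simp add: chart_pt_def length_ws)
  next
    case (Suc k)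
    then have k: "k < length ps" using that by simp
    have inc: "dot3 (rep_proj2 (ls ! k)) (rep_proj2 (ps ! k)) = 0" "dot3 (rep_proj2 (ls ! k)) x = 0"
      using Pyls(3)[OF k] by (simp_all add: incident_iff x_def)
    have "\<exists>c. c \<noteq> 0 \<and> rep_proj2 (ls ! k) = c *s (chart_at ws a b ! Suc k)"
    proof (cases "k = i0")
      case True
      then have bl: blown using k by simp
      have "dot3 \<mu> (q1 + b *s q2) = dot3 \<mu> q1 + b * dot3 \<mu> q2" by (simp add: dot3_expand algebra_simps)
      also have "\<dots> = 0" using bl \<mu>(1)[OF bl] by (simp add: b_def)
      finally show ?thesis
        using cross_unique[of \<mu> q0 "q1 + b *s q2"] \<mu>[OF bl] chart_i0_nonzero True chart_nth(2)[OF k]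
        by (simp add: \<mu>_def)
    next
      case False
      have "dot3 (rep_proj2 (ls ! k)) (chart_at ws a b ! 0) = 0" unfolding w0x dot3_scale using inc by simp
      moreover have "cross (rep_proj2 (ps ! k)) (chart_at ws a b ! 0) \<noteq> 0" using dom k False by (simp add: dom_iff)
      ultimately show ?thesis using cross_unique[OF inc(1)] False chart_nth(2)[OF k] by simp
    qed
    moreover have "chart_at ws a b ! Suc k \<noteq> 0"
      using dom k unfolding chart_dom_def by (metis Suc_less_eq length_chart(1) length_ws nth_mem)
    ultimately have "abs_proj2 (chart_at ws a b ! Suc k) = ls ! k" using abs_proj2_eqI by metis
    then show ?thesis using Suc k Pyls by (simp add: chart_pt_def length_ws)
  qed
  then have "P = chart_pt ws a b"
    by (intro nth_equalityI) (auto simp: Pyls length_ws)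
  then show ?thesis using dom by blast
qed

lemma dot3_hom_mlinear: "eval_mpoly rf_const (mlinear i a) (blowup_generic_point ps) = dot3 (vmap rf_const a) (blowup_generic_point ps ! i)"
  "eval_mpoly id (mlinear i a) vs = dot3 a (vs ! i)"
  by (simp_all add: eval_mlinear_dot3)

lemma coordinate_forms:
  "\<exists>F G e. multihomogeneous (length ws) e F \<and> multihomogeneous (length ws) e G \<and>
    eval_mpoly rf_const F (blowup_generic_point ps) = cu * eval_mpoly rf_const G (blowup_generic_point ps) \<and>
    (\<forall>a b. chart_dom ws a b \<longrightarrow> eval_mpoly id G (chart_at ws a b) \<noteq> 0)"
  "\<exists>F G e. multihomogeneous (length ws) e F \<and> multihomogeneous (length ws) e G \<and>
    eval_mpoly rf_const F (blowup_generic_point ps) = cv * eval_mpoly rf_const G (blowup_generic_point ps) \<and>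
    (\<forall>a b. chart_dom ws a b \<longrightarrow> eval_mpoly id G (chart_at ws a b) \<noteq> 0)"
proof -
  have ml: "multihomogeneous (length ws) (unit_degree 0) (mlinear 0 n)" for n :: "'a ^ 3"
    by (rule multihomogeneous_mlinear) (simp add: length_ws)
  have G0: "dot3 n0 (chart_at ws a b ! 0) \<noteq> 0" for a b
  proof -
    have "dot3 n0 (q0 + a *s q1 + c *s q2) = dot3 n0 q0 + a * dot3 n0 q1 + c * dot3 n0 q2" for c
      by (simp add: vec3_simps algebra_simps)
    then show ?thesis using n0 by (simp add: chart_nth)
  qed
  show "\<exists>F G e. multihomogeneous (length ws) e F \<and> multihomogeneous (length ws) e G \<and>
    eval_mpoly rf_const F (blowup_generic_point ps) = cu * eval_mpoly rf_const G (blowup_generic_point ps) \<and>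
    (\<forall>a b. chart_dom ws a b \<longrightarrow> eval_mpoly id G (chart_at ws a b) \<noteq> 0)"
    using ml G0
    by (intro exI[of _ "mlinear 0 n1"] exI[of _ "mlinear 0 n0"] exI[of _ "unit_degree 0"])
      (simp add: dot3_hom_mlinear generic_nth lin_def[symmetric] cu_def)
  show "\<exists>F G e. multihomogeneous (length ws) e F \<and> multihomogeneous (length ws) e G \<and>
    eval_mpoly rf_const F (blowup_generic_point ps) = cv * eval_mpoly rf_const G (blowup_generic_point ps) \<and>
    (\<forall>a b. chart_dom ws a b \<longrightarrow> eval_mpoly id G (chart_at ws a b) \<noteq> 0)"
  proof (cases blown)
    case False
    then show ?thesis
      using ml G0
      by (intro exI[of _ "mlinear 0 n2"] exI[of _ "mlinear 0 n0"] exI[of _ "unit_degree 0"])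
        (simp add: dot3_hom_mlinear generic_nth lin_def[symmetric] cv_def)
  next
    case True
    have ml: "multihomogeneous (length ws) (unit_degree (Suc i0)) (mlinear (Suc i0) n)" for n :: "'a ^ 3"
      by (rule multihomogeneous_mlinear) (use True in \<open>simp add: length_ws\<close>)
    have "vmap (ev2 rf_const cu cv) (w i0) = cross (vmap rf_const q0) (vmap rf_const q1 + cv *s vmap rf_const q2)"
      by (simp add: vmap_w[OF rf_hom])
    \<comment> \<open>The line through \<open>q0\<close> and \<open>q1 + cv * q2\<close> is
      orthogonal to \<open>q1 + cv * q2\<close>. This makes the slope a quotient of two linear forms
      in the coordinates of the line.\<close>
    then have g: "dot3 (vmap rf_const (- q1)) (blowup_generic_point ps ! Suc i0) =
        cv * dot3 (vmap rf_const q2) (blowup_generic_point ps ! Suc i0)"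
      unfolding generic_i0[OF True] dot3_scale
      by (simp add: vec3_simps rf_const_arith) (simp add: algebra_simps)
    have "dot3 q2 (cross q0 (q1 + b *s q2)) = dot3 (cross q0 q1) q2" for b
      by (simp add: vec3_simps algebra_simps)
    then have "dot3 q2 (chart_at ws a b ! Suc i0) \<noteq> 0" for a b using True det by (simp add: chart_nth)
    then show ?thesis using ml g
      by (intro exI[of _ "mlinear (Suc i0) (- q1)"] exI[of _ "mlinear (Suc i0) q2"] exI[of _ "unit_degree (Suc i0)"])
        (simp add: dot3_hom_mlinear)
  qed
qed

lemma pre_chart: "pre_chart ps ws cu cv"
proof
  show "length ws = Suc (length ps)" by (rule length_ws)
  show "\<exists>c. c \<noteq> 0 \<and> blowup_generic_point ps ! i = c *s vmap (ev2 rf_const cu cv) (ws ! i)" if "i \<le> length ps" for i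
  proof (cases i)
    case 0
    then show ?thesis using generic_w0 by (intro exI[of _ "lin n0"]) (simp add: nth_ws generic_nth)
  next
    case (Suc k)
    then have k: "k < length ps" using that by simp
    show ?thesis
    proof (cases "k = i0")
      case True
      then show ?thesis using generic_i0 k Suc by (intro exI[of _ "lin n1"]) (simp add: nth_ws)
    next
      case False
      have "blowup_generic_point ps ! i = lin n0 *s vmap (ev2 rf_const cu cv) (w k)"
        unfolding Suc generic_nth(2)[OF k] vmap_w[OF rf_hom]
        using False by (subst generic_w0) (simp add: cross_scale)
      then show ?thesis using Suc k by (intro exI[of _ "lin n0"]) (simp add: nth_ws)
    qed
  qed
  show "\<exists>F G e. multihomogeneous (length ws) e F \<and> multihomogeneous (length ws) e G \<and>
    eval_mpoly rf_const F (blowup_generic_point ps) = z * eval_mpoly rf_const G (blowup_generic_point ps) \<and>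
    (\<forall>a b. chart_dom ws a b \<longrightarrow> eval_mpoly id G (chart_at ws a b) \<noteq> 0)"
    if "z = cu \<and> (z' :: 'a poly poly) = vX \<or> z = cv \<and> z' = vY" for z z'
    using that coordinate_forms by blast
  show "jacobian cu cv \<noteq> 0" using det by (auto simp: jacobian_frame ce_def)
next
  fix a b assume dom: "chart_dom ws a b"
  let ?x = "chart_at ws a b ! 0"
  have "incident (ps ! i) (chart_pt ws a b ! Suc i) \<and> incident (chart_pt ws a b ! 0) (chart_pt ws a b ! Suc i)"
    if i: "i < length ps" for i
  proof -
    have nz: "chart_at ws a b ! Suc i \<noteq> 0"
      using dom i unfolding chart_dom_def by (metis Suc_less_eq length_chart(1) length_ws nth_mem)
    have "dot3 (chart_at ws a b ! Suc i) (rep_proj2 (ps ! i)) = 0"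
      using i centre by (simp add: chart_nth)
    moreover have "dot3 (chart_at ws a b ! Suc i) ?x = 0"
    proof (cases "i = i0")
      case True
      then have x: "?x = q0 + a *s (q1 + b *s q2)" using i 
        by (simp add: chart_nth vector_add_ldistrib vector_smult_assoc add.assoc)
      have l: "chart_at ws a b ! Suc i = cross q0 (q1 + b *s q2)"
        using True chart_nth(2)[OF i] by simp
      show ?thesis unfolding l x by (simp add: vec3_simps algebra_simps)
    qed (simp add: chart_nth(2)[OF i])
    moreover have "\<exists>c. rep_proj2 (chart_pt ws a b ! 0) = c *s ?x"
      using rep_abs_proj2[OF chart_0_nonzero] by (simp add: chart_pt_def length_ws) metis
    ultimately show ?thesis
      using nz i by (auto simp: chart_pt_def length_ws incident_abs dot3_scale)
  qed
  moreover obtain y ls where yls: "chart_pt ws a b = y # ls"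
    by (cases "chart_pt ws a b") (use length_ws in \<open>auto simp: chart_pt_def chart_at_def ws_def\<close>)
  moreover have "length ls = length ps"
    using arg_cong[OF yls, of length] by (simp add: length_ws)
  ultimately show "chart_pt ws a b \<in> blowup ps" by (auto simp: blowup_def)
next
  fix a b assume dom: "chart_dom ws a b"
  let ?x = "chart_at ws a b ! 0"
  have "\<exists>m. cross (rep_proj2 (ps ! i)) ?x $ m \<noteq> 0" if "i < length ps" "i \<noteq> i0" for i
    using dom that by (auto simp: dom_iff Finite_Cartesian_Product.vec_eq_iff)
  then obtain m where m: "\<And>i. i < length ps \<Longrightarrow> i \<noteq> i0 \<Longrightarrow> cross (rep_proj2 (ps ! i)) ?x $ m i \<noteq> 0" by metis
  define I where "I = {..<length ps} - {i0}"
  \<comment> \<open>For every other centre one coordinate of the cross product that is nonzero at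
    the given point certifies that the point is not that centre.\<close>
  define K where "K = (\<Prod>i\<in>I. mlinear 0 (cross_row (rep_proj2 (ps ! i)) (m i)))"
  define Q where "Q = (if blown then mlinear (Suc i0) q2 else mconst 1)"
  define H where "H = mlinear 0 n0 * (Q * K)"
  have ev: "eval_mpoly id H vs \<noteq> 0 \<longleftrightarrow> dot3 n0 (vs ! 0) \<noteq> 0 \<and> (blown \<longrightarrow> dot3 q2 (vs ! Suc i0) \<noteq> 0) \<and>
      (\<forall>i\<in>I. cross (rep_proj2 (ps ! i)) (vs ! 0) $ m i \<noteq> 0)" for vs
  proof -
    have "finite I" by (simp add: I_def)
    then show ?thesis
      by (simp add: H_def Q_def K_def eval_mpoly_mult eval_mpoly_prod eval_mlinear_dot3 eval_mconst dot3_cross_row)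
  qed
  have ml: "multihomogeneous (length ws) (unit_degree 0) (mlinear 0 n)" for n :: "'a ^ 3"
    by (rule multihomogeneous_mlinear) (simp add: length_ws)
  have "\<exists>e. multihomogeneous (length ws) e Q"
    using multihomogeneous_mconst[of "length ws" "1::'a"] multihomogeneous_mlinear[of "Suc i0" "length ws" q2]
    by (auto simp: Q_def length_ws)
  then obtain eQ where eQ: "multihomogeneous (length ws) eQ Q" by blast
  have "multihomogeneous (length ws) (\<lambda>k. \<Sum>i\<in>I. unit_degree 0 k) K"
    unfolding K_def by (rule multihomogeneous_prod) (rule ml)
  from multihomogeneous_mult[OF ml multihomogeneous_mult[OF eQ this]]
  obtain e where e: "multihomogeneous (length ws) e H" unfolding H_def by blast
  have "eval_mpoly id H (chart_at ws a b) \<noteq> 0"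
  proof -
    have "dot3 n0 (q0 + a *s q1 + c *s q2) = dot3 n0 q0 + a * dot3 n0 q1 + c * dot3 n0 q2" for c
      by (simp add: vec3_simps algebra_simps)
    moreover have "dot3 q2 (cross q0 (q1 + b *s q2)) = dot3 (cross q0 q1) q2" for b
      by (simp add: vec3_simps algebra_simps)
    ultimately show ?thesis unfolding ev using m n0 det by (simp add: I_def chart_nth)
  qed
  moreover have "chart_dom ws a' b'" if "eval_mpoly id H (chart_at ws a' b') \<noteq> 0" for a' b'
    using that unfolding ev dom_iff I_def by force
  moreover have "\<exists>a' b'. chart_dom ws a' b' \<and> P = chart_pt ws a' b'" if Pb: "P \<in> blowup ps" and PH: "val H P \<noteq> 0" for P
  proof (rule chart_surj[OF Pb])
    obtain y ls where P: "P = y # ls" "length ls = length ps" using Pb by (auto simp: blowup_def)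
    have v: "dot3 n0 (rep_proj2 y) \<noteq> 0" "blown \<Longrightarrow> dot3 q2 (rep_proj2 (ls ! i0)) \<noteq> 0"
      "\<And>i. i \<in> I \<Longrightarrow> cross (rep_proj2 (ps ! i)) (rep_proj2 y) $ m i \<noteq> 0"
      using PH P unfolding ev by auto
    show "dot3 n0 (rep_proj2 (hd P)) \<noteq> 0" using v P by simp
    show "dot3 (rep_proj2 (P ! Suc i0)) q2 \<noteq> 0" if blown using v(2) that P by (simp add: dot3_commute)
    show "cross (rep_proj2 (ps ! i)) (rep_proj2 (hd P)) \<noteq> 0" if "i < length ps" "i \<noteq> i0" for i
      using v(3)[of i] that P by (auto simp: I_def)
  qed
  ultimately show "\<exists>H e. multihomogeneous (length ws) e H \<and>
      eval_mpoly id H (chart_at ws a b) \<noteq> 0 \<and>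
      (\<forall>a' b'. eval_mpoly id H (chart_at ws a' b') \<noteq> 0 \<longrightarrow> chart_dom ws a' b') \<and>
      (\<forall>P\<in>blowup ps. val H P \<noteq> 0 \<longrightarrow> (\<exists>a' b'. chart_dom ws a' b' \<and> P = chart_pt ws a' b'))"
    using e by (intro exI[of _ H] exI[of _ e]) simp
qed

end

section \<open>Plane curves of bounded degree\<close>

definition cf :: "'a::comm_ring_1 poly poly \<Rightarrow> nat \<Rightarrow> nat \<Rightarrow> 'a" where
  "cf f r s = coeff (coeff f s) r"

definition tri :: "nat \<Rightarrow> (nat \<times> nat) set" where
  "tri d = {(r, s). r + s \<le> d}"

definition tdeg :: "nat \<Rightarrow> 'a::comm_ring_1 poly poly \<Rightarrow> bool" where
  "tdeg d f \<longleftrightarrow> (\<forall>r s. d < r + s \<longrightarrow> cf f r s = 0)"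

definition vord :: "nat \<Rightarrow> 'a::comm_ring_1 poly poly \<Rightarrow> bool" where
  "vord k f \<longleftrightarrow> (\<forall>r s. r + s < k \<longrightarrow> cf f r s = 0)"

lemma finite_tri [simp]: "finite (tri d)"
  by (rule finite_subset[of _ "{..d} \<times> {..d}"]) (auto simp: tri_def)

lemma cf_simps [simp]: "cf (f + g) r s = cf f r s + cf g r s" "cf (f - g) r s = cf f r s - cf g r s"
  "cf (- f) r s = - cf f r s" "cf 0 r s = 0" "cf (sum F A) r s = (\<Sum>x\<in>A. cf (F x) r s)"
  "cf (cc c * f) r s = c * cf f r s"
  by (simp_all add: cf_def coeff_sum cc_def)

lemma poly2_eqI: "(\<And>r s. cf f r s = cf g r s) \<Longrightarrow> f = g"
  by (simp add: cf_def poly_eq_iff)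

lemma vX_power: "vX ^ r = [:monom 1 r:]"
  by (induction r) (auto simp: vX_def monom_Suc one_pCons[symmetric] simp del: pCons_one)

lemma vY_power: "vY ^ s = monom 1 s"
  by (induction s) (auto simp: vY_def monom_Suc)

lemma monomial_eq: "cc c * (vX ^ r * vY ^ s) = monom (monom c r) s"
  unfolding vX_power vY_power by (simp add: cc_def smult_monom)

lemma cf_monomial: "cf (cc c * (vX ^ r * vY ^ s)) i j = (if i = r \<and> j = s then c else 0)"
  unfolding monomial_eq by (simp add: cf_def coeff_monom)

lemma cf_monomial_1: "cf (vX ^ r * vY ^ s) i j = (if i = r \<and> j = s then 1 else 0)"
  using cf_monomial[of 1 r s i j] by simp

lemma cf_mult: "cf (f * g) r s = (\<Sum>j\<le>s. \<Sum>i\<le>r. cf f i j * cf g (r - i) (s - j))"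
  by (simp add: cf_def coeff_mult coeff_sum)

lemma poly2_as_sum:
  assumes "tdeg d f"
  shows "f = (\<Sum>(r, s)\<in>tri d. cc (cf f r s) * (vX ^ r * vY ^ s))"
proof (rule poly2_eqI)
  fix i j
  have "cf (\<Sum>(r, s)\<in>tri d. cc (cf f r s) * (vX ^ r * vY ^ s)) i j =
    (\<Sum>x\<in>tri d. if x = (i, j) then cf f i j else 0)"
    unfolding cf_simps(5) case_prod_unfold cf_monomial by (rule sum.cong) (auto simp: prod_eq_iff)
  also have "\<dots> = (if (i, j) \<in> tri d then cf f i j else 0)" by (simp add: sum.delta)
  also have "\<dots> = cf f i j" using assms by (auto simp: tdeg_def tri_def not_le)
  finally show "cf f i j = cf (\<Sum>(r, s)\<in>tri d. cc (cf f r s) * (vX ^ r * vY ^ s)) i j" ..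
qed

lemma tdeg_simps [intro]:
  "tdeg d f \<Longrightarrow> tdeg d g \<Longrightarrow> tdeg d (f + g)" "tdeg d f \<Longrightarrow> tdeg d g \<Longrightarrow> tdeg d (f - g)"
  "tdeg d f \<Longrightarrow> tdeg d (- f)" "tdeg d 0" "(\<And>x. x \<in> A \<Longrightarrow> tdeg d (F x)) \<Longrightarrow> tdeg d (sum F A)"
  by (auto simp: tdeg_def intro!: sum.neutral)

lemma tdeg_mono: "tdeg d f \<Longrightarrow> d \<le> d' \<Longrightarrow> tdeg d' f"
  by (auto simp: tdeg_def)

lemma tdeg_mult: "tdeg d f \<Longrightarrow> tdeg e g \<Longrightarrow> tdeg (d + e) (f * g)"
  unfolding tdeg_def cf_mult
proof (intro allI impI sum.neutral ballI)
  fix r s j i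
  assume *: "\<forall>r s. d < r + s \<longrightarrow> cf f r s = 0" "\<forall>r s. e < r + s \<longrightarrow> cf g r s = 0"
    "d + e < r + s" "j \<in> {..s}" "i \<in> {..r}"
  then have "d < i + j \<or> e < (r - i) + (s - j)" by auto
  then show "cf f i j * cf g (r - i) (s - j) = 0" using * by auto
qed

lemma tdeg_basic: "tdeg d (cc c)" "tdeg (Suc d) vX" "tdeg (Suc d) vY" "tdeg d 1"
  by (auto simp: tdeg_def cf_def cc_def vX_def vY_def coeff_pCons split: nat.splits)

lemma tdeg_power: "tdeg d f \<Longrightarrow> tdeg (n * d) (f ^ n)"
  by (induction n) (auto simp: tdeg_basic intro: tdeg_mult)

lemma vord_simps [intro]:
  "vord d f \<Longrightarrow> vord d g \<Longrightarrow> vord d (f + g)" "vord d f \<Longrightarrow> vord d g \<Longrightarrow> vord d (f - g)"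
  "vord d 0" "(\<And>x. x \<in> A \<Longrightarrow> vord d (F x)) \<Longrightarrow> vord d (sum F A)" "vord 0 f"
  by (auto simp: vord_def intro!: sum.neutral)

lemma vord_mult: "vord d f \<Longrightarrow> vord e g \<Longrightarrow> vord (d + e) (f * g)"
  unfolding vord_def cf_mult
proof (intro allI impI sum.neutral ballI)
  fix r s j i
  assume *: "\<forall>r s. r + s < d \<longrightarrow> cf f r s = 0" "\<forall>r s. r + s < e \<longrightarrow> cf g r s = 0"
    "r + s < d + e" "j \<in> {..s}" "i \<in> {..r}"
  then have "i + j < d \<or> (r - i) + (s - j) < e" by auto
  then show "cf f i j * cf g (r - i) (s - j) = 0" using * by auto
qed

lemma vord_mono: "vord d f \<Longrightarrow> d' \<le> d \<Longrightarrow> vord d' f"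
  by (auto simp: vord_def)

lemma vord_power: "vord d f \<Longrightarrow> vord (n * d) (f ^ n)"
  by (induction n) (auto intro: vord_mult)

text \<open>The value at \<open>x\<close> of the form of degree \<open>d\<close> with dehomogenization \<open>f\<close>.\<close>

definition hform :: "nat \<Rightarrow> ('a \<Rightarrow> 'b) \<Rightarrow> 'a::comm_ring_1 poly poly \<Rightarrow> 'b::comm_ring_1 ^ 3 \<Rightarrow> 'b" where
  "hform d \<phi> f x = (\<Sum>(r, s)\<in>tri d. \<phi> (cf f r s) * (x $ 1 ^ r * x $ 2 ^ s * x $ 3 ^ (d - (r + s))))"

lemma hform_scale: "hform d \<phi> f (c *s x) = c ^ d * hform d \<phi> f x"
  unfolding hform_def sum_distrib_left
proof (rule sum.cong)
  fix z assume z: "z \<in> tri d"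
  obtain r s where rs: "z = (r, s)" "r + s \<le> d" using z by (cases z) (auto simp: tri_def)
  then have "c ^ d = c ^ r * c ^ s * c ^ (d - (r + s))" by (metis le_add_diff_inverse power_add)
  then show "(case z of (r, s) \<Rightarrow> \<phi> (cf f r s) * ((c *s x) $ 1 ^ r * (c *s x) $ 2 ^ s * (c *s x) $ 3 ^ (d - (r + s)))) =
    c ^ d * (case z of (r, s) \<Rightarrow> \<phi> (cf f r s) * (x $ 1 ^ r * x $ 2 ^ s * x $ 3 ^ (d - (r + s))))"
    using rs by (simp add: power_mult_distrib mult_ac)
qed simp

lemma hform_hom:
  assumes "comm_ring_hom \<psi>"
  shows "\<psi> (hform d \<phi> f x) = hform d (\<lambda>c. \<psi> (\<phi> c)) f (vmap \<psi> x)"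
proof -
  interpret comm_ring_hom \<psi> by fact
  show ?thesis by (simp add: hform_def hom_sum hom_mult hom_power case_prod_unfold)
qed

lemma hform_ev2:
  assumes \<phi>: "comm_ring_hom \<phi>" and "tdeg d f" and "x $ 3 * w = 1"
  shows "hform d \<phi> f x = x $ 3 ^ d * ev2 \<phi> (x $ 1 * w) (x $ 2 * w) f"
proof -
  note e = ev2_simps[OF \<phi>]
  have "ev2 \<phi> (x $ 1 * w) (x $ 2 * w) f = 
    (\<Sum>(r, s)\<in>tri d. \<phi> (cf f r s) * ((x $ 1 * w) ^ r * (x $ 2 * w) ^ s))"
    by (subst poly2_as_sum[OF assms(2)]) (simp add: e case_prod_unfold)
  then have "x $ 3 ^ d * ev2 \<phi> (x $ 1 * w) (x $ 2 * w) f = 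
    (\<Sum>(r, s)\<in>tri d. x $ 3 ^ d * (\<phi> (cf f r s) * ((x $ 1 * w) ^ r * (x $ 2 * w) ^ s)))"
    by (simp add: sum_distrib_left case_prod_unfold)
  also have "\<dots> = hform d \<phi> f x"
    unfolding hform_def
  proof (rule sum.cong)
    fix z assume z: "z \<in> tri d"
    obtain r s where rs: "z = (r, s)" "r + s \<le> d" using z by (cases z) (auto simp: tri_def)
    then have p: "x $ 3 ^ d = x $ 3 ^ r * x $ 3 ^ s * x $ 3 ^ (d - (r + s))" by (metis le_add_diff_inverse power_add)
    have "x $ 3 ^ r * w ^ r = 1" "x $ 3 ^ s * w ^ s = 1"
      using assms(3) by (simp_all flip: power_mult_distrib)
    moreover have "x $ 3 ^ d * ((x $ 1 * w) ^ r * (x $ 2 * w) ^ s) =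
      (x $ 3 ^ r * w ^ r) * (x $ 3 ^ s * w ^ s) * (x $ 1 ^ r * x $ 2 ^ s * x $ 3 ^ (d - (r + s)))"
      unfolding p power_mult_distrib by (simp only: mult_ac)
    ultimately have "x $ 3 ^ d * ((x $ 1 * w) ^ r * (x $ 2 * w) ^ s) = x $ 1 ^ r * x $ 2 ^ s * x $ 3 ^ (d - (r + s))"
      by simp
    then show "(case z of (r, s) \<Rightarrow> x $ 3 ^ d * (\<phi> (cf f r s) * ((x $ 1 * w) ^ r * (x $ 2 * w) ^ s))) =
      (case z of (r, s) \<Rightarrow> \<phi> (cf f r s) * (x $ 1 ^ r * x $ 2 ^ s * x $ 3 ^ (d - (r + s))))"
      using rs by (simp add: mult.left_commute)
  qed simp
  finally show ?thesis ..
qed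

lemma hform_add: 
  assumes "comm_ring_hom \<phi>"
  shows "hform d \<phi> (f + g) x = hform d \<phi> f x + hform d \<phi> g x"
    "hform d \<phi> (sum F A) x = (\<Sum>i\<in>A. hform d \<phi> (F i) x)"
proof -
  interpret comm_ring_hom \<phi> by fact
  show add: "hform d \<phi> (f + g) x = hform d \<phi> f x + hform d \<phi> g x" for f g
    by (simp add: hform_def hom_add algebra_simps case_prod_unfold sum.distrib)
  show "hform d \<phi> (sum F A) x = (\<Sum>i\<in>A. hform d \<phi> (F i) x)"
    by (induction A rule: infinite_finite_induct) (auto simp: add, auto simp: hform_def)
qed

lemma hform_monomial:
  assumes "comm_ring_hom \<phi>" "r + s \<le> d"
  shows "hform d \<phi> (cc c * (vX ^ r * vY ^ s)) x = \<phi> c * (x $ 1 ^ r * x $ 2 ^ s * x $ 3 ^ (d - (r + s)))"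
proof -
  interpret comm_ring_hom \<phi> by fact
  have "hform d \<phi> (cc c * (vX ^ r * vY ^ s)) x = 
    (\<Sum>z\<in>tri d. if z = (r, s) then \<phi> c * (x $ 1 ^ r * x $ 2 ^ s * x $ 3 ^ (d - (r + s))) else 0)"
    unfolding hform_def by (rule sum.cong) (auto simp: cf_monomial_1 split: if_splits)
  moreover have "(r, s) \<in> tri d" using assms(2) by (simp add: tri_def)
  ultimately show ?thesis by (simp add: sum.delta)
qed

lemma hform_mult:
  assumes \<phi>: "comm_ring_hom \<phi>" and f: "tdeg d f" and g: "tdeg e g"
  shows "hform (d + e) \<phi> (f * g) x = hform d \<phi> f x * hform e \<phi> g x"
proof -
  interpret comm_ring_hom \<phi> by fact
  have "hform (d + e) \<phi> ((\<Sum>z\<in>tri d. cc (cf f (fst z) (snd z)) * (vX ^ fst z * vY ^ snd z)) * 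
      (\<Sum>z\<in>tri e. cc (cf g (fst z) (snd z)) * (vX ^ fst z * vY ^ snd z))) x = 
    (\<Sum>z\<in>tri d. \<Sum>z'\<in>tri e. hform (d + e) \<phi> (cc (cf f (fst z) (snd z) * cf g (fst z') (snd z')) * 
      (vX ^ (fst z + fst z') * vY ^ (snd z + snd z'))) x)"
    unfolding sum_product hform_add[OF \<phi>]
    by (intro sum.cong refl arg_cong[where f = "\<lambda>f. hform _ _ f _"])
      (simp add: power_add comm_ring_hom.axioms cc_def algebra_simps)
  also have "\<dots> = (\<Sum>z\<in>tri d. \<Sum>z'\<in>tri e. (\<phi> (cf f (fst z) (snd z)) * (x $ 1 ^ fst z * x $ 2 ^ snd z * x $ 3 ^ (d - (fst z + snd z)))) *
     (\<phi> (cf g (fst z') (snd z')) * (x $ 1 ^ fst z' * x $ 2 ^ snd z' * x $ 3 ^ (e - (fst z' + snd z')))))"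
  proof (intro sum.cong refl)
    fix z z' assume "z \<in> tri d" "z' \<in> tri e"
    then have le: "fst z + snd z \<le> d" "fst z' + snd z' \<le> e" by (auto simp: tri_def)
    then have eq: "d + e - (fst z + fst z' + (snd z + snd z')) = (d - (fst z + snd z)) + (e - (fst z' + snd z'))" by simp
    then show "hform (d + e) \<phi> (cc (cf f (fst z) (snd z) * cf g (fst z') (snd z')) * 
      (vX ^ (fst z + fst z') * vY ^ (snd z + snd z'))) x = 
      (\<phi> (cf f (fst z) (snd z)) * (x $ 1 ^ fst z * x $ 2 ^ snd z * x $ 3 ^ (d - (fst z + snd z)))) *
     (\<phi> (cf g (fst z') (snd z')) * (x $ 1 ^ fst z' * x $ 2 ^ snd z' * x $ 3 ^ (e - (fst z' + snd z'))))"
      by (subst hform_monomial[OF \<phi>], use le in linarith, unfold eq power_add)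
        (simp only: hom_mult mult_ac)
  qed
  also have "\<dots> = hform d \<phi> f x * hform e \<phi> g x"
    by (simp add: hform_def sum_product case_prod_unfold)
  finally show ?thesis
    using poly2_as_sum[OF f] poly2_as_sum[OF g] by (simp add: case_prod_unfold)
qed

section \<open>Taylor expansion, multiplicity and leading forms at a point\<close>

definition shift :: "'a \<Rightarrow> 'a \<Rightarrow> 'a::comm_ring_1 poly poly \<Rightarrow> 'a poly poly" where
  "shift a b f = ev2 cc (vX + cc a) (vY + cc b) f"

lemmas shift_simps = ev2_cc[of "vX + cc a" "vY + cc b" for a b, folded shift_def]

lemma ev2_shift:
  assumes "comm_ring_hom \<phi>"
  shows "ev2 \<phi> A B (shift a b f) = ev2 \<phi> (A + \<phi> a) (B + \<phi> b) f"
  unfolding shift_def hom_ev2[OF comm_ring_hom_cc comm_ring_hom_ev2[OF assms]]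
  by (simp add: ev2_simps[OF assms])

lemma tdeg_shift:
  assumes "tdeg d f" shows "tdeg d (shift a b f)"
proof -
  have "shift a b f = (\<Sum>(r, s)\<in>tri d. cc (cf f r s) * ((vX + cc a) ^ r * (vY + cc b) ^ s))"
    by (subst poly2_as_sum[OF assms]) (simp add: shift_simps case_prod_unfold)
  moreover have "tdeg d (cc (cf f r s) * ((vX + cc a) ^ r * (vY + cc b) ^ s))" if "r + s \<le> d" for r s
  proof -
    have "tdeg 1 (vX + cc a)" "tdeg 1 (vY + cc b)" using tdeg_basic(2,3)[of 0] by (auto simp: tdeg_basic)
    then have "tdeg (0 + (r * 1 + s * 1)) (cc (cf f r s) * ((vX + cc a) ^ r * (vY + cc b) ^ s))"
      by (intro tdeg_mult tdeg_power tdeg_basic)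
    then show ?thesis using that tdeg_mono by simp blast
  qed
  ultimately show ?thesis by (auto simp: tri_def case_prod_unfold intro!: tdeg_simps)
qed

definition mult_at :: "nat \<Rightarrow> 'a::comm_ring_1 \<times> 'a \<Rightarrow> 'a poly poly \<Rightarrow> bool" where
  "mult_at k p f \<longleftrightarrow> vord k (shift (fst p) (snd p) f)"

lemma mult_at_mult: "mult_at k p f \<Longrightarrow> mult_at l p g \<Longrightarrow> mult_at (k + l) p (f * g)"
  by (simp add: mult_at_def shift_simps vord_mult)

lemma mult_at_0 [simp]: "mult_at 0 p f" by (auto simp: mult_at_def)

lemma mult_at_mult_right: "mult_at k p f \<Longrightarrow> mult_at k p (f * g)"
  using mult_at_mult[of k p f 0 g] by simp

lemma mult_at_mult_left: "mult_at k p g \<Longrightarrow> mult_at k p (f * g)"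
  using mult_at_mult[of 0 p f k g] by simp

lemma mult_at_power: "mult_at k p f \<Longrightarrow> mult_at (n * k) p (f ^ n)"
  by (simp add: mult_at_def shift_simps vord_power)

lemma mult_at_add: "mult_at k p f \<Longrightarrow> mult_at k p g \<Longrightarrow> mult_at k p (f + g)"
  and mult_at_diff: "mult_at k p f \<Longrightarrow> mult_at k p g \<Longrightarrow> mult_at k p (f - g)"
  and mult_at_sum: "(\<And>x. x \<in> A \<Longrightarrow> mult_at k p (F x)) \<Longrightarrow> mult_at k p (sum F A)"
  by (auto simp: mult_at_def shift_simps)

lemma mult_at_mono: "mult_at k p f \<Longrightarrow> l \<le> k \<Longrightarrow> mult_at l p f"
  using vord_mono by (auto simp: mult_at_def)

lemma pt_0_0: "pt 0 0 f = cf f 0 0"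
  by (simp add: pt_eq cf_def poly_0_coeff_0)

lemma mult_at_1_iff: "mult_at 1 p f \<longleftrightarrow> pt (fst p) (snd p) f = 0"
proof -
  have "pt 0 0 (shift (fst p) (snd p) f) = pt (fst p) (snd p) f"
    by (simp add: ev2_shift)
  then show ?thesis by (auto simp: mult_at_def vord_def pt_0_0)
qed

text \<open>The equation of the tangent cone: the homogeneous part of degree \<open>k\<close> of the
  Taylor expansion at \<open>p\<close>, evaluated in the direction \<open>(S, T)\<close>.\<close>

definition lead_form :: "nat \<Rightarrow> 'a::comm_ring_1 \<times> 'a \<Rightarrow> ('a \<Rightarrow> 'b) \<Rightarrow> 'a poly poly \<Rightarrow> 'b::comm_ring_1 \<Rightarrow> 'b \<Rightarrow> 'b" where
  "lead_form k p \<phi> f S T = (\<Sum>r\<le>k. \<phi> (cf (shift (fst p) (snd p) f) r (k - r)) * (S ^ r * T ^ (k - r)))"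

lemma lead_form_scale: "lead_form k p \<phi> f (c * S) (c * T) = c ^ k * lead_form k p \<phi> f S T"
  unfolding lead_form_def sum_distrib_left
proof (rule sum.cong)
  fix r assume "r \<in> {..k}"
  then have "c ^ k = c ^ r * c ^ (k - r)" by (simp flip: power_add)
  then show "\<phi> (cf (shift (fst p) (snd p) f) r (k - r)) * ((c * S) ^ r * (c * T) ^ (k - r)) =
    c ^ k * (\<phi> (cf (shift (fst p) (snd p) f) r (k - r)) * (S ^ r * T ^ (k - r)))"
    by (simp add: power_mult_distrib mult_ac)
qed simp

text \<open>The substitution of a blow-up: \<open>t\<close> measures the distance from the point and
  \<open>(S, T)\<close> the direction. Taylor terms of order below \<open>k\<close> vanish, those of
  order \<open>k\<close> give the tangent cone, and all others carry one more factor
  \<open>t\<close>. The case \<open>t = vX\<close> produces the local equation after removal of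
  \<open>k\<close> exceptional curves.\<close>

lemma hform_at_point:
  assumes \<phi>: "comm_ring_hom \<phi>" and f: "tdeg d f" "mult_at k (a, b) f" and "k \<le> d"
  shows "\<exists>h. hform d \<phi> f (vector [z * \<phi> a + t * S, z * \<phi> b + t * T, z]) = 
    t ^ k * (z ^ (d - k) * lead_form k (a, b) \<phi> f S T + t * h)"
proof -
  interpret comm_ring_hom \<phi> by fact
  note e = ev2_simps[OF \<phi>]
  let ?g = "shift a b f"
  have g: "tdeg d ?g" by (rule tdeg_shift) fact
  have low: "cf ?g r s = 0" if "r + s < k" for r s using f(2) that by (simp add: mult_at_def vord_def)
  have "hform d \<phi> f (vector [z * \<phi> a + t * S, z * \<phi> b + t * T, z]) =
     hform d \<phi> ?g (vector [t * S, t * T, z])"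
  proof -
    text \<open>Both sides are polynomial in \<open>z\<close>, which need not be invertible, so the identity is first
      proved on monomials by homogenizing the binomial expansion.\<close>
    have X: "tdeg 1 (vX + cc a)" "tdeg 1 (vY + cc b)" using tdeg_basic(2,3)[of 0] by (auto simp: tdeg_basic)
    have hp: "hform (n * 1) \<phi> (h ^ n) x = hform 1 \<phi> h x ^ n" if "tdeg 1 h" for h n x
    proof (induction n)
      case 0
      show ?case using hform_monomial[OF \<phi>, of 0 0 0 1 x] by (simp add: cc_def)
    next
      case (Suc n)
      have "hform (1 + n * 1) \<phi> (h * h ^ n) x = hform 1 \<phi> h x * hform (n * 1) \<phi> (h ^ n) x"
        by (rule hform_mult[OF \<phi> that tdeg_power[OF that]])
      then show ?case using Suc by simp
    qed
    have lin: "hform 1 \<phi> (vX + cc c) x = x $ 1 + \<phi> c * x $ 3" "hform 1 \<phi> (vY + cc c) x = x $ 2 + \<phi> c * x $ 3" for c x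
      using hform_monomial[OF \<phi>, of 1 0 1 1 x] hform_monomial[OF \<phi>, of 0 1 1 1 x] hform_monomial[OF \<phi>, of 0 0 1 c x]
      by (simp_all add: hform_add[OF \<phi>])
    let ?x = "vector [t * S, t * T, z] :: 'b ^ 3" and ?y = "vector [z * \<phi> a + t * S, z * \<phi> b + t * T, z] :: 'b ^ 3"
    have "hform d \<phi> ?g ?x = (\<Sum>(r, s)\<in>tri d. hform d \<phi> (cc (cf f r s) * ((vX + cc a) ^ r * (vY + cc b) ^ s)) ?x)"
      by (subst poly2_as_sum[OF f(1)]) (simp add: shift_simps case_prod_unfold hform_add[OF \<phi>])
    also have "\<dots> = hform d \<phi> f ?y"
      unfolding hform_def[of d \<phi> f]
    proof (rule sum.cong)
      fix w assume w: "w \<in> tri d"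
      obtain r s where rs: "w = (r, s)" "r + s \<le> d" using w by (cases w) (auto simp: tri_def)
      have t: "tdeg (r * 1 + s * 1) ((vX + cc a) ^ r * (vY + cc b) ^ s)"
        by (intro tdeg_mult tdeg_power X)
      have "hform ((d - (r + s)) + (r * 1 + s * 1)) \<phi> (cc (cf f r s) * ((vX + cc a) ^ r * (vY + cc b) ^ s)) ?x =
        hform (d - (r + s)) \<phi> (cc (cf f r s)) ?x * (hform (r * 1) \<phi> ((vX + cc a) ^ r) ?x * hform (s * 1) \<phi> ((vY + cc b) ^ s) ?x)"
        by (simp only: hform_mult[OF \<phi> tdeg_basic(1) t] hform_mult[OF \<phi> tdeg_power[OF X(1)] tdeg_power[OF X(2)]])
      also have "\<dots> = (\<phi> (cf f r s) * z ^ (d - (r + s))) * ((t * S + \<phi> a * z) ^ r * (t * T + \<phi> b * z) ^ s)"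
        unfolding hp[OF X(1)] hp[OF X(2)] lin
        using hform_monomial[OF \<phi>, of 0 0 "d - (r + s)" "cf f r s" ?x] by simp
      finally show "(case w of (r, s) \<Rightarrow> hform d \<phi> (cc (cf f r s) * ((vX + cc a) ^ r * (vY + cc b) ^ s)) ?x) =
        (case w of (r, s) \<Rightarrow> \<phi> (cf f r s) * (?y $ 1 ^ r * ?y $ 2 ^ s * ?y $ 3 ^ (d - (r + s))))"
        using rs by (simp add: mult_ac add.commute)
    qed simp
    finally show ?thesis ..
  qed
  also have "\<dots> = (\<Sum>(r, s)\<in>tri d. \<phi> (cf ?g r s) * (t ^ (r + s) * (S ^ r * T ^ s * z ^ (d - (r + s)))))"
    unfolding hform_def by (simp add: power_mult_distrib power_add mult_ac case_prod_unfold)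
  also have "\<dots> = (\<Sum>(r, s)\<in>{(r, s). r + s = k}. \<phi> (cf ?g r s) * (t ^ (r + s) * (S ^ r * T ^ s * z ^ (d - (r + s))))) +
    (\<Sum>(r, s)\<in>{(r, s)\<in>tri d. k < r + s}. \<phi> (cf ?g r s) * (t ^ (r + s) * (S ^ r * T ^ s * z ^ (d - (r + s)))))"
    (is "sum ?F _ = sum ?F ?A + sum ?F ?B")
  proof -
    have "finite ?A" by (rule finite_subset[OF _ finite_tri[of k]]) (auto simp: tri_def)
    moreover have "finite ?B" by (rule finite_subset[OF _ finite_tri[of d]]) auto
    ultimately have "sum ?F ?A + sum ?F ?B = sum ?F (?A \<union> ?B)"
      by (intro sum.union_disjoint[symmetric]) auto
    also have "\<dots> = sum ?F (tri d)"
    proof (rule sum.mono_neutral_left)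
      show "?A \<union> ?B \<subseteq> tri d" using \<open>k \<le> d\<close> by (auto simp: tri_def)
      show "\<forall>w\<in>tri d - (?A \<union> ?B). ?F w = 0"
      proof
        fix w assume w: "w \<in> tri d - (?A \<union> ?B)"
        then have "fst w + snd w < k" by (cases w) auto
        then show "?F w = 0" using low by (cases w) auto
      qed
    qed simp
    finally show ?thesis ..
  qed
  also have "sum ?F ?A = t ^ k * (z ^ (d - k) * lead_form k (a, b) \<phi> f S T)"
  proof -
    have "sum ?F ?A = (\<Sum>r\<le>k. ?F (r, k - r))"
      by (rule sum.reindex_bij_witness[of _ "\<lambda>r. (r, k - r)" fst]) auto
    then show ?thesis by (simp add: lead_form_def sum_distrib_left mult_ac)
  qed
  also have "sum ?F ?B = t ^ k * (t * (\<Sum>(r, s)\<in>?B. \<phi> (cf ?g r s) * (t ^ (r + s - Suc k) * (S ^ r * T ^ s * z ^ (d - (r + s))))))"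
    unfolding sum_distrib_left
  proof (rule sum.cong)
    fix w assume w: "w \<in> ?B"
    obtain r s where rs: "w = (r, s)" "k < r + s" using w by (cases w) auto
    then have "t ^ (r + s) = t ^ k * (t * t ^ (r + s - Suc k))"
      by (metis Suc_leI le_add_diff_inverse power_Suc power_add mult.assoc power_Suc2)
    then show "?F w = t ^ k * (t * (case w of (r, s) \<Rightarrow> \<phi> (cf ?g r s) * (t ^ (r + s - Suc k) * (S ^ r * T ^ s * z ^ (d - (r + s))))))"
      using rs by (simp add: mult_ac)
  qed simp
  finally show ?thesis unfolding distrib_left[symmetric] by (rule exI)
qed

section \<open>Local parameters in a chart\<close>

lemma cc_arith: "cc (a + b) = cc a + cc b" "cc (a * b) = cc a * cc b" "cc (a - b) = cc a - cc b"
  by (simp_all add: cc_def)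

lemma point_ideal:
  assumes "pt a b A = 0"
  shows "\<exists>A1 A2. A = (vX - cc a) * A1 + (vY - cc b) * A2"
proof -
  have "\<exists>A1 A2. A - cc (pt a b A) = (vX - cc a) * A1 + (vY - cc b) * A2"
  proof (induction A rule: poly2_induct)
    case (const c)
    show ?case by (rule exI[of _ 0], rule exI[of _ 0]) (simp add: ev2_id)
  next
    case X
    show ?case by (rule exI[of _ 1], rule exI[of _ 0]) (simp add: ev2_id)
  next
    case Y
    show ?case by (rule exI[of _ 0], rule exI[of _ 1]) (simp add: ev2_id)
  next
    case (add f g)
    then obtain f1 f2 g1 g2 where fg: "f - cc (pt a b f) = (vX - cc a) * f1 + (vY - cc b) * f2"
      "g - cc (pt a b g) = (vX - cc a) * g1 + (vY - cc b) * g2" by blast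
    have "f + g - cc (pt a b (f + g)) = (f - cc (pt a b f)) + (g - cc (pt a b g))"
      by (simp add: ev2_id cc_arith)
    also have "\<dots> = (vX - cc a) * (f1 + g1) + (vY - cc b) * (f2 + g2)"
      unfolding fg by (simp add: algebra_simps)
    finally show ?case by blast
  next
    case (mult f g)
    then obtain f1 f2 g1 g2 where fg: "f - cc (pt a b f) = (vX - cc a) * f1 + (vY - cc b) * f2"
      "g - cc (pt a b g) = (vX - cc a) * g1 + (vY - cc b) * g2" by blast
    have "f * g - cc (pt a b (f * g)) = (f - cc (pt a b f)) * g + cc (pt a b f) * (g - cc (pt a b g))"
      by (simp add: ev2_id cc_arith algebra_simps)
    also have "\<dots> = (vX - cc a) * (f1 * g + cc (pt a b f) * g1) + (vY - cc b) * (f2 * g + cc (pt a b f) * g2)"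
      unfolding fg by (simp add: algebra_simps)
    finally show ?case by blast
  qed
  then show ?thesis using assms by simp
qed

section \<open>The local ring at a closed point of a chart, and its local parameters\<close>

context chart
begin

context
  fixes a b assumes dom: "dom a b"
begin

definition "Oring = {ev A / ev B | A B. pt a b B \<noteq> 0}"
definition "Oideal = {ev A / ev B | A B. pt a b A = 0 \<and> pt a b B \<noteq> 0}"

lemma pt_nonzero: "pt a b B \<noteq> 0 \<Longrightarrow> B \<noteq> 0" by (auto simp: ev2_id)

lemma Oring_add: "f \<in> Oring \<Longrightarrow> g \<in> Oring \<Longrightarrow> f + g \<in> Oring"
  and Oring_mult: "f \<in> Oring \<Longrightarrow> g \<in> Oring \<Longrightarrow> f * g \<in> Oring"
proof -
  assume "f \<in> Oring" "g \<in> Oring"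
  then obtain A B A' B' where *: "f = ev A / ev B" "pt a b B \<noteq> 0" "g = ev A' / ev B'" "pt a b B' \<noteq> 0"
    by (auto simp: Oring_def)
  then have "f + g = ev (A * B' + A' * B) / ev (B * B')" "f * g = ev (A * A') / ev (B * B')" "pt a b (B * B') \<noteq> 0"
    using pt_nonzero by (simp_all add: ev_simps ev2_id add_frac_eq)
  then show "f + g \<in> Oring" "f * g \<in> Oring" unfolding Oring_def by blast+
qed

lemma Oideal_add: 
  assumes "f \<in> Oideal" "g \<in> Oideal" shows "f + g \<in> Oideal"
proof -
  obtain A B A' B' where *: "f = ev A / ev B" "pt a b A = 0" "pt a b B \<noteq> 0" 
    "g = ev A' / ev B'" "pt a b A' = 0" "pt a b B' \<noteq> 0"
    using assms by (auto simp: Oideal_def)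
  then have "f + g = ev (A * B' + A' * B) / ev (B * B')" "pt a b (A * B' + A' * B) = 0" "pt a b (B * B') \<noteq> 0"
    using pt_nonzero by (simp_all add: ev_simps ev2_id add_frac_eq)
  then show "f + g \<in> Oideal" unfolding Oideal_def by blast
qed

lemma Oideal_mult: 
  assumes "f \<in> Oideal" "g \<in> Oring" shows "f * g \<in> Oideal" "g * f \<in> Oideal"
proof -
  obtain A B A' B' where *: "f = ev A / ev B" "pt a b A = 0" "pt a b B \<noteq> 0" 
    "g = ev A' / ev B'" "pt a b B' \<noteq> 0"
    using assms by (auto simp: Oideal_def Oring_def)
  then have "f * g = ev (A * A') / ev (B * B')" "pt a b (A * A') = 0" "pt a b (B * B') \<noteq> 0"
    by (simp_all add: ev_simps ev2_id)
  then show "f * g \<in> Oideal" unfolding Oideal_def by blast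
  then show "g * f \<in> Oideal" by (simp add: mult.commute)
qed

lemma Oring_unit_iff:
  assumes "pt a b B \<noteq> 0"
  shows "ev A / ev B \<in> units_in Oring \<longleftrightarrow> pt a b A \<noteq> 0"
proof
  assume "ev A / ev B \<in> units_in Oring"
  then obtain C D where CD: "inverse (ev A / ev B) = ev C / ev D" "pt a b D \<noteq> 0" "A \<noteq> 0"
    by (auto simp: units_in_def Oring_def)
  have "B \<noteq> 0" "D \<noteq> 0" using assms CD pt_nonzero by blast+
  then have "ev (B * D) = ev (C * A)" using CD by (simp add: ev_simps field_simps)
  then have "B * D = C * A" by simp
  then have "pt a b B * pt a b D = pt a b C * pt a b A" by (metis ev2_id(5))
  then show "pt a b A \<noteq> 0" using assms CD by auto
next
  assume "pt a b A \<noteq> 0"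
  then have "A \<noteq> 0" "B \<noteq> 0" using assms pt_nonzero by blast+
  then show "ev A / ev B \<in> units_in Oring"
    unfolding units_in_def Oring_def using assms \<open>pt a b A \<noteq> 0\<close> by auto
qed

lemma Oring_nonideal_unit: "f \<in> Oring \<Longrightarrow> f \<notin> Oideal \<Longrightarrow> f \<in> units_in Oring"
  using Oring_unit_iff by (auto simp: Oring_def Oideal_def)

lemma maximal_Oring: "maximal_ideal_of Oring = Oideal"
  unfolding maximal_ideal_of_def
proof (intro equalityI subsetI)
  fix f assume "f \<in> Oring - units_in Oring"
  then show "f \<in> Oideal" using Oring_nonideal_unit by blast
next
  fix f assume "f \<in> Oideal"
  then obtain A B where "f = ev A / ev B" "pt a b A = 0" "pt a b B \<noteq> 0" by (auto simp: Oideal_def)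
  then show "f \<in> Oring - units_in Oring" using Oring_unit_iff[of B A] by (auto simp: Oring_def)
qed

lemma one_notin_Oideal: "1 \<notin> Oideal"
proof
  assume "1 \<in> Oideal"
  then have "1 \<in> Oring - units_in Oring" using maximal_Oring by (simp add: maximal_ideal_of_def)
  then show False by (auto simp: units_in_def)
qed

lemma local_ring_Oring: "local_ring ps (\<sigma> a b) = Oring"
  using local_ring_\<sigma>[OF dom] by (simp add: Oring_def)

lemma ev_in_Oring: "ev A \<in> Oring"
proof -
  have "ev A = ev A / ev 1" "pt a b 1 \<noteq> 0" by (simp_all add: ev_simps ev2_id)
  then show ?thesis unfolding Oring_def by blast
qed

lemma ev_in_Oideal: "pt a b A = 0 \<Longrightarrow> ev A \<in> Oideal"
proof -
  assume "pt a b A = 0"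
  moreover have "ev A = ev A / ev 1" "pt a b 1 \<noteq> 0" by (simp_all add: ev_simps ev2_id)
  ultimately show ?thesis unfolding Oideal_def by blast
qed

lemma chart_local_parameters:
  "local_parameters ps (\<sigma> a b) (u - rf_const a) (v - rf_const b)"
proof -
  have uv: "u - rf_const a = ev (vX - cc a)" "v - rf_const b = ev (vY - cc b)" by (simp_all add: ev_simps)
  have "Oideal = {g * (u - rf_const a) + h * (v - rf_const b) |g h. g \<in> Oring \<and> h \<in> Oring}"
  proof (intro equalityI subsetI)
    fix f assume "f \<in> Oideal"
    then obtain A B where AB: "f = ev A / ev B" "pt a b A = 0" "pt a b B \<noteq> 0" by (auto simp: Oideal_def)
    obtain A1 A2 where "A = (vX - cc a) * A1 + (vY - cc b) * A2" using point_ideal[OF AB(2)] by blast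
    then have "f = (ev A1 / ev B) * (u - rf_const a) + (ev A2 / ev B) * (v - rf_const b)"
      unfolding uv AB(1) by (simp add: ev_simps add_divide_distrib mult.commute)
    moreover have "ev A1 / ev B \<in> Oring" "ev A2 / ev B \<in> Oring" using AB(3) by (auto simp: Oring_def)
    ultimately show "f \<in> {g * (u - rf_const a) + h * (v - rf_const b) |g h. g \<in> Oring \<and> h \<in> Oring}" by blast
  next
    fix f assume "f \<in> {g * (u - rf_const a) + h * (v - rf_const b) |g h. g \<in> Oring \<and> h \<in> Oring}"
    moreover have "ev (vX - cc a) \<in> Oideal" "ev (vY - cc b) \<in> Oideal"
      by (auto simp: ev2_id intro!: ev_in_Oideal)
    ultimately show "f \<in> Oideal" unfolding uv using Oideal_mult Oideal_add by auto
  qed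
  then show ?thesis
    unfolding local_parameters_def local_ring_Oring maximal_Oring unfolding uv using ev_in_Oring by simp
qed

text \<open>By the chain rule the derivatives of a regular function are combinations of those of
  \<open>u\<close> and \<open>v\<close> with regular coefficients.\<close>

lemma jacobian_in_Oring:
  assumes "f \<in> Oring" "g \<in> Oring"
  shows "jacobian f g / jacobian u v \<in> Oring"
proof -
  have "\<exists>f1\<in>Oring. \<exists>f2\<in>Oring. deriv_x f = f1 * deriv_x u + f2 * deriv_x v \<and> deriv_y f = f1 * deriv_y u + f2 * deriv_y v"
    if fO: "f \<in> Oring" for f
  proof -
    obtain A B where AB: "f = ev A / ev B" "pt a b B \<noteq> 0" using fO by (auto simp: Oring_def)
    have B: "ev B \<noteq> 0" using AB pt_nonzero by simp
    let ?x = "map_poly pderiv" and ?y = "pderiv"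
    define f1 where "f1 = ev (?x A * B - A * ?x B) / ev (B * B)"
    define f2 where "f2 = ev (?y A * B - A * ?y B) / ev (B * B)"
    have "pt a b (B * B) \<noteq> 0" using AB by (simp add: ev2_id)
    then have "f1 \<in> Oring" "f2 \<in> Oring" unfolding f1_def f2_def Oring_def by blast+
    moreover have "D f = f1 * D u + f2 * D v" if D: "derivation D" "\<And>c. D (rf_const c) = 0" for D
      unfolding AB(1) derivation_divide[OF D(1) B] derivation_ev2[OF D rf_hom] f1_def f2_def
      using B by (simp add: ev_simps field_simps power2_eq_square)
    ultimately show ?thesis
      using derivation_deriv_x derivation_deriv_y deriv_simps(1,2) by blast
  qed
  from this[OF assms(1)] this[OF assms(2)] obtain f1 f2 g1 g2 where
    fg: "f1 \<in> Oring" "f2 \<in> Oring" "deriv_x f = f1 * deriv_x u + f2 * deriv_x v" "deriv_y f = f1 * deriv_y u + f2 * deriv_y v"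
    "g1 \<in> Oring" "g2 \<in> Oring" "deriv_x g = g1 * deriv_x u + g2 * deriv_x v" "deriv_y g = g1 * deriv_y u + g2 * deriv_y v"
    by blast
  have "jacobian f g = (f1 * g2 + ev (- 1) * (f2 * g1)) * jacobian u v"
    unfolding jacobian_def fg by (simp add: ev_simps algebra_simps)
  then have "jacobian f g / jacobian u v = f1 * g2 + ev (- 1) * (f2 * g1)" using jac by simp
  then show ?thesis using fg by (auto intro!: Oring_add Oring_mult ev_in_Oring)
qed

text \<open>Write \<open>u\<close> and \<open>v\<close>, up to constants, as combinations of
  \<open>u'\<close> and \<open>v'\<close> and expand the Jacobian of the pair. Modulo the maximal
  ideal only multiples of \<open>J u' v'\<close> survive. The total is 1, so \<open>J u' v'\<close>
  is not in the maximal ideal. Hence the canonical sheaf has the same generator for all local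
  parameters.\<close>

lemma jacobian_local_parameters:
  assumes "local_parameters ps (\<sigma> a b) u' v'"
  shows "jacobian u' v' / jacobian u v \<in> units_in (local_ring ps (\<sigma> a b))"
proof -
  have *: "u' \<in> Oring" "v' \<in> Oring" "Oideal = {g * u' + h * v' |g h. g \<in> Oring \<and> h \<in> Oring}"
    using assms unfolding local_parameters_def local_ring_Oring maximal_Oring by blast+
  define J where "J f g = jacobian f g / jacobian u v" for f g
  have JO: "J f g \<in> Oring" if "f \<in> Oring" "g \<in> Oring" for f g
    unfolding J_def using jacobian_in_Oring that by blast
  have zero_one: "0 \<in> Oring" "1 \<in> Oring" using ev_in_Oring[of 0] ev_in_Oring[of 1] by (simp_all add: ev_simps)
  have "1 * u' + 0 * v' \<in> Oideal" "0 * u' + 1 * v' \<in> Oideal" unfolding *(3) using zero_one by blast+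
  then have uv': "u' \<in> Oideal" "v' \<in> Oideal" by simp_all
  have "u - rf_const a \<in> Oideal" "v - rf_const b \<in> Oideal"
    using ev_in_Oideal[of "vX - cc a"] ev_in_Oideal[of "vY - cc b"] by (auto simp: ev2_id ev_simps)
  then obtain \<alpha> \<beta> \<gamma> \<epsilon> where co: "\<alpha> \<in> Oring" "\<beta> \<in> Oring" "\<gamma> \<in> Oring" "\<epsilon> \<in> Oring"
    "u - rf_const a = \<alpha> * u' + \<beta> * v'" "v - rf_const b = \<gamma> * u' + \<epsilon> * v'"
    unfolding *(3) by blast
  define w where "w = \<gamma> * u' + \<epsilon> * v'"
  have w: "w \<in> Oring" unfolding w_def using co * by (auto intro!: Oring_add Oring_mult)
  have "jacobian (u - rf_const a) (v - rf_const b) = jacobian u v"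
  proof -
    have eq: "u - rf_const a = u + rf_const (- a)" "v - rf_const b = v + rf_const (- b)" by (simp_all add: rf_const_arith)
    show ?thesis unfolding eq jacobian_add_left jacobian_add_right by simp
  qed
  then have "J (\<alpha> * u' + \<beta> * v') w = 1" using jac co by (simp add: J_def w_def)
  moreover have "J (\<alpha> * u' + \<beta> * v') w = \<alpha> * J u' w + u' * J \<alpha> w + \<beta> * J v' w + v' * J \<beta> w"
    by (simp add: J_def jacobian_add_left jacobian_mult_left add_divide_distrib)
  moreover have "J u' w = u' * J u' \<gamma> + \<epsilon> * J u' v' + v' * J u' \<epsilon>"
    by (simp add: J_def w_def jacobian_add_right jacobian_mult_right add_divide_distrib)
  moreover have "J v' w = u' * J v' \<gamma> + \<gamma> * (ev (- 1) * J u' v') + v' * J v' \<epsilon>"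
    using jacobian_swap[of v' u']
    by (simp add: J_def w_def jacobian_add_right jacobian_mult_right add_divide_distrib diff_divide_distrib ev_simps)
  ultimately have one: "1 = \<alpha> * (u' * J u' \<gamma> + \<epsilon> * J u' v' + v' * J u' \<epsilon>) + u' * J \<alpha> w +
      \<beta> * (u' * J v' \<gamma> + \<gamma> * (ev (- 1) * J u' v') + v' * J v' \<epsilon>) + v' * J \<beta> w" by simp
  have "J u' v' \<notin> Oideal"
  proof
    assume JI: "J u' v' \<in> Oideal"
    have "1 \<in> Oideal" unfolding one
      using uv' JI co w * by (intro Oideal_add Oideal_mult JO ev_in_Oring)
    then show False using one_notin_Oideal by blast
  qed
  then show ?thesis
    unfolding local_ring_Oring J_def[symmetric] using Oring_nonideal_unit JO * by blast
qed

end

lemma finite_components: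
  assumes "h \<noteq> 0"
  shows "finite {Z \<pi> |\<pi>. irreducible \<pi> \<and> \<pi> dvd h}"
proof (cases "h dvd 1")
  case True
  have "\<not> \<pi> dvd h" if "irreducible \<pi>" for \<pi>
    using that True dvd_trans unfolding irreducible_def by blast
  then have "{Z \<pi> |\<pi>. irreducible \<pi> \<and> \<pi> dvd h} = {}" by blast
  then show ?thesis by (simp only: finite.emptyI)
next
  case False
  then obtain M where M: "mset_factors M h" using mset_factors_exist assms by blast
  have "Z \<pi> \<in> Z ` set_mset M" if \<pi>: "irreducible \<pi>" "\<pi> dvd h" for \<pi>
  proof -
    have "\<pi> dvd prod_mset M" using \<pi>(2) mset_factorsD(3)[OF M] by simp
    then obtain x where "x \<in># M" "\<pi> dvd x"
      using prime_elem_dvd_prod_mset[OF irreducible_imp_prime2[OF \<pi>(1)]] by blast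
    then show ?thesis using Z_assoc[OF \<pi>(1)] mset_factorsD(1)[OF M] by blast
  qed
  then have "{Z \<pi> |\<pi>. irreducible \<pi> \<and> \<pi> dvd h} \<subseteq> Z ` set_mset M" by blast
  then show ?thesis using finite_subset by blast
qed

lemma \<sigma>_Z_iff:
  assumes "dom a b"
  shows "\<sigma> a b \<in> Z \<pi> \<longleftrightarrow> pt a b \<pi> = 0"
proof
  assume "\<sigma> a b \<in> Z \<pi>"
  obtain F G e where F: "form e F" "form e G" "sub F = \<pi> * sub G" 
      "\<And>a b. dom a b \<Longrightarrow> pt a b (sub G) \<noteq> 0" using homogenize[of \<pi>] by blast
  have "val F (\<sigma> a b) = 0" using \<open>\<sigma> a b \<in> Z \<pi>\<close> F(1,3) by (auto simp: Z_def)
  then show "pt a b \<pi> = 0" using val_\<sigma>[OF assms F(1)] F assms by (simp add: ev2_id)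
qed (rule Z_\<sigma>[OF assms])

end

lemma irreducible_vX: "irreducible (vX :: 'a::field poly poly)"
proof -
  have "irreducible ([:0, 1:] :: 'a poly)" by (rule irreducible_linear_field_poly) simp
  then show ?thesis by (simp add: vX_def irreducible_const_poly_iff del: pCons_one)
qed

section \<open>The atlas of the blow-up\<close>

abbreviation e1 :: "'a::comm_ring_1 ^ 3" where "e1 \<equiv> vector [1, 0, 0]"
abbreviation e2 :: "'a::comm_ring_1 ^ 3" where "e2 \<equiv> vector [0, 1, 0]"
abbreviation e3 :: "'a::comm_ring_1 ^ 3" where "e3 \<equiv> vector [0, 0, 1]"

type_synonym 'a frame_data = "nat \<times> ('a^3) \<times> ('a^3) \<times> ('a^3) \<times> ('a^3) \<times> ('a^3) \<times> ('a^3)"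

definition plane_frames :: "nat \<Rightarrow> 'a::field frame_data set" where
  "plane_frames n = {(n, e3, e1, e2, e3, e1, e2), (n, e1, e2, e3, e1, e2, e3), (n, e2, e3, e1, e2, e3, e1)}"

text \<open>The axes are the directions \<open>e1\<close> and \<open>e2\<close> at infinity; the two
  orders cover the slopes other than infinity and other than 0. The divisions by
  \<open>p $ 3\<close> require the centre to lie in the affine part.\<close>

definition point_frames :: "nat \<Rightarrow> 'a::field ^ 3 \<Rightarrow> 'a frame_data set" where
  "point_frames i p =
    {(i, p, e1, e2, vector [0, 0, 1 / p$3], vector [1, 0, - p$1 / p$3], vector [0, 1, - p$2 / p$3]),
     (i, p, e2, e1, vector [0, 0, 1 / p$3], vector [0, 1, - p$2 / p$3], vector [1, 0, - p$1 / p$3])}"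

definition atlas :: "'a::field proj2 list \<Rightarrow> 'a frame_data set" where
  "atlas ps = plane_frames (length ps) \<union> (\<Union>i<length ps. point_frames i (rep_proj2 (ps ! i)))"

lemma finite_atlas: "finite (atlas ps)"
  by (auto simp: atlas_def plane_frames_def point_frames_def)

definition aff :: "'a::field proj2 \<Rightarrow> 'a \<times> 'a" where
  "aff p = (rep_proj2 p $ 1 / rep_proj2 p $ 3, rep_proj2 p $ 2 / rep_proj2 p $ 3)"

text \<open>Staying away from the line at infinity is an open condition on the points and gives
  every centre affine coordinates.\<close>

locale affine_points =
  fixes ps :: "'a::{alg_closed_field, field_char_0} proj2 list"
  assumes distinct: "distinct ps" and finite_part: "i < length ps \<Longrightarrow> rep_proj2 (ps ! i) $ 3 \<noteq> 0"
begin

lemma frame_plane: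
  "frame ps (length ps) e3 e1 e2 e3 e1 e2" "frame ps (length ps) e1 e2 e3 e1 e2 e3"
  "frame ps (length ps) e2 e3 e1 e2 e3 e1"
proof -
  have "\<forall>i j::3. (e3 $ i * e3 $ j + e1 $ i * e1 $ j + e2 $ i * e2 $ j :: 'a) = (if i = j then 1 else 0)"
    "\<forall>i j::3. (e1 $ i * e1 $ j + e2 $ i * e2 $ j + e3 $ i * e3 $ j :: 'a) = (if i = j then 1 else 0)"
    "\<forall>i j::3. (e2 $ i * e2 $ j + e3 $ i * e3 $ j + e1 $ i * e1 $ j :: 'a) = (if i = j then 1 else 0)"
    by (simp_all add: forall_3)
  then show "frame ps (length ps) e3 e1 e2 e3 e1 e2" "frame ps (length ps) e1 e2 e3 e1 e2 e3"
    "frame ps (length ps) e2 e3 e1 e2 e3 e1"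
    by (simp_all add: frame_def dot3_expand cross_nth)
qed

lemma frame_point:
  assumes i: "i < length ps"
  defines "p \<equiv> rep_proj2 (ps ! i)"
  shows "frame ps i p e1 e2 (vector [0, 0, 1 / p$3]) (vector [1, 0, - p$1 / p$3]) (vector [0, 1, - p$2 / p$3])"
    "frame ps i p e2 e1 (vector [0, 0, 1 / p$3]) (vector [0, 1, - p$2 / p$3]) (vector [1, 0, - p$1 / p$3])"
proof -
  have p3: "p $ 3 \<noteq> 0" using finite_part[OF i] by (simp add: p_def)
  let ?m0 = "vector [0, 0, 1 / p$3] :: 'a ^ 3" and ?m1 = "vector [1, 0, - p$1 / p$3] :: 'a ^ 3" and ?m2 = "vector [0, 1, - p$2 / p$3] :: 'a ^ 3"
  have "\<forall>i j. p $ i * ?m0 $ j + e1 $ i * ?m1 $ j + e2 $ i * ?m2 $ j = (if i = j then 1 else 0)"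
    "\<forall>i j. p $ i * ?m0 $ j + e2 $ i * ?m2 $ j + e1 $ i * ?m1 $ j = (if i = j then 1 else 0)"
    using p3 by (simp_all add: forall_3)
  then show "frame ps i p e1 e2 ?m0 ?m1 ?m2" "frame ps i p e2 e1 ?m0 ?m2 ?m1"
    using p3 by (simp_all add: frame_def dot3_expand cross_nth p_def)
qed

lemma atlas_frame:
  assumes "(i0, q0, q1, q2, n0, n1, n2) \<in> atlas ps"
  shows "frame ps i0 q0 q1 q2 n0 n1 n2"
  using assms frame_plane frame_point by (auto simp: atlas_def plane_frames_def point_frames_def)

lemma cross_distinct:
  assumes "i < length ps" "j < length ps" "i \<noteq> j"
  shows "cross (rep_proj2 (ps ! i)) (rep_proj2 (ps ! j)) \<noteq> 0"
  using assms distinct by (simp add: cross_rep_eq_0_iff nth_eq_iff_index_eq)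

text \<open>Over a centre the line through it misses \<open>e1\<close> or \<open>e2\<close>, for
  otherwise incidence with the centre would make all its coordinates zero; this selects one of the
  two slope charts. Away from the centres a nonzero coordinate selects a standard chart of the
  plane.\<close>

lemma atlas_covers_ex:
  assumes P: "P \<in> blowup ps"
  shows "\<exists>i0 q0 q1 q2 n0 n1 n2 a b. (i0, q0, q1, q2, n0, n1, n2) \<in> atlas ps \<and>
    chart_dom (frame.ws ps i0 q0 q1 q2) a b \<and> P = chart_pt (frame.ws ps i0 q0 q1 q2) a b"
proof -
  obtain x ls where xls: "P = x # ls" "length ls = length ps"
    "\<And>i. i < length ps \<Longrightarrow> incident (ps ! i) (ls ! i) \<and> incident x (ls ! i)"
    using P by (auto simp: blowup_def)
  have atl: "\<exists>i0 q0 q1 q2 n0 n1 n2 a b. (i0, q0, q1, q2, n0, n1, n2) \<in> atlas ps \<and>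
    chart_dom (frame.ws ps i0 q0 q1 q2) a b \<and> P = chart_pt (frame.ws ps i0 q0 q1 q2) a b"
    if "(i0, q0, q1, q2, n0, n1, n2) \<in> atlas ps" "dot3 n0 (rep_proj2 x) \<noteq> 0"
      "\<And>i. i < length ps \<Longrightarrow> i \<noteq> i0 \<Longrightarrow> cross (rep_proj2 (ps ! i)) (rep_proj2 x) \<noteq> 0"
      "i0 < length ps \<Longrightarrow> dot3 (rep_proj2 (ls ! i0)) q2 \<noteq> 0" for i0 q0 q1 q2 n0 n1 n2
    using frame.chart_surj[OF atlas_frame[OF that(1)] P] that xls by fastforce
  show ?thesis
  proof (cases "x \<in> set ps")
    case True
    then obtain i where i: "i < length ps" "x = ps ! i" by (auto simp: in_set_conv_nth)
    let ?p = "rep_proj2 (ps ! i)" and ?l = "rep_proj2 (ls ! i)"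
    have p3: "?p $ 3 \<noteq> 0" by (rule finite_part[OF i(1)])
    have lp: "?l $ 1 * ?p $ 1 + ?l $ 2 * ?p $ 2 + ?l $ 3 * ?p $ 3 = 0"
      using xls(3)[OF i(1)] by (simp add: incident_iff dot3_expand)
    have "?l $ 1 \<noteq> 0 \<or> ?l $ 2 \<noteq> 0"
    proof (rule ccontr)
      assume "\<not> ?thesis"
      then have "?l = 0" using lp p3 by (simp add: vec3_simps)
      then show False by simp
    qed
    then have *: "dot3 ?l e2 \<noteq> 0 \<or> dot3 ?l e1 \<noteq> 0" by (auto simp: dot3_expand)
    have fr: "point_frames i ?p \<subseteq> atlas ps" using i by (auto simp: atlas_def)
    have c: "\<And>j. j < length ps \<Longrightarrow> j \<noteq> i \<Longrightarrow> cross (rep_proj2 (ps ! j)) (rep_proj2 x) \<noteq> 0"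
      using cross_distinct i by simp
    have d: "dot3 (vector [0, 0, 1 / ?p$3]) (rep_proj2 x) \<noteq> 0" using p3 i by (simp add: dot3_expand)
    from * show ?thesis
    proof
      assume "dot3 ?l e2 \<noteq> 0"
      moreover have "(i, ?p, e1, e2, vector [0, 0, 1 / ?p$3], vector [1, 0, - ?p$1 / ?p$3], vector [0, 1, - ?p$2 / ?p$3]) \<in> atlas ps"
        using fr by (auto simp: point_frames_def)
      ultimately show ?thesis using atl[OF _ d c] by blast
    next
      assume "dot3 ?l e1 \<noteq> 0"
      moreover have "(i, ?p, e2, e1, vector [0, 0, 1 / ?p$3], vector [0, 1, - ?p$2 / ?p$3], vector [1, 0, - ?p$1 / ?p$3]) \<in> atlas ps"
        using fr by (auto simp: point_frames_def)
      ultimately show ?thesis using atl[OF _ d c] by blast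
    qed
  next
    case False
    have c: "\<And>j. j < length ps \<Longrightarrow> j \<noteq> length ps \<Longrightarrow> cross (rep_proj2 (ps ! j)) (rep_proj2 x) \<noteq> 0"
      using False by (auto simp: cross_rep_eq_0_iff)
    have "rep_proj2 x $ 1 \<noteq> 0 \<or> rep_proj2 x $ 2 \<noteq> 0 \<or> rep_proj2 x $ 3 \<noteq> 0"
      using rep_proj2_nonzero[of x] by (auto simp: vec3_simps)
    then have "dot3 e1 (rep_proj2 x) \<noteq> 0 \<or> dot3 e2 (rep_proj2 x) \<noteq> 0 \<or> dot3 e3 (rep_proj2 x) \<noteq> 0"
      by (simp add: dot3_expand)
    moreover have "plane_frames (length ps) \<subseteq> atlas ps" by (simp add: atlas_def)
    then have "(length ps, e3, e1, e2, e3, e1, e2) \<in> atlas ps" "(length ps, e1, e2, e3, e1, e2, e3) \<in> atlas ps"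
      "(length ps, e2, e3, e1, e2, e3, e1) \<in> atlas ps" by (auto simp: plane_frames_def)
    ultimately show ?thesis using atl[OF _ _ c] by blast
  qed
qed

lemma atlas_covers:
  assumes "P \<in> blowup ps"
  obtains i0 q0 q1 q2 n0 n1 n2 a b where "(i0, q0, q1, q2, n0, n1, n2) \<in> atlas ps"
    "chart_dom (frame.ws ps i0 q0 q1 q2) a b" "P = chart_pt (frame.ws ps i0 q0 q1 q2) a b"
  using atlas_covers_ex[OF assms] by (elim exE conjE) (rule that)

lemma dense_in_blowup:
  assumes "P \<in> blowup ps" and F: "multihomogeneous (Suc (length ps)) e F"
    and "eval_mpoly rf_const F (blowup_generic_point ps) = 0"
  shows "val F P = 0"
proof -
  obtain i0 q0 q1 q2 n0 n1 n2 a b where at: "(i0, q0, q1, q2, n0, n1, n2) \<in> atlas ps"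
    "chart_dom (frame.ws ps i0 q0 q1 q2) a b" "P = chart_pt (frame.ws ps i0 q0 q1 q2) a b"
    by (rule atlas_covers[OF assms(1)])
  interpret frame ps i0 q0 q1 q2 n0 n1 n2 by (rule atlas_frame[OF at(1)])
  interpret pre_chart ps ws cu cv by (rule pre_chart)
  have F': "multihomogeneous (length ws) e F" using F by (simp add: length_ws)
  have "eval_mpoly cc F ws = 0" using gval_eq_0_iff[OF F'] assms(3) by blast
  then show ?thesis using val_\<sigma>[OF at(2) F'] at(3) by (simp add: ev2_id)
qed

lemma frame_is_chart:
  assumes "frame ps i0 q0 q1 q2 n0 n1 n2"
  shows "chart ps (frame.ws ps i0 q0 q1 q2) (frame.cu n0 n1) (frame.cv ps i0 n0 n1 n2)"
proof -
  interpret frame ps i0 q0 q1 q2 n0 n1 n2 by fact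
  interpret pre_chart ps ws cu cv by (rule pre_chart)
  show ?thesis
    by unfold_locales (use dense_in_blowup in \<open>simp add: length_ws\<close>)
qed

lemma dvr_prime_divisor:
  assumes "prime_divisor ps C"
  shows "\<exists>t. dvr (local_ring_along ps C) t" and "\<exists>P. P \<in> C" and "C \<subseteq> blowup ps"
proof -
  show sub: "C \<subseteq> blowup ps" using assms by (auto simp: prime_divisor_def)
  show "\<exists>P. P \<in> C" using assms by (auto simp: prime_divisor_def irreducible_closedin_def)
  then obtain P where P: "P \<in> C" "P \<in> blowup ps" using sub by blast
  obtain i0 q0 q1 q2 n0 n1 n2 a b where at: "(i0, q0, q1, q2, n0, n1, n2) \<in> atlas ps"
    "chart_dom (frame.ws ps i0 q0 q1 q2) a b" "P = chart_pt (frame.ws ps i0 q0 q1 q2) a b"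
    by (rule atlas_covers[OF P(2)])
  interpret frame ps i0 q0 q1 q2 n0 n1 n2 by (rule atlas_frame[OF at(1)])
  interpret chart ps ws cu cv by (rule frame_is_chart) (rule frame_axioms)
  show "\<exists>t. dvr (local_ring_along ps C) t"
    by (rule dvr_along[OF assms at(2)]) (use P at in simp)
qed

text \<open>The quotient of two linear forms, each nonzero at some point of \<open>C\<close>, is a
  unit along \<open>C\<close>. The common order is minus the multiplicity of \<open>C\<close> in the
  pulled-back line at infinity, because \<open>lin\<close> is dehomogenized with respect to the last
  coordinate.\<close>

lemma ord_lin_eq:
  assumes C: "prime_divisor ps C" and P: "P \<in> C" "dot3 n (rep_proj2 (hd P)) \<noteq> 0"
    and P': "P' \<in> C" "dot3 n' (rep_proj2 (hd P')) \<noteq> 0"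
  shows "ord_along ps C (lin n) = ord_along ps C (lin n')"
proof -
  obtain t where "dvr (local_ring_along ps C) t" using dvr_prime_divisor[OF C] by blast
  then interpret dvr "local_ring_along ps C" t .
  have nz: "n \<noteq> 0" "n' \<noteq> 0" using P P' by (auto simp: dot3_expand)
  then have lnz: "lin n \<noteq> 0" "lin n' \<noteq> 0" using lin_nonzero by blast+
  have sub: "C \<subseteq> blowup ps" by (rule dvr_prime_divisor[OF C])
  have ratio: "lin m / lin m' \<in> local_ring_along ps C" if "P \<in> C" "dot3 m' (rep_proj2 (hd P)) \<noteq> 0" for P m m'
  proof -
    have ml: "multihomogeneous (Suc (length ps)) (unit_degree 0) (mlinear 0 k)" for k :: "'a ^ 3"
      by (rule multihomogeneous_mlinear) simp
    have g: "eval_mpoly rf_const (mlinear 0 k) (blowup_generic_point ps) = lin k" for k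
      by (simp add: eval_mlinear_dot3 lin_def blowup_generic_point_def)
    moreover have "val (mlinear 0 m') P \<noteq> 0"
      using that sub by (auto simp: eval_mlinear_dot3 blowup_def)
    ultimately have "lin m / lin m' \<in> local_ring ps P"
      unfolding local_ring_def mem_Collect_eq using ml
      by (intro exI[of _ "mlinear 0 m"] exI[of _ "mlinear 0 m'"] exI[of _ "unit_degree 0"]) simp
    then show ?thesis using that(1) by (auto simp: local_ring_along_def)
  qed
  have "lin n / lin n' \<in> units_in (local_ring_along ps C)"
    using ratio[OF P, of n'] ratio[OF P', of n] lnz by (simp add: units_in_def)
  then have "ord_along ps C (lin n / lin n') = 0" by (simp add: ord_along_eq ord_in_unit)
  then show ?thesis using ord_in_divide[OF lnz] by (simp add: ord_along_eq)
qed

text \<open>The chart contains every point of the exceptional curve but one, the direction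
  \<open>q2\<close>. The work lies in showing that the closure picks up this point.\<close>

lemma exceptional_vX:
  assumes "frame ps i0 q0 q1 q2 n0 n1 n2" "i0 < length ps"
  shows "chart.Z (frame.ws ps i0 q0 q1 q2) vX = exceptional_curve ps i0"
proof -
  interpret frame ps i0 q0 q1 q2 n0 n1 n2 by fact
  interpret chart ps ws cu cv by (rule frame_is_chart) fact
  have c0: "rep_proj2 (ps ! i0) = q0" by (rule centre) fact
  have w0: "w0 = vmap cc q0 + vX *s (vmap cc q1 + vY *s vmap cc q2)"
    using assms(2) by (simp add: w0_def Finite_Cartesian_Product.vec_eq_iff algebra_simps)
  have len': "length P = Suc (length ps)" if "P \<in> blowup ps" for P
    using that by (auto simp: blowup_def)
  show ?thesis
  proof (intro equalityI subsetI)
    fix P assume P: "P \<in> Z vX"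
    then have bl: "P \<in> blowup ps" using Z_subset_blowup by blast
    have "cross q0 (rep_proj2 (hd P)) $ m = 0" for m
    proof -
      let ?F = "mlinear 0 (cross_row q0 m)"
      have f: "form (unit_degree 0) ?F" by (rule multihomogeneous_mlinear) (simp add: length_ws)
      have row: "vmap cc (cross_row q0 m) = cross_row (vmap cc q0) m"
        using exhaust_3[of m]
        by (auto simp: Finite_Cartesian_Product.vec_eq_iff cross_row_def cross_nth axis_def cc_arith)
      have "sub ?F = cross (vmap cc q0) w0 $ m"
        by (simp add: eval_mlinear_dot3 nth_ws row dot3_cross_row)
      also have "\<dots> = vX * cross (vmap cc q0) (vmap cc q1 + vY *s vmap cc q2) $ m"
        unfolding w0 using exhaust_3[of m] by (auto simp: cross_nth algebra_simps)
      finally have "vX dvd sub ?F" by simp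
      then have "val ?F P = 0" using P f by (auto simp: Z_def)
      then show ?thesis using len'[OF bl] by (cases P) (simp_all add: eval_mlinear_dot3 dot3_cross_row)
    qed
    then have "cross (rep_proj2 (ps ! i0)) (rep_proj2 (hd P)) = 0"
      by (simp add: Finite_Cartesian_Product.vec_eq_iff c0)
    then show "P \<in> exceptional_curve ps i0" using bl by (simp add: cross_rep_eq_0_iff exceptional_curve_def)
  next
    fix P assume "P \<in> exceptional_curve ps i0"
    then have P: "P \<in> blowup ps" "hd P = ps ! i0" by (auto simp: exceptional_curve_def)
    then obtain ls where ls: "P = (ps ! i0) # ls" "length ls = length ps"
      "\<And>i. i < length ps \<Longrightarrow> incident (ps ! i) (ls ! i) \<and> incident (ps ! i0) (ls ! i)"
      by (auto simp: blowup_def)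
    have c: "cross (rep_proj2 (ps ! i)) q0 \<noteq> 0" if "i < length ps" "i \<noteq> i0" for i
      using cross_distinct[OF that(1) assms(2) that(2)] c0 by simp
    have dom0: "dom 0 b" for b
      unfolding dom_iff using c assms(2) by (simp add: chart_nth)
    show "P \<in> Z vX"
    proof (cases "dot3 (rep_proj2 (P ! Suc i0)) q2 = 0")
      case False
      then obtain a b where ab: "dom a b" "P = \<sigma> a b"
        using chart_surj[OF P(1)] c P(2) c0 n0 by (auto simp: dot3_expand)
      have "abs_proj2 (chart_at ws a b ! 0) = ps ! i0"
        using ab(2) ls(1) by (simp add: chart_pt_def) (metis length_chart(1) length_ws nth_Cons_0 nth_map zero_less_Suc)
      then obtain k where k: "q0 = k *s (chart_at ws a b ! 0)"
        using rep_abs_proj2[OF chart_0_nonzero] c0 by metis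
      then have "k \<noteq> 0" using c0 rep_proj2_nonzero[of "ps ! i0"] by auto
      moreover have "cross q0 q0 = k *s cross q0 (chart_at ws a b ! 0)"
        using arg_cong[OF k, of "cross q0"] by (simp only: cross_scale)
      moreover have "cross q0 (chart_at ws a b ! 0) = a *s cross q0 (q1 + b *s q2)"
        using assms(2) by (simp add: chart_nth vec3_simps algebra_simps)
      moreover have "cross q0 q0 = 0" by (simp add: vec3_simps mult.commute)
      ultimately have "a = 0" using chart_i0_nonzero by (metis vector_mul_eq_0)
      then show ?thesis using \<sigma>_Z_iff[OF ab(1)] ab(2) by (simp add: ev2_id)
    next
      case True
      text \<open>This point of the exceptional curve is the limit \<open>b \<rightarrow> \<infinity>\<close> of the points
        with \<open>a = 0\<close> of the chart.\<close>
      define vs where "vs = (\<lambda>s. q0 # map (\<lambda>i. if i = i0 then cross q0 (s *s q1 + q2) else cross (rep_proj2 (ps ! i)) q0) [0..<length ps])"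
      define ws' where "ws' = vmap cc q0 # map (\<lambda>i. if i = i0 then cross (vmap cc q0) (vX *s vmap cc q1 + vmap cc q2) else cross (vmap cc (rep_proj2 (ps ! i))) (vmap cc q0)) [0..<length ps]"
      have vs_nth: "vs s ! 0 = q0" "i < length ps \<Longrightarrow> vs s ! Suc i = (if i = i0 then cross q0 (s *s q1 + q2) else cross (rep_proj2 (ps ! i)) q0)" for s i
        by (simp_all add: vs_def)
      have len_ws': "length ws' = length ws" by (simp add: ws'_def length_ws)
      have at_ws': "chart_at ws' s 0 = vs s" for s
      proof -
        have h: "comm_ring_hom (pt s 0)" by (rule comm_ring_hom_ev2) simp
        show ?thesis
          unfolding chart_at_def ws'_def vs_def
          by (simp add: vmap_simps[OF h] vmap_vmap ev2_id)
      qed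
      have "val F P = 0" if F: "form e F" "vX dvd sub F" for F e
      proof -
        have zero: "eval_mpoly id F (vs s) = 0" if "s \<noteq> 0" for s
        proof -
          let ?k = "\<lambda>i. if i = Suc i0 then s else 1"
          have "eval_mpoly id F (vs s) = (\<Prod>i<length ws. ?k i ^ e i) * eval_mpoly id F (chart_at ws 0 (1 / s))"
          proof (rule eval_mpoly_scale[OF F(1)])
            fix i assume "i < length ws"
            moreover have "cross q0 (s *s q1 + q2) = s *s cross q0 (q1 + (1 / s) *s q2)"
              using that by (simp add: vector_add_ldistrib vector_smult_assoc flip: cross_scale)
            ultimately show "vs s ! i = ?k i *s chart_at ws 0 (1 / s) ! i"
              using assms(2) by (cases i) (simp_all add: chart_nth vs_nth length_ws)
          qed
          moreover have "eval_mpoly id F (chart_at ws 0 (1 / s)) = 0"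
            using pt_dvd[OF F(2), of 0 "1 / s"] pt_sub[OF F(1)] by (simp add: ev2_id)
          ultimately show ?thesis by simp
        qed
        \<comment> \<open>The value of the form along the rescaled family is a polynomial in the
          parameter. It vanishes at every nonzero parameter, hence also at 0, because the field is
          infinite.\<close>
        define g where "g = poly (eval_mpoly cc F ws') [:0:]"
        have g: "poly g s = eval_mpoly id F (vs s)" for s
          using pt_sub[of ws' e F s 0] F(1) len_ws' by (simp add: at_ws' g_def pt_eq)
        have "g = 0"
        proof (rule ccontr)
          assume "g \<noteq> 0"
          then have "finite {s. poly g s = 0}" by (rule poly_roots_finite)
          moreover have "UNIV - {0} \<subseteq> {s. poly g s = 0}" using zero g by auto
          ultimately have "finite (UNIV - {0 :: 'a})" using finite_subset by blast
          then show False by (simp add: infinite_UNIV_char_0)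
        qed
        then have z: "eval_mpoly id F (vs 0) = 0" using g[of 0] by simp
        have "\<exists>k. map rep_proj2 P ! i = k *s vs 0 ! i" if "i < length ws" for i
        proof (cases i)
          case 0
          then show ?thesis using ls(1) c0 by (auto simp: vs_nth intro!: exI[of _ 1])
        next
          case (Suc j)
          then have j: "j < length ps" using that by (simp add: length_ws)
          have inc: "dot3 (rep_proj2 (ls ! j)) (rep_proj2 (ps ! j)) = 0" "dot3 (rep_proj2 (ls ! j)) q0 = 0"
            using ls(3)[OF j] c0 by (simp_all add: incident_iff)
          have "\<exists>k. rep_proj2 (ls ! j) = k *s vs 0 ! Suc j"
          proof (cases "j = i0")
            case True
            have "dot3 (cross q0 q2) q1 = - dot3 (cross q0 q1) q2" by (simp add: vec3_simps algebra_simps)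
            moreover have "dot3 0 q1 = 0" by (simp add: dot3_expand)
            ultimately have "cross q0 q2 \<noteq> 0" using det(1) by auto
            moreover have "dot3 (rep_proj2 (ls ! i0)) q2 = 0" 
              using \<open>dot3 (rep_proj2 (P ! Suc i0)) q2 = 0\<close> ls(1) by simp
            ultimately show ?thesis
              using cross_unique[of "rep_proj2 (ls ! i0)" q0 q2] inc True vs_nth(2)[OF j, of 0] by auto
          next
            case False
            then show ?thesis using cross_unique[OF inc c[OF j False]] vs_nth(2)[OF j, of 0] by auto
          qed
          then show ?thesis using Suc ls j by simp
        qed
        then obtain k where "\<And>i. i < length ws \<Longrightarrow> map rep_proj2 P ! i = k i *s vs 0 ! i" by metis
        from eval_mpoly_scale[OF F(1) this] show ?thesis using z by simp
      qed
      then show ?thesis using len'[OF P(1)] by (auto simp: Z_def length_ws)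
    qed
  qed
qed

lemma prime_exceptional:
  assumes i: "i < length ps"
  shows "prime_divisor ps (exceptional_curve ps i)"
proof -
  note fr = frame_point(1)[OF i]
  interpret frame ps i "rep_proj2 (ps ! i)" e1 e2 "vector [0, 0, 1 / rep_proj2 (ps ! i) $ 3]"
    "vector [1, 0, - rep_proj2 (ps ! i) $ 1 / rep_proj2 (ps ! i) $ 3]"
    "vector [0, 1, - rep_proj2 (ps ! i) $ 2 / rep_proj2 (ps ! i) $ 3]" by (rule fr)
  interpret chart ps ws cu cv by (rule frame_is_chart) (rule fr)
  have "dom 0 0"
    unfolding dom_iff using cross_distinct[OF _ i] by (simp add: chart_nth)
  then have "prime_divisor ps (Z vX)"
    by (rule prime_divisor_Z[OF irreducible_vX]) (simp add: ev2_id)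
  then show ?thesis using exceptional_vX[OF fr i] by simp
qed

end

section \<open>Canonical divisor and sections\<close>

text \<open>What it means for the section of dL - kE given by \<open>f\<close> to be nonzero at
  \<open>P\<close>, in terms of the plane alone: over a centre, the tangent cone must not contain
  the direction of the line in \<open>P\<close>, whose point at infinity is
  \<open>(s : t : 0)\<close>. Homogeneity makes the scaling of all representatives harmless.\<close>

definition nonvanishing_at :: "nat \<Rightarrow> nat \<Rightarrow> 'a::field proj2 list \<Rightarrow> 'a poly poly \<Rightarrow> 'a proj2 list \<Rightarrow> bool" where
  "nonvanishing_at d k ps f P \<longleftrightarrow>
    hd P \<notin> set ps \<and> hform d (\<lambda>c. c) f (rep_proj2 (hd P)) \<noteq> 0 \<or>
    (\<exists>i<length ps. hd P = ps ! i \<and> (\<exists>s t. dot3 (rep_proj2 (P ! Suc i)) (vector [s, t, 0]) = 0 \<and>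
       lead_form k (aff (ps ! i)) (\<lambda>c. c) f s t \<noteq> 0))"

lemma lead_form_hom:
  assumes "comm_ring_hom \<psi>"
  shows "\<psi> (lead_form k p \<phi> f S T) = lead_form k p (\<lambda>c. \<psi> (\<phi> c)) f (\<psi> S) (\<psi> T)"
proof -
  interpret comm_ring_hom \<psi> by fact
  show ?thesis by (simp add: lead_form_def hom_sum hom_mult hom_power)
qed

context affine_points
begin

context
  fixes i0 q0 q1 q2 n0 n1 n2
  assumes fr: "frame ps i0 q0 q1 q2 n0 n1 n2"
begin

interpretation frame ps i0 q0 q1 q2 n0 n1 n2 by (rule fr)
interpretation chart ps ws cu cv by (rule frame_is_chart) (rule fr)

lemma hd_\<sigma>:
  assumes "dom a b"
  shows "\<exists>k. k \<noteq> 0 \<and> rep_proj2 (hd (\<sigma> a b)) = k *s (chart_at ws a b ! 0)"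
proof -
  have "hd (\<sigma> a b) = abs_proj2 (chart_at ws a b ! 0)"
    using length_ws by (cases ws) (auto simp: chart_pt_def chart_at_def)
  then show ?thesis using rep_abs_proj2[OF chart_0_nonzero] by metis
qed

lemma hd_\<sigma>_eq_point:
  assumes "dom a b" "i < length ps" "hd (\<sigma> a b) = ps ! i"
  shows "i = i0 \<and> a = 0"
proof -
  obtain k where k: "k \<noteq> 0" "rep_proj2 (ps ! i) = k *s (chart_at ws a b ! 0)" using hd_\<sigma>[OF assms(1)] assms(3) by auto
  have "cross (rep_proj2 (ps ! i)) (chart_at ws a b ! 0) = 0"
    unfolding k(2) by (simp add: vec3_simps mult.commute)
  moreover from this have i: "i = i0" using assms(1,2) dom_iff by blast
  moreover have "cross q0 (chart_at ws a b ! 0) = a *s cross q0 (q1 + b *s q2)"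
    using i assms(2) by (simp add: chart_nth) (simp add: vec3_simps algebra_simps)
  ultimately have "a *s cross q0 (q1 + b *s q2) = 0" using centre assms(2) by simp
  then have "a = 0" using chart_i0_nonzero by simp
  then show ?thesis using i by simp
qed

lemma ord_ce:
  assumes C: "prime_divisor ps C" and ab: "dom a b" "\<sigma> a b \<in> C"
  shows "ord_along ps C ce = exceptional_divisor ps C"
proof -
  obtain t where "dvr (local_ring_along ps C) t" using dvr_prime_divisor[OF C] by blast
  then interpret dvr "local_ring_along ps C" t .
  have other: "C \<noteq> exceptional_curve ps i" if "i < length ps" "i \<noteq> i0" for i
    using hd_\<sigma>_eq_point[OF ab(1) that(1)] ab(2) that(2) by (auto simp: exceptional_curve_def)
  have "exceptional_divisor ps C = (\<Sum>i<length ps. if i = i0 then (if C = exceptional_curve ps i0 then 1 else 0) else 0)"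
    unfolding exceptional_divisor_def by (rule sum.cong) (use other in auto)
  then have E: "exceptional_divisor ps C = (if blown \<and> C = exceptional_curve ps i0 then 1 else 0)"
    by (simp add: sum.delta)
  show ?thesis
  proof (cases blown)
    case False
    then show ?thesis using E ord_in_unit[OF units_one] by (simp add: ce_def ord_along_eq)
  next
    case True
    have ce: "ce = ev vX" using True by (simp add: ce_def ev_simps)
    have vX: "vX \<noteq> (0 :: 'a poly poly)" by (simp add: vX_def)
    show ?thesis
    proof (cases "a = 0")
      case True
      then have "pt a b vX = 0" by (simp add: ev2_id)
      then show ?thesis
        using ord_along_ev(3)[OF C ab vX irreducible_vX] E \<open>blown\<close> exceptional_vX[OF fr] ce by simp
    next
      case False
      then have "pt a b vX \<noteq> 0" by (simp add: ev2_id)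
      moreover have "C \<noteq> exceptional_curve ps i0"
        using hd_\<sigma>_eq_point[OF ab(1) True] ab(2) False by (auto simp: exceptional_curve_def)
      ultimately show ?thesis using ord_along_ev(2)[OF C ab vX] E ce by simp
    qed
  qed
qed

lemma ord_jacobian:
  assumes C: "prime_divisor ps C" and ab: "dom a b" "\<sigma> a b \<in> C"
    and lp: "local_parameters ps (\<sigma> a b) u v"
  shows "ord_along ps C (jacobian u v) = - 3 * ord_along ps C (lin n0) - exceptional_divisor ps C"
    "jacobian u v \<noteq> 0"
proof -
  obtain t where "dvr (local_ring_along ps C) t" using dvr_prime_divisor[OF C] by blast
  then interpret dvr "local_ring_along ps C" t .
  let ?\<delta> = "jacobian u v / jacobian cu cv"
  have \<delta>: "?\<delta> \<in> units_in (local_ring ps (\<sigma> a b))" by (rule jacobian_local_parameters[OF ab(1) lp])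
  then have nz: "?\<delta> \<noteq> 0" by (auto simp: units_in_def)
  then show j: "jacobian u v \<noteq> 0" by auto
  have "?\<delta> \<in> units_in (local_ring_along ps C)" using \<delta> ab(2) by (auto simp: units_in_def local_ring_along_def)
  then have 0: "ord_along ps C ?\<delta> = 0" by (simp add: ord_along_eq ord_in_unit)
  have ce: "ce \<noteq> 0" by (simp add: ce_def)
  let ?d = "dot3 (cross n0 n1) n2"
  have c: "rf_const ?d = ev (cc ?d)" by (simp add: ev_simps)
  have "cc ?d \<noteq> 0" using det(2) by (simp add: cc_def)
  then have d: "ord_along ps C (rf_const ?d) = 0"
    unfolding c using ord_along_ev(2)[OF C ab] det(2) by (simp add: ev2_id)
  have "ord_along ps C (jacobian cu cv) = - (3 * ord_along ps C (lin n0) + ord_along ps C ce)"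
    using d det(2) ce unfolding jacobian_frame ord_along_eq
    by (simp add: ord_in_divide ord_in_mult ord_in_power)
  moreover have "ord_along ps C (jacobian u v) = ord_along ps C ?\<delta> + ord_along ps C (jacobian cu cv)"
    using ord_in_mult[OF nz jac] jac by (simp add: ord_along_eq)
  ultimately show "ord_along ps C (jacobian u v) = - 3 * ord_along ps C (lin n0) - exceptional_divisor ps C"
    using 0 ord_ce[OF C ab] by simp
qed

lemma n0_nonvanishing:
  assumes "dom a b" shows "dot3 n0 (rep_proj2 (hd (\<sigma> a b))) \<noteq> 0"
proof -
  have "dot3 n0 (q0 + a *s q1 + c *s q2) = dot3 n0 q0 + a * dot3 n0 q1 + c * dot3 n0 q2" for c
    by (simp add: vec3_simps algebra_simps)
  then have "dot3 n0 (chart_at ws a b ! 0) = 1" using n0 by (simp add: chart_nth)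
  then show ?thesis using hd_\<sigma>[OF assms] by (auto simp: dot3_scale)
qed

text \<open>\<open>h\<close> is the local equation of the divisor of \<open>f\<close> as a section
  of dL - kE. Off the exceptional curve its zeros are those of the form; on \<open>a = 0\<close> its
  value is the leading form times a power of \<open>q0 $ 3\<close>.\<close>

lemma section_local:
  assumes q: "blown \<Longrightarrow> q1 $ 3 = 0 \<and> q2 $ 3 = 0"
    and f: "tdeg d f" "\<And>i. i < length ps \<Longrightarrow> mult_at k (aff (ps ! i)) f" and "k \<le> d"
  shows "\<exists>h. Fract f 1 = lin n0 ^ d * ce ^ k * ev h \<and>
    (\<forall>a b. dom a b \<and> nonvanishing_at d k ps f (\<sigma> a b) \<longrightarrow> pt a b h \<noteq> 0)"
proof -
  define F where "F = hform d cc f w0"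
  have "Fract f 1 = hform d rf_const f generic_point"
    using hform_ev2[OF rf_hom f(1), of generic_point 1] by (simp add: generic_point_nth ev2_rf_generic)
  also have "\<dots> = lin n0 ^ d * hform d rf_const f (vmap ev w0)"
    by (subst generic_w0) (rule hform_scale)
  also have "hform d rf_const f (vmap ev w0) = ev F"
    unfolding F_def hform_hom[OF comm_ring_hom_ev2[OF rf_hom]] by (simp add: ev_simps)
  finally have Ff: "Fract f 1 = lin n0 ^ d * ev F" .
  have ptF: "pt a b F = hform d (\<lambda>c. c) f (chart_at ws a b ! 0)" for a b
    unfolding F_def hform_hom[OF comm_ring_hom_ev2[OF comm_ring_hom_id(1)]]
    by (simp add: ev2_id chart_at_def length_ws nth_ws)
  have outside: "pt a b F \<noteq> 0" if d: "dom a b" and nv: "nonvanishing_at d k ps f (\<sigma> a b)" and na: "\<not> blown \<or> a \<noteq> 0" for a b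
  proof -
    obtain c where c: "c \<noteq> 0" "rep_proj2 (hd (\<sigma> a b)) = c *s (chart_at ws a b ! 0)" using hd_\<sigma>[OF d] by blast
    have "hd (\<sigma> a b) \<notin> set ps"
      using hd_\<sigma>_eq_point[OF d] na by (metis in_set_conv_nth)
    then have "hform d (\<lambda>c. c) f (rep_proj2 (hd (\<sigma> a b))) \<noteq> 0"
      using nv nth_mem unfolding nonvanishing_at_def by metis
    then show ?thesis unfolding ptF c(2) hform_scale by simp
  qed
  show ?thesis
  proof (cases blown)
    case False
    then show ?thesis using Ff outside by (intro exI[of _ F]) (simp add: ce_def)
  next
    case True
    have c0: "rep_proj2 (ps ! i0) = q0" using centre True by simp
    have q3: "q0 $ 3 \<noteq> 0" using finite_part[OF True] c0 by simp
    define S T where "S = cc (q1 $ 1) + vY * cc (q2 $ 1)" and "T = cc (q1 $ 2) + vY * cc (q2 $ 2)"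
    have aff: "aff (ps ! i0) = (q0 $ 1 / q0 $ 3, q0 $ 2 / q0 $ 3)" by (simp add: aff_def c0)
    have w0: "w0 = vector [cc (q0 $ 3) * cc (q0 $ 1 / q0 $ 3) + vX * S, cc (q0 $ 3) * cc (q0 $ 2 / q0 $ 3) + vX * T, cc (q0 $ 3)]"
      using True q q3 by (simp add: w0_def vec3_simps S_def T_def algebra_simps flip: cc_arith)
    obtain h' where h': "F = vX ^ k * (cc (q0 $ 3) ^ (d - k) * lead_form k (aff (ps ! i0)) cc f S T + vX * h')"
      using hform_at_point[OF comm_ring_hom_cc f(1) f(2)[OF True, unfolded aff] \<open>k \<le> d\<close>, of "cc (q0 $ 3)" vX S T]
      unfolding F_def w0 aff by blast
    define h where "h = cc (q0 $ 3) ^ (d - k) * lead_form k (aff (ps ! i0)) cc f S T + vX * h'"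
    have Fh: "F = vX ^ k * h" by (simp add: h' h_def)
    have "ev F = ce ^ k * ev h" using True by (simp add: Fh ce_def ev_simps)
    moreover have "pt a b h \<noteq> 0" if dom: "dom a b" and nv: "nonvanishing_at d k ps f (\<sigma> a b)" for a b
    proof (cases "a = 0")
      case False
      then have "pt a b F \<noteq> 0" using outside[OF dom nv] by blast
      then show ?thesis by (auto simp: Fh ev2_id)
    next
      case a: True
      obtain c where c: "c \<noteq> 0" "rep_proj2 (hd (\<sigma> a b)) = c *s q0"
        using hd_\<sigma>[OF dom] a True by (auto simp: chart_nth)
      then have hd: "hd (\<sigma> a b) = ps ! i0" using c0 proj2_eq_iff[of "ps ! i0" "hd (\<sigma> a b)"] by auto
      then have "hd (\<sigma> a b) \<in> set ps" using True by simp
      then obtain i s t where i: "i < length ps" "hd (\<sigma> a b) = ps ! i" "dot3 (rep_proj2 (\<sigma> a b ! Suc i)) (vector [s, t, 0]) = 0"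
        "lead_form k (aff (ps ! i)) (\<lambda>c. c) f s t \<noteq> 0" using nv unfolding nonvanishing_at_def by blast
      have "i = i0" using hd_\<sigma>_eq_point[OF dom i(1,2)] by simp
      have lnz: "chart_at ws a b ! Suc i0 \<noteq> 0" using True chart_i0_nonzero by (simp add: chart_nth)
      have "\<sigma> a b ! Suc i0 = abs_proj2 (chart_at ws a b ! Suc i0)" "chart_at ws a b ! Suc i0 = cross q0 (q1 + b *s q2)"
        using True by (simp_all add: chart_pt_def length_ws chart_nth)
      then obtain c' where c': "c' \<noteq> 0" "rep_proj2 (\<sigma> a b ! Suc i0) = c' *s cross q0 (q1 + b *s q2)"
        using rep_abs_proj2[OF lnz] by metis
      let ?S = "q1 $ 1 + b * q2 $ 1" and ?T = "q1 $ 2 + b * q2 $ 2"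
      have cr: "cross q0 (q1 + b *s q2) = vector [- (q0 $ 3 * ?T), q0 $ 3 * ?S, q0 $ 1 * ?T - q0 $ 2 * ?S]"
        using q[OF True] by (simp add: vec3_simps)
      have "c' * (q0 $ 3 * (t * ?S - s * ?T)) = 0"
        using i(3) unfolding \<open>i = i0\<close> c'(2) cr dot3_scale by (simp add: dot3_expand algebra_simps)
      then have st: "t * ?S = s * ?T" using c'(1) q3 by simp
      have ST: "?S \<noteq> 0 \<or> ?T \<noteq> 0" using chart_i0_nonzero[of b] unfolding cr by (auto simp: vec3_simps)
      \<comment> \<open>The given direction and the direction of the chart both lie on the same line
        through the centre, so they are proportional.\<close>
      then obtain m where m: "s = m * ?S" "t = m * ?T"
      proof
        assume S: "?S \<noteq> 0"
        have "s = (s / ?S) * ?S" "t = (s / ?S) * ?T" using S st by (simp_all add: field_simps)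
        then show ?thesis by (rule that)
      next
        assume T: "?T \<noteq> 0"
        have "s = (t / ?T) * ?S" "t = (t / ?T) * ?T" using T st by (simp_all add: field_simps)
        then show ?thesis by (rule that)
      qed
      have "lead_form k (aff (ps ! i0)) (\<lambda>c. c) f ?S ?T \<noteq> 0"
        using i(4) unfolding \<open>i = i0\<close> m lead_form_scale by simp
      moreover have "pt a b h = q0 $ 3 ^ (d - k) * lead_form k (aff (ps ! i0)) (\<lambda>c. c) f ?S ?T"
        unfolding h_def ev2_id lead_form_hom[OF comm_ring_hom_ev2[OF comm_ring_hom_id(1)]]
        by (simp add: a ev2_id S_def T_def)
      ultimately show ?thesis using q3 by simp
    qed
    ultimately show ?thesis using Ff by (intro exI[of _ h]) (simp add: mult.assoc)
  qed
qed

end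

section \<open>Global divisors assembled from the charts\<close>

lemma atlas_directions:
  assumes "(i0, q0, q1, q2, n0, n1, n2) \<in> atlas ps" "i0 < length ps"
  shows "q1 $ 3 = 0 \<and> q2 $ 3 = 0"
  using assms by (auto simp: atlas_def plane_frames_def point_frames_def)

text \<open>Every admissible point and pair of local parameters in the definite description gives
  the same number, by \<open>ord_jacobian\<close> and \<open>ord_lin_eq\<close>; the coordinates of
  a chart provide one such pair.\<close>

lemma canonical_divisor_eq:
  assumes C: "prime_divisor ps C" and P: "P \<in> C" "dot3 n (rep_proj2 (hd P)) \<noteq> 0" and f: "f \<noteq> 0"
  shows "canonical_divisor ps f C = ord_along ps C f + 3 * ord_along ps C (lin n) + exceptional_divisor ps C"
proof -
  obtain t where "dvr (local_ring_along ps C) t" using dvr_prime_divisor[OF C] by blast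
  then interpret dvr "local_ring_along ps C" t .
  let ?n = "ord_along ps C f + 3 * ord_along ps C (lin n) + exceptional_divisor ps C"
  have key: "ord_along ps C (f / jacobian u v) = ?n"
    if P': "P' \<in> C" and lp: "local_parameters ps P' u v" for P' u v
  proof -
    have "P' \<in> blowup ps" using P' dvr_prime_divisor[OF C] by blast
    then obtain i0 q0 q1 q2 n0 n1 n2 a b where at: "(i0, q0, q1, q2, n0, n1, n2) \<in> atlas ps"
      "chart_dom (frame.ws ps i0 q0 q1 q2) a b" "P' = chart_pt (frame.ws ps i0 q0 q1 q2) a b"
      by (rule atlas_covers)
    note fr = atlas_frame[OF at(1)]
    note oj = ord_jacobian[OF fr C at(2) P'[unfolded at(3)] lp[unfolded at(3)]]
    have "ord_along ps C (lin n0) = ord_along ps C (lin n)"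
      using ord_lin_eq[OF C P' _ P] n0_nonvanishing[OF fr at(2)] at(3) by simp
    then show ?thesis
      using oj ord_in_divide[OF f oj(2)] by (simp add: ord_along_eq)
  qed
  have "P \<in> blowup ps" using P dvr_prime_divisor[OF C] by blast
  then obtain i0 q0 q1 q2 n0 n1 n2 a b where at: "(i0, q0, q1, q2, n0, n1, n2) \<in> atlas ps"
    "chart_dom (frame.ws ps i0 q0 q1 q2) a b" "P = chart_pt (frame.ws ps i0 q0 q1 q2) a b"
    by (rule atlas_covers)
  interpret frame ps i0 q0 q1 q2 n0 n1 n2 by (rule atlas_frame[OF at(1)])
  interpret chart ps ws cu cv by (rule frame_is_chart) (rule frame_axioms)
  have "(THE n. \<exists>P\<in>C. \<exists>u v. local_parameters ps P u v \<and> n = ord_along ps C (f / jacobian u v)) = ?n"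
  proof (rule the_equality)
    show "\<exists>P\<in>C. \<exists>u v. local_parameters ps P u v \<and> ?n = ord_along ps C (f / jacobian u v)"
      using chart_local_parameters[OF at(2)] key P(1) at(3) by metis
  qed (use key in auto)
  then show ?thesis using C by (simp add: canonical_divisor_def)
qed

lemma line_pullback_eq:
  assumes C: "prime_divisor ps C" and P: "P \<in> C" "dot3 n (rep_proj2 (hd P)) \<noteq> 0"
  shows "line_pullback ps a C = ord_along ps C (linear_form a) - ord_along ps C (lin n)"
proof -
  obtain t where "dvr (local_ring_along ps C) t" using dvr_prime_divisor[OF C] by blast
  then interpret dvr "local_ring_along ps C" t .
  let ?n = "ord_along ps C (linear_form a) - ord_along ps C (lin n)"
  have key: "ord_along ps C (linear_form a / linear_form b) = ?n"
    if "P' \<in> C" "\<not> incident (hd P') b" for P' b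
    using ord_lin_eq[OF C that(1) _ P, of "rep_proj2 b"] that(2)
    by (simp add: linear_form_eq incident_iff ord_along_eq ord_in_divide lin_nonzero)
  have "n \<noteq> 0" using P(2) by (auto simp: dot3_expand)
  then have "\<not> incident (hd P) (abs_proj2 n)" using P(2) by (simp add: incident_abs)
  then have "(THE n. \<exists>P\<in>C. \<exists>b. \<not> incident (hd P) b \<and> n = ord_along ps C (linear_form a / linear_form b)) = ?n"
  proof (intro the_equality)
    show "\<exists>P\<in>C. \<exists>b. \<not> incident (hd P) b \<and> ?n = ord_along ps C (linear_form a / linear_form b)"
      using key[OF P(1) \<open>\<not> incident (hd P) (abs_proj2 n)\<close>] P(1) \<open>\<not> incident (hd P) (abs_proj2 n)\<close> by metis
  qed (use key in auto)
  then show ?thesis using C by (simp add: line_pullback_def)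
qed

text \<open>Bridge from divisors to curves: -2K + 10L - 2E is 16L - 4E up to linear equivalence, and
  the member belonging to \<open>f\<close> has the local equations of
  \<open>section_local\<close>.\<close>

theorem base_point_free_of_sections:
  assumes L: "L = line_pullback ps a" and E: "E = exceptional_divisor ps"
    and K: "K = canonical_divisor ps f0" "f0 \<noteq> 0"
    and sections: "\<And>P. P \<in> blowup ps \<Longrightarrow> \<exists>f. tdeg 16 f \<and> (\<forall>i<length ps. mult_at 4 (aff (ps ! i)) f) \<and>
      nonvanishing_at 16 4 ps f P"
  shows "base_point_free ps (linear_system ps (\<lambda>C. - 2 * K C + 2 * int 5 * L C - 2 * E C))"
  unfolding base_point_free_def
proof
  fix P0 assume P0: "P0 \<in> blowup ps"
  then obtain f where f: "tdeg 16 f" "\<And>i. i < length ps \<Longrightarrow> mult_at 4 (aff (ps ! i)) f"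
    "nonvanishing_at 16 4 ps f P0" using sections by blast
  let ?D = "\<lambda>C. - 2 * K C + 2 * int 5 * L C - 2 * E C"
  have la: "linear_form a \<noteq> 0" by (simp add: linear_form_eq lin_nonzero)
  have "f \<noteq> 0"
    using f(3) by (auto simp: nonvanishing_at_def hform_def lead_form_def shift_simps)
  then have f1: "Fract f 1 \<noteq> 0" by (simp add: Zero_fract_def eq_fract)
  \<comment> \<open>The square of \<open>f0\<close> cancels the chosen 2-form in -2K and the tenth
    power cancels the chosen line in 10L. The orders of \<open>lin n0\<close> add up to -6 - 10 + 16
    and the exceptional parts to -2 - 2 + 4, so only the local equation of \<open>f\<close>
    remains.\<close>
  define g where "g = f0 ^ 2 * Fract f 1 / linear_form a ^ 10"
  have g: "g \<noteq> 0" using f1 la K(2) by (simp add: g_def)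
  define D' where "D' = (\<lambda>C. ?D C + principal_divisor ps g C)"
  have local: "\<exists>h. h \<noteq> 0 \<and>
      (\<forall>C a b. prime_divisor ps C \<and> chart_dom (frame.ws ps i0 q0 q1 q2) a b \<and> chart_pt (frame.ws ps i0 q0 q1 q2) a b \<in> C \<longrightarrow>
        D' C = ord_along ps C (ev2 rf_const (frame.cu n0 n1) (frame.cv ps i0 n0 n1 n2) h) \<and>
        (chart_pt (frame.ws ps i0 q0 q1 q2) a b = P0 \<longrightarrow> pt a b h \<noteq> 0))"
    if at: "(i0, q0, q1, q2, n0, n1, n2) \<in> atlas ps" for i0 q0 q1 q2 n0 n1 n2
  proof -
    note fr = atlas_frame[OF at]
    interpret frame ps i0 q0 q1 q2 n0 n1 n2 by (rule fr)
    interpret chart ps ws cu cv by (rule frame_is_chart) (rule fr)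
    obtain h where h: "Fract f 1 = lin n0 ^ 16 * ce ^ 4 * ev h"
      "\<And>a b. dom a b \<Longrightarrow> nonvanishing_at 16 4 ps f (\<sigma> a b) \<Longrightarrow> pt a b h \<noteq> 0"
      using section_local[OF fr atlas_directions[OF at] f(1) f(2)] by auto
    have h0: "h \<noteq> 0" using f1 h(1) by (auto simp: ev_simps)
    have "D' C = ord_along ps C (ev h)" if C: "prime_divisor ps C" and ab: "dom a1 b1" "\<sigma> a1 b1 \<in> C" for C a1 b1
    proof -
      obtain t where "dvr (local_ring_along ps C) t" using dvr_prime_divisor[OF C] by blast
      then interpret dvr "local_ring_along ps C" t .
      note nv = n0_nonvanishing[OF fr ab(1)]
      have ce: "ce \<noteq> 0" by (simp add: ce_def)
      have KC: "K C = ord_along ps C f0 + 3 * ord_along ps C (lin n0) + E C"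
        unfolding K(1) E by (rule canonical_divisor_eq[OF C ab(2) nv K(2)])
      have LC: "L C = ord_along ps C (linear_form a) - ord_along ps C (lin n0)"
        unfolding L by (rule line_pullback_eq[OF C ab(2) nv])
      have "ord_along ps C g = 2 * ord_along ps C f0 + (16 * ord_along ps C (lin n0) + 4 * ord_along ps C ce + ord_along ps C (ev h))
        - 10 * ord_along ps C (linear_form a)"
        unfolding g_def h(1) ord_along_eq using la K(2) ce h0
        by (simp add: ord_in_divide ord_in_mult ord_in_power)
      then show ?thesis
        using KC LC ord_ce[OF fr C ab] C E by (simp add: D'_def principal_divisor_def)
    qed
    then show ?thesis using h0 h(2) f(3) by blast
  qed
  show "\<exists>D\<in>linear_system ps ?D. P0 \<notin> \<Union>(support D)"
  proof
    have nonprime: "D' C = 0" if "\<not> prime_divisor ps C" for C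
    proof -
      have "exceptional_divisor ps C = 0"
        using that prime_exceptional unfolding exceptional_divisor_def by (intro sum.neutral) auto
      then show ?thesis
        using that by (simp add: D'_def L E K canonical_divisor_def line_pullback_def principal_divisor_def)
    qed
    have nonneg: "D' C \<ge> 0" for C
    proof (cases "prime_divisor ps C")
      case True
      then obtain P where P: "P \<in> C" using dvr_prime_divisor by blast
      then have "P \<in> blowup ps" using dvr_prime_divisor(3)[OF True] by blast
      then obtain i0 q0 q1 q2 n0 n1 n2 a b where at: "(i0, q0, q1, q2, n0, n1, n2) \<in> atlas ps"
        "chart_dom (frame.ws ps i0 q0 q1 q2) a b" "P = chart_pt (frame.ws ps i0 q0 q1 q2) a b"
        by (rule atlas_covers)
      interpret frame ps i0 q0 q1 q2 n0 n1 n2 by (rule atlas_frame[OF at(1)])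
      interpret chart ps ws cu cv by (rule frame_is_chart) (rule frame_axioms)
      from local[OF at(1)] obtain h where h0: "h \<noteq> 0" and
        *: "\<forall>C a b. prime_divisor ps C \<and> dom a b \<and> \<sigma> a b \<in> C \<longrightarrow>
          D' C = ord_along ps C (ev h) \<and> (\<sigma> a b = P0 \<longrightarrow> pt a b h \<noteq> 0)" by (elim exE conjE) (rule that)
      have "h \<noteq> 0" "D' C = ord_along ps C (ev h)"
        using * h0 True P at(2,3) by metis+
      then show ?thesis using ord_along_ev(1)[OF True at(2)] P at(3) by simp
    qed (simp add: nonprime)
    \<comment> \<open>The components of \<open>D'\<close> that meet a given chart. They correspond
      to irreducible factors of one polynomial, so a finite atlas makes the support finite.\<close>
    define S :: "'a frame_data \<Rightarrow> 'a proj2 list set set" where "S = (\<lambda>(i0, q0, q1, q2, n0, n1, n2). {C. prime_divisor ps C \<and> D' C \<noteq> 0 \<and>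
      (\<exists>a b. chart_dom (frame.ws ps i0 q0 q1 q2) a b \<and> chart_pt (frame.ws ps i0 q0 q1 q2) a b \<in> C)})"
    have "finite (S \<kappa>)" if in_atlas: "\<kappa> \<in> atlas ps" for \<kappa> :: "'a frame_data"
    proof -
      obtain i0 q0 q1 q2 n0 n1 n2 where \<kappa>: "\<kappa> = (i0, q0, q1, q2, n0, n1, n2)" by (cases \<kappa>) auto
      note at = in_atlas[unfolded \<kappa>]
      interpret frame ps i0 q0 q1 q2 n0 n1 n2 by (rule atlas_frame[OF at])
      interpret chart ps ws cu cv by (rule frame_is_chart) (rule frame_axioms)
      from local[OF at] obtain h where h: "h \<noteq> 0"
        "\<forall>C a b. prime_divisor ps C \<and> dom a b \<and> \<sigma> a b \<in> C \<longrightarrow>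
          D' C = ord_along ps C (ev h) \<and> (\<sigma> a b = P0 \<longrightarrow> pt a b h \<noteq> 0)" by (elim exE conjE) (rule that)
      have "S \<kappa> \<subseteq> {Z \<pi> |\<pi>. irreducible \<pi> \<and> \<pi> dvd h}"
      proof
        fix C assume "C \<in> S \<kappa>"
        then obtain a b where C: "prime_divisor ps C" "D' C \<noteq> 0" and ab: "dom a b" "\<sigma> a b \<in> C"
          by (auto simp: S_def \<kappa>)
        have "ord_along ps C (ev h) \<noteq> 0" using h(2) C ab by metis
        then show "C \<in> {Z \<pi> |\<pi>. irreducible \<pi> \<and> \<pi> dvd h}"
          using ord_along_ev(4)[OF C(1) ab h(1)] by blast
      qed
      then show ?thesis using finite_components[OF h(1)] finite_subset by blast
    qed
    then have fin: "finite (\<Union>\<kappa>\<in>atlas ps. S \<kappa>)" using finite_atlas by (intro finite_UN_I)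
    have "support D' \<subseteq> (\<Union>\<kappa>\<in>atlas ps. S \<kappa>)"
    proof
      fix C assume "C \<in> support D'"
      then have C: "D' C \<noteq> 0" "prime_divisor ps C" using nonprime by (auto simp: support_def)
      then obtain P where P: "P \<in> C" using dvr_prime_divisor by blast
      then have "P \<in> blowup ps" using dvr_prime_divisor(3)[OF C(2)] by blast
      then obtain i0 q0 q1 q2 n0 n1 n2 a b where at: "(i0, q0, q1, q2, n0, n1, n2) \<in> atlas ps"
        "chart_dom (frame.ws ps i0 q0 q1 q2) a b" "P = chart_pt (frame.ws ps i0 q0 q1 q2) a b"
        by (rule atlas_covers)
      then have "C \<in> S (i0, q0, q1, q2, n0, n1, n2)" using C P by (auto simp: S_def)
      then show "C \<in> (\<Union>\<kappa>\<in>atlas ps. S \<kappa>)" using at(1) by blast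
    qed
    then have "finite (support D')" using fin by (rule finite_subset)
    then have "is_divisor ps D'" using nonprime by (auto simp: is_divisor_def support_def)
    moreover have "effective D'" using nonneg by (simp add: effective_def)
    moreover have "linearly_equivalent ps ?D D'"
      unfolding linearly_equivalent_def using g by (intro exI[of _ g]) (simp add: D'_def fun_eq_iff)
    ultimately show "D' \<in> linear_system ps ?D" by (simp add: linear_system_def)
    show "P0 \<notin> \<Union>(support D')"
    proof
      assume "P0 \<in> \<Union>(support D')"
      then obtain C where C: "D' C \<noteq> 0" "P0 \<in> C" "prime_divisor ps C" using nonprime by (auto simp: support_def)
      obtain i0 q0 q1 q2 n0 n1 n2 a b where at: "(i0, q0, q1, q2, n0, n1, n2) \<in> atlas ps"
        "chart_dom (frame.ws ps i0 q0 q1 q2) a b" "P0 = chart_pt (frame.ws ps i0 q0 q1 q2) a b"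
        by (rule atlas_covers[OF P0])
      interpret frame ps i0 q0 q1 q2 n0 n1 n2 by (rule atlas_frame[OF at(1)])
      interpret chart ps ws cu cv by (rule frame_is_chart) (rule frame_axioms)
      from local[OF at(1)] obtain h where h0: "h \<noteq> 0" and
        *: "\<forall>C a b. prime_divisor ps C \<and> dom a b \<and> \<sigma> a b \<in> C \<longrightarrow>
          D' C = ord_along ps C (ev h) \<and> (\<sigma> a b = P0 \<longrightarrow> pt a b h \<noteq> 0)" by (elim exE conjE) (rule that)
      have h: "h \<noteq> 0" "D' C = ord_along ps C (ev h)" "pt a b h \<noteq> 0"
        using * h0 C(2,3) at(2,3) by metis+
      then have "D' C = 0" using ord_along_ev(2)[OF C(3) at(2) _ h(1,3)] C(2) at(3) by simp
      then show False using C(1) by simp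
    qed
  qed
qed

end

section \<open>Polynomial families and semicontinuity\<close>

text \<open>Polynomial functions of the affine coordinates of \<open>n\<close> points. The inductive
  form makes closure properties immediate; an actual form is produced only once, when openness is
  proved.\<close>

inductive polyfun :: "nat \<Rightarrow> ((nat \<Rightarrow> 'a::field \<times> 'a) \<Rightarrow> 'a) \<Rightarrow> bool" for n where
  const: "polyfun n (\<lambda>x. c)"
| coord_fst: "i < n \<Longrightarrow> polyfun n (\<lambda>x. fst (x i))"
| coord_snd: "i < n \<Longrightarrow> polyfun n (\<lambda>x. snd (x i))"
| add: "polyfun n f \<Longrightarrow> polyfun n g \<Longrightarrow> polyfun n (\<lambda>x. f x + g x)"
| mult: "polyfun n f \<Longrightarrow> polyfun n g \<Longrightarrow> polyfun n (\<lambda>x. f x * g x)"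

lemma polyfun_diff: "polyfun n f \<Longrightarrow> polyfun n g \<Longrightarrow> polyfun n (\<lambda>x. f x - g x)"
  using polyfun.add[of n f "\<lambda>x. (- 1) * g x"] polyfun.mult[OF polyfun.const[of n "- 1"], of g] by simp

lemma polyfun_sum: "(\<And>i. i \<in> A \<Longrightarrow> polyfun n (f i)) \<Longrightarrow> polyfun n (\<lambda>x. \<Sum>i\<in>A. f i x)"
  by (induction A rule: infinite_finite_induct) (auto intro: polyfun.intros)

lemma polyfun_prod: "(\<And>i. i \<in> A \<Longrightarrow> polyfun n (f i)) \<Longrightarrow> polyfun n (\<lambda>x. \<Prod>i\<in>A. f i x)"
  by (induction A rule: infinite_finite_induct) (auto intro: polyfun.intros)

section \<open>Homogenization: a nonvanishing polynomial function defines a Zariski open set\<close>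

lemma multihomogeneous_cong:
  "multihomogeneous n e F \<Longrightarrow> (\<And>i. i < n \<Longrightarrow> e i = e' i) \<Longrightarrow> multihomogeneous n e' F"
  by (simp add: multihomogeneous_def)

definition affine_part :: "('a::field ^ 3) list \<Rightarrow> nat \<Rightarrow> 'a \<times> 'a" where
  "affine_part vs i = (vs ! i $ 1 / vs ! i $ 3, vs ! i $ 2 / vs ! i $ 3)"

definition last_coords :: "nat \<Rightarrow> 'a::comm_ring_1 mpoly" where
  "last_coords n = (\<Prod>i<n. mlinear i e3)"

lemma last_coords_form: "multihomogeneous n (\<lambda>_. 1) (last_coords n)"
  unfolding last_coords_def
  by (rule multihomogeneous_cong[OF multihomogeneous_prod[OF multihomogeneous_mlinear]])
    (auto simp: unit_degree_def)

lemma eval_last_coords: "eval_mpoly id (last_coords n) vs = (\<Prod>i<n. vs ! i $ 3)"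
  by (simp add: last_coords_def eval_mpoly_prod eval_mlinear_dot3 dot3_expand)

text \<open>Denominators are cleared by powers of the product of all last coordinates. Using one
  exponent \<open>N\<close> for all factors lets sums be brought to a common multidegree.\<close>

lemma polyfun_form:
  assumes "polyfun n g"
  shows "\<exists>N F. multihomogeneous n (\<lambda>_. N) F \<and> (\<forall>vs. (\<forall>i<n. vs ! i $ 3 \<noteq> 0) \<longrightarrow>
    eval_mpoly id F vs = (\<Prod>i<n. vs ! i $ 3) ^ N * g (affine_part vs))"
  using assms
proof induction
  case (const c)
  show ?case
    by (rule exI[of _ 0], rule exI[of _ "mconst c"]) (simp add: multihomogeneous_mconst eval_mconst)
next
  case (coord_fst i)
  have m: "multihomogeneous n (\<lambda>k. unit_degree i k + (\<Sum>j\<in>{..<n}-{i}. unit_degree j k)) (mlinear i e1 * (\<Prod>j\<in>{..<n}-{i}. mlinear j e3))"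
    using coord_fst by (intro multihomogeneous_mult multihomogeneous_prod multihomogeneous_mlinear) auto
  have "multihomogeneous n (\<lambda>_. 1) (mlinear i e1 * (\<Prod>j\<in>{..<n}-{i}. mlinear j e3))"
    by (rule multihomogeneous_cong[OF m]) (use coord_fst in \<open>auto simp: unit_degree_def\<close>)
  then show ?case
    using coord_fst
    by (intro exI[of _ 1] exI[of _ "mlinear i e1 * (\<Prod>j\<in>{..<n}-{i}. mlinear j e3)"])
      (auto simp: eval_mpoly_mult eval_mpoly_prod eval_mlinear_dot3 dot3_expand affine_part_def prod.remove[of "{..<n}" i])
next
  case (coord_snd i)
  have m: "multihomogeneous n (\<lambda>k. unit_degree i k + (\<Sum>j\<in>{..<n}-{i}. unit_degree j k)) (mlinear i e2 * (\<Prod>j\<in>{..<n}-{i}. mlinear j e3))"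
    using coord_snd by (intro multihomogeneous_mult multihomogeneous_prod multihomogeneous_mlinear) auto
  have "multihomogeneous n (\<lambda>_. 1) (mlinear i e2 * (\<Prod>j\<in>{..<n}-{i}. mlinear j e3))"
    by (rule multihomogeneous_cong[OF m]) (use coord_snd in \<open>auto simp: unit_degree_def\<close>)
  then show ?case
    using coord_snd
    by (intro exI[of _ 1] exI[of _ "mlinear i e2 * (\<Prod>j\<in>{..<n}-{i}. mlinear j e3)"])
      (auto simp: eval_mpoly_mult eval_mpoly_prod eval_mlinear_dot3 dot3_expand affine_part_def prod.remove[of "{..<n}" i])
next
  case (add f g)
  then obtain N F N' F' where F: "multihomogeneous n (\<lambda>_. N) F"
    "\<And>vs. (\<forall>i<n. vs ! i $ 3 \<noteq> 0) \<Longrightarrow> eval_mpoly id F vs = (\<Prod>i<n. vs ! i $ 3) ^ N * f (affine_part vs)"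
    and F': "multihomogeneous n (\<lambda>_. N') F'"
    "\<And>vs. (\<forall>i<n. vs ! i $ 3 \<noteq> 0) \<Longrightarrow> eval_mpoly id F' vs = (\<Prod>i<n. vs ! i $ 3) ^ N' * g (affine_part vs)" by blast
  have pw: "multihomogeneous n (\<lambda>_. k) (last_coords n ^ k)" "eval_mpoly id (last_coords n ^ k) vs = (\<Prod>i<n. vs ! i $ 3) ^ k"
    for k and vs :: "('a ^ 3) list"
  proof (induction k)
    case 0
    { case 1 show ?case using multihomogeneous_mconst[of n 1] by (simp add: mconst_def) }
    { case 2 show ?case by (simp add: eval_mpoly_1) }
  next
    case (Suc k)
    { case 1 show ?case using multihomogeneous_mult[OF last_coords_form Suc(1)] by simp }
    { case 2 show ?case unfolding power_Suc eval_mpoly_mult[OF comm_ring_hom_id(2)] eval_last_coords Suc(2) .. }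
  qed
  have "multihomogeneous n (\<lambda>_. N + N') (last_coords n ^ N' * F + last_coords n ^ N * F')"
    using multihomogeneous_mult[OF pw(1) F(1), of N'] multihomogeneous_mult[OF pw(1) F'(1), of N]
    by (intro multihomogeneous_add) (simp_all add: add.commute)
  then show ?case
  proof (intro exI[of _ "N + N'"] exI[of _ "last_coords n ^ N' * F + last_coords n ^ N * F'"] conjI allI impI)
    fix vs :: "('a ^ 3) list" assume vs: "\<forall>i<n. vs ! i $ 3 \<noteq> 0"
    show "eval_mpoly id (last_coords n ^ N' * F + last_coords n ^ N * F') vs =
        (\<Prod>i<n. vs ! i $ 3) ^ (N + N') * (f (affine_part vs) + g (affine_part vs))"
      unfolding eval_mpoly_add[OF comm_ring_hom_id(2)] eval_mpoly_mult[OF comm_ring_hom_id(2)] pw(2) F(2)[OF vs] F'(2)[OF vs]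
      by (simp add: power_add algebra_simps)
  qed
next
  case (mult f g)
  then obtain N F N' F' where F: "multihomogeneous n (\<lambda>_. N) F"
    "\<And>vs. (\<forall>i<n. vs ! i $ 3 \<noteq> 0) \<Longrightarrow> eval_mpoly id F vs = (\<Prod>i<n. vs ! i $ 3) ^ N * f (affine_part vs)"
    and F': "multihomogeneous n (\<lambda>_. N') F'"
    "\<And>vs. (\<forall>i<n. vs ! i $ 3 \<noteq> 0) \<Longrightarrow> eval_mpoly id F' vs = (\<Prod>i<n. vs ! i $ 3) ^ N' * g (affine_part vs)" by blast
  show ?case
    using multihomogeneous_mult[OF F(1) F'(1)]
  proof (intro exI[of _ "N + N'"] exI[of _ "F * F'"] conjI allI impI)
    fix vs :: "('a ^ 3) list" assume vs: "\<forall>i<n. vs ! i $ 3 \<noteq> 0"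
    show "eval_mpoly id (F * F') vs = (\<Prod>i<n. vs ! i $ 3) ^ (N + N') * (f (affine_part vs) * g (affine_part vs))"
      unfolding eval_mpoly_mult[OF comm_ring_hom_id(2)] F(2)[OF vs] F'(2)[OF vs] by (simp add: power_add)
  qed
qed

lemma open_polyfun_nonzero:
  assumes "polyfun n g"
  shows "openin (zariski n) {ps :: 'a::field proj2 list. length ps = n \<and>
    (\<forall>i<n. rep_proj2 (ps ! i) $ 3 \<noteq> 0) \<and> g (affine_part (map rep_proj2 ps)) \<noteq> 0}" (is "openin _ ?U")
proof -
  obtain N F where F: "multihomogeneous n (\<lambda>_. N) F"
    "\<And>vs. (\<forall>i<n. vs ! i $ 3 \<noteq> 0) \<Longrightarrow> eval_mpoly id F vs = (\<Prod>i<n. vs ! i $ 3) ^ N * g (affine_part vs)"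
    using polyfun_form[OF assms] by blast
  have "?U = nonvanishing_locus n (last_coords n * F)"
    by (auto simp: nonvanishing_locus_def eval_mpoly_mult eval_last_coords F(2))
  then show ?thesis
    using multihomogeneous_mult[OF last_coords_form F(1)] unfolding openin_zariski_iff by blast
qed

text \<open>Full row rank is an open condition. Gaussian elimination is carried out without
  division: the pivot is nonzero at \<open>x0\<close>, the reduced rows \<open>a'\<close> remain
  polynomial in \<open>x\<close>, and \<open>g\<close> is the product of the successive
  pivots.\<close>

lemma polyfun_solvable_open:
  fixes a :: "'k \<Rightarrow> 'j \<Rightarrow> (nat \<Rightarrow> 'a::field \<times> 'a) \<Rightarrow> 'a"
  assumes "finite K" "finite J" "\<And>k j. polyfun n (a k j)"
    and "\<And>b. \<exists>c. \<forall>k\<in>K. (\<Sum>j\<in>J. c j * a k j x0) = b k"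
  shows "\<exists>g. polyfun n g \<and> g x0 \<noteq> 0 \<and>
    (\<forall>x. g x \<noteq> 0 \<longrightarrow> (\<forall>b. \<exists>c. \<forall>k\<in>K. (\<Sum>j\<in>J. c j * a k j x) = b k))"
  using assms
proof (induction K arbitrary: J a rule: finite_induct)
  case empty
  show ?case by (rule exI[of _ "\<lambda>x. 1"]) (simp add: polyfun.const)
next
  case (insert k0 K)
  obtain c1 where "\<forall>k\<in>insert k0 K. (\<Sum>j\<in>J. c1 j * a k j x0) = (if k = k0 then 1 else 0)"
    using insert.prems(3)[of "\<lambda>k. if k = k0 then 1 else 0"] by blast
  then have "(\<Sum>j\<in>J. c1 j * a k0 j x0) \<noteq> 0" by simp
  moreover have "(\<Sum>j\<in>J. c1 j * a k0 j x0) = 0" if "\<forall>j\<in>J. a k0 j x0 = 0"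
    using that by (intro sum.neutral) simp
  ultimately obtain j0 where j0: "j0 \<in> J" "a k0 j0 x0 \<noteq> 0" by blast
  define J' where "J' = J - {j0}"
  define a' where "a' = (\<lambda>k j x. a k0 j0 x * a k j x - a k j0 x * a k0 j x)"
  have J: "finite J'" "\<And>f :: 'j \<Rightarrow> 'a. sum f J = f j0 + sum f J'"
    using insert.prems(1) j0 by (auto simp: J'_def sum.remove)
  have a'_sum: "(\<Sum>j\<in>J'. c j * a' k j x) = a k0 j0 x * (\<Sum>j\<in>J'. c j * a k j x) - a k j0 x * (\<Sum>j\<in>J'. c j * a k0 j x)" for c k x
    by (simp add: a'_def algebra_simps sum_subtractf sum_distrib_left)
  have "\<exists>c. \<forall>k\<in>K. (\<Sum>j\<in>J'. c j * a' k j x0) = b k" for b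
  proof -
    obtain c where c: "\<forall>k\<in>insert k0 K. (\<Sum>j\<in>J. c j * a k j x0) = (if k = k0 then 0 else b k / a k0 j0 x0)"
      using insert.prems(3)[of "\<lambda>k. if k = k0 then 0 else b k / a k0 j0 x0"] by blast
    have 0: "(\<Sum>j\<in>J'. c j * a k0 j x0) = - (c j0 * a k0 j0 x0)" using c J(2) by (simp add: eq_neg_iff_add_eq_0 add.commute)
    have "(\<Sum>j\<in>J'. c j * a' k j x0) = b k" if "k \<in> K" for k
    proof -
      have "k \<noteq> k0" using that insert.hyps by auto
      then have "c j0 * a k j0 x0 + (\<Sum>j\<in>J'. c j * a k j x0) = b k / a k0 j0 x0" using c J(2) that by simp
      then have S: "(\<Sum>j\<in>J'. c j * a k j x0) = b k / a k0 j0 x0 - c j0 * a k j0 x0" by (simp add: algebra_simps)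
      show ?thesis unfolding a'_sum 0 S using j0(2) by (simp add: algebra_simps)
    qed
    then show ?thesis by blast
  qed
  moreover have "polyfun n (a' k j)" for k j
    unfolding a'_def by (intro polyfun_diff polyfun.mult insert.prems(2))
  ultimately obtain g where g: "polyfun n g" "g x0 \<noteq> 0"
    "\<And>x. g x \<noteq> 0 \<Longrightarrow> \<forall>b. \<exists>c. \<forall>k\<in>K. (\<Sum>j\<in>J'. c j * a' k j x) = b k"
    using insert.IH[of J' a'] J(1) by blast
  show ?case
  proof (intro exI[of _ "\<lambda>x. g x * a k0 j0 x"] conjI allI impI)
    show "polyfun n (\<lambda>x. g x * a k0 j0 x)" by (intro polyfun.mult g insert.prems(2))
    show "g x0 * a k0 j0 x0 \<noteq> 0" using g j0 by simp
    fix x b assume "g x * a k0 j0 x \<noteq> 0"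
    then have gx: "g x \<noteq> 0" and \<alpha>: "a k0 j0 x \<noteq> 0" by auto
    obtain c' where c': "\<forall>k\<in>K. (\<Sum>j\<in>J'. c' j * a' k j x) = a k0 j0 x * b k - a k j0 x * b k0"
      using g(3)[OF gx] by (elim allE[of _ "\<lambda>k. a k0 j0 x * b k - a k j0 x * b k0"]) blast
    define s where "s = (\<Sum>j\<in>J'. c' j * a k0 j x)"
    define c where "c = c'(j0 := (b k0 - s) / a k0 j0 x)"
    have cJ: "(\<Sum>j\<in>J. c j * a k j x) = (b k0 - s) / a k0 j0 x * a k j0 x + (\<Sum>j\<in>J'. c' j * a k j x)" for k
    proof -
      have "(\<Sum>j\<in>J'. c j * a k j x) = (\<Sum>j\<in>J'. c' j * a k j x)" by (rule sum.cong) (auto simp: c_def J'_def)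
      then show ?thesis unfolding J(2) by (simp add: c_def)
    qed
    have "(\<Sum>j\<in>J. c j * a k j x) = b k" if k: "k \<in> insert k0 K" for k
    proof (cases "k = k0")
      case True
      then show ?thesis unfolding cJ using \<alpha> by (simp add: s_def)
    next
      case False
      then have "a k0 j0 x * (\<Sum>j\<in>J'. c' j * a k j x) - a k j0 x * s = a k0 j0 x * b k - a k j0 x * b k0"
        using c' k unfolding a'_sum s_def by auto
      then have "a k0 j0 x * (\<Sum>j\<in>J'. c' j * a k j x) = a k0 j0 x * b k - a k j0 x * (b k0 - s)"
        by (simp add: algebra_simps)
      then have "(\<Sum>j\<in>J'. c' j * a k j x) = b k - a k j0 x * (b k0 - s) / a k0 j0 x"
        using \<alpha> by (simp add: field_simps)
      then show ?thesis unfolding cJ by (simp add: mult.commute)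
    qed
    then show "\<exists>c. \<forall>k\<in>insert k0 K. (\<Sum>j\<in>J. c j * a k j x) = b k" by blast
  qed
qed

section \<open>Multiplicity conditions in families of curves\<close>

definition polyfam :: "nat \<Rightarrow> nat \<Rightarrow> ((nat \<Rightarrow> 'a::field \<times> 'a) \<Rightarrow> 'a poly poly) \<Rightarrow> bool" where
  "polyfam n d f \<longleftrightarrow> (\<forall>x. tdeg d (f x)) \<and> (\<forall>r s. polyfun n (\<lambda>x. cf (f x) r s))"

text \<open>The Taylor coefficients that have to vanish for multiplicity \<open>k\<close> at the points \<open>x 0, x 1, \<dots>\<close>.\<close>

definition jet_index :: "nat \<Rightarrow> nat \<Rightarrow> (nat \<times> nat \<times> nat) set" where
  "jet_index n k = {(i, r, s). i < n \<and> r + s < k}"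

definition jet :: "nat \<times> nat \<times> nat \<Rightarrow> (nat \<Rightarrow> 'a::field \<times> 'a) \<Rightarrow> 'a poly poly \<Rightarrow> 'a" where
  "jet j x f = (case j of (i, r, s) \<Rightarrow> cf (shift (fst (x i)) (snd (x i)) f) r s)"

lemma finite_jet_index: "finite (jet_index n k)"
  by (rule finite_subset[of _ "{..<n} \<times> {..<k} \<times> {..<k}"]) (auto simp: jet_index_def)

lemma mult_at_iff_jets: "(\<forall>i<n. mult_at k (x i) f) \<longleftrightarrow> (\<forall>j\<in>jet_index n k. jet j x f = 0)"
  by (auto simp: mult_at_def vord_def jet_index_def jet_def)

lemma jet_linear: "jet j x (f + g) = jet j x f + jet j x g" "jet j x (f - g) = jet j x f - jet j x g"
  "jet j x (cc c * f) = c * jet j x f" "jet j x 0 = 0"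
  "jet j x (sum F A) = (\<Sum>i\<in>A. jet j x (F i))"
  by (simp_all add: jet_def shift_simps case_prod_unfold)

lemma polyfun_cf_power:
  assumes i: "i < n"
  shows "polyfun n (\<lambda>x. cf ((vX + cc (fst (x i))) ^ r) p q)"
    "polyfun n (\<lambda>x. cf ((vY + cc (snd (x i))) ^ r) p q)"
proof -
  have c: "polyfun n (\<lambda>x. cf (cc (h x)) p q)" if "polyfun n h" for h p q
    using that polyfun.const[of n 0] by (cases p; cases q) (auto simp: cf_def cc_def)
  have X: "polyfun n (\<lambda>x. cf (vX + cc (fst (x i))) p q)" for p q
    unfolding cf_simps by (intro polyfun.add polyfun.const c polyfun.coord_fst i)
  have Y: "polyfun n (\<lambda>x. cf (vY + cc (snd (x i))) p q)" for p q
    unfolding cf_simps by (intro polyfun.add polyfun.const c polyfun.coord_snd i)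
  show "polyfun n (\<lambda>x. cf ((vX + cc (fst (x i))) ^ r) p q)"
    by (induction r arbitrary: p q)
      (auto simp: power_Suc cf_mult intro!: polyfun_sum polyfun.mult X polyfun.const simp del: cf_simps)
  show "polyfun n (\<lambda>x. cf ((vY + cc (snd (x i))) ^ r) p q)"
    by (induction r arbitrary: p q)
      (auto simp: power_Suc cf_mult intro!: polyfun_sum polyfun.mult Y polyfun.const simp del: cf_simps)
qed

lemma shift_as_sum:
  assumes "tdeg d f"
  shows "shift a b f = (\<Sum>z\<in>tri d. cc (cf f (fst z) (snd z)) * ((vX + cc a) ^ fst z * (vY + cc b) ^ snd z))"
  by (subst poly2_as_sum[OF assms]) (simp add: shift_simps case_prod_unfold)

lemma polyfun_jet:
  assumes f: "polyfam n d f" and j: "j \<in> jet_index n k"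
  shows "polyfun n (\<lambda>x. jet j x (f x))"
proof -
  obtain i r s where irs: "j = (i, r, s)" "i < n" using j by (auto simp: jet_index_def)
  have "jet j x (f x) = (\<Sum>z\<in>tri d. cf (f x) (fst z) (snd z) *
      cf ((vX + cc (fst (x i))) ^ fst z * (vY + cc (snd (x i))) ^ snd z) r s)" for x
  proof -
    have "tdeg d (f x)" using f by (simp add: polyfam_def)
    then have "shift (fst (x i)) (snd (x i)) (f x) = (\<Sum>z\<in>tri d. cc (cf (f x) (fst z) (snd z)) *
      ((vX + cc (fst (x i))) ^ fst z * (vY + cc (snd (x i))) ^ snd z))"
      by (rule shift_as_sum)
    then show ?thesis by (simp add: jet_def irs)
  qed
  moreover have "polyfun n (\<lambda>x. \<Sum>z\<in>tri d. cf (f x) (fst z) (snd z) *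
      cf ((vX + cc (fst (x i))) ^ fst z * (vY + cc (snd (x i))) ^ snd z) r s)"
    unfolding cf_mult using f irs
    by (intro polyfun_sum polyfun.mult polyfun_cf_power) (auto simp: polyfam_def)
  ultimately show ?thesis by simp
qed

lemma polyfam_const: "tdeg d f \<Longrightarrow> polyfam n d (\<lambda>x. f)"
  by (simp add: polyfam_def polyfun.const)

text \<open>Independent conditions have a kernel of locally constant dimension, so each curve
  satisfying them at \<open>x0\<close> extends to a family satisfying them everywhere. The
  conditions are imposed one at a time; avoiding division costs the constant factor
  \<open>c\<close>.\<close>

lemma deform_kernel:
  assumes dual: "\<And>j. j \<in> jet_index n k \<Longrightarrow> tdeg d (e j)"
      "\<And>j j'. j \<in> jet_index n k \<Longrightarrow> j' \<in> jet_index n k \<Longrightarrow> jet j' x0 (e j) = (if j' = j then 1 else 0)"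
    and f0: "tdeg d f0" "\<And>j. j \<in> jet_index n k \<Longrightarrow> jet j x0 f0 = 0"
  shows "\<exists>f c. polyfam n d f \<and> (\<forall>x. \<forall>j\<in>jet_index n k. jet j x (f x) = 0) \<and> c \<noteq> 0 \<and> f x0 = cc c * f0"
proof -
  have "\<exists>f c. polyfam n d f \<and> (\<forall>x. \<forall>j\<in>K. jet j x (f x) = 0) \<and> c \<noteq> 0 \<and> f x0 = cc c * f0"
    if "finite K" "K \<subseteq> jet_index n k" "tdeg d f0" "\<And>j. j \<in> K \<Longrightarrow> jet j x0 f0 = 0" for K f0
    using that
  proof (induction K arbitrary: f0 rule: finite_induct)
    case empty
    then show ?case by (intro exI[of _ "\<lambda>x. f0"] exI[of _ 1]) (simp add: polyfam_const)
  next
    case (insert j0 K)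
    have j0: "j0 \<in> jet_index n k" using insert.prems by simp
    obtain f c where f: "polyfam n d f" "\<forall>x. \<forall>j\<in>K. jet j x (f x) = 0" "c \<noteq> 0" "f x0 = cc c * f0"
      using insert.IH[of f0] insert.prems by auto
    have "jet j x0 (e j0) = 0" if "j \<in> K" for j
      using dual(2)[OF j0, of j] insert.prems(1) insert.hyps that by auto
    then obtain g c' where g: "polyfam n d g" "\<forall>x. \<forall>j\<in>K. jet j x (g x) = 0" "c' \<noteq> 0" "g x0 = cc c' * e j0"
      using insert.IH[of "e j0"] insert.prems(1) dual(1)[OF j0] by auto
    \<comment> \<open>The combination cancels the jet \<open>j0\<close> identically in
      \<open>x\<close>. At \<open>x0\<close> the jet of \<open>f\<close> is already 0 and that of
      \<open>g\<close> is \<open>c'\<close>, so a nonzero multiple of \<open>f0\<close> is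
      left.\<close>
    define h where "h x = cc (jet j0 x (g x)) * f x - cc (jet j0 x (f x)) * g x" for x
    have td: "tdeg d (f x)" "tdeg d (g x)" for x using f g by (auto simp: polyfam_def)
    have "tdeg d (h x)" for x
      using tdeg_mult[OF tdeg_basic(1)[of 0] td(1)] tdeg_mult[OF tdeg_basic(1)[of 0] td(2)] by (auto simp: h_def)
    moreover have "polyfun n (\<lambda>x. cf (h x) r s)" for r s
      unfolding h_def cf_simps
      by (intro polyfun_diff polyfun.mult polyfun_jet[OF f(1) j0] polyfun_jet[OF g(1) j0])
        (use f g in \<open>auto simp: polyfam_def\<close>)
    ultimately have "polyfam n d h" by (simp add: polyfam_def)
    moreover have "\<forall>x. \<forall>j\<in>insert j0 K. jet j x (h x) = 0"
      using f(2) g(2) by (auto simp: h_def jet_linear)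
    moreover have "h x0 = cc (c' * c) * f0"
      using f(4) g(4) dual(2)[OF j0 j0] insert.prems(3)[of j0] by (simp add: h_def jet_linear cc_arith)
    ultimately show ?case using f(3) g(3) by (intro exI[of _ h] exI[of _ "c' * c"]) auto
  qed
  then show ?thesis using finite_jet_index f0 by blast
qed

text \<open>The first hypothesis says that the multiplicity conditions at \<open>x0\<close> are independent in
  degree \<open>d\<close>, the second one that \<open>F\<close> generates the curves of degree \<open>d + m\<close> with these multiplicities.
  Both persist on a neighbourhood of \<open>x0\<close>.\<close>

lemma generation_open:
  fixes x0 :: "nat \<Rightarrow> 'a::field \<times> 'a" and F :: "'m \<Rightarrow> 'a poly poly"
  assumes dual: "\<And>j. j \<in> jet_index n k \<Longrightarrow> tdeg d (e j)"
      "\<And>j j'. j \<in> jet_index n k \<Longrightarrow> j' \<in> jet_index n k \<Longrightarrow> jet j' x0 (e j) = (if j' = j then 1 else 0)"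
    and F: "finite I" "\<And>l. l \<in> I \<Longrightarrow> tdeg d (F l)" "\<And>l i. l \<in> I \<Longrightarrow> i < n \<Longrightarrow> mult_at k (x0 i) (F l)"
    and gen: "\<And>G. tdeg (d + m) G \<Longrightarrow> (\<forall>i<n. mult_at k (x0 i) G) \<Longrightarrow>
      \<exists>M. (\<forall>l\<in>I. tdeg m (M l)) \<and> G = (\<Sum>l\<in>I. F l * M l)"
  shows "\<exists>g. polyfun n g \<and> g x0 \<noteq> 0 \<and> (\<forall>x. g x \<noteq> 0 \<longrightarrow>
    (\<forall>G. tdeg (d + m) G \<and> (\<forall>i<n. mult_at k (x i) G) \<longrightarrow>
      (\<exists>F' M. (\<forall>l\<in>I. tdeg d (F' l) \<and> (\<forall>i<n. mult_at k (x i) (F' l)) \<and> tdeg m (M l)) \<and> G = (\<Sum>l\<in>I. F' l * M l))))"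
proof -
  let ?K = "jet_index n k"
  note fin = finite_jet_index[of n k] F(1) finite_tri
  have "\<exists>f c. polyfam n d f \<and> (\<forall>x. \<forall>j\<in>?K. jet j x (f x) = 0) \<and> c \<noteq> 0 \<and> f x0 = cc c * F l" if "l \<in> I" for l
    using deform_kernel[OF dual F(2)[OF that]] F(3)[OF that] mult_at_iff_jets by blast
  then obtain Ft c where Ft: "\<And>l. l \<in> I \<Longrightarrow> polyfam n d (Ft l)" "\<And>l x j. l \<in> I \<Longrightarrow> j \<in> ?K \<Longrightarrow> jet j x (Ft l x) = 0"
    "\<And>l. l \<in> I \<Longrightarrow> c l \<noteq> 0" "\<And>l. l \<in> I \<Longrightarrow> Ft l x0 = cc (c l) * F l" by metis
  \<comment> \<open>The curves \<open>e j\<close> are adjoined as a complement of the kernel. The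
    target is then the fixed space of all polynomials of degree \<open>d + m\<close> and not a
    kernel that moves with \<open>x\<close>, so surjectivity is a rank condition.\<close>
  define J where "J = (I \<times> tri m) <+> ?K"
  have finJ: "finite J" unfolding J_def using fin by (intro finite_Plus finite_cartesian_product)
  define V where "V j x = (case j of Inl (l, r, s) \<Rightarrow> if l \<in> I then Ft l x * (vX ^ r * vY ^ s) else 0 | Inr k' \<Rightarrow> e k')"
    for j :: "('m \<times> nat \<times> nat) + (nat \<times> nat \<times> nat)" and x
  have mono: "tdeg m (cc c * (vX ^ r * vY ^ s))" if "(r, s) \<in> tri m" for c :: 'a and r s
    using that by (auto simp: tdeg_def tri_def cf_monomial_1)
  have sumJ: "(\<Sum>j\<in>J. cc (c j) * V j x) = (\<Sum>l\<in>I. Ft l x * (\<Sum>(r, s)\<in>tri m. cc (c (Inl (l, r, s))) * (vX ^ r * vY ^ s))) +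
      (\<Sum>j\<in>?K. cc (c (Inr j)) * e j)" for c x
  proof -
    have "(\<Sum>j\<in>J. cc (c j) * V j x) = (\<Sum>z\<in>I \<times> tri m. cc (c (Inl z)) * V (Inl z) x) + (\<Sum>j\<in>?K. cc (c (Inr j)) * V (Inr j) x)"
      unfolding J_def using fin by (simp add: sum.Plus)
    also have "(\<Sum>z\<in>I \<times> tri m. cc (c (Inl z)) * V (Inl z) x) = (\<Sum>l\<in>I. \<Sum>z\<in>tri m. cc (c (Inl (l, z))) * V (Inl (l, z)) x)"
      by (simp add: sum.cartesian_product)
    also have "\<dots> = (\<Sum>l\<in>I. Ft l x * (\<Sum>(r, s)\<in>tri m. cc (c (Inl (l, r, s))) * (vX ^ r * vY ^ s)))"
      by (intro sum.cong refl) (simp add: V_def sum_distrib_left case_prod_unfold mult_ac)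
    finally show ?thesis by (simp add: V_def)
  qed
  have Vpf: "polyfun n (\<lambda>x. cf (V j x) r s)" for j r s
  proof (cases j)
    case (Inl a)
    obtain l p q where a: "a = (l, p, q)" by (cases a) auto
    show ?thesis
    proof (cases "l \<in> I")
      case True
      then show ?thesis
        unfolding Inl a V_def sum.case prod.case using Ft(1)[OF True]
        by (auto simp: cf_mult polyfam_def intro!: polyfun_sum polyfun.mult polyfun.const)
    qed (simp add: Inl a V_def polyfun.const)
  qed (simp add: V_def polyfun.const)
  obtain g1 where g1: "polyfun n g1" "g1 x0 \<noteq> 0"
    "\<And>x. g1 x \<noteq> 0 \<Longrightarrow> \<forall>b. \<exists>c. \<forall>z\<in>tri (d + m). (\<Sum>j\<in>J. c j * cf (V j x) (fst z) (snd z)) = b z"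
  proof -
    have "\<exists>c. \<forall>z\<in>tri (d + m). (\<Sum>j\<in>J. c j * cf (V j x0) (fst z) (snd z)) = b z" for b
    proof -
      define G where "G = (\<Sum>z\<in>tri (d + m). cc (b z) * (vX ^ fst z * vY ^ snd z))"
      have cfG: "cf G (fst z) (snd z) = b z" if "z \<in> tri (d + m)" for z
      proof -
        have "cf G (fst z) (snd z) = (\<Sum>z'\<in>tri (d + m). if z' = z then b z' else 0)"
          unfolding G_def cf_simps(5) cf_monomial by (rule sum.cong) (auto simp: prod_eq_iff)
        then show ?thesis using that by simp
      qed
      have tG: "tdeg (d + m) G"
        unfolding G_def by (rule tdeg_simps) (auto simp: tdeg_def tri_def cf_monomial_1)
      \<comment> \<open>\<open>R\<close> has the same jets as \<open>G\<close> at \<open>x0\<close>,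
        so that \<open>G - R\<close> satisfies the multiplicity conditions and \<open>gen\<close>
        applies to it.\<close>
      define R where "R = (\<Sum>j\<in>?K. cc (jet j x0 G) * e j)"
      have "tdeg (0 + d) (cc (jet j x0 G) * e j)" if "j \<in> ?K" for j
        by (rule tdeg_mult[OF tdeg_basic(1) dual(1)[OF that]])
      then have "tdeg (0 + d) R" unfolding R_def by (rule tdeg_simps)
      then have "tdeg (d + m) (G - R)" using tG tdeg_mono[of d R "d + m"] by (intro tdeg_simps) auto
      moreover have "jet j x0 (G - R) = 0" if j: "j \<in> ?K" for j
      proof -
        have "jet j x0 R = (\<Sum>i\<in>?K. if i = j then jet j x0 G else 0)"
          unfolding R_def jet_linear by (rule sum.cong) (use dual(2) j in auto)
        then show ?thesis using j fin by (simp add: jet_linear)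
      qed
      then have "\<forall>i<n. mult_at k (x0 i) (G - R)" unfolding mult_at_iff_jets by blast
      ultimately obtain M where M: "\<forall>l\<in>I. tdeg m (M l)" "G - R = (\<Sum>l\<in>I. F l * M l)" using gen by blast
      define c' where "c' j = (case j of Inl (l, r, s) \<Rightarrow> cf (M l) r s / c l | Inr j \<Rightarrow> jet j x0 G)" for j
      have "Ft l x0 * (\<Sum>(r, s)\<in>tri m. cc (c' (Inl (l, r, s))) * (vX ^ r * vY ^ s)) = F l * M l" if l: "l \<in> I" for l
      proof -
        have "M l = (\<Sum>(r, s)\<in>tri m. cc (cf (M l) r s) * (vX ^ r * vY ^ s))" using poly2_as_sum M(1) l by blast
        also have "\<dots> = cc (c l) * (\<Sum>(r, s)\<in>tri m. cc (c' (Inl (l, r, s))) * (vX ^ r * vY ^ s))"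
          unfolding sum_distrib_left
        proof (rule sum.cong)
          fix z assume "z \<in> tri m"
          obtain r s where "z = (r, s)" by (cases z)
          moreover have "cc (c l) * cc (cf (M l) r s / c l) = cc (cf (M l) r s)"
            unfolding cc_arith(2)[symmetric] using Ft(3)[OF l] by simp
          ultimately show "(case z of (r, s) \<Rightarrow> cc (cf (M l) r s) * (vX ^ r * vY ^ s)) =
            cc (c l) * (case z of (r, s) \<Rightarrow> cc (c' (Inl (l, r, s))) * (vX ^ r * vY ^ s))"
            by (simp add: c'_def mult.assoc[symmetric])
        qed simp
        finally show ?thesis using Ft(4)[OF l] by (simp add: mult_ac)
      qed
      then have "(\<Sum>j\<in>J. cc (c' j) * V j x0) = (\<Sum>l\<in>I. F l * M l) + R"
        unfolding sumJ by (simp add: R_def c'_def)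
      then have "G = (\<Sum>j\<in>J. cc (c' j) * V j x0)" using M(2) by (simp add: diff_eq_eq)
      then have "\<forall>z\<in>tri (d + m). (\<Sum>j\<in>J. c' j * cf (V j x0) (fst z) (snd z)) = b z"
        using cfG by (metis (no_types, lifting) cf_simps(5,6) sum.cong)
      then show ?thesis by blast
    qed
    from polyfun_solvable_open[OF finite_tri[of "d + m"] finJ, of n "\<lambda>z j x. cf (V j x) (fst z) (snd z)" x0, OF Vpf this]
    show ?thesis using that by blast
  qed
  \<comment> \<open>Where \<open>g2\<close> does not vanish the jets of the curves
    \<open>e j\<close> still form an invertible matrix. This excludes contributions of the
    complement to curves that satisfy the conditions at \<open>x\<close>.\<close>
  obtain g2 where g2: "polyfun n g2" "g2 x0 \<noteq> 0"
    "\<And>x. g2 x \<noteq> 0 \<Longrightarrow> \<forall>b. \<exists>c. \<forall>j\<in>?K. (\<Sum>j'\<in>?K. c j' * (if j \<in> ?K \<and> j' \<in> ?K then jet j' x (e j) else 0)) = b j"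
  proof -
    have "polyfun n (\<lambda>x. if j \<in> ?K \<and> j' \<in> ?K then jet j' x (e j) else 0)" for j j'
    proof (cases "j \<in> ?K \<and> j' \<in> ?K")
      case True
      then show ?thesis using polyfun_jet[OF polyfam_const[OF dual(1)], of j j' n k] by simp
    next
      case False
      then have eq: "(if j \<in> ?K \<and> j' \<in> ?K then jet j' x (e j) else 0) = 0" for x by auto
      show ?thesis unfolding eq by (rule polyfun.const)
    qed
    moreover have "\<exists>c. \<forall>j\<in>?K. (\<Sum>j'\<in>?K. c j' * (if j \<in> ?K \<and> j' \<in> ?K then jet j' x0 (e j) else 0)) = b j" for b
    proof (intro exI[of _ b] ballI)
      fix j assume j: "j \<in> ?K"
      have "(\<Sum>j'\<in>?K. b j' * (if j \<in> ?K \<and> j' \<in> ?K then jet j' x0 (e j) else 0)) = (\<Sum>j'\<in>?K. if j' = j then b j else 0)"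
        by (rule sum.cong) (use dual(2) j in auto)
      then show "(\<Sum>j'\<in>?K. b j' * (if j \<in> ?K \<and> j' \<in> ?K then jet j' x0 (e j) else 0)) = b j" using j fin by simp
    qed
    ultimately show ?thesis
      using that polyfun_solvable_open[OF fin(1) fin(1), of n "\<lambda>j j' x. if j \<in> ?K \<and> j' \<in> ?K then jet j' x (e j) else 0" x0] by blast
  qed
  show ?thesis
  proof (intro exI[of _ "\<lambda>x. g1 x * g2 x"] conjI allI impI)
    show "polyfun n (\<lambda>x. g1 x * g2 x)" "g1 x0 * g2 x0 \<noteq> 0" using g1 g2 by (auto intro: polyfun.mult)
    fix x G assume "g1 x * g2 x \<noteq> 0" and G: "tdeg (d + m) G \<and> (\<forall>i<n. mult_at k (x i) G)"
    then have gx: "g1 x \<noteq> 0" "g2 x \<noteq> 0" by auto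
    obtain c where c: "\<forall>z\<in>tri (d + m). (\<Sum>j\<in>J. c j * cf (V j x) (fst z) (snd z)) = cf G (fst z) (snd z)"
      using g1(3)[OF gx(1)] by (elim allE[of _ "\<lambda>z. cf G (fst z) (snd z)"]) blast
    have tV: "tdeg (d + m) (V j x)" if "j \<in> J" for j
    proof (cases j)
      case (Inl a)
      obtain l r s where a: "a = (l, r, s)" by (cases a) auto
      then have l: "l \<in> I" "(r, s) \<in> tri m" using that Inl by (auto simp: J_def)
      then have "tdeg d (Ft l x)" using Ft(1) by (simp add: polyfam_def)
      then show ?thesis using tdeg_mult[OF _ mono[OF l(2), of 1]] l by (simp add: V_def Inl a)
    next
      case (Inr j')
      then have "tdeg d (e j')" using that dual(1) by (auto simp: J_def)
      then show ?thesis using tdeg_mono[of d "e j'" "d + m"] by (simp add: Inr V_def)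
    qed
    have "G = (\<Sum>j\<in>J. cc (c j) * V j x)"
    proof (rule poly2_eqI)
      fix r s
      show "cf G r s = cf (\<Sum>j\<in>J. cc (c j) * V j x) r s"
      proof (cases "(r, s) \<in> tri (d + m)")
        case True
        then show ?thesis using c by (auto simp: cf_simps)
      next
        case False
        then have "d + m < r + s" by (simp add: tri_def)
        then have "cf G r s = 0" "\<And>j. j \<in> J \<Longrightarrow> cf (V j x) r s = 0" using G tV unfolding tdeg_def by blast+
        then show ?thesis by simp
      qed
    qed
    define M where "M l = (\<Sum>(r, s)\<in>tri m. cc (c (Inl (l, r, s))) * (vX ^ r * vY ^ s))" for l
    define \<delta> where "\<delta> j = c (Inr j)" for j
    have Geq: "G = (\<Sum>l\<in>I. Ft l x * M l) + (\<Sum>j\<in>?K. cc (\<delta> j) * e j)"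
      using \<open>G = _\<close> sumJ by (simp add: M_def \<delta>_def)
    have Ftm: "mult_at k (x i) (Ft l x)" if "l \<in> I" "i < n" for l i
      using Ft(2)[OF that(1)] mult_at_iff_jets[of n k x "Ft l x"] that(2) by blast
    have "mult_at k (x i) (\<Sum>l\<in>I. Ft l x * M l)" if "i < n" for i
      using Ftm that by (intro mult_at_sum mult_at_mult_right) auto
    then have "jet j x (\<Sum>l\<in>I. Ft l x * M l) = 0" if "j \<in> ?K" for j using mult_at_iff_jets that by blast
    moreover have "jet j x G = 0" if "j \<in> ?K" for j using G mult_at_iff_jets that by blast
    ultimately have 0: "(\<Sum>j\<in>?K. \<delta> j * jet j' x (e j)) = 0" if "j' \<in> ?K" for j'
      using arg_cong[OF Geq, of "jet j' x"] that by (simp add: jet_linear)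
    \<comment> \<open>Comparing jets shows that \<open>\<delta>\<close> is annihilated by the
      matrix; pairing it with a preimage \<open>b\<close> of the unit vector at \<open>j0\<close>
      isolates the single entry.\<close>
    have "\<delta> j0 = 0" if j0: "j0 \<in> ?K" for j0
    proof -
      obtain b where b: "\<forall>j\<in>?K. (\<Sum>j'\<in>?K. b j' * (if j \<in> ?K \<and> j' \<in> ?K then jet j' x (e j) else 0)) = (if j = j0 then 1 else 0)"
        using g2(3)[OF gx(2)] by (elim allE[of _ "\<lambda>j. if j = j0 then 1 else 0"]) blast
      have "\<delta> j0 = (\<Sum>j\<in>?K. \<delta> j * (if j = j0 then 1 else 0))" using j0 fin by (simp add: if_distrib cong: if_cong)
      also have "\<dots> = (\<Sum>j\<in>?K. \<delta> j * (\<Sum>j'\<in>?K. b j' * jet j' x (e j)))"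
        using b by (intro sum.cong refl arg_cong2[where f = "(*)"]) simp
      also have "\<dots> = (\<Sum>j'\<in>?K. b j' * (\<Sum>j\<in>?K. \<delta> j * jet j' x (e j)))"
        unfolding sum_distrib_left by (subst sum.swap) (simp add: mult_ac)
      also have "\<dots> = 0" using 0 by simp
      finally show ?thesis .
    qed
    then have "G = (\<Sum>l\<in>I. Ft l x * M l)" using Geq by simp
    moreover have "tdeg d (Ft l x)" if "l \<in> I" for l using Ft(1)[OF that] by (simp add: polyfam_def)
    moreover have "tdeg m (M l)" for l
      unfolding M_def using mono by (intro tdeg_simps) (auto simp: case_prod_unfold)
    ultimately show "\<exists>F' M. (\<forall>l\<in>I. tdeg d (F' l) \<and> (\<forall>i<n. mult_at k (x i) (F' l)) \<and> tdeg m (M l)) \<and> G = (\<Sum>l\<in>I. F' l * M l)"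
      using Ftm by (intro exI[of _ "\<lambda>l. Ft l x"] exI[of _ M]) auto
  qed
qed

section \<open>Fourteen points of a four by four grid\<close>

definition gA :: "'a::field_char_0 poly poly" where
  "gA = vX * (vX - cc 1) * (vX - cc 2) * (vX - cc 3)"

definition gB :: "'a::field_char_0 poly poly" where
  "gB = vY * (vY - cc 1) * (vY - cc 2) * (vY - cc 3)"

definition grid :: "('a::field_char_0 \<times> 'a) set" where
  "grid = {0, 1, 2, 3} \<times> {0, 1, 2, 3}"

definition fourteen :: "('a::field_char_0 \<times> 'a) set" where
  "fourteen = grid - {(0, 0), (1, 2)}"

lemma tdeg_linear: "tdeg 1 (vX - cc c)" "tdeg 1 (vY - cc c)" "tdeg 1 vX" "tdeg 1 vY"
  using tdeg_basic(2,3)[of 0] tdeg_basic(1)[of 1 c] by auto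

lemma tdeg_gA: "tdeg 4 gA" and tdeg_gB: "tdeg 4 gB"
proof -
  have "tdeg (1 + 1 + 1 + 1) gA" "tdeg (1 + 1 + 1 + 1) gB"
    unfolding gA_def gB_def by (intro tdeg_mult tdeg_linear)+
  moreover have "1 + 1 + 1 + 1 = (4 :: nat)" by simp
  ultimately show "tdeg 4 gA" "tdeg 4 gB" by (simp_all only:)
qed

lemma tdeg_AB: "tdeg (4 * (i + j)) (gA ^ i * gB ^ j)"
  using tdeg_mult[OF tdeg_power[OF tdeg_gA, of i] tdeg_power[OF tdeg_gB, of j]] by (simp add: algebra_simps)

text \<open>Division by both quartics with a remainder of degree below 4 in each variable. The total
  degree does not grow, because the top terms are pure fourth powers. The last clause handles
  \<open>d < 4\<close>, where the natural number \<open>d - 4\<close> is 0 and would admit constant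
  quotients.\<close>

definition divisible_form :: "nat \<Rightarrow> 'a::field_char_0 poly poly \<Rightarrow> bool" where
  "divisible_form d f \<longleftrightarrow> (\<exists>r g h. f = r + gA * g + gB * h \<and> tdeg d r \<and> (\<forall>a b. cf r a b \<noteq> 0 \<longrightarrow> a < 4 \<and> b < 4) \<and>
    tdeg (d - 4) g \<and> tdeg (d - 4) h \<and> (d < 4 \<longrightarrow> g = 0 \<and> h = 0))"

lemma divisible_form_add:
  assumes "divisible_form d f" "divisible_form d f'" shows "divisible_form d (f + f')"
proof -
  obtain r g h where 1: "f = r + gA * g + gB * h" "tdeg d r" "\<forall>a b. cf r a b \<noteq> 0 \<longrightarrow> a < 4 \<and> b < 4"
    "tdeg (d - 4) g" "tdeg (d - 4) h" "d < 4 \<longrightarrow> g = 0 \<and> h = 0"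
    using assms(1) unfolding divisible_form_def by blast
  obtain r' g' h' where 2: "f' = r' + gA * g' + gB * h'" "tdeg d r'" "\<forall>a b. cf r' a b \<noteq> 0 \<longrightarrow> a < 4 \<and> b < 4"
    "tdeg (d - 4) g'" "tdeg (d - 4) h'" "d < 4 \<longrightarrow> g' = 0 \<and> h' = 0"
    using assms(2) unfolding divisible_form_def by blast
  show ?thesis unfolding divisible_form_def
  proof (intro exI conjI)
    show "f + f' = (r + r') + gA * (g + g') + gB * (h + h')" using 1 2 by (simp add: algebra_simps)
    show "\<forall>a b. cf (r + r') a b \<noteq> 0 \<longrightarrow> a < 4 \<and> b < 4" using 1(3) 2(3) by (metis add_0 cf_simps(1))
  qed (use 1 2 in auto)
qed

lemma divisible_form_mono:
  assumes "divisible_form d f" "d \<le> d'" shows "divisible_form d' f"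
proof -
  obtain r g h where 1: "f = r + gA * g + gB * h" "tdeg d r" "\<forall>a b. cf r a b \<noteq> 0 \<longrightarrow> a < 4 \<and> b < 4"
    "tdeg (d - 4) g" "tdeg (d - 4) h" "d < 4 \<longrightarrow> g = 0 \<and> h = 0"
    using assms(1) unfolding divisible_form_def by blast
  have "tdeg d' r" "tdeg (d' - 4) g" "tdeg (d' - 4) h" using 1 assms(2) by (auto intro: tdeg_mono)
  moreover have "d' < 4 \<longrightarrow> g = 0 \<and> h = 0" using 1 assms(2) by auto
  ultimately show ?thesis unfolding divisible_form_def using 1(1,3) by blast
qed

lemma cc_uminus: "cc (- c) = - cc c"
  by (simp add: cc_def)

lemma cc_nat: "cc 0 = 0" "cc 1 = 1" "cc (numeral k) = numeral k"
  by (simp_all add: cc_def numeral_poly)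

lemma cc_numeral: "cc 0 = 0" "cc 1 = 1" "cc (numeral k) = numeral k" "cc (- 1) = - 1" "cc (- numeral k) = - numeral k"
  by (simp_all only: cc_uminus cc_nat)

lemma gA_expand: "gA = vX ^ 4 + cc (- 6) * vX ^ 3 + cc 11 * vX ^ 2 + cc (- 6) * vX"
  and gB_expand: "gB = vY ^ 4 + cc (- 6) * vY ^ 3 + cc 11 * vY ^ 2 + cc (- 6) * vY"
proof -
  show "gA = vX ^ 4 + cc (- 6) * vX ^ 3 + cc 11 * vX ^ 2 + cc (- 6) * vX"
    unfolding gA_def by (simp add: cc_numeral algebra_simps eval_nat_numeral)
  show "gB = vY ^ 4 + cc (- 6) * vY ^ 3 + cc 11 * vY ^ 2 + cc (- 6) * vY"
    unfolding gB_def by (simp add: cc_numeral algebra_simps eval_nat_numeral)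
qed

lemma tdeg_monomial: "r + s \<le> d \<Longrightarrow> tdeg d (cc c * (vX ^ r * vY ^ s))"
  by (auto simp: tdeg_def cf_monomial_1)

lemma divisible_form_monomial:
  fixes c :: "'a::field_char_0"
  shows "divisible_form (r + s) (cc c * (vX ^ r * vY ^ s))"
proof (induction "r + s" arbitrary: r s c rule: less_induct)
  case less
  have low: "divisible_form (r + s) (cc c' * (vX ^ r' * vY ^ s'))" if "r' + s' < r + s" for c' :: 'a and r' s'
    using less[of r' s' c'] that divisible_form_mono[of "r' + s'" _ "r + s"] by simp
  show ?case
  proof (cases "r \<ge> 4")
    case True
    then obtain r' where r: "r = r' + 4" by (metis add.commute le_Suc_ex)
    have g: "divisible_form (r + s) (gA * (cc c * (vX ^ r' * vY ^ s)))"
      unfolding divisible_form_def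
      by (rule exI[of _ 0], rule exI[of _ "cc c * (vX ^ r' * vY ^ s)"], rule exI[of _ 0])
        (use tdeg_monomial[of r' s "r' + s" c] in \<open>auto simp: r\<close>)
    \<comment> \<open>One rewriting step with X^4 = \<open>gA\<close> + 6 X^3 - 11 X^2 + 6 X; the
      last three terms lower the total degree.\<close>
    have eq: "cc c * (vX ^ r * vY ^ s) = gA * (cc c * (vX ^ r' * vY ^ s)) + cc (6 * c) * (vX ^ (r' + 3) * vY ^ s) +
        cc (- 11 * c) * (vX ^ (r' + 2) * vY ^ s) + cc (6 * c) * (vX ^ (r' + 1) * vY ^ s)"
    proof -
      have "cc (6 * c) = cc 6 * cc c" "cc (- 11 * c) = - (cc 11 * cc c)" "cc (- 6) = (- cc 6 :: 'a poly poly)"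
        by (simp_all add: cc_def)
      then show ?thesis unfolding gA_expand r by (simp add: algebra_simps power_add power_numeral_reduce)
    qed
    show ?thesis
      unfolding eq by (intro divisible_form_add g low) (simp_all add: r)
  next
    case r4: False
    show ?thesis
    proof (cases "s \<ge> 4")
      case True
      then obtain s' where s: "s = s' + 4" by (metis add.commute le_Suc_ex)
      have g: "divisible_form (r + s) (gB * (cc c * (vX ^ r * vY ^ s')))"
        unfolding divisible_form_def
        by (rule exI[of _ 0], rule exI[of _ 0], rule exI[of _ "cc c * (vX ^ r * vY ^ s')"])
          (use tdeg_monomial[of r s' "r + s'" c] in \<open>auto simp: s\<close>)
      have eq: "cc c * (vX ^ r * vY ^ s) = gB * (cc c * (vX ^ r * vY ^ s')) + cc (6 * c) * (vX ^ r * vY ^ (s' + 3)) +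
          cc (- 11 * c) * (vX ^ r * vY ^ (s' + 2)) + cc (6 * c) * (vX ^ r * vY ^ (s' + 1))"
      proof -
        have "cc (6 * c) = cc 6 * cc c" "cc (- 11 * c) = - (cc 11 * cc c)" "cc (- 6) = (- cc 6 :: 'a poly poly)"
          by (simp_all add: cc_def)
        then show ?thesis unfolding gB_expand s by (simp add: algebra_simps power_add power_numeral_reduce)
      qed
      show ?thesis
        unfolding eq by (intro divisible_form_add g low) (simp_all add: s)
    next
      case False
      then show ?thesis
        unfolding divisible_form_def
        by (intro exI[of _ "cc c * (vX ^ r * vY ^ s)"] exI[of _ 0])
          (use tdeg_monomial[of r s "r + s" c] r4 in \<open>auto simp: cf_monomial_1 split: if_splits\<close>)
    qed
  qed
qed

lemma divisible_form_all:
  assumes "tdeg d f" shows "divisible_form d f"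
proof -
  have zero: "divisible_form d 0"
    unfolding divisible_form_def by (intro exI[of _ 0]) auto
  have "divisible_form d (\<Sum>(r, s)\<in>S. cc (cf f r s) * (vX ^ r * vY ^ s))" if "finite S" "S \<subseteq> tri d" for S
    using that
  proof (induction S rule: finite_induct)
    case (insert z S)
    obtain r s where z: "z = (r, s)" by (cases z)
    then have "divisible_form d (cc (cf f r s) * (vX ^ r * vY ^ s))"
      using insert.prems divisible_form_mono[OF divisible_form_monomial, of r s d] by (auto simp: tri_def)
    then show ?case using insert z by (auto intro: divisible_form_add)
  qed (simp add: zero)
  from this[OF finite_tri, of d] show ?thesis using poly2_as_sum[OF assms] by simp
qed

text \<open>Root counting in two rounds: for each of the four abscissas the polynomial in y has
  degree below 4 and four roots; then every coefficient, as a polynomial in x, has four roots as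
  well.\<close>

lemma reduced_zero:
  fixes r :: "'a::field_char_0 poly poly"
  assumes red: "\<And>a b. cf r a b \<noteq> 0 \<Longrightarrow> a < 4 \<and> b < 4" and z: "\<And>p. p \<in> grid \<Longrightarrow> pt (fst p) (snd p) r = 0"
  shows "r = 0"
proof -
  have four: "card {0, 1, 2, 3 :: 'a} = 4" by simp
  have roots: "q = 0" if "degree q < 4" "\<And>x. x \<in> {0, 1, 2, 3 :: 'a} \<Longrightarrow> poly q x = 0" for q :: "'a poly"
  proof (rule ccontr)
    assume "q \<noteq> 0"
    then have "card {x. poly q x = 0} \<le> degree q" by (rule card_poly_roots_bound)
    moreover have "card {0, 1, 2, 3 :: 'a} \<le> card {x. poly q x = 0}"
      by (rule card_mono) (use poly_roots_finite[OF \<open>q \<noteq> 0\<close>] that(2) in auto)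
    ultimately show False using that(1) four by simp
  qed
  have deg: "degree (coeff r j) < 4" for j
    by (rule degree_lessI) (use red in \<open>auto simp: cf_def not_less[symmetric]\<close>)
  have x0: "map_poly (\<lambda>p. poly p x) r = 0" if "x \<in> {0, 1, 2, 3}" for x
  proof (rule roots)
    show "degree (map_poly (\<lambda>p. poly p x) r) < 4"
    proof (rule degree_lessI)
      show "\<forall>k\<ge>4. coeff (map_poly (\<lambda>p. poly p x) r) k = 0"
      proof (intro allI impI)
        fix k :: nat assume "k \<ge> 4"
        then have "coeff r k = 0" using red by (auto simp: poly_eq_iff cf_def not_less[symmetric])
        then show "coeff (map_poly (\<lambda>p. poly p x) r) k = 0" by (simp add: coeff_map_poly)
      qed
    qed simp
    fix y assume "y \<in> {0, 1, 2, 3 :: 'a}"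
    then have "(x, y) \<in> grid" using that by (simp only: grid_def mem_Sigma_iff simp_thms)
    from z[OF this] show "poly (map_poly (\<lambda>p. poly p x) r) y = 0" by (simp add: ev2_def)
  qed
  have "coeff r j = 0" for j
    by (rule roots[OF deg]) (use x0 in \<open>metis coeff_0 coeff_map_poly poly_0\<close>)
  then show ?thesis by (simp add: poly_eq_iff)
qed

section \<open>Powers of the ideal of the grid\<close>

lemma gA_root: "p \<in> grid \<Longrightarrow> mult_at 1 p gA" and gB_root: "p \<in> grid \<Longrightarrow> mult_at 1 p gB"
  unfolding mult_at_1_iff by (auto simp: grid_def gA_def gB_def ev2_id)

lemma mult_AB: "p \<in> grid \<Longrightarrow> mult_at (i + j) p (gA ^ i * gB ^ j)"
  using mult_at_mult[OF mult_at_power[OF gA_root] mult_at_power[OF gB_root], of p i j] by simp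

text \<open>The roots of the quartics are simple, so near every grid point \<open>gA\<close> and
  \<open>gB\<close> are the two local coordinates up to units.\<close>

lemma shift_gA: "p \<in> grid \<Longrightarrow> \<exists>\<alpha>. shift (fst p) (snd p) gA = vX * \<alpha> \<and> cf \<alpha> 0 0 \<noteq> 0"
  and shift_gB: "p \<in> grid \<Longrightarrow> \<exists>\<beta>. shift (fst p) (snd p) gB = vY * \<beta> \<and> cf \<beta> 0 0 \<noteq> 0"
proof -
  assume p: "p \<in> (grid :: ('a \<times> 'a) set)"
  obtain x y where xy: "p = (x, y)" "x \<in> {0, 1, 2, 3}" "y \<in> {0, 1, 2, 3}" using p by (auto simp: grid_def)
  let ?X = "\<lambda>c. vX + cc c :: 'a poly poly" and ?Y = "\<lambda>c. vY + cc c :: 'a poly poly"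
  have s: "shift (fst p) (snd p) gA = ?X x * ?X (x - 1) * ?X (x - 2) * ?X (x - 3)"
    "shift (fst p) (snd p) gB = ?Y y * ?Y (y - 1) * ?Y (y - 2) * ?Y (y - 3)"
    by (simp_all add: gA_def gB_def shift_simps xy cc_arith add_diff_eq)
  have c0: "cf f 0 0 = pt 0 0 f" for f :: "'a poly poly" by (simp add: pt_0_0)
  have A: "\<exists>\<alpha>. f = vX * \<alpha> \<and> cf \<alpha> 0 0 \<noteq> 0" if "f = vX * (?X a * ?X b * ?X c)" "a * b * c \<noteq> 0" for f a b c
    using that by (intro exI[of _ "?X a * ?X b * ?X c"]) (simp add: c0 ev2_id)
  have B: "\<exists>\<alpha>. f = vY * \<alpha> \<and> cf \<alpha> 0 0 \<noteq> 0" if "f = vY * (?Y a * ?Y b * ?Y c)" "a * b * c \<noteq> 0" for f a b c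
    using that by (intro exI[of _ "?Y a * ?Y b * ?Y c"]) (simp add: c0 ev2_id)
  consider "x = 0" | "x = 1" | "x = 2" | "x = 3" using xy by auto
  then show "\<exists>\<alpha>. shift (fst p) (snd p) gA = vX * \<alpha> \<and> cf \<alpha> 0 0 \<noteq> 0"
  proof cases
    case 1 show ?thesis by (rule A[of _ "- 1" "- 2" "- 3"]) (simp_all add: s 1)
  next
    case 2 show ?thesis by (rule A[of _ 1 "- 1" "- 2"]) (simp_all add: s 2 mult_ac)
  next
    case 3 show ?thesis by (rule A[of _ 2 1 "- 1"]) (simp_all add: s 3 mult_ac)
  next
    case 4 show ?thesis by (rule A[of _ 3 2 1]) (simp_all add: s 4 mult_ac)
  qed
  consider "y = 0" | "y = 1" | "y = 2" | "y = 3" using xy by auto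
  then show "\<exists>\<beta>. shift (fst p) (snd p) gB = vY * \<beta> \<and> cf \<beta> 0 0 \<noteq> 0"
  proof cases
    case 1 show ?thesis by (rule B[of _ "- 1" "- 2" "- 3"]) (simp_all add: s 1)
  next
    case 2 show ?thesis by (rule B[of _ 1 "- 1" "- 2"]) (simp_all add: s 2 mult_ac)
  next
    case 3 show ?thesis by (rule B[of _ 2 1 "- 1"]) (simp_all add: s 3 mult_ac)
  next
    case 4 show ?thesis by (rule B[of _ 3 2 1]) (simp_all add: s 4 mult_ac)
  qed
qed

lemma cf_vX_vY_mult: "cf (vX ^ i * vY ^ j * q) a b = (if i \<le> a \<and> j \<le> b then cf q (a - i) (b - j) else 0)"
proof -
  have "cf (vX ^ i * vY ^ j * q) a b = (\<Sum>b'\<le>b. \<Sum>a'\<le>a. if b' = j then (if a' = i then cf q (a - i) (b - j) else 0) else 0)"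
    unfolding cf_mult[of "vX ^ i * vY ^ j"] cf_monomial_1 by (intro sum.cong refl) auto
  also have "\<dots> = (\<Sum>b'\<le>b. if b' = j then (\<Sum>a'\<le>a. if a' = i then cf q (a - i) (b - j) else 0) else 0)"
    by (intro sum.cong refl) auto
  finally show ?thesis by simp
qed

text \<open>Passing from \<open>m\<close> to \<open>m + 1\<close>, the coefficients \<open>g i\<close> must vanish on the grid, so their remainders modulo
  \<open>gA, gB\<close> are zero.\<close>

lemma grid_multiplicity:
  fixes f :: "'a::field_char_0 poly poly"
  assumes "tdeg d f" "\<And>p. p \<in> grid \<Longrightarrow> mult_at m p f" "4 * m \<le> d"
  shows "\<exists>g. f = (\<Sum>i\<le>m. gA ^ i * gB ^ (m - i) * g i) \<and> (\<forall>i\<le>m. tdeg (d - 4 * m) (g i))"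
  using assms
proof (induction m)
  case 0
  then show ?case by (intro exI[of _ "\<lambda>_. f"]) simp
next
  case (Suc m)
  have "mult_at m p f" if "p \<in> grid" for p using Suc.prems(2)[OF that] mult_at_mono by fastforce
  then obtain g where g: "f = (\<Sum>i\<le>m. gA ^ i * gB ^ (m - i) * g i)" "\<And>i. i \<le> m \<Longrightarrow> tdeg (d - 4 * m) (g i)"
    using Suc.IH Suc.prems by auto
  \<comment> \<open>In local coordinates the term with index \<open>k\<close> starts at X^k Y^(m-k),
    so the Taylor coefficient at \<open>(i, m - i)\<close> receives only the value of
    \<open>g i\<close> times a unit.\<close>
  have van: "pt (fst p) (snd p) (g i) = 0" if p: "p \<in> grid" and i: "i \<le> m" for p i
  proof -
    let ?s = "shift (fst p) (snd p)"
    obtain \<alpha> \<beta> where ab: "?s gA = vX * \<alpha>" "cf \<alpha> 0 0 \<noteq> 0" "?s gB = vY * \<beta>" "cf \<beta> 0 0 \<noteq> 0"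
      using shift_gA[OF p] shift_gB[OF p] by blast
    have "?s f = (\<Sum>k\<le>m. vX ^ k * vY ^ (m - k) * (\<alpha> ^ k * \<beta> ^ (m - k) * ?s (g k)))"
      unfolding g(1) by (simp add: shift_simps ab power_mult_distrib mult_ac)
    then have "cf (?s f) i (m - i) = (\<Sum>k\<le>m. if k = i then cf (\<alpha> ^ i * \<beta> ^ (m - i) * ?s (g i)) 0 0 else 0)"
      unfolding cf_simps(5)
      by (simp only: cf_simps(5) cf_vX_vY_mult) (intro sum.cong refl, use i in auto)
    also have "\<dots> = pt 0 0 (\<alpha> ^ i * \<beta> ^ (m - i) * ?s (g i))" using i by (simp add: pt_0_0)
    also have "\<dots> = cf \<alpha> 0 0 ^ i * cf \<beta> 0 0 ^ (m - i) * pt 0 0 (?s (g i))" by (simp add: ev2_id pt_0_0)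
    also have "pt 0 0 (?s (g i)) = pt (fst p) (snd p) (g i)" by (simp add: ev2_shift)
    finally have "cf (?s f) i (m - i) = cf \<alpha> 0 0 ^ i * cf \<beta> 0 0 ^ (m - i) * pt (fst p) (snd p) (g i)" .
    moreover have "cf (?s f) i (m - i) = 0" using Suc.prems(2)[OF p] i by (simp add: mult_at_def vord_def)
    ultimately show ?thesis using ab by simp
  qed
  have "\<exists>g1 h1. g i = gA * g1 + gB * h1 \<and> tdeg (d - 4 * Suc m) g1 \<and> tdeg (d - 4 * Suc m) h1" if i: "i \<le> m" for i
  proof -
    obtain r g1 h1 where r: "g i = r + gA * g1 + gB * h1" "\<forall>a b. cf r a b \<noteq> 0 \<longrightarrow> a < 4 \<and> b < 4"
      "tdeg (d - 4 * m - 4) g1" "tdeg (d - 4 * m - 4) h1"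
      using divisible_form_all[OF g(2)[OF i]] unfolding divisible_form_def by blast
    have "pt (fst p) (snd p) r = 0" if "p \<in> grid" for p
      using van[OF that i] gA_root[OF that] gB_root[OF that] unfolding r(1) mult_at_1_iff by (simp add: ev2_id)
    then have "r = 0" using reduced_zero r(2) by blast
    then show ?thesis using r by (intro exI[of _ g1] exI[of _ h1]) (simp add: diff_diff_eq add.commute)
  qed
  then obtain g1 h1 where gh: "\<And>i. i \<le> m \<Longrightarrow> g i = gA * g1 i + gB * h1 i"
    "\<And>i. i \<le> m \<Longrightarrow> tdeg (d - 4 * Suc m) (g1 i)" "\<And>i. i \<le> m \<Longrightarrow> tdeg (d - 4 * Suc m) (h1 i)" by metis
  \<comment> \<open>Regrouping: the quotient by \<open>gA\<close> raises the exponent of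
    \<open>gA\<close> and moves to the next index, while the quotient by \<open>gB\<close> stays at
    its index.\<close>
  define g' where "g' i = (if i = 0 then 0 else g1 (i - 1)) + (if i \<le> m then h1 i else 0)" for i
  have "f = (\<Sum>i\<le>m. gA ^ Suc i * gB ^ (m - i) * g1 i) + (\<Sum>i\<le>m. gA ^ i * gB ^ (Suc m - i) * h1 i)"
    unfolding g(1) sum.distrib[symmetric]
    by (intro sum.cong refl) (auto simp: gh(1) Suc_diff_le algebra_simps)
  also have "(\<Sum>i\<le>m. gA ^ Suc i * gB ^ (m - i) * g1 i) = (\<Sum>i\<le>Suc m. gA ^ i * gB ^ (Suc m - i) * (if i = 0 then 0 else g1 (i - 1)))"
    by (subst sum.atMost_Suc_shift) simp
  also have "(\<Sum>i\<le>m. gA ^ i * gB ^ (Suc m - i) * h1 i) = (\<Sum>i\<le>Suc m. gA ^ i * gB ^ (Suc m - i) * (if i \<le> m then h1 i else 0))"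
    by simp
  finally have "f = (\<Sum>i\<le>Suc m. gA ^ i * gB ^ (Suc m - i) * g' i)"
    unfolding g'_def sum.distrib[symmetric] distrib_left[symmetric] .
  moreover have "tdeg (d - 4 * Suc m) (g' i)" if "i \<le> Suc m" for i
    unfolding g'_def using gh(2)[of "i - 1"] gh(3)[of i] that by (intro tdeg_simps) auto
  ultimately show ?case by blast
qed

text \<open>Repeated division writes every polynomial, modulo the fourth power of the ideal of the
  grid, in the 10 * 16 products listed in \<open>mono\<close>. Their number equals that of the 160
  jets on the grid.\<close>

lemma grid_span_induct:
  assumes add: "\<And>f g. M f \<Longrightarrow> M g \<Longrightarrow> M (f + g)" and zero: "M 0"
    and high: "\<And>i j g. i + j = 4 \<Longrightarrow> M (gA ^ i * gB ^ j * g)"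
    and mono: "\<And>i j c a b. i + j \<le> 3 \<Longrightarrow> a \<le> 3 \<Longrightarrow> b \<le> 3 \<Longrightarrow> M (gA ^ i * gB ^ j * (cc c * (vX ^ a * vY ^ b)))"
  shows "M f"
proof -
  have "M (gA ^ i * gB ^ j * g)" if "i + j + k = 4" for i j k g
    using that
  proof (induction k arbitrary: i j g)
    case 0
    then show ?case using high by simp
  next
    case (Suc k)
    obtain d where d: "tdeg d g"
    proof
      show "tdeg (degree g + (\<Sum>b\<le>degree g. degree (coeff g b))) g"
        unfolding tdeg_def
      proof (intro allI impI)
        fix r s assume *: "degree g + (\<Sum>b\<le>degree g. degree (coeff g b)) < r + s"
        show "cf g r s = 0"
        proof (cases "s \<le> degree g")
          case True
          then have "degree (coeff g s) \<le> (\<Sum>b\<le>degree g. degree (coeff g b))" by (intro member_le_sum) auto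
          then have "degree (coeff g s) < r" using * True by linarith
          then show ?thesis by (simp add: cf_def coeff_eq_0)
        qed (simp add: cf_def coeff_eq_0)
      qed
    qed
    obtain r g1 h1 where r: "g = r + gA * g1 + gB * h1" "tdeg d r" "\<forall>a b. cf r a b \<noteq> 0 \<longrightarrow> a < 4 \<and> b < 4"
      using divisible_form_all[OF d] unfolding divisible_form_def by blast
    have sum: "M (gA ^ i * gB ^ j * (\<Sum>z\<in>S. cc (cf r (fst z) (snd z)) * (vX ^ fst z * vY ^ snd z)))" if "finite S" for S
      using that
    proof (induction S rule: finite_induct)
      case (insert z S)
      have "M (gA ^ i * gB ^ j * (cc (cf r (fst z) (snd z)) * (vX ^ fst z * vY ^ snd z)))"
      proof (cases "cf r (fst z) (snd z) = 0")
        case False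
        then have "fst z < 4" "snd z < 4" using r(3) by blast+
        then show ?thesis using Suc.prems by (intro mono) auto
      qed (simp add: zero)
      then show ?case using insert add by (simp add: distrib_left)
    qed (simp add: zero)
    have "M (gA ^ i * gB ^ j * r)"
      using sum[OF finite_tri[of d]] poly2_as_sum[OF r(2)] by (simp add: case_prod_unfold)
    moreover have "M (gA ^ Suc i * gB ^ j * g1)" "M (gA ^ i * gB ^ Suc j * h1)"
      using Suc.IH[of "Suc i" j g1] Suc.IH[of i "Suc j" h1] Suc.prems by simp_all
    ultimately have "M (gA ^ i * gB ^ j * r + gA ^ Suc i * gB ^ j * g1 + gA ^ i * gB ^ Suc j * h1)"
      using add by blast
    then show ?case unfolding r(1) by (simp add: algebra_simps)
  qed
  from this[of 0 0 4 f] show ?thesis by simp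
qed

section \<open>Lowering the degree to 16 by corrections of high multiplicity\<close>

lemma grid_fourteen: "grid = fourteen \<union> {(0, 0), (1, 2)}" and fourteen_grid: "p \<in> fourteen \<Longrightarrow> p \<in> grid"
  by (auto simp: grid_def fourteen_def)

lemma tdeg_mult_le: "tdeg i f \<Longrightarrow> tdeg j g \<Longrightarrow> i + j \<le> d \<Longrightarrow> tdeg d (f * g)"
  using tdeg_mult tdeg_mono by blast

lemma tdeg_cc_mult: "tdeg d f \<Longrightarrow> tdeg d (cc c * f)"
  using tdeg_mult_le[OF tdeg_basic(1)[of 0]] by force

lemma tdeg_pow: "tdeg n (vX ^ n)" "tdeg n (vY ^ n)"
  using tdeg_power[OF tdeg_linear(3), of n] tdeg_power[OF tdeg_linear(4), of n] by simp_all

lemma tdeg_cc_linear: "tdeg (Suc 0) (cc u * vX + cc v)" "tdeg (Suc 0) (cc u * vY + cc v)"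
  by (intro tdeg_simps tdeg_basic tdeg_mult_le[OF tdeg_basic(1)[of 0] tdeg_basic(2)[of 0]]
    tdeg_mult_le[OF tdeg_basic(1)[of 0] tdeg_basic(3)[of 0]]; simp)+

text \<open>Corrections whose cubic jets vanish at the fourteen points. Order 2 at the omitted
  points is all that the squares in \<open>quintic_relation\<close> reach, and it still leaves
  values at these points unchanged.\<close>

definition cubic_mult :: "'a::field_char_0 poly poly \<Rightarrow> bool" where
  "cubic_mult h \<longleftrightarrow> (\<forall>p\<in>fourteen. mult_at 4 p h) \<and> mult_at 2 (0, 0) h \<and> mult_at 2 (1, 2) h"

text \<open>The degree of \<open>f\<close> can be lowered to 16 without touching its cubic jets at
  the fourteen points or its values at the two omitted ones.\<close>

definition interpolable :: "'a::field_char_0 poly poly \<Rightarrow> bool" where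
  "interpolable f \<longleftrightarrow> (\<exists>f' h. f = f' + h \<and> tdeg 16 f' \<and> cubic_mult h)"

lemma interpolableI: "tdeg 16 f \<Longrightarrow> interpolable f" "cubic_mult f \<Longrightarrow> interpolable f"
proof -
  have "cubic_mult 0" by (simp add: cubic_mult_def mult_at_def shift_simps vord_simps(3))
  then show "tdeg 16 f \<Longrightarrow> interpolable f" "cubic_mult f \<Longrightarrow> interpolable f"
    unfolding interpolable_def
    by (rule_tac exI[of _ f], rule_tac exI[of _ 0], simp) (rule_tac exI[of _ 0], rule_tac exI[of _ f], simp add: tdeg_simps)
qed

lemma interpolable_add:
  assumes "interpolable f" "interpolable g" shows "interpolable (f + g)"
proof -
  obtain f' h where 1: "f = f' + h" "tdeg 16 f'" "cubic_mult h" using assms(1) unfolding interpolable_def by blast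
  obtain g' k where 2: "g = g' + k" "tdeg 16 g'" "cubic_mult k" using assms(2) unfolding interpolable_def by blast
  show ?thesis unfolding interpolable_def
    by (rule exI[of _ "f' + g'"], rule exI[of _ "h + k"])
      (use 1 2 in \<open>auto simp: cubic_mult_def intro: mult_at_add\<close>)
qed

lemma interpolable_scale:
  assumes "interpolable f" shows "interpolable (cc c * f)"
proof -
  obtain f' h where 1: "f = f' + h" "tdeg 16 f'" "cubic_mult h" using assms(1) unfolding interpolable_def by blast
  show ?thesis unfolding interpolable_def
    by (rule exI[of _ "cc c * f'"], rule exI[of _ "cc c * h"])
      (use 1 tdeg_mult[OF tdeg_basic(1)[of 0 c], of 16 f'] in \<open>auto simp: cubic_mult_def distrib_left intro: mult_at_mult_left\<close>)
qed

lemma interpolable_comb: "interpolable f \<Longrightarrow> interpolable g \<Longrightarrow> interpolable (cc a * f + cc b * g)"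
  by (intro interpolable_add interpolable_scale)

lemma interpolable_mod: "interpolable f \<Longrightarrow> tdeg 16 (g - f) \<Longrightarrow> interpolable g"
  using interpolable_add[OF _ interpolableI(1), of f "g - f"] by simp

text \<open>Only terms of degree 5 and 6 matter: every product here is later multiplied by a factor
  of degree 12, and 4 + 12 does not exceed 16.\<close>

lemma cubic_top_terms:
  fixes \<alpha> \<beta> :: "'a::field_char_0"
  assumes u: "tdeg (Suc 0) u" and v: "tdeg (Suc 0) v"
  shows "tdeg 4 (vX ^ 3 * vY ^ 3 + cc \<alpha> * (vX ^ 2 * vY ^ 3) + cc \<beta> * (vX ^ 3 * vY ^ 2) -
      (vX ^ 3 + cc \<alpha> * vX ^ 2 + u) * (vY ^ 3 + cc \<beta> * vY ^ 2 + v))"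
    and "tdeg 4 (vX ^ 3 * vY ^ 2 - (vX ^ 3 + cc \<alpha> * vX ^ 2 + u) * (vY ^ 2 + v))"
    and "tdeg 4 (vX ^ 2 * vY ^ 3 - (vX ^ 2 + u) * (vY ^ 3 + cc \<beta> * vY ^ 2 + v))"
proof -
  note t = tdeg_mult_le[OF tdeg_pow(1) tdeg_pow(2)] tdeg_mult_le[OF tdeg_pow(1) v] tdeg_mult_le[OF u tdeg_pow(2)]
    tdeg_mult_le[OF u v]
  have "tdeg 4 (- (cc \<alpha> * (cc \<beta> * (vX ^ 2 * vY ^ 2)) + vX ^ 3 * v + cc \<alpha> * (vX ^ 2 * v) + u * vY ^ 3 + cc \<beta> * (u * vY ^ 2) + u * v))"
    by (intro tdeg_simps(1,3) tdeg_cc_mult; rule t; simp)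
  then show "tdeg 4 (vX ^ 3 * vY ^ 3 + cc \<alpha> * (vX ^ 2 * vY ^ 3) + cc \<beta> * (vX ^ 3 * vY ^ 2) -
      (vX ^ 3 + cc \<alpha> * vX ^ 2 + u) * (vY ^ 3 + cc \<beta> * vY ^ 2 + v))"
    by (simp add: algebra_simps)
  have "tdeg 4 (- (vX ^ 3 * v + cc \<alpha> * (vX ^ 2 * vY ^ 2) + cc \<alpha> * (vX ^ 2 * v) + u * vY ^ 2 + u * v))"
    by (intro tdeg_simps(1,3) tdeg_cc_mult; rule t; simp)
  then show "tdeg 4 (vX ^ 3 * vY ^ 2 - (vX ^ 3 + cc \<alpha> * vX ^ 2 + u) * (vY ^ 2 + v))"
    by (simp add: algebra_simps)
  have "tdeg 4 (- (u * vY ^ 3 + cc \<beta> * (vX ^ 2 * vY ^ 2) + cc \<beta> * (u * vY ^ 2) + vX ^ 2 * v + u * v))"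
    by (intro tdeg_simps(1,3) tdeg_cc_mult; rule t; simp)
  then show "tdeg 4 (vX ^ 2 * vY ^ 3 - (vX ^ 2 + u) * (vY ^ 3 + cc \<beta> * vY ^ 2 + v))"
    by (simp add: algebra_simps)
qed

text \<open>\<open>a * b\<close> is a product of cubics that vanishes at all grid points but one, which is not among the fourteen.\<close>

locale corner =
  fixes a b r s :: "'a::field_char_0 poly poly" and a2 a1 a0 b2 b1 b0 r1 r0 s1 s0 \<kappa> \<mu> :: 'a
  assumes a: "a = vX ^ 3 + cc a2 * vX ^ 2 + (cc a1 * vX + cc a0)"
    and b: "b = vY ^ 3 + cc b2 * vY ^ 2 + (cc b1 * vY + cc b0)"
    and r: "r = vX ^ 2 + (cc r1 * vX + cc r0)" and s: "s = vY ^ 2 + (cc s1 * vY + cc s0)"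
    and sq: "a ^ 2 = cc \<kappa> * a + gA * r" "b ^ 2 = cc \<mu> * b + gB * s"
    and van: "\<And>p. p \<in> fourteen \<Longrightarrow> mult_at 1 p (a * b)"
begin

text \<open>\<open>a * b * W\<close> has multiplicity 1 + 3 at the fourteen points and 3 on the rest
  of the grid, hence it is an admissible correction. Modulo degree 16 only its terms of bidegree (3,
  3), (2, 3) and (3, 2) are left.\<close>

lemma top_relation:
  assumes ij: "i + j = 3"
  defines "W \<equiv> gA ^ i * gB ^ j"
  shows "interpolable ((vX ^ 3 * vY ^ 3 + cc a2 * (vX ^ 2 * vY ^ 3) + cc b2 * (vX ^ 3 * vY ^ 2)) * W)"
proof (rule interpolable_mod)
  have m: "mult_at 3 p W" if "p \<in> grid" for p using mult_AB[OF that, of i j] ij unfolding W_def by simp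
  have "mult_at (1 + 3) p (a * b * W)" if "p \<in> fourteen" for p
    using that by (intro mult_at_mult van m fourteen_grid)
  moreover have "mult_at 2 p (a * b * W)" if "p \<in> grid" for p
    using mult_at_mono[OF m[OF that], of 2] by (intro mult_at_mult_left) simp
  ultimately show "interpolable (a * b * W)"
    by (intro interpolableI(2)) (simp add: cubic_mult_def grid_fourteen)
  have "tdeg 12 W" using tdeg_AB[of i j] ij by (simp add: W_def)
  then show "tdeg 16 ((vX ^ 3 * vY ^ 3 + cc a2 * (vX ^ 2 * vY ^ 3) + cc b2 * (vX ^ 3 * vY ^ 2)) * W - a * b * W)"
    using tdeg_mult_le[OF cubic_top_terms(1)[OF tdeg_cc_linear(1) tdeg_cc_linear(2)], of 12 W 16]
    unfolding a b by (simp add: left_diff_distrib)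
qed

text \<open>\<open>(a * b) ^ 2 * V\<close> reaches multiplicity 2 + 2 at the fourteen points.
  Expanding by \<open>sq\<close> gives four terms: the multiple of \<open>a * b * V\<close> has
  degree 14, the term with \<open>gA * gB * V\<close> has multiplicity 4 on the whole grid, and the
  mixed terms leave two monomials multiplied by products of three quartics.\<close>

lemma quintic_relation:
  assumes ij: "i + j = 2"
  defines "V \<equiv> gA ^ i * gB ^ j"
  shows "interpolable (cc \<kappa> * (vX ^ 3 * vY ^ 2 * (gB * V)) + cc \<mu> * (vX ^ 2 * vY ^ 3 * (gA * V)))"
proof (rule interpolable_mod)
  have m: "mult_at 2 p V" if "p \<in> grid" for p using mult_AB[OF that, of i j] ij unfolding V_def by simp
  have "mult_at (2 * 1 + 2) p ((a * b) ^ 2 * V)" if "p \<in> fourteen" for p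
    using that by (intro mult_at_mult mult_at_power van m fourteen_grid)
  moreover have "mult_at 2 p ((a * b) ^ 2 * V)" if "p \<in> grid" for p
    using m[OF that] by (intro mult_at_mult_left)
  ultimately have sqr: "interpolable ((a * b) ^ 2 * V)"
    by (intro interpolableI(2)) (simp add: cubic_mult_def grid_fourteen)
  have "mult_at 4 p (gA * gB * V)" if "p \<in> grid" for p
    using mult_AB[OF that, of "Suc i" "Suc j"] ij unfolding V_def by (simp add: mult_ac)
  then have mixed: "interpolable (gA * gB * V * (r * s))"
    by (intro interpolableI(2)) (auto simp: cubic_mult_def grid_fourteen
      intro!: mult_at_mult_right[of _ _ "gA * gB * V"] intro: mult_at_mono[of 4 _ _ 2])
  show "interpolable (cc 1 * ((a * b) ^ 2 * V) + cc (- 1) * (gA * gB * V * (r * s)))"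
    by (intro interpolable_comb sqr mixed)
  have dV: "tdeg 8 V" using tdeg_AB[of i j] ij by (simp add: V_def)
  have d1: "tdeg 12 (gB * V)" "tdeg 12 (gA * V)" using tdeg_mult[OF tdeg_gA dV] tdeg_mult[OF tdeg_gB dV] by simp_all
  have E: "tdeg 16 ((vX ^ 3 * vY ^ 2 - a * s) * (gB * V))" "tdeg 16 ((vX ^ 2 * vY ^ 3 - r * b) * (gA * V))"
    unfolding a b r s
    by (intro tdeg_mult_le[OF cubic_top_terms(2)[OF tdeg_cc_linear(1) tdeg_cc_linear(2)] d1(1)]
        tdeg_mult_le[OF cubic_top_terms(3)[OF tdeg_cc_linear(1) tdeg_cc_linear(2)] d1(2)]; simp)+
  have "tdeg 3 a" "tdeg 3 b"
    unfolding a b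
    by (intro tdeg_simps(1) tdeg_pow tdeg_mono[OF tdeg_cc_linear(1)] tdeg_mono[OF tdeg_cc_linear(2)]
        tdeg_mult_le[OF tdeg_basic(1)[of 0] tdeg_pow(1)] tdeg_mult_le[OF tdeg_basic(1)[of 0] tdeg_pow(2)]; simp)+
  then have ab: "tdeg 16 (a * b * V)" by (intro tdeg_mult_le[OF tdeg_mult[of 3 a 3 b] dV]) auto
  have "tdeg 16 (cc \<kappa> * ((vX ^ 3 * vY ^ 2 - a * s) * (gB * V)) + cc \<mu> * ((vX ^ 2 * vY ^ 3 - r * b) * (gA * V)) - cc \<kappa> * (cc \<mu> * (a * b * V)))"
    by (intro tdeg_simps(1,2) tdeg_cc_mult E ab)
  moreover have "(a * b) ^ 2 = (cc \<kappa> * a + gA * r) * (cc \<mu> * b + gB * s)" unfolding power_mult_distrib sq ..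
  ultimately show "tdeg 16 (cc \<kappa> * (vX ^ 3 * vY ^ 2 * (gB * V)) + cc \<mu> * (vX ^ 2 * vY ^ 3 * (gA * V)) -
      (cc 1 * ((a * b) ^ 2 * V) + cc (- 1) * (gA * gB * V * (r * s))))"
    by (simp add: cc_numeral algebra_simps)
qed

end

text \<open>The omitted point is (0, 0) here and (1, 2) in \<open>corner_2\<close>. If c is the
  omitted abscissa, then a * (X - c) = \<open>gA\<close>. With \<kappa> = a(c) and r = (a -
  \<kappa>) / (X - c) this gives a^2 = \<kappa> a + a (a - \<kappa>) = \<kappa> a +
  \<open>gA\<close> r. The constants for \<open>b\<close> arise in the same way from the
  ordinate.\<close>

lemma corner_1: "corner ((vX - cc 1) * (vX - cc 2) * (vX - cc 3)) ((vY - cc 1) * (vY - cc 2) * (vY - cc 3))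
    (vX ^ 2 + (cc (- 6) * vX + cc 11)) (vY ^ 2 + (cc (- 6) * vY + cc 11))
    (- 6) 11 (- 6) (- 6) 11 (- 6) (- 6) 11 (- 6) 11 (- 6) (- 6 :: 'a::field_char_0)"
proof
  show "mult_at 1 p ((vX - cc 1) * (vX - cc 2) * (vX - cc 3) * ((vY - cc 1) * (vY - cc 2) * (vY - cc 3)))" if "p \<in> fourteen" for p :: "'a \<times> 'a"
    using that unfolding mult_at_1_iff by (auto simp: grid_def fourteen_def ev2_id)
qed (simp_all add: cc_numeral gA_def gB_def algebra_simps eval_nat_numeral)

lemma corner_2: "corner (vX * (vX - cc 2) * (vX - cc 3)) (vY * (vY - cc 1) * (vY - cc 3))
    (vX ^ 2 + (cc (- 4) * vX + cc 2)) (vY ^ 2 + (cc (- 2) * vY + cc (- 1)))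
    (- 5) 6 0 (- 4) 3 0 (- 4) 2 (- 2) (- 1) 2 (- 2 :: 'a::field_char_0)"
proof
  show "mult_at 1 p (vX * (vX - cc 2) * (vX - cc 3) * (vY * (vY - cc 1) * (vY - cc 3)))" if "p \<in> fourteen" for p :: "'a \<times> 'a"
    using that unfolding mult_at_1_iff by (auto simp: grid_def fourteen_def ev2_id)
qed (simp_all add: cc_numeral gA_def gB_def algebra_simps eval_nat_numeral)

lemma cc_comb: "cc a * (cc b * x + cc c * y) + cc a' * (cc b' * x + cc c' * y) = cc (a * b + a' * b') * x + cc (a * c + a' * c') * y"
proof -
  have h: "cc (u + v) = cc u + cc v" "cc (u * v) = cc u * cc v" for u v :: 'a by (simp_all add: cc_def)
  show ?thesis unfolding h by (simp add: algebra_simps)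
qed

text \<open>For each of the four \<open>W\<close> three monomials exceed degree 16. Both corners
  give one top relation per \<open>W\<close>, and one quintic relation for each of the three
  products of two quartics. The quintic relations link different \<open>W\<close> and supply what
  the top relations alone cannot.\<close>

lemma interpolable_top:
  assumes ij: "i + j = 3"
  defines "W \<equiv> gA ^ i * gB ^ j :: 'a::field_char_0 poly poly"
  shows "interpolable (vX ^ 3 * vY ^ 3 * W)" "interpolable (vX ^ 2 * vY ^ 3 * W)" "interpolable (vX ^ 3 * vY ^ 2 * W)"
proof -
  let ?e0 = "vX ^ 3 * vY ^ 3 * W" and ?e1 = "vX ^ 2 * vY ^ 3 * W" and ?e2 = "vX ^ 3 * vY ^ 2 * W"
  have R1: "interpolable (?e0 + cc (- 6) * ?e1 + cc (- 6) * ?e2)"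
    using corner.top_relation[OF corner_1 ij] by (simp add: W_def algebra_simps)
  have R2: "interpolable (?e0 + cc (- 5) * ?e1 + cc (- 4) * ?e2)"
    using corner.top_relation[OF corner_2 ij] by (simp add: W_def algebra_simps)
  \<comment> \<open>The difference of the two top relations removes the term of degree 18.\<close>
  have R3: "interpolable (?e1 + cc 2 * ?e2)"
    using interpolable_comb[OF R2 R1, of 1 "- 1"] by (simp add: cc_numeral algebra_simps)
  have V: "interpolable (vX ^ 3 * vY ^ 2 * (gB * V))" "interpolable (vX ^ 2 * vY ^ 3 * (gA * V))"
    if "i' + j' = 2" "V = gA ^ i' * gB ^ j'" for i' j' V
  proof -
    let ?x = "vX ^ 3 * vY ^ 2 * (gB * V)" and ?y = "vX ^ 2 * vY ^ 3 * (gA * V)"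
    have S1: "interpolable (cc (- 6) * ?x + cc (- 6) * ?y)"
      using corner.quintic_relation[OF corner_1 that(1)] by (simp only: that(2))
    have S2: "interpolable (cc 2 * ?x + cc (- 2) * ?y)"
      using corner.quintic_relation[OF corner_2 that(1)] by (simp only: that(2))
    \<comment> \<open>The weights invert the matrix with rows (-6, -6) and (2, -2), of determinant
      24. Omitting (0, 0) and (1, 1) would replace the second row by (2, 2), proportional to the
      first; this is why the second omitted point is off the diagonal.\<close>
    show "interpolable ?x" "interpolable ?y"
      using interpolable_comb[OF S1 S2, of "- 1 / 12" "1 / 4"] interpolable_comb[OF S1 S2, of "- 1 / 12" "- 1 / 4"]
      unfolding cc_comb by (simp_all add: cc_numeral)
  qed
  \<comment> \<open>A quintic relation yields the monomial matching a factor of \<open>W\<close>: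
    \<open>?e1\<close> from a factor \<open>gA\<close>, \<open>?e2\<close> from a factor
    \<open>gB\<close>. \<open>R3\<close> supplies the other one. \<open>gA ^ 3\<close> has no factor
    \<open>gB\<close> and needs its own case.\<close>
  have e12: "interpolable ?e1 \<and> interpolable ?e2"
  proof (cases j)
    case 0
    then have "W = gA * (gA ^ 2 * gB ^ 0)" using ij by (simp add: W_def eval_nat_numeral)
    then have 1: "interpolable ?e1" using V(2)[of 2 0] by simp
    have "interpolable (cc 1 * ?e1 + cc 2 * ?e2)" "interpolable (cc 1 * ?e1 + cc 0 * ?e2)"
      using R3 1 by (simp_all add: cc_numeral)
    from interpolable_comb[OF this, of "1 / 2" "- 1 / 2"] have "interpolable ?e2"
      unfolding cc_comb by (simp add: cc_numeral)
    then show ?thesis using 1 by simp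
  next
    case (Suc j')
    then have "W = gB * (gA ^ i * gB ^ j')" by (simp add: W_def mult_ac)
    then have 2: "interpolable ?e2" using V(1)[of i j'] ij Suc by simp
    have "interpolable ?e1"
      using interpolable_comb[OF R3 2, of 1 "- 2"] by (simp add: cc_numeral algebra_simps)
    then show ?thesis using 2 by simp
  qed
  then show "interpolable ?e1" "interpolable ?e2" by simp_all
  have "interpolable ((?e0 + cc (- 6) * ?e1 + cc (- 6) * ?e2) + (cc 6 * ?e1 + cc 6 * ?e2))"
    using e12 by (intro interpolable_add R1 interpolable_comb) simp_all
  then show "interpolable ?e0" by (simp add: cc_numeral algebra_simps)
qed

text \<open>A reduced product exceeds degree 16 only if three quartics occur and the two remaining
  exponents add up to 5 or 6, which leaves the three monomials of
  \<open>interpolable_top\<close>.\<close>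

lemma interpolable_all: "interpolable f"
proof (induction f rule: grid_span_induct)
  case (1 f g)
  then show ?case by (rule interpolable_add)
next
  case 2
  show ?case by (rule interpolableI(1)) (rule tdeg_simps)
next
  case (3 i j g)
  have "mult_at 4 p (gA ^ i * gB ^ j * g)" if "p \<in> grid" for p
    using mult_AB[OF that, of i j] 3 by (simp add: mult_at_mult_right)
  then show ?case
    by (intro interpolableI(2)) (auto simp: cubic_mult_def grid_fourteen intro: mult_at_mono[of 4 _ _ 2])
next
  case (4 i j c a b)
  show ?case
  proof (cases "4 * (i + j) + (a + b) \<le> 16")
    case True
    then show ?thesis
      by (intro interpolableI(1) tdeg_mult_le[OF tdeg_AB tdeg_monomial[OF order.refl]])
  next
    case False
    with 4 have ij: "i + j = 3" by presburger
    have "a = 3 \<and> b = 3 \<or> a = 2 \<and> b = 3 \<or> a = 3 \<and> b = 2" using 4 False by presburger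
    then have "interpolable (vX ^ a * vY ^ b * (gA ^ i * gB ^ j))"
      using interpolable_top[OF ij] by auto
    from interpolable_scale[OF this, of c] show ?thesis by (simp add: mult_ac)
  qed
qed

section \<open>Independence and generation at the special position\<close>

lemma grid_reduction: "\<exists>h. tdeg 18 h \<and> (\<forall>p\<in>grid. mult_at 4 p (f - h))"
proof (induction f rule: grid_span_induct)
  case (1 f g)
  then obtain h k where "tdeg 18 h" "\<forall>p\<in>grid. mult_at 4 p (f - h)" "tdeg 18 k" "\<forall>p\<in>grid. mult_at 4 p (g - k)" by blast
  then show ?case
    by (intro exI[of _ "h + k"]) (auto simp: add_diff_add intro: mult_at_add)
next
  case 2
  have "vord 4 0" by auto
  then show ?case by (intro exI[of _ 0]) (auto simp: mult_at_def shift_simps)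
next
  case (3 i j g)
  have "mult_at 4 p (gA ^ i * gB ^ j * g)" if "p \<in> grid" for p
    using mult_AB[OF that, of i j] 3 by (simp add: mult_at_mult_right)
  then show ?case by (intro exI[of _ 0]) auto
next
  case (4 i j c a b)
  have "vord 4 0" by auto
  \<comment> \<open>At most three quartics and two exponents up to 3: 4 * 3 + 3 + 3 = 18.\<close>
  moreover have "tdeg 18 (gA ^ i * gB ^ j * (cc c * (vX ^ a * vY ^ b)))"
    using 4 by (intro tdeg_mult_le[OF tdeg_AB tdeg_monomial[OF order.refl]]) simp
  ultimately show ?case
    by (intro exI[of _ "gA ^ i * gB ^ j * (cc c * (vX ^ a * vY ^ b))"]) (auto simp: mult_at_def shift_simps)
qed

text \<open>The idempotent of the Chinese remainder theorem modulo fourth powers. The Lagrange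
  polynomial \<open>\<delta>\<close> is 1 at \<open>p\<close> and 0 at the other grid points; its
  fourth power has order 4 there, and 1 - (1 - x)^4 sharpens the value 1 at \<open>p\<close> to
  order 4 while remaining divisible by x.\<close>

lemma grid_idempotent:
  assumes p: "p \<in> grid"
  shows "\<exists>\<epsilon>. (\<forall>q\<in>grid. q \<noteq> p \<longrightarrow> mult_at 4 q \<epsilon>) \<and> mult_at 4 p (1 - \<epsilon>)"
proof -
  define S :: "'a set" where "S = {0, 1, 2, 3}"
  have S: "finite S" "grid = S \<times> S" by (simp_all add: S_def grid_def)
  obtain a b where ab: "p = (a, b)" "a \<in> S" "b \<in> S" using p by (auto simp: S)
  define D where "D = (\<Prod>c\<in>S - {a}. vX - cc c) * (\<Prod>c\<in>S - {b}. vY - cc c)"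
  have D: "pt x y D = (\<Prod>c\<in>S - {a}. x - c) * (\<Prod>c\<in>S - {b}. y - c)" for x y
    unfolding D_def ev2_id ..
  define \<delta> where "\<delta> = cc (1 / pt a b D) * D"
  have "pt a b D \<noteq> 0" using S(1) by (auto simp: D)
  then have "mult_at 1 p (1 - \<delta>)" unfolding mult_at_1_iff by (simp add: ab \<delta>_def ev2_id)
  moreover have "1 - \<delta> ^ 4 = (1 - \<delta>) * (1 + \<delta> + \<delta> ^ 2 + \<delta> ^ 3)" by (simp add: algebra_simps eval_nat_numeral)
  ultimately have 1: "mult_at 4 p ((1 - \<delta> ^ 4) ^ 4)"
    using mult_at_power[of 1 p "1 - \<delta> ^ 4" 4] mult_at_mult_right[of 1 p "1 - \<delta>"] by simp
  have 0: "mult_at 4 q (\<delta> ^ 4)" if "q \<in> grid" "q \<noteq> p" for q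
  proof -
    have "fst q \<in> S - {a} \<or> snd q \<in> S - {b}" using that ab by (cases q) (auto simp: S)
    then have "pt (fst q) (snd q) D = 0" using S(1) by (auto simp: D)
    then have "mult_at 1 q \<delta>" unfolding mult_at_1_iff by (simp add: \<delta>_def ev2_id)
    then show ?thesis using mult_at_power[of 1 q \<delta> 4] by simp
  qed
  have "1 - (1 - x) ^ 4 = x * (4 - 6 * x + 4 * x ^ 2 - x ^ 3)" for x :: "'a poly poly"
    by (simp add: algebra_simps eval_nat_numeral)
  then have "mult_at 4 q (1 - (1 - \<delta> ^ 4) ^ 4)" if "q \<in> grid" "q \<noteq> p" for q
    using 0[OF that] mult_at_mult_right by metis
  then show ?thesis using 1 by (intro exI[of _ "1 - (1 - \<delta> ^ 4) ^ 4"]) simp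
qed

text \<open>These are 140 conditions on a space of dimension 153.\<close>

lemma fourteen_duals:
  fixes p :: "'a::field_char_0 \<times> 'a"
  assumes p: "p \<in> fourteen" and rs: "r + s < 4"
  shows "\<exists>e. tdeg 16 e \<and> (\<forall>q\<in>fourteen. \<forall>r' s'. r' + s' < 4 \<longrightarrow>
    cf (shift (fst q) (snd q) e) r' s' = (if q = p \<and> r' = r \<and> s' = s then 1 else 0))"
proof -
  obtain \<epsilon> where \<epsilon>: "\<And>q. q \<in> grid \<Longrightarrow> q \<noteq> p \<Longrightarrow> mult_at 4 q \<epsilon>" "mult_at 4 p (1 - \<epsilon>)"
    using grid_idempotent[OF fourteen_grid[OF p]] by blast
  \<comment> \<open>\<open>\<epsilon> * m\<close> has the prescribed cubic jet at \<open>p\<close>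
    and zero jets at the other grid points. Lowering its degree to 16 subtracts a correction that is
    invisible at the fourteen points.\<close>
  define m where "m = (vX - cc (fst p)) ^ r * (vY - cc (snd p)) ^ s"
  obtain e h where e: "\<epsilon> * m = e + h" "tdeg 16 e" "cubic_mult h"
    using interpolable_all[of "\<epsilon> * m"] unfolding interpolable_def by blast
  have sm: "shift (fst p) (snd p) m = vX ^ r * vY ^ s" by (simp add: m_def shift_simps)
  have "cf (shift (fst q) (snd q) e) r' s' = (if q = p \<and> r' = r \<and> s' = s then 1 else 0)"
    if q: "q \<in> fourteen" and rs': "r' + s' < 4" for q r' s'
  proof -
    have z: "cf (shift (fst q) (snd q) f) r' s' = 0" if "mult_at 4 q f" for f
      using that rs' by (simp add: mult_at_def vord_def)
    have h: "mult_at 4 q h" using e(3) q by (simp add: cubic_mult_def)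
    show ?thesis
    proof (cases "q = p")
      case True
      define Z where "Z = (1 - \<epsilon>) * m + h"
      have "e = m - Z" using e(1) by (simp add: Z_def algebra_simps)
      moreover have "mult_at 4 q Z" using \<epsilon>(2) h True unfolding Z_def by (intro mult_at_add mult_at_mult_right) simp_all
      ultimately have "cf (shift (fst q) (snd q) e) r' s' = cf (shift (fst q) (snd q) m) r' s'"
        using z by (simp add: shift_simps)
      then show ?thesis using True sm by (simp add: cf_monomial_1)
    next
      case False
      have "e = \<epsilon> * m - h" using e(1) by simp
      then have "mult_at 4 q e"
        using \<epsilon>(1)[OF fourteen_grid[OF q] False] h by (auto intro: mult_at_diff mult_at_mult_right)
      then show ?thesis using z False by simp
    qed
  qed
  then show ?thesis using e(2) by blast
qed

text \<open>The products of four quartics all vanish at the two omitted points as well, so they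
  cannot generate on their own. \<open>F\<close> repairs this: the sum of the two idempotents is 1
  at the omitted points, and lowering its degree does not change values there.\<close>

lemma fourteen_separating:
  "\<exists>F :: 'a::field_char_0 poly poly. tdeg 16 F \<and> (\<forall>p\<in>fourteen. mult_at 4 p F) \<and> mult_at 1 (0, 0) (1 - F) \<and> mult_at 1 (1, 2) (1 - F)"
proof -
  have g: "(0, 0) \<in> (grid :: ('a \<times> 'a) set)" "(1, 2) \<in> (grid :: ('a \<times> 'a) set)" by (auto simp: grid_def)
  obtain \<epsilon> where e: "\<And>q. q \<in> grid \<Longrightarrow> q \<noteq> (0, 0) \<Longrightarrow> mult_at 4 q \<epsilon>" "mult_at 4 (0, 0) (1 - \<epsilon> :: 'a poly poly)"
    using grid_idempotent[OF g(1)] by blast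
  obtain \<eta> where n: "\<And>q. q \<in> grid \<Longrightarrow> q \<noteq> (1, 2) \<Longrightarrow> mult_at 4 q \<eta>" "mult_at 4 (1, 2) (1 - \<eta> :: 'a poly poly)"
    using grid_idempotent[OF g(2)] by blast
  obtain F h where F: "\<epsilon> + \<eta> = F + h" "tdeg 16 F" "cubic_mult h"
    using interpolable_all[of "\<epsilon> + \<eta>"] unfolding interpolable_def by blast
  have "F = \<epsilon> + \<eta> - h" using F(1) by simp
  moreover have "mult_at 4 p (\<epsilon> + \<eta> - h)" if "p \<in> fourteen" for p
    using that F(3) e(1)[of p] n(1)[of p]
    by (intro mult_at_diff mult_at_add) (auto simp: cubic_mult_def fourteen_def)
  moreover have "1 - F = (1 - \<epsilon>) - \<eta> + h" "1 - F = (1 - \<eta>) - \<epsilon> + h" using F(1) by (simp_all add: algebra_simps)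
  moreover have "mult_at 1 (0, 0) ((1 - \<epsilon>) - \<eta> + h)"
  proof (rule mult_at_add, rule mult_at_diff)
    show "mult_at 1 (0, 0) (1 - \<epsilon>)" by (rule mult_at_mono[OF e(2)]) simp
    show "mult_at 1 (0, 0) \<eta>" by (rule mult_at_mono[OF n(1)[OF g(1)]]) simp_all
    show "mult_at 1 (0, 0) h" using F(3) mult_at_mono[of 2 "(0, 0)" h 1] by (simp add: cubic_mult_def)
  qed
  moreover have "mult_at 1 (1, 2) ((1 - \<eta>) - \<epsilon> + h)"
  proof (rule mult_at_add, rule mult_at_diff)
    show "mult_at 1 (1, 2) (1 - \<eta>)" by (rule mult_at_mono[OF n(2)]) simp
    show "mult_at 1 (1, 2) \<epsilon>" by (rule mult_at_mono[OF e(1)[OF g(2)]]) simp_all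
    show "mult_at 1 (1, 2) h" using F(3) mult_at_mono[of 2 "(1, 2)" h 1] by (simp add: cubic_mult_def)
  qed
  ultimately show ?thesis using F(2) by metis
qed

text \<open>\<open>U\<close> is a truncated geometric series, the inverse of \<open>F\<close> modulo
  order 4 at the omitted points. Subtracting \<open>F * H\<close>, with \<open>H\<close> a reduction
  of \<open>G * U\<close>, therefore makes \<open>G\<close> vanish to order 4 on the whole grid,
  where the quartics generate.\<close>

lemma fourteen_generation:
  fixes F :: "'a::field_char_0 poly poly"
  assumes F: "tdeg 16 F" "\<And>p. p \<in> fourteen \<Longrightarrow> mult_at 4 p F" "mult_at 1 (0, 0) (1 - F)" "mult_at 1 (1, 2) (1 - F)"
    and G: "tdeg 56 G" "\<And>p. p \<in> fourteen \<Longrightarrow> mult_at 4 p G"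
  shows "\<exists>M. (\<forall>l\<le>5. tdeg 40 (M l)) \<and> G = (\<Sum>l\<le>5. (if l < 5 then gA ^ l * gB ^ (4 - l) else F) * M l)"
proof -
  define U where "U = 1 + (1 - F) + (1 - F) ^ 2 + (1 - F) ^ 3"
  have FU: "F * U = 1 - (1 - F) ^ 4" unfolding U_def by (simp add: algebra_simps eval_nat_numeral)
  obtain H where H: "tdeg 18 H" "\<And>p. p \<in> grid \<Longrightarrow> mult_at 4 p (G * U - H)" using grid_reduction by blast
  have eq: "G - F * H = G * (1 - F) ^ 4 + F * (G * U - H)"
  proof -
    have "F * (G * U - H) = G * (F * U) - F * H" by (simp add: algebra_simps)
    then show ?thesis unfolding FU by (simp add: algebra_simps)
  qed
  have m: "mult_at 4 p (G - F * H)" if p: "p \<in> grid" for p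
    unfolding eq
  proof (rule mult_at_add)
    show "mult_at 4 p (F * (G * U - H))" by (intro mult_at_mult_left H p)
    show "mult_at 4 p (G * (1 - F) ^ 4)"
    proof (cases "p \<in> fourteen")
      case True
      then show ?thesis by (intro mult_at_mult_right G)
    next
      case False
      then have "mult_at 1 p (1 - F)" using p F(3,4) unfolding grid_fourteen by blast
      then show ?thesis using mult_at_power[of 1 p "1 - F" 4] by (intro mult_at_mult_left) simp
    qed
  qed
  \<comment> \<open>The correction has degree 16 + 18 = 34. The quotients by products of four
    quartics have degree 56 - 16 = 40.\<close>
  have "tdeg 56 (G - F * H)" by (intro tdeg_simps(2) G tdeg_mult_le[OF F(1) H(1)]) simp
  from grid_multiplicity[OF this m] have "\<exists>g. G - F * H = (\<Sum>i\<le>4. gA ^ i * gB ^ (4 - i) * g i) \<and> (\<forall>i\<le>4. tdeg 40 (g i))" by simp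
  then obtain g where g: "G - F * H = (\<Sum>i\<le>4. gA ^ i * gB ^ (4 - i) * g i)" "\<forall>i\<le>4. tdeg 40 (g i)" by blast
  define M where "M = g(5 := H)"
  have "(\<Sum>l\<le>5. (if l < 5 then gA ^ l * gB ^ (4 - l) else F) * M l) =
      (\<Sum>l\<le>4. (if l < 5 then gA ^ l * gB ^ (4 - l) else F) * M l) + F * H"
    using sum.atMost_Suc[of "\<lambda>l. (if l < 5 then gA ^ l * gB ^ (4 - l) else F) * M l" 4] by (simp add: M_def)
  also have "(\<Sum>l\<le>4. (if l < 5 then gA ^ l * gB ^ (4 - l) else F) * M l) = G - F * H"
    unfolding g(1) by (rule sum.cong) (auto simp: M_def)
  finally have "G = (\<Sum>l\<le>5. (if l < 5 then gA ^ l * gB ^ (4 - l) else F) * M l)" by simp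
  moreover have "tdeg 40 (M l)" if "l \<le> 5" for l
    using that g(2) tdeg_mono[OF H(1), of 40] by (auto simp: M_def)
  ultimately show ?thesis by blast
qed

lemma generic_generation:
  fixes x0 :: "nat \<Rightarrow> 'a::field_char_0 \<times> 'a"
  assumes x0: "inj_on x0 {..<14}" "x0 ` {..<14} = fourteen"
  shows "\<exists>g. polyfun 14 g \<and> g x0 \<noteq> 0 \<and> (\<forall>x. g x \<noteq> 0 \<longrightarrow>
    (\<forall>G. tdeg 56 G \<and> (\<forall>i<14. mult_at 4 (x i) G) \<longrightarrow>
      (\<exists>F M. (\<forall>l\<in>{..5::nat}. tdeg 16 (F l) \<and> (\<forall>i<14. mult_at 4 (x i) (F l)) \<and> tdeg 40 (M l)) \<and> G = (\<Sum>l\<le>5. F l * M l))))"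
proof -
  have x0_in: "x0 i \<in> fourteen" if "i < 14" for i using x0(2) that by blast
  have "\<exists>e. tdeg 16 e \<and> (\<forall>j'\<in>jet_index 14 4. jet j' x0 e = (if j' = j then 1 else 0))" if "j \<in> jet_index 14 4" for j
  proof -
    obtain i r s where j: "j = (i, r, s)" "i < 14" "r + s < 4"
      using \<open>j \<in> jet_index 14 4\<close> unfolding jet_index_def by blast
    obtain e where e: "tdeg 16 e" "\<And>q r' s'. q \<in> fourteen \<Longrightarrow> r' + s' < 4 \<Longrightarrow>
        cf (shift (fst q) (snd q) e) r' s' = (if q = x0 i \<and> r' = r \<and> s' = s then 1 else 0)"
      using fourteen_duals[OF x0_in[OF j(2)] j(3)] by blast
    have "jet j' x0 e = (if j' = j then 1 else 0)" if "j' \<in> jet_index 14 4" for j'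
    proof -
      obtain i' r' s' where j': "j' = (i', r', s')" "i' < 14" "r' + s' < 4"
        using \<open>j' \<in> jet_index 14 4\<close> unfolding jet_index_def by blast
      have "x0 i' = x0 i \<longleftrightarrow> i' = i" using x0(1) j(2) j'(2) by (auto simp: inj_on_def)
      then show ?thesis using e(2)[OF x0_in[OF j'(2)] j'(3)] by (simp add: jet_def j(1) j'(1))
    qed
    then show ?thesis using e(1) by blast
  qed
  then obtain e where e: "\<And>j. j \<in> jet_index 14 4 \<Longrightarrow> tdeg 16 (e j)"
    "\<And>j j'. j \<in> jet_index 14 4 \<Longrightarrow> j' \<in> jet_index 14 4 \<Longrightarrow> jet j' x0 (e j) = (if j' = j then 1 else 0)"
    by metis
  obtain F :: "'a poly poly" where "tdeg 16 F \<and> (\<forall>p\<in>fourteen. mult_at 4 p F) \<and> mult_at 1 (0, 0) (1 - F) \<and> mult_at 1 (1, 2) (1 - F)"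
    using fourteen_separating by (elim exE)
  then have F: "tdeg 16 F" "\<And>p. p \<in> fourteen \<Longrightarrow> mult_at 4 p F" "mult_at 1 (0, 0) (1 - F)" "mult_at 1 (1, 2) (1 - F)"
    by simp_all
  define Fl where "Fl l = (if l < 5 then gA ^ l * gB ^ (4 - l) else F)" for l :: nat
  have 1: "tdeg 16 (Fl l)" if "l \<in> {..5}" for l
  proof (cases "l < 5")
    case True
    then show ?thesis unfolding Fl_def using tdeg_mono[OF tdeg_AB[of l "4 - l"], of 16] by simp
  qed (simp add: Fl_def F(1))
  have 2: "mult_at 4 (x0 i) (Fl l)" if "l \<in> {..5}" "i < 14" for l i
    using that mult_AB[OF fourteen_grid[OF x0_in], of i l "4 - l"] F(2)[OF x0_in] by (auto simp: Fl_def)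
  have 3: "\<exists>M. (\<forall>l\<in>{..5}. tdeg 40 (M l)) \<and> G = (\<Sum>l\<le>5. Fl l * M l)"
    if G: "tdeg (16 + 40) G" "\<forall>i<14. mult_at 4 (x0 i) G" for G
  proof -
    have "mult_at 4 p G" if "p \<in> fourteen" for p using that G(2) x0(2) by (metis imageE lessThan_iff)
    then show ?thesis using fourteen_generation[OF F, of G] G(1) unfolding Fl_def Ball_def atMost_iff by simp
  qed
  have "(56::nat) = 16 + 40" by simp
  then show ?thesis by (simp only:) (rule generation_open[OF e finite_atMost 1 2 3])
qed

section \<open>Base points of the linear system\<close>

lemma lead_form_add: "lead_form k p (\<lambda>c. c) (sum F A) s t = (\<Sum>l\<in>A. lead_form k p (\<lambda>c. c) (F l) s t)"
  unfolding lead_form_def shift_simps cf_simps sum_distrib_right by (rule sum.swap)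

lemma lead_form_0: "lead_form 0 p (\<lambda>c. c) f s t = pt (fst p) (snd p) f"
  by (simp add: lead_form_def pt_0_0[symmetric] ev2_shift)

text \<open>Restrict to the line through \<open>p\<close> in direction \<open>(s, t)\<close> and compare lowest order terms.\<close>

lemma lead_form_mult:
  fixes f g :: "'a::field poly poly"
  assumes f: "tdeg d f" "mult_at k p f" "k \<le> d" and g: "tdeg e g" "mult_at l p g" "l \<le> e"
  shows "lead_form (k + l) p (\<lambda>c. c) (f * g) s t = lead_form k p (\<lambda>c. c) f s t * lead_form l p (\<lambda>c. c) g s t"
proof -
  obtain a b where p: "p = (a, b)" by (cases p)
  define \<phi> where "\<phi> = (\<lambda>c :: 'a. [:c:])"
  have \<phi>: "comm_ring_hom \<phi>" by unfold_locales (auto simp: \<phi>_def)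
  define x :: "'a poly ^ 3" where "x = vector [1 * \<phi> a + [:0, 1:] * \<phi> s, 1 * \<phi> b + [:0, 1:] * \<phi> t, 1]"
  have c: "lead_form j p \<phi> h (\<phi> s) (\<phi> t) = \<phi> (lead_form j p (\<lambda>c. c) h s t)" for j h
    using lead_form_hom[OF \<phi>, of j p "\<lambda>c. c" h s t] by simp
  have exp: "\<exists>h'. hform d \<phi> h x = [:0, 1:] ^ j * (\<phi> (lead_form j p (\<lambda>c. c) h s t) + [:0, 1:] * h')"
    if "tdeg d h" "mult_at j p h" "j \<le> d" for d h j
    using hform_at_point[OF \<phi> that(1) that(2)[unfolded p] that(3), of 1 "[:0, 1:]" "\<phi> s" "\<phi> t"] c[of j h]
    unfolding p x_def by simp
  obtain h1 where 1: "hform d \<phi> f x = [:0, 1:] ^ k * (\<phi> (lead_form k p (\<lambda>c. c) f s t) + [:0, 1:] * h1)"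
    using exp[OF f] by blast
  obtain h2 where 2: "hform e \<phi> g x = [:0, 1:] ^ l * (\<phi> (lead_form l p (\<lambda>c. c) g s t) + [:0, 1:] * h2)"
    using exp[OF g] by blast
  obtain h3 where 3: "hform (d + e) \<phi> (f * g) x = [:0, 1:] ^ (k + l) * (\<phi> (lead_form (k + l) p (\<lambda>c. c) (f * g) s t) + [:0, 1:] * h3)"
    using exp[OF tdeg_mult[OF f(1) g(1)] mult_at_mult[OF f(2) g(2)]] f(3) g(3) by auto
  have "hform (d + e) \<phi> (f * g) x =
      [:0, 1:] ^ (k + l) * ((\<phi> (lead_form k p (\<lambda>c. c) f s t) + [:0, 1:] * h1) * (\<phi> (lead_form l p (\<lambda>c. c) g s t) + [:0, 1:] * h2))"
    unfolding hform_mult[OF \<phi> f(1) g(1)] 1 2 power_add by (simp only: mult_ac)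
  then have "\<phi> (lead_form (k + l) p (\<lambda>c. c) (f * g) s t) + [:0, 1:] * h3 =
      (\<phi> (lead_form k p (\<lambda>c. c) f s t) + [:0, 1:] * h1) * (\<phi> (lead_form l p (\<lambda>c. c) g s t) + [:0, 1:] * h2)"
    unfolding 3 by simp
  from arg_cong[OF this, of "\<lambda>q. poly q 0"] show ?thesis by (simp add: \<phi>_def)
qed

text \<open>At \<open>P\<close> a product takes the product of the values; over a centre the leading
  form of \<open>F l\<close> is multiplied by the plain value of \<open>M l\<close>, which carries
  no multiplicity. If all \<open>F l\<close> vanished at \<open>P\<close>, so would the sum.\<close>

lemma nonvanishing_factor:
  assumes F: "\<And>l. l \<in> I \<Longrightarrow> tdeg d (F l)" "\<And>l i. l \<in> I \<Longrightarrow> i < length ps \<Longrightarrow> mult_at k (aff (ps ! i)) (F l)"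
    and M: "\<And>l. l \<in> I \<Longrightarrow> tdeg m (M l)" and kd: "k \<le> d"
    and nv: "nonvanishing_at (d + m) k ps (\<Sum>l\<in>I. F l * M l) P"
  shows "\<exists>l\<in>I. nonvanishing_at d k ps (F l) P"
  using nv[unfolded nonvanishing_at_def]
proof (elim disjE exE conjE)
  assume P: "hd P \<notin> set ps" and nz: "hform (d + m) (\<lambda>c. c) (\<Sum>l\<in>I. F l * M l) (rep_proj2 (hd P)) \<noteq> 0"
  from nz[unfolded hform_add(2)[OF comm_ring_hom_id(1)]] obtain l where "l \<in> I" "hform (d + m) (\<lambda>c. c) (F l * M l) (rep_proj2 (hd P)) \<noteq> 0"
    by (rule sum.not_neutral_contains_not_neutral)
  then show ?thesis using P unfolding nonvanishing_at_def
    by (auto simp: hform_mult[OF comm_ring_hom_id(1) F(1) M])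
next
  fix i s t assume i: "i < length ps" "hd P = ps ! i" "dot3 (rep_proj2 (P ! Suc i)) (vector [s, t, 0]) = 0"
    and nz: "lead_form k (aff (ps ! i)) (\<lambda>c. c) (\<Sum>l\<in>I. F l * M l) s t \<noteq> 0"
  from nz[unfolded lead_form_add] obtain l where l: "l \<in> I" "lead_form k (aff (ps ! i)) (\<lambda>c. c) (F l * M l) s t \<noteq> 0"
    by (rule sum.not_neutral_contains_not_neutral)
  then have "lead_form k (aff (ps ! i)) (\<lambda>c. c) (F l) s t \<noteq> 0"
    using lead_form_mult[OF F(1)[OF l(1)] F(2)[OF l(1) i(1)] kd M[OF l(1)] mult_at_0] by auto
  then show ?thesis unfolding nonvanishing_at_def using i l(1) by blast
qed

section \<open>Powers of lines through the points\<close>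

definition line_at :: "'a::field \<times> 'a \<Rightarrow> 'a \<Rightarrow> 'a \<Rightarrow> 'a poly poly" where
  "line_at p \<alpha> \<beta> = cc \<alpha> * (vX - cc (fst p)) + cc \<beta> * (vY - cc (snd p))"

lemma line_at_basic:
  "tdeg 1 (line_at p \<alpha> \<beta>)" "mult_at 1 p (line_at p \<alpha> \<beta>)"
  "lead_form 1 p (\<lambda>c. c) (line_at p \<alpha> \<beta>) s t = \<alpha> * s + \<beta> * t"
  "hform 1 (\<lambda>c. c) (line_at p \<alpha> \<beta>) x = \<alpha> * (x $ 1 - fst p * x $ 3) + \<beta> * (x $ 2 - snd p * x $ 3)"
proof -
  show "tdeg 1 (line_at p \<alpha> \<beta>)"
    unfolding line_at_def by (intro tdeg_simps(1) tdeg_cc_mult tdeg_linear)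
  show "mult_at 1 p (line_at p \<alpha> \<beta>)"
    unfolding mult_at_1_iff by (simp add: line_at_def ev2_id)
  have "shift (fst p) (snd p) (line_at p \<alpha> \<beta>) = cc \<alpha> * (vX ^ 1 * vY ^ 0) + cc \<beta> * (vX ^ 0 * vY ^ 1)"
    by (simp add: line_at_def shift_simps)
  then have "cf (shift (fst p) (snd p) (line_at p \<alpha> \<beta>)) r q = \<alpha> * (if r = 1 \<and> q = 0 then 1 else 0) + \<beta> * (if r = 0 \<and> q = 1 then 1 else 0)" for r q
    by (simp only: cf_simps cf_monomial_1)
  then show "lead_form 1 p (\<lambda>c. c) (line_at p \<alpha> \<beta>) s t = \<alpha> * s + \<beta> * t"
    unfolding lead_form_def by simp
  have "line_at p \<alpha> \<beta> = cc \<alpha> * (vX ^ 1 * vY ^ 0) + cc \<beta> * (vX ^ 0 * vY ^ 1) + cc (- \<alpha> * fst p - \<beta> * snd p) * (vX ^ 0 * vY ^ 0)"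
    by (simp add: line_at_def cc_def algebra_simps)
  then show "hform 1 (\<lambda>c. c) (line_at p \<alpha> \<beta>) x = \<alpha> * (x $ 1 - fst p * x $ 3) + \<beta> * (x $ 2 - snd p * x $ 3)"
    by (simp only: hform_add(1)[OF comm_ring_hom_id(1)] hform_monomial[OF comm_ring_hom_id(1)]) (simp add: algebra_simps)
qed

lemma hform_prod:
  assumes "\<And>i. i < n \<Longrightarrow> tdeg d (f i)"
  shows "tdeg (d * n) (\<Prod>i<n. f i) \<and> hform (d * n) (\<lambda>c. c) (\<Prod>i<n. f i) x = (\<Prod>i<n. hform d (\<lambda>c. c) (f i) x)"
  using assms
proof (induction n)
  case 0
  have "hform 0 (\<lambda>c. c) (cc 1 * (vX ^ 0 * vY ^ 0)) x = 1"
    by (subst hform_monomial[OF comm_ring_hom_id(1)]) simp_all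
  then show ?case by (simp add: cc_numeral tdeg_basic)
next
  case (Suc n)
  then have IH: "tdeg (d * n) (\<Prod>i<n. f i)" "hform (d * n) (\<lambda>c. c) (\<Prod>i<n. f i) x = (\<Prod>i<n. hform d (\<lambda>c. c) (f i) x)" by auto
  show ?case
    using tdeg_mult[OF IH(1) Suc.prems[of n]] hform_mult[OF comm_ring_hom_id(1) IH(1) Suc.prems[of n], of x]
    by (simp add: IH(2) add.commute)
qed

lemma line_at_power:
  "tdeg k (line_at p \<alpha> \<beta> ^ k)" "mult_at k p (line_at p \<alpha> \<beta> ^ k)"
  "lead_form k p (\<lambda>c. c) (line_at p \<alpha> \<beta> ^ k) s t = (\<alpha> * s + \<beta> * t) ^ k"
  "hform k (\<lambda>c. c) (line_at p \<alpha> \<beta> ^ k) x = (\<alpha> * (x $ 1 - fst p * x $ 3) + \<beta> * (x $ 2 - snd p * x $ 3)) ^ k"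
proof -
  show 1: "tdeg k (line_at p \<alpha> \<beta> ^ k)" for k using tdeg_power[OF line_at_basic(1)] by simp
  show 2: "mult_at k p (line_at p \<alpha> \<beta> ^ k)" for k using mult_at_power[OF line_at_basic(2)] by simp
  show "lead_form k p (\<lambda>c. c) (line_at p \<alpha> \<beta> ^ k) s t = (\<alpha> * s + \<beta> * t) ^ k"
  proof (induction k)
    case 0
    show ?case by (simp add: lead_form_0 ev2_id)
  next
    case (Suc k)
    have "lead_form (1 + k) p (\<lambda>c. c) (line_at p \<alpha> \<beta> * line_at p \<alpha> \<beta> ^ k) s t = (\<alpha> * s + \<beta> * t) * (\<alpha> * s + \<beta> * t) ^ k"
      unfolding lead_form_mult[OF line_at_basic(1,2) order.refl 1 2 order.refl] line_at_basic(3) Suc.IH ..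
    then show ?case by simp
  qed
  show "hform k (\<lambda>c. c) (line_at p \<alpha> \<beta> ^ k) x = (\<alpha> * (x $ 1 - fst p * x $ 3) + \<beta> * (x $ 2 - snd p * x $ 3)) ^ k"
    using hform_prod[of k 1 "\<lambda>_. line_at p \<alpha> \<beta>" x] line_at_basic(1)[of p \<alpha> \<beta>] unfolding line_at_basic(4) by simp
qed

lemma affine_difference:
  assumes "rep_proj2 p $ 3 \<noteq> 0" "x \<noteq> p"
  shows "\<exists>\<alpha> \<beta>. \<alpha> * (rep_proj2 x $ 1 - fst (aff p) * rep_proj2 x $ 3) + \<beta> * (rep_proj2 x $ 2 - snd (aff p) * rep_proj2 x $ 3) \<noteq> 0"
proof (rule ccontr)
  assume *: "\<not> ?thesis"
  have "rep_proj2 x $ 1 = rep_proj2 p $ 1 / rep_proj2 p $ 3 * rep_proj2 x $ 3"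
    "rep_proj2 x $ 2 = rep_proj2 p $ 2 / rep_proj2 p $ 3 * rep_proj2 x $ 3"
    using *[simplified, rule_format, of 1 0] *[simplified, rule_format, of 0 1] by (simp_all add: aff_def)
  then have "cross (rep_proj2 x) (rep_proj2 p) = 0" using assms(1) by (simp add: vec3_simps)
  then show False using assms(2) by (simp add: cross_rep_eq_0_iff)
qed

text \<open>Each line through a point is chosen to avoid the image of \<open>P\<close>. If
  \<open>P\<close> lies over that point, the line is chosen instead with a direction different from
  the one recorded in \<open>P\<close>.\<close>

lemma (in affine_points) nonvanishing_product_of_lines:
  assumes P: "P \<in> blowup ps"
  shows "\<exists>G. tdeg (k * length ps) G \<and> (\<forall>i<length ps. mult_at k (aff (ps ! i)) G) \<and> nonvanishing_at (k * length ps) k ps G P"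
proof -
  let ?n = "length ps" and ?x = "rep_proj2 (hd P)"
  obtain x ls where P_eq: "P = x # ls" "length ls = ?n" "\<And>i. i < ?n \<Longrightarrow> incident (ps ! i) (ls ! i)"
    using P by (auto simp: blowup_def)
  have "\<exists>\<alpha> \<beta>. (hd P \<noteq> ps ! i \<longrightarrow> \<alpha> * (?x $ 1 - fst (aff (ps ! i)) * ?x $ 3) + \<beta> * (?x $ 2 - snd (aff (ps ! i)) * ?x $ 3) \<noteq> 0) \<and>
      (hd P = ps ! i \<longrightarrow> \<alpha> * rep_proj2 (P ! Suc i) $ 2 - \<beta> * rep_proj2 (P ! Suc i) $ 1 \<noteq> 0)" if i: "i < ?n" for i
  proof (cases "hd P = ps ! i")
    case True
    let ?l = "rep_proj2 (P ! Suc i)"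
    have "dot3 ?l (rep_proj2 (ps ! i)) = 0" using P_eq(3)[OF i] by (simp add: incident_iff P_eq(1))
    then have "?l $ 1 \<noteq> 0 \<or> ?l $ 2 \<noteq> 0"
      using finite_part[OF i] rep_proj2_nonzero[of "P ! Suc i"] by (auto simp: vec3_simps)
    then show ?thesis
    proof
      assume "?l $ 1 \<noteq> 0"
      then show ?thesis using True by (intro exI[of _ 0] exI[of _ 1]) simp
    next
      assume "?l $ 2 \<noteq> 0"
      then show ?thesis using True by (intro exI[of _ 1] exI[of _ 0]) simp
    qed
  next
    case False
    then show ?thesis using affine_difference[OF finite_part[OF i] False] by simp
  qed
  then obtain \<alpha> \<beta> where ne: "\<And>i. i < ?n \<Longrightarrow> hd P \<noteq> ps ! i \<Longrightarrow> \<alpha> i * (?x $ 1 - fst (aff (ps ! i)) * ?x $ 3) + \<beta> i * (?x $ 2 - snd (aff (ps ! i)) * ?x $ 3) \<noteq> 0"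
    and eq: "\<And>i. i < ?n \<Longrightarrow> hd P = ps ! i \<Longrightarrow> \<alpha> i * rep_proj2 (P ! Suc i) $ 2 - \<beta> i * rep_proj2 (P ! Suc i) $ 1 \<noteq> 0"
    by metis
  define f where "f i = line_at (aff (ps ! i)) (\<alpha> i) (\<beta> i) ^ k" for i
  define G where "G = (\<Prod>i<?n. f i)"
  have fG: "G = f i * (\<Prod>j\<in>{..<?n}-{i}. f j)" if "i < ?n" for i
    unfolding G_def using that by (intro prod.remove) auto
  have G: "tdeg (k * ?n) G" "hform (k * ?n) (\<lambda>c. c) G y = (\<Prod>i<?n. hform k (\<lambda>c. c) (f i) y)" for y
    using hform_prod[of ?n k f y] line_at_power(1)[of k] unfolding G_def f_def by blast+
  have m: "mult_at k (aff (ps ! i)) G" if "i < ?n" for i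
    unfolding fG[OF that] f_def by (intro mult_at_mult_right line_at_power)
  have "nonvanishing_at (k * ?n) k ps G P"
  proof (cases "hd P \<in> set ps")
    case False
    then have "hform k (\<lambda>c. c) (f i) ?x \<noteq> 0" if "i < ?n" for i
    proof -
      have "hd P \<noteq> ps ! i" using False nth_mem[OF that] by metis
      from ne[OF that this] show ?thesis unfolding f_def line_at_power(4) by simp
    qed
    then have "hform (k * ?n) (\<lambda>c. c) G ?x \<noteq> 0" unfolding G(2) by simp
    then show ?thesis using False unfolding nonvanishing_at_def by blast
  next
    case True
    then obtain i where i: "i < ?n" "hd P = ps ! i" by (metis in_set_conv_nth)
    \<comment> \<open>\<open>(s : t : 0)\<close> is the point at infinity of the line in
      \<open>P\<close>, that is, its direction.\<close>
    define s where "s = rep_proj2 (P ! Suc i) $ 2"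
    define t where "t = - rep_proj2 (P ! Suc i) $ 1"
    define R where "R = (\<Prod>j\<in>{..<?n}-{i}. f j)"
    have "pt (fst (aff (ps ! i))) (snd (aff (ps ! i))) (f j) \<noteq> 0" if "j \<in> {..<?n}-{i}" for j
    proof -
      have "ps ! j \<noteq> hd P" using that i distinct by (simp add: nth_eq_iff_index_eq)
      then have "\<alpha> j * (?x $ 1 - fst (aff (ps ! j)) * ?x $ 3) + \<beta> j * (?x $ 2 - snd (aff (ps ! j)) * ?x $ 3) \<noteq> 0"
        using ne[of j] that by auto
      moreover have "\<alpha> j * (?x $ 1 - fst (aff (ps ! j)) * ?x $ 3) + \<beta> j * (?x $ 2 - snd (aff (ps ! j)) * ?x $ 3) =
          ?x $ 3 * (\<alpha> j * (fst (aff (ps ! i)) - fst (aff (ps ! j))) + \<beta> j * (snd (aff (ps ! i)) - snd (aff (ps ! j))))"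
        using finite_part[OF i(1)] i(2) by (simp add: aff_def[of "ps ! i"] field_simps)
      ultimately show ?thesis by (auto simp: f_def line_at_def ev2_id)
    qed
    then have R0: "pt (fst (aff (ps ! i))) (snd (aff (ps ! i))) R \<noteq> 0" by (simp add: R_def ev2_id)
    have "tdeg (k * (?n - 1)) R"
    proof -
      have "tdeg (k * card A) (\<Prod>j\<in>A. f j)" if "finite A" for A
        using that
      proof (induction A rule: finite_induct)
        case (insert j A)
        then show ?case using tdeg_mult[OF line_at_power(1) insert.IH] by (simp add: f_def)
      qed (simp add: tdeg_basic)
      from this[of "{..<?n}-{i}"] show ?thesis using i by (simp add: R_def)
    qed
    from lead_form_mult[OF line_at_power(1,2) order.refl this mult_at_0]
    have "lead_form k (aff (ps ! i)) (\<lambda>c. c) G s t = (\<alpha> i * s + \<beta> i * t) ^ k * pt (fst (aff (ps ! i))) (snd (aff (ps ! i))) R"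
      unfolding fG[OF i(1)] R_def[symmetric] f_def lead_form_0 line_at_power(3) by simp
    moreover have "\<alpha> i * s + \<beta> i * t \<noteq> 0" using eq[OF i] by (simp add: s_def t_def)
    ultimately have "lead_form k (aff (ps ! i)) (\<lambda>c. c) G s t \<noteq> 0" using R0 by simp
    moreover have "dot3 (rep_proj2 (P ! Suc i)) (vector [s, t, 0]) = 0" by (simp add: dot3_expand s_def t_def)
    ultimately show ?thesis unfolding nonvanishing_at_def using i by blast
  qed
  then show ?thesis using G(1) m by blast
qed

section \<open>An open set of point configurations\<close>

lemma polyfun_local: "polyfun n g \<Longrightarrow> (\<And>i. i < n \<Longrightarrow> x i = y i) \<Longrightarrow> g x = g y"
  by (induction rule: polyfun.induct) auto

lemma grid_as_nat: "(grid :: ('a::field_char_0 \<times> 'a) set) = (\<lambda>(a, b). (of_nat a, of_nat b)) ` ({..<4} \<times> {..<4})"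
proof -
  have "{0, 1, 2, 3 :: 'a} = of_nat ` {..<4 :: nat}" by (simp add: eval_nat_numeral lessThan_Suc insert_commute)
  then show ?thesis unfolding grid_def by (simp only:) auto
qed

lemma card_fourteen: "card (fourteen :: ('a::field_char_0 \<times> 'a) set) = 14"
proof -
  have "card (grid :: ('a \<times> 'a) set) = 16" "finite (grid :: ('a \<times> 'a) set)" by (simp_all add: grid_def card_cartesian_product)
  moreover have "{(0, 0), (1, 2)} \<subseteq> (grid :: ('a \<times> 'a) set)" "card {(0, 0), (1 :: 'a, 2 :: 'a)} = 2" by (auto simp: grid_def)
  ultimately show ?thesis unfolding fourteen_def by (subst card_Diff_subset) auto
qed

text \<open>The coordinates are base 4 digits of the value of the linear function, so this single
  function separates the grid.\<close>

lemma grid_separated: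
  assumes "p \<in> grid" "q \<in> grid" "fst p + 4 * snd p = fst q + 4 * (snd q :: 'a::field_char_0)" shows "p = q"
proof -
  obtain a b c d where *: "p = (of_nat a, of_nat b)" "q = (of_nat c, of_nat d)" "a < 4" "b < 4" "c < 4" "d < 4"
    using assms(1,2) unfolding grid_as_nat by auto
  have "of_nat (a + 4 * b) = (of_nat (c + 4 * d) :: 'a)" using assms(3) by (simp add: *)
  then have "a + 4 * b = c + 4 * d" by (simp only: of_nat_eq_iff)
  moreover from this have "(a + 4 * b) mod 4 = (c + 4 * d) mod 4" by (rule arg_cong)
  then have "a = c" using *(3,5) by simp
  ultimately show ?thesis using *(1,2) by simp
qed

theorem lemma3p3:
  fixes d s :: nat
  assumes "d = 5" and "s = 14"
  shows "\<exists>U :: 'a::{alg_closed_field, field_char_0} proj2 list set.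
    openin (zariski s) U \<and> U \<noteq> {} \<and>
    (\<forall>ps\<in>U. distinct ps \<and>
      (\<forall>L E K. (\<exists>a. L = line_pullback ps a) \<and> E = exceptional_divisor ps \<and>
               (\<exists>f. f \<noteq> 0 \<and> K = canonical_divisor ps f) \<longrightarrow>
         base_point_free ps
           (linear_system ps (\<lambda>C. - 2 * K C + 2 * int d * L C - 2 * E C))))"
proof -
  have "finite (fourteen :: ('a \<times> 'a) set)" by (rule card_ge_0_finite) (simp add: card_fourteen)
  then obtain x0 :: "nat \<Rightarrow> 'a \<times> 'a" where x0: "bij_betw x0 {0..<14} (fourteen :: ('a \<times> 'a) set)"
    using ex_bij_betw_nat_finite[of "fourteen :: ('a \<times> 'a) set"] unfolding card_fourteen by blast
  then have inj: "inj_on x0 {..<14}" and im: "x0 ` {..<14} = fourteen" by (simp_all add: bij_betw_def atLeast0LessThan)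
  obtain g where g: "polyfun 14 g" "g x0 \<noteq> 0"
    and gen: "\<And>x. g x \<noteq> 0 \<Longrightarrow> (\<forall>G. tdeg 56 G \<and> (\<forall>i<14. mult_at 4 (x i) G) \<longrightarrow>
      (\<exists>F M. (\<forall>l\<in>{..5::nat}. tdeg 16 (F l) \<and> (\<forall>i<14. mult_at 4 (x i) (F l)) \<and> tdeg 40 (M l)) \<and> G = (\<Sum>l\<le>5. F l * M l)))"
    using generic_generation[OF inj im] by blast
  \<comment> \<open>The discriminant of one linear function of the coordinates. Its nonvanishing
    implies that the points are distinct, and it is a single polynomial, whereas comparing two
    coordinates would give a disjunction.\<close>
  define D where "D x = (\<Prod>i<14. \<Prod>j<i. (fst (x i) + 4 * snd (x i)) - (fst (x j) + 4 * snd (x j)))" for x :: "nat \<Rightarrow> 'a \<times> 'a"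
  have D_poly: "polyfun 14 D"
    unfolding D_def by (intro polyfun_prod polyfun_diff polyfun.intros) simp_all
  have D_x0: "D x0 \<noteq> 0"
  proof -
    have "fst (x0 i) + 4 * snd (x0 i) \<noteq> fst (x0 j) + 4 * snd (x0 j)" if "i < 14" "j < i" for i j
    proof
      assume *: "fst (x0 i) + 4 * snd (x0 i) = fst (x0 j) + 4 * snd (x0 j)"
      have "x0 i \<in> fourteen" "x0 j \<in> fourteen" using that im by auto
      then have "x0 i = x0 j" using grid_separated[OF fourteen_grid fourteen_grid *] by blast
      then show False using inj_onD[OF inj, of i j] that by simp
    qed
    then show ?thesis unfolding D_def by (auto simp: prod_zero_iff)
  qed
  have gD: "polyfun 14 (\<lambda>x. g x * D x)" by (intro polyfun.mult g D_poly)
  define U where "U = {ps :: 'a proj2 list. length ps = 14 \<and> (\<forall>i<14. rep_proj2 (ps ! i) $ 3 \<noteq> 0) \<and>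
    g (affine_part (map rep_proj2 ps)) * D (affine_part (map rep_proj2 ps)) \<noteq> 0}"
  have "openin (zariski 14) U" unfolding U_def by (rule open_polyfun_nonzero[OF gD])
  moreover have "U \<noteq> {}"
  proof -
    define p where "p i = abs_proj2 (vector [fst (x0 i), snd (x0 i), 1])" for i
    have "vector [fst (x0 i), snd (x0 i), 1] \<noteq> (0 :: 'a ^ 3)" for i by (simp add: vec3_simps)
    from rep_abs_proj2[OF this] have p: "\<exists>c. c \<noteq> 0 \<and> rep_proj2 (p i) = c *s vector [fst (x0 i), snd (x0 i), 1]" for i
      unfolding p_def by metis
    define ps where "ps = map p [0..<14]"
    have ps: "length ps = 14" "ps ! i = p i" if "i < 14" for i using that by (simp_all add: ps_def)
    have "affine_part (map rep_proj2 ps) i = x0 i" if "i < 14" for i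
      using p[of i] ps[OF that] that by (auto simp: affine_part_def)
    then have "g (affine_part (map rep_proj2 ps)) * D (affine_part (map rep_proj2 ps)) = g x0 * D x0"
      by (rule polyfun_local[OF gD])
    moreover have "rep_proj2 (ps ! i) $ 3 \<noteq> 0" if "i < 14" for i using p[of i] ps[OF that] by auto
    ultimately have "ps \<in> U" using g D_x0 ps(1)[of 0] unfolding U_def by auto
    then show ?thesis by blast
  qed
  moreover have "distinct ps \<and> (\<forall>L E K. (\<exists>a. L = line_pullback ps a) \<and> E = exceptional_divisor ps \<and>
      (\<exists>f. f \<noteq> 0 \<and> K = canonical_divisor ps f) \<longrightarrow>
        base_point_free ps (linear_system ps (\<lambda>C. - 2 * K C + 2 * int 5 * L C - 2 * E C)))" if ps: "ps \<in> U" for ps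
  proof -
    have n: "length ps = 14" and fin: "\<And>i. i < 14 \<Longrightarrow> rep_proj2 (ps ! i) $ 3 \<noteq> 0"
      and nz: "g (affine_part (map rep_proj2 ps)) \<noteq> 0" "D (affine_part (map rep_proj2 ps)) \<noteq> 0"
      using ps unfolding U_def by auto
    have x: "affine_part (map rep_proj2 ps) i = aff (ps ! i)" if "i < 14" for i
      using that n by (simp add: affine_part_def aff_def)
    have "ps ! i \<noteq> ps ! j" if "i < 14" "j < i" for i j
    proof
      assume "ps ! i = ps ! j"
      then have eq: "affine_part (map rep_proj2 ps) i = affine_part (map rep_proj2 ps) j" using x that by simp
      have "D (affine_part (map rep_proj2 ps)) = 0"
        unfolding D_def prod_zero_iff[OF finite_lessThan]
        by (rule bexI[of _ i], rule bexI[of _ j]) (use that eq in auto)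
      then show False using nz(2) by simp
    qed
    then have dist: "distinct ps" unfolding distinct_conv_nth n by (metis linorder_neqE_nat)
    interpret affine_points ps by unfold_locales (use dist fin n in auto)
    have sections: "\<exists>f. tdeg 16 f \<and> (\<forall>i<length ps. mult_at 4 (aff (ps ! i)) f) \<and> nonvanishing_at 16 4 ps f P"
      if P: "P \<in> blowup ps" for P
    proof -
      obtain G where G: "tdeg (4 * length ps) G" "\<forall>i<length ps. mult_at 4 (aff (ps ! i)) G" "nonvanishing_at (4 * length ps) 4 ps G P"
        using nonvanishing_product_of_lines[OF P, of 4] by blast
      \<comment> \<open>Fourfold lines through fourteen points have degree 56; this is the source of
        the degree 40 of the multipliers in the generation statement.\<close>
      have "4 * length ps = 16 + 40" by (simp add: n)
      note G = G[unfolded this]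
      have "tdeg 56 G \<and> (\<forall>i<14. mult_at 4 (affine_part (map rep_proj2 ps) i) G)" using G(1,2) n x by simp
      with gen[OF nz(1)] obtain F M where FM: "\<forall>l\<in>{..5::nat}. tdeg 16 (F l) \<and>
          (\<forall>i<14. mult_at 4 (affine_part (map rep_proj2 ps) i) (F l)) \<and> tdeg 40 (M l)" "G = (\<Sum>l\<le>5. F l * M l)"
        by blast
      have F: "\<forall>i<length ps. mult_at 4 (aff (ps ! i)) (F l)" if "l \<in> {..5}" for l using FM(1) that x n by metis
      have "\<exists>l\<in>{..5}. nonvanishing_at 16 4 ps (F l) P"
        by (rule nonvanishing_factor[where m = 40 and M = M]) (use FM F G(3) in auto)
      then show ?thesis using FM(1) F by blast
    qed
    show ?thesis using dist base_point_free_of_sections[OF _ _ _ _ sections] by blast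
  qed
  ultimately show ?thesis unfolding assms by (intro exI[of _ U] conjI[of "openin _ _"] conjI[of "_ \<noteq> _"] ballI)
qed

end
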